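(* Let $s\in(0,1)$, $\gamma\in(1,2)$, $T>0$, $f\in L^\infty(0,T;L^2(\Omega))$, $g\in\mathbb{H}^{2s}(\Omega)$ and $h\in L^2(\Omega)$. Then the problem $$\partial_t^\gamma u+\mathcal{L}^su=f\ \text{ in }\Omega\times(0,T),\qquad u(0)=g,\quad\partial_tu(0)=h\ \text{ in }\Omega,$$ has a unique weak solution, and it is given by the representation formula $$u(\cdot,t)=G_\gamma(t)g+H_\gamma(t)h+\int_0^tF_\gamma(t-r)f(\cdot,r)\,dr.$$ In addition, $$\|u\|_{L^\infty(0,T;\mathbb{H}^s(\Omega))}+\|\partial_tu\|_{L^2(0,T;L^2(\Omega))}\le C\left(\|f\|_{L^2(0,T;L^2(\Omega))}+\|g\|_{\mathbb{H}^s(\Omega)}+\|h\|_{L^2(\Omega)}\right)$$ and $$\|\partial_tu\|_{L^\infty(0,T;L^2(\Omega))}\le C\left(\|f\|_{L^\infty(0,T;L^2(\Omega))}+\|g\|_{\mathbb{H}^{2s}(\Omega)}+\|h\|_{L^2(\Omega)}\right),$$ where the constants $C$ are independent of the problem data $f,g,h$.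
   Context: $\Omega\subset\mathbb{R}^n$ ($n\ge1$) is open, bounded and convex. $\mathcal{L}w=-\mathrm{div}(A\nabla w)+cw$ with homogeneous Dirichlet boundary conditions, where $0\le c\in L^\infty(\Omega)$ and $A$ is a Lipschitz ($C^{0,1}$), symmetric, uniformly positive definite matrix field on $\Omega$. $\{(\lambda_k,\varphi_k)\}_{k\ge1}\subset\mathbb{R}_+\times H_0^1(\Omega)$ are the eigenpairs of $\mathcal{L}$, with $\{\varphi_k\}$ an orthonormal basis of $L^2(\Omega)$. For $r\ge0$, $\mathbb{H}^r(\Omega)=\{w=\sum_kw_k\varphi_k:\|w\|_{\mathbb{H}^r(\Omega)}^2=\sum_k\lambda_k^r|w_k|^2<\infty\}$, and $\mathbb{H}^{-r}(\Omega)$ is its dual. The spectral fractional power is $\mathcal{L}^s:\mathbb{H}^s(\Omega)\to\mathbb{H}^{-s}(\Omega)$, $\mathcal{L}^sw=\sum_k\lambda_k^sw_k\varphi_k$. $\partial_t^\gamma$ is the left-sided Caputo derivative, $\partial_t^\gamma u(t)=\frac1{\Gamma(2-\gamma)}\int_0^t(t-r)^{1-\gamma}\frac{d^2u(r)}{dr^2}\,dr$. Mittag-Leffler function: $E_{\gamma,\mu}(z)=\sum_{k\ge0}\frac{z^k}{\Gamma(\gamma k+\mu)}$. With $w_k=(w,\varphi_k)_{L^2(\Omega)}$, the solution operators are $$G_\gamma(t)w=\sum_kE_{\gamma,1}(-\lambda_k^st^\gamma)w_k\varphi_k,\quad H_\gamma(t)w=\sum_ktE_{\gamma,2}(-\lambda_k^st^\gamma)w_k\varphi_k,\quad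 F_\gamma(t)w=\sum_kt^{\gamma-1}E_{\gamma,\gamma}(-\lambda_k^st^\gamma)w_k\varphi_k.$$ Weak solution: $u\in L^\infty(0,T;\mathbb{H}^s(\Omega))$ with $\partial_tu\in L^\infty(0,T;L^2(\Omega))$ and $\partial_t^\gamma u\in L^2(0,T;\mathbb{H}^{-s}(\Omega))$, such that $u(0)=g$, $\partial_tu(0)=h$ and, for a.e. $t\in(0,T)$, $$\langle\partial_t^\gamma u,v\rangle+\langle\mathcal{L}^su,v\rangle=\langle f,v\rangle\quad\forall v\in\mathbb{H}^s(\Omega),$$ where $\langle\cdot,\cdot\rangle$ is the duality pairing between $\mathbb{H}^{-s}(\Omega)$ and $\mathbb{H}^s(\Omega)$. The initial conditions are understood through the continuity $u\in C([0,T];\mathbb{H}^s(\Omega))$ and $\partial_tu\in C([0,T];L^2(\Omega))$. *)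

theory Defs
  imports "HOL-Analysis.Analysis" "HOL-Probability.Essential_Supremum"
begin

section \<open>Lebesgue and Sobolev spaces on an open set\<close>

text \<open>Elements of \<open>L\<^sup>2(\<Omega>)\<close> are represented by functions on the whole space of which only the
  values on \<open>\<Omega>\<close> matter; equality of elements is equality almost everywhere on \<open>\<Omega>\<close>.\<close>

definition L2_space :: "'a::euclidean_space set \<Rightarrow> ('a \<Rightarrow> real) set" where
  "L2_space \<Omega> = {w \<in> borel_measurable (lebesgue_on \<Omega>). integrable (lebesgue_on \<Omega>) (\<lambda>x. (w x)\<^sup>2)}"

definition L2_inner :: "'a::euclidean_space set \<Rightarrow> ('a \<Rightarrow> real) \<Rightarrow> ('a \<Rightarrow> real) \<Rightarrow> real" where
  "L2_inner \<Omega> w v = (LINT x|lebesgue_on \<Omega>. w x * v x)"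

definition L2_norm :: "'a::euclidean_space set \<Rightarrow> ('a \<Rightarrow> real) \<Rightarrow> real" where
  "L2_norm \<Omega> w = sqrt (LINT x|lebesgue_on \<Omega>. (w x)\<^sup>2)"

primrec iterated_derivative ::
  "'a list \<Rightarrow> ('a::euclidean_space \<Rightarrow> real) \<Rightarrow> 'a \<Rightarrow> real" where
  "iterated_derivative [] f = f"
| "iterated_derivative (b # bs) f = (\<lambda>x. frechet_derivative (iterated_derivative bs f) (at x) b)"

definition test_functions :: "'a::euclidean_space set \<Rightarrow> ('a \<Rightarrow> real) set" where
  "test_functions \<Omega> = {\<psi>.
     (\<forall>bs x. set bs \<subseteq> Basis \<longrightarrow> iterated_derivative bs \<psi> differentiable (at x)) \<and>
     compact (closure {x. \<psi> x \<noteq> 0}) \<and> closure {x. \<psi> x \<noteq> 0} \<subseteq> \<Omega>}"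

definition partial_derivative :: "'n::finite \<Rightarrow> (real^'n \<Rightarrow> real) \<Rightarrow> real^'n \<Rightarrow> real" where
  "partial_derivative i \<psi> x = frechet_derivative \<psi> (at x) (axis i 1)"

definition has_weak_gradient ::
  "(real^'n) set \<Rightarrow> (real^'n::finite \<Rightarrow> real) \<Rightarrow> (real^'n \<Rightarrow> real^'n) \<Rightarrow> bool" where
  "has_weak_gradient \<Omega> w D \<longleftrightarrow>
     (\<forall>i. (\<lambda>x. D x $ i) \<in> L2_space \<Omega> \<and>
          (\<forall>\<psi>\<in>test_functions \<Omega>.
             L2_inner \<Omega> w (partial_derivative i \<psi>) = - L2_inner \<Omega> (\<lambda>x. D x $ i) \<psi>))"

text \<open>\<open>H\<^sub>0\<^sup>1(\<Omega>)\<close> is the closure of the test functions in \<open>H\<^sup>1(\<Omega>)\<close>.\<close>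

definition H01_space :: "(real^'n::finite) set \<Rightarrow> (real^'n \<Rightarrow> real) set" where
  "H01_space \<Omega> = {w \<in> L2_space \<Omega>. \<exists>D. has_weak_gradient \<Omega> w D \<and>
     (\<exists>\<psi>. (\<forall>j. \<psi> j \<in> test_functions \<Omega>) \<and>
        (\<lambda>j::nat. L2_norm \<Omega> (\<lambda>x. \<psi> j x - w x)) \<longlonglongrightarrow> 0 \<and>
        (\<forall>i. (\<lambda>j. L2_norm \<Omega> (\<lambda>x. partial_derivative i (\<psi> j) x - D x $ i)) \<longlonglongrightarrow> 0))}"

text \<open>Weak form of \<open>-div(A \<nabla>\<phi>) + c \<phi> = \<mu> \<phi>\<close> in \<open>\<Omega>\<close>, \<open>\<phi> = 0\<close> on the boundary.  That \<open>\<phi>\<close> is nonzero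
  is not part of this definition.\<close>

definition dirichlet_eigenpair ::
  "(real^'n::finite) set \<Rightarrow> (real^'n \<Rightarrow> real^'n^'n) \<Rightarrow> (real^'n \<Rightarrow> real) \<Rightarrow>
     real \<Rightarrow> (real^'n \<Rightarrow> real) \<Rightarrow> bool" where
  "dirichlet_eigenpair \<Omega> A c \<mu> \<phi> \<longleftrightarrow> \<phi> \<in> H01_space \<Omega> \<and>
     (\<exists>D. has_weak_gradient \<Omega> \<phi> D \<and>
        (\<forall>v\<in>H01_space \<Omega>. \<forall>Dv. has_weak_gradient \<Omega> v Dv \<longrightarrow>
           (LINT x|lebesgue_on \<Omega>. (A x *v D x) \<bullet> Dv x + c x * \<phi> x * v x) = \<mu> * L2_inner \<Omega> \<phi> v))"

definition L2_sums ::
  "'a::euclidean_space set \<Rightarrow> (nat \<Rightarrow> 'a \<Rightarrow> real) \<Rightarrow> ('a \<Rightarrow> real) \<Rightarrow> bool" where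
  "L2_sums \<Omega> F w \<longleftrightarrow> w \<in> L2_space \<Omega> \<and>
     (\<lambda>N. L2_norm \<Omega> (\<lambda>x. (\<Sum>k<N. F k x) - w x)) \<longlonglongrightarrow> 0"

definition L2_orthonormal_basis ::
  "'a::euclidean_space set \<Rightarrow> (nat \<Rightarrow> 'a \<Rightarrow> real) \<Rightarrow> bool" where
  "L2_orthonormal_basis \<Omega> \<phi> \<longleftrightarrow>
     (\<forall>k. \<phi> k \<in> L2_space \<Omega>) \<and>
     (\<forall>j k. L2_inner \<Omega> (\<phi> j) (\<phi> k) = (if j = k then 1 else 0)) \<and>
     (\<forall>w\<in>L2_space \<Omega>. L2_sums \<Omega> (\<lambda>k x. L2_inner \<Omega> w (\<phi> k) * \<phi> k x) w)"


section \<open>The spectral scale and the fractional power\<close>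

text \<open>Eigenpairs are indexed from 0.  For the nonnegative exponents used here, and eigenvalues bounded
  away from 0, the series \<open>\<Sum>\<^sub>k w\<^sub>k \<phi>\<^sub>k\<close> converges in \<open>L\<^sup>2(\<Omega>)\<close>.\<close>

definition HH_space ::
  "'a::euclidean_space set \<Rightarrow> (nat \<Rightarrow> real) \<Rightarrow> (nat \<Rightarrow> 'a \<Rightarrow> real) \<Rightarrow> real \<Rightarrow> ('a \<Rightarrow> real) set" where
  "HH_space \<Omega> lam \<phi> r =
     {w \<in> L2_space \<Omega>. summable (\<lambda>k. lam k powr r * (L2_inner \<Omega> w (\<phi> k))\<^sup>2)}"

definition HH_norm ::
  "'a::euclidean_space set \<Rightarrow> (nat \<Rightarrow> real) \<Rightarrow> (nat \<Rightarrow> 'a \<Rightarrow> real) \<Rightarrow> real \<Rightarrow> ('a \<Rightarrow> real) \<Rightarrow> real" where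
  "HH_norm \<Omega> lam \<phi> r w = sqrt (\<Sum>k. lam k powr r * (L2_inner \<Omega> w (\<phi> k))\<^sup>2)"

text \<open>The dual of \<open>HH_space \<dots> r\<close>: only the values of a functional on \<open>HH_space \<dots> r\<close> matter, and
  the duality pairing \<open>\<langle>F, v\<rangle>\<close> is \<open>F v\<close>.  An \<open>f \<in> L\<^sup>2(\<Omega>)\<close> is identified with \<open>L2_inner \<Omega> f\<close>.\<close>

definition HH_dual ::
  "'a::euclidean_space set \<Rightarrow> (nat \<Rightarrow> real) \<Rightarrow> (nat \<Rightarrow> 'a \<Rightarrow> real) \<Rightarrow> real \<Rightarrow> (('a \<Rightarrow> real) \<Rightarrow> real) set" where
  "HH_dual \<Omega> lam \<phi> r = {F.
     (\<forall>v\<in>HH_space \<Omega> lam \<phi> r. \<forall>w\<in>HH_space \<Omega> lam \<phi> r. \<forall>a b.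
        F (\<lambda>x. a * v x + b * w x) = a * F v + b * F w) \<and>
     (\<exists>M. \<forall>v\<in>HH_space \<Omega> lam \<phi> r. \<bar>F v\<bar> \<le> M * HH_norm \<Omega> lam \<phi> r v)}"

definition HH_dual_norm ::
  "'a::euclidean_space set \<Rightarrow> (nat \<Rightarrow> real) \<Rightarrow> (nat \<Rightarrow> 'a \<Rightarrow> real) \<Rightarrow> real \<Rightarrow> (('a \<Rightarrow> real) \<Rightarrow> real) \<Rightarrow> real" where
  "HH_dual_norm \<Omega> lam \<phi> r F =
     (SUP v\<in>{v \<in> HH_space \<Omega> lam \<phi> r. HH_norm \<Omega> lam \<phi> r v \<le> 1}. \<bar>F v\<bar>)"

text \<open>\<open>\<Sum>\<^sub>k \<lambda>\<^sub>k\<^sup>s w\<^sub>k \<phi>\<^sub>k\<close> as an element of the dual space.\<close>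

definition fractional_power ::
  "'a::euclidean_space set \<Rightarrow> (nat \<Rightarrow> real) \<Rightarrow> (nat \<Rightarrow> 'a \<Rightarrow> real) \<Rightarrow> real \<Rightarrow>
     ('a \<Rightarrow> real) \<Rightarrow> (('a \<Rightarrow> real) \<Rightarrow> real)" where
  "fractional_power \<Omega> lam \<phi> s w =
     (\<lambda>v. \<Sum>k. lam k powr s * L2_inner \<Omega> w (\<phi> k) * L2_inner \<Omega> (\<phi> k) v)"


section \<open>Bochner spaces on a time interval\<close>

text \<open>A space of real-valued functions (or of functionals) is given by its carrier \<open>X\<close> and its
  norm \<open>N\<close>; both \<open>L\<^sup>2(\<Omega>)\<close> and the dual spaces above are of this kind.\<close>

definition strongly_measurable ::
  "real measure \<Rightarrow> ('c \<Rightarrow> real) set \<Rightarrow> (('c \<Rightarrow> real) \<Rightarrow> real) \<Rightarrow> (real \<Rightarrow> 'c \<Rightarrow> real) \<Rightarrow> bool" where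
  "strongly_measurable M X N u \<longleftrightarrow> (AE t in M. u t \<in> X) \<and>
     (\<exists>\<sigma>. (\<forall>j. simple_function M (\<sigma> j) \<and> \<sigma> j ` space M \<subseteq> X) \<and>
        (AE t in M. (\<lambda>j::nat. N (\<lambda>x. \<sigma> j t x - u t x)) \<longlonglongrightarrow> 0))"

definition simple_integral_fun :: "real measure \<Rightarrow> (real \<Rightarrow> 'c \<Rightarrow> real) \<Rightarrow> 'c \<Rightarrow> real" where
  "simple_integral_fun M \<sigma> = (\<lambda>x. \<Sum>z\<in>\<sigma> ` space M. measure M (\<sigma> -` {z} \<inter> space M) * z x)"

text \<open>Bochner integral over a finite measure space.  Its value is determined up to \<open>N\<close>-distance 0.\<close>

definition has_vector_integral ::
  "real measure \<Rightarrow> ('c \<Rightarrow> real) set \<Rightarrow> (('c \<Rightarrow> real) \<Rightarrow> real) \<Rightarrow> (real \<Rightarrow> 'c \<Rightarrow> real) \<Rightarrow>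
     ('c \<Rightarrow> real) \<Rightarrow> bool" where
  "has_vector_integral M X N u I \<longleftrightarrow> (AE t in M. u t \<in> X) \<and> I \<in> X \<and>
     (\<exists>\<sigma>. (\<forall>j. simple_function M (\<sigma> j) \<and> \<sigma> j ` space M \<subseteq> X) \<and>
        (AE t in M. (\<lambda>j::nat. N (\<lambda>x. \<sigma> j t x - u t x)) \<longlonglongrightarrow> 0) \<and>
        (\<lambda>j. \<integral>\<^sup>+ t. ennreal (N (\<lambda>x. \<sigma> j t x - u t x)) \<partial>M) \<longlonglongrightarrow> 0 \<and>
        (\<lambda>j. N (\<lambda>x. simple_integral_fun M (\<sigma> j) x - I x)) \<longlonglongrightarrow> 0)"

definition Lp_time ::
  "real \<Rightarrow> real \<Rightarrow> ('c \<Rightarrow> real) set \<Rightarrow> (('c \<Rightarrow> real) \<Rightarrow> real) \<Rightarrow> (real \<Rightarrow> 'c \<Rightarrow> real) set" where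
  "Lp_time p T X N = {u. strongly_measurable (lebesgue_on {0<..<T}) X N u \<and>
     integrable (lebesgue_on {0<..<T}) (\<lambda>t. N (u t) powr p)}"

definition Lp_time_norm ::
  "real \<Rightarrow> real \<Rightarrow> (('c \<Rightarrow> real) \<Rightarrow> real) \<Rightarrow> (real \<Rightarrow> 'c \<Rightarrow> real) \<Rightarrow> real" where
  "Lp_time_norm p T N u = (LINT t|lebesgue_on {0<..<T}. N (u t) powr p) powr (1 / p)"

definition Linf_time ::
  "real \<Rightarrow> ('c \<Rightarrow> real) set \<Rightarrow> (('c \<Rightarrow> real) \<Rightarrow> real) \<Rightarrow> (real \<Rightarrow> 'c \<Rightarrow> real) set" where
  "Linf_time T X N = {u. strongly_measurable (lebesgue_on {0<..<T}) X N u \<and>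
     esssup (lebesgue_on {0<..<T}) (\<lambda>t. ereal (N (u t))) < \<infinity>}"

definition Linf_time_norm :: "real \<Rightarrow> (('c \<Rightarrow> real) \<Rightarrow> real) \<Rightarrow> (real \<Rightarrow> 'c \<Rightarrow> real) \<Rightarrow> real" where
  "Linf_time_norm T N u = real_of_ereal (esssup (lebesgue_on {0<..<T}) (\<lambda>t. ereal (N (u t))))"

definition C_time ::
  "real \<Rightarrow> ('c \<Rightarrow> real) set \<Rightarrow> (('c \<Rightarrow> real) \<Rightarrow> real) \<Rightarrow> (real \<Rightarrow> 'c \<Rightarrow> real) set" where
  "C_time T X N = {u. \<forall>t\<in>{0..T}. u t \<in> X \<and>
     ((\<lambda>\<tau>. N (\<lambda>x. u \<tau> x - u t x)) \<longlongrightarrow> 0) (at t within {0..T})}"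

text \<open>The distributional time derivative of an \<open>L\<^sup>2(\<Omega>)\<close>-valued function.\<close>

definition has_weak_time_derivative ::
  "'a::euclidean_space set \<Rightarrow> real \<Rightarrow> (real \<Rightarrow> 'a \<Rightarrow> real) \<Rightarrow> (real \<Rightarrow> 'a \<Rightarrow> real) \<Rightarrow> bool" where
  "has_weak_time_derivative \<Omega> T u u' \<longleftrightarrow>
     u \<in> Lp_time 1 T (L2_space \<Omega>) (L2_norm \<Omega>) \<and> u' \<in> Lp_time 1 T (L2_space \<Omega>) (L2_norm \<Omega>) \<and>
     (\<forall>\<psi>\<in>test_functions {0<..<T}. \<exists>I.
        has_vector_integral (lebesgue_on {0<..<T}) (L2_space \<Omega>) (L2_norm \<Omega>)
          (\<lambda>t x. deriv \<psi> t * u t x) I \<and>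
        has_vector_integral (lebesgue_on {0<..<T}) (L2_space \<Omega>) (L2_norm \<Omega>)
          (\<lambda>t x. - \<psi> t * u' t x) I)"


section \<open>The Caputo derivative of order between 1 and 2\<close>

text \<open>For a function \<open>y\<close> with \<open>y' = p\<close> whose second derivative \<open>y'' = q\<close> is integrable, the Caputo
  derivative is given by the following formula.\<close>

definition caputo_formula :: "real \<Rightarrow> (real \<Rightarrow> real) \<Rightarrow> real \<Rightarrow> real" where
  "caputo_formula \<gamma> q t = 1 / Gamma (2 - \<gamma>) * (LINT r|lebesgue_on {0..t}. (t - r) powr (1 - \<gamma>) * q r)"

text \<open>Solutions of the wave problem with merely bounded \<open>f\<close> have a continuous first, but in general no
  integrable second time derivative, so the formula has to be read with \<open>y''\<close> a distribution.
  Integrating it over \<open>(0,t)\<close> and using \<open>\<integral>\<^sub>0\<^sup>t y'' = p(t) - p(0)\<close> gives an identity that only involves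
  \<open>p\<close>; lemma \<open>caputo_derivative_iff_formula\<close> below shows that the two agree
  whenever \<open>y''\<close> is integrable.\<close>

definition caputo_derivative :: "real \<Rightarrow> real \<Rightarrow> (real \<Rightarrow> real) \<Rightarrow> (real \<Rightarrow> real) \<Rightarrow> bool" where
  "caputo_derivative \<gamma> T p z \<longleftrightarrow> integrable (lebesgue_on {0..T}) z \<and>
     (\<forall>t\<in>{0..T}. (LINT r|lebesgue_on {0..t}. z r) =
        1 / Gamma (2 - \<gamma>) * (LINT r|lebesgue_on {0..t}. (t - r) powr (1 - \<gamma>) * (p r - p 0)))"

section \<open>Solution operators\<close>

definition mittag_leffler :: "real \<Rightarrow> real \<Rightarrow> real \<Rightarrow> real" where
  "mittag_leffler \<gamma> \<mu> z = (\<Sum>k. z ^ k / Gamma (\<gamma> * real k + \<mu>))"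

definition spectral_multiplier ::
  "'a::euclidean_space set \<Rightarrow> (nat \<Rightarrow> 'a \<Rightarrow> real) \<Rightarrow> (nat \<Rightarrow> real) \<Rightarrow> ('a \<Rightarrow> real) \<Rightarrow> 'a \<Rightarrow> real" where
  "spectral_multiplier \<Omega> \<phi> m w =
     (SOME y. L2_sums \<Omega> (\<lambda>k x. m k * L2_inner \<Omega> w (\<phi> k) * \<phi> k x) y)"

definition G_op where
  "G_op \<Omega> lam \<phi> s \<gamma> t =
     spectral_multiplier \<Omega> \<phi> (\<lambda>k. mittag_leffler \<gamma> 1 (- (lam k powr s) * t powr \<gamma>))"

definition H_op where
  "H_op \<Omega> lam \<phi> s \<gamma> t =
     spectral_multiplier \<Omega> \<phi> (\<lambda>k. t * mittag_leffler \<gamma> 2 (- (lam k powr s) * t powr \<gamma>))"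

definition F_op where
  "F_op \<Omega> lam \<phi> s \<gamma> t =
     spectral_multiplier \<Omega> \<phi>
       (\<lambda>k. t powr (\<gamma> - 1) * mittag_leffler \<gamma> \<gamma> (- (lam k powr s) * t powr \<gamma>))"


section \<open>Weak solutions\<close>

text \<open>\<open>u'\<close> is the continuous representative of \<open>\<partial>\<^sub>t u\<close>, which gives the initial conditions their
  meaning, and \<open>w = \<partial>\<^sub>t\<^sup>\<gamma> u\<close>.  The Caputo derivative is an identity in the dual space, so it is
  tested against all \<open>v\<close>.\<close>

definition weak_solution ::
  "'a::euclidean_space set \<Rightarrow> (nat \<Rightarrow> real) \<Rightarrow> (nat \<Rightarrow> 'a \<Rightarrow> real) \<Rightarrow> real \<Rightarrow> real \<Rightarrow> real \<Rightarrow>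
     (real \<Rightarrow> 'a \<Rightarrow> real) \<Rightarrow> ('a \<Rightarrow> real) \<Rightarrow> ('a \<Rightarrow> real) \<Rightarrow> (real \<Rightarrow> 'a \<Rightarrow> real) \<Rightarrow> bool" where
  "weak_solution \<Omega> lam \<phi> s \<gamma> T f g h u \<longleftrightarrow>
     u \<in> Linf_time T (HH_space \<Omega> lam \<phi> s) (HH_norm \<Omega> lam \<phi> s) \<and>
     u \<in> C_time T (HH_space \<Omega> lam \<phi> s) (HH_norm \<Omega> lam \<phi> s) \<and>
     (AE x in lebesgue_on \<Omega>. u 0 x = g x) \<and>
     (\<exists>u' w.
        has_weak_time_derivative \<Omega> T u u' \<and>
        u' \<in> Linf_time T (L2_space \<Omega>) (L2_norm \<Omega>) \<and>
        u' \<in> C_time T (L2_space \<Omega>) (L2_norm \<Omega>) \<and>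
        (AE x in lebesgue_on \<Omega>. u' 0 x = h x) \<and>
        w \<in> Lp_time 2 T (HH_dual \<Omega> lam \<phi> s) (HH_dual_norm \<Omega> lam \<phi> s) \<and>
        (\<forall>v\<in>HH_space \<Omega> lam \<phi> s. caputo_derivative \<gamma> T (\<lambda>t. L2_inner \<Omega> (u' t) v) (\<lambda>t. w t v)) \<and>
        (AE t in lebesgue_on {0<..<T}. \<forall>v\<in>HH_space \<Omega> lam \<phi> s.
           w t v + fractional_power \<Omega> lam \<phi> s (u t) v = L2_inner \<Omega> (f t) v))"


section \<open>Consistency of the two forms of the Caputo derivative\<close>

lemma AE_zero_of_integral_Ioi_zero:
  fixes d :: "real \<Rightarrow> real"
  assumes d: "integrable lborel d"
    and z: "\<And>t. (LINT x|lborel. indicator {t<..} x * d x) = 0"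
  shows "AE x in lborel. d x = 0"
proof -
  have [measurable]: "d \<in> borel_measurable lborel" using d by auto
  let ?P = "density lborel (\<lambda>x. ennreal (d x))"
  let ?N = "density lborel (\<lambda>x. ennreal (- d x))"
  have ii: "integrable lborel (\<lambda>x. indicator {t<..} x * max 0 (e x))"
    if "integrable lborel e" for t :: real and e :: "real \<Rightarrow> real"
  proof -
    have "integrable lborel (\<lambda>x. indicator {t<..} x *\<^sub>R max 0 (e x))"
      using that by (intro integrable_mult_indicator integrable_max) auto
    then show ?thesis by simp
  qed
  have em: "emeasure (density lborel (\<lambda>x. ennreal (e x))) {t<..}
      = ennreal (LINT x|lborel. indicator {t<..} x * max 0 (e x))"
    if e: "integrable lborel e" for t :: real and e :: "real \<Rightarrow> real"
  proof -
    have [measurable]: "e \<in> borel_measurable lborel" using e by auto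
    have "emeasure (density lborel (\<lambda>x. ennreal (e x))) {t<..}
        = (\<integral>\<^sup>+ x. ennreal (indicator {t<..} x * max 0 (e x)) \<partial>lborel)"
      by (subst emeasure_density)
         (auto intro!: nn_integral_cong simp: indicator_def max_def ennreal_neg split: if_splits)
    also have "\<dots> = ennreal (LINT x|lborel. indicator {t<..} x * max 0 (e x))"
      by (intro nn_integral_eq_integral ii e) auto
    finally show ?thesis .
  qed
  have nd: "integrable lborel (\<lambda>x. - d x)" using d by simp
  have "?P = ?N"
  proof (rule measure_eqI_lessThan)
    fix t :: real
    show "emeasure ?P {t<..} < \<infinity>" by (simp add: em[OF d])
    have "(LINT x|lborel. indicator {t<..} x * max 0 (d x)) - (LINT x|lborel. indicator {t<..} x * max 0 (- d x))
        = (LINT x|lborel. indicator {t<..} x * max 0 (d x) - indicator {t<..} x * max 0 (- d x))"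
      by (intro Bochner_Integration.integral_diff[symmetric] ii d nd)
    also have "\<dots> = (LINT x|lborel. indicator {t<..} x * d x)"
      by (intro Bochner_Integration.integral_cong) (auto simp: indicator_def max_def)
    finally show "emeasure ?P {t<..} = emeasure ?N {t<..}"
      using z[of t] by (simp add: em[OF d] em[OF nd])
  qed auto
  then have "AE x in lborel. ennreal (d x) = ennreal (- d x)"
    by (intro sigma_finite_measure.density_unique[OF sigma_finite_lborel]) auto
  then show ?thesis
    by eventually_elim (smt (verit) ennreal_eq_0_iff ennreal_neg)
qed

lemma integral_powr_kernel:
  fixes a \<rho> \<tau> :: real
  assumes a: "-1 < a" and c: "\<rho> \<le> t"
  shows "has_bochner_integral lborel (\<lambda>x. indicator {\<rho>..t} x * (x - \<rho>) powr a) ((t - \<rho>) powr (a + 1) / (a + 1))"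
    and "has_bochner_integral lborel (\<lambda>x. indicator {\<rho>..t} x * (t - x) powr a) ((t - \<rho>) powr (a + 1) / (a + 1))"
proof -
  define K where "K = (t - \<rho>) powr (a + 1) / (a + 1)"
  have "((\<lambda>x. x powr a) has_integral K) {0..t - \<rho>}"
    unfolding K_def using assms by (intro has_integral_powr_from_0) auto
  from nn_integral_has_integral_lebesgue[OF _ this]
  have "(\<integral>\<^sup>+ x. ennreal (indicator {0..t - \<rho>} x * x powr a) \<partial>lborel) = ennreal K" by auto
  then have *: "has_bochner_integral lborel (\<lambda>x. indicator {0..t - \<rho>} x * x powr a) K"
    using assms by (intro has_bochner_integral_nn_integral) (auto simp: K_def)
  have 1: "(\<lambda>x. indicator {0..t - \<rho>} (- \<rho> + 1 * x) * (- \<rho> + 1 * x) powr a)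
      = (\<lambda>x. indicator {\<rho>..t} x * (x - \<rho>) powr a)"
    by (auto simp: fun_eq_iff indicator_def)
  have 2: "(\<lambda>x. indicator {0..t - \<rho>} (t + (-1) * x) * (t + (-1) * x) powr a)
      = (\<lambda>x. indicator {\<rho>..t} x * (t - x) powr a)"
    by (auto simp: fun_eq_iff indicator_def)
  show "has_bochner_integral lborel (\<lambda>x. indicator {\<rho>..t} x * (x - \<rho>) powr a) ((t - \<rho>) powr (a + 1) / (a + 1))"
    using * lborel_integrable_real_affine[of "\<lambda>x. indicator {0..t - \<rho>} x * x powr a" 1 "-\<rho>"]
      lborel_integral_real_affine[of 1 "\<lambda>x. indicator {0..t - \<rho>} x * x powr a" "-\<rho>"]
    unfolding 1 K_def[symmetric] has_bochner_integral_iff by simp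
  show "has_bochner_integral lborel (\<lambda>x. indicator {\<rho>..t} x * (t - x) powr a) ((t - \<rho>) powr (a + 1) / (a + 1))"
    using * lborel_integrable_real_affine[of "\<lambda>x. indicator {0..t - \<rho>} x * x powr a" "-1" t]
      lborel_integral_real_affine[of "-1" "\<lambda>x. indicator {0..t - \<rho>} x * x powr a" t]
    unfolding 2 K_def[symmetric] has_bochner_integral_iff by simp
qed

lemma integral_kernel_swap:
  fixes k :: "real \<Rightarrow> real \<Rightarrow> real" and q W :: "real \<Rightarrow> real"
  assumes [measurable]: "case_prod k \<in> borel_measurable (lborel \<Otimes>\<^sub>M lborel)"
    and q: "integrable lborel q"
    and nonneg: "\<And>\<tau> r. 0 \<le> k \<tau> r"
    and k: "\<And>r. has_bochner_integral lborel (\<lambda>\<tau>. k \<tau> r) (W r)"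
    and W: "\<And>r. W r \<le> B" "W \<in> borel_measurable lborel"
  shows "has_bochner_integral lborel (\<lambda>\<tau>. LINT r|lborel. k \<tau> r * q r) (LINT r|lborel. W r * q r)"
proof -
  have [measurable]: "q \<in> borel_measurable lborel" using q by auto
  have k1: "integrable lborel (\<lambda>\<tau>. k \<tau> r)" "(LINT \<tau>|lborel. k \<tau> r) = W r" for r
    using k[of r] by (auto simp: has_bochner_integral_iff)
  have W0: "0 \<le> W r" for r
    using nonneg k1(2)[of r] by (metis Bochner_Integration.integral_nonneg)
  have Wq: "integrable lborel (\<lambda>r. W r * \<bar>q r\<bar>)"
  proof (rule Bochner_Integration.integrable_bound)
    show "integrable lborel (\<lambda>r. B * \<bar>q r\<bar>)" using q by auto
    show "(\<lambda>r. W r * \<bar>q r\<bar>) \<in> borel_measurable lborel" using W(2) by measurable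
    show "AE r in lborel. norm (W r * \<bar>q r\<bar>) \<le> norm (B * \<bar>q r\<bar>)"
      using W(1) W0 by (auto simp: abs_mult intro!: AE_I2 mult_right_mono order_trans[OF W(1)])
  qed
  have I: "integrable (lborel \<Otimes>\<^sub>M lborel) (\<lambda>(r, \<tau>). k \<tau> r * q r)"
  proof (rule lborel_pair.Fubini_integrable)
    have [measurable]: "(\<lambda>(r, \<tau>). k \<tau> r) \<in> borel_measurable (lborel \<Otimes>\<^sub>M lborel)"
      using measurable_pair_swap[OF assms(1)] by (simp add: split_def)
    show "(\<lambda>(r, \<tau>). k \<tau> r * q r) \<in> borel_measurable (lborel \<Otimes>\<^sub>M lborel)"
    proof -
      have "(\<lambda>p. (case p of (r, \<tau>) \<Rightarrow> k \<tau> r) * q (fst p)) \<in> borel_measurable (lborel \<Otimes>\<^sub>M lborel)"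
        by measurable
      then show ?thesis by (simp add: split_def)
    qed
    have "(\<lambda>r. LINT \<tau>|lborel. norm (case (r, \<tau>) of (r, \<tau>) \<Rightarrow> k \<tau> r * q r)) = (\<lambda>r. W r * \<bar>q r\<bar>)"
      using nonneg k1(2) by (auto simp: abs_mult fun_eq_iff)
    then show "integrable lborel (\<lambda>r. LINT \<tau>|lborel. norm (case (r, \<tau>) of (r, \<tau>) \<Rightarrow> k \<tau> r * q r))"
      using Wq by simp
    show "AE r in lborel. integrable lborel (\<lambda>\<tau>. case (r, \<tau>) of (r, \<tau>) \<Rightarrow> k \<tau> r * q r)"
      using k1(1) by auto
  qed
  have "integrable lborel (\<lambda>\<tau>. LINT r|lborel. k \<tau> r * q r)"
    using lborel_pair.integrable_snd[OF I] .
  moreover have "(LINT \<tau>|lborel. LINT r|lborel. k \<tau> r * q r) = (LINT r|lborel. LINT \<tau>|lborel. k \<tau> r * q r)"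
    using lborel_pair.Fubini_integral[OF I] .
  ultimately show ?thesis using k1(2) by (simp add: has_bochner_integral_iff)
qed

lemma caputo_kernel_identity:
  fixes q :: "real \<Rightarrow> real"
  assumes \<gamma>: "1 < \<gamma>" "\<gamma> < 2" and q: "integrable lborel q"
  shows "has_bochner_integral lborel
      (\<lambda>\<tau>. indicator {0..t} \<tau> * (LINT r|lborel. indicator {0..\<tau>} r * (\<tau> - r) powr (1 - \<gamma>) * q r))
      (LINT r|lborel. indicator {0..t} r * (t - r) powr (1 - \<gamma>) * (LINT \<rho>|lborel. indicator {0..r} \<rho> * q \<rho>))"
proof -
  define W where "W r = indicator {0..t} r * ((t - r) powr (2 - \<gamma>) / (2 - \<gamma>))" for r
  have Wm: "W \<in> borel_measurable lborel" unfolding W_def by measurable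
  have WB: "W r \<le> \<bar>t\<bar> powr (2 - \<gamma>) / (2 - \<gamma>)" for r
    using \<gamma> by (auto simp: W_def indicator_def intro!: divide_right_mono powr_mono2)
  have "has_bochner_integral lborel
      (\<lambda>\<tau>. LINT r|lborel. (if 0 \<le> r \<and> r \<le> \<tau> \<and> \<tau> \<le> t then (\<tau> - r) powr (1 - \<gamma>) else 0) * q r)
      (LINT r|lborel. W r * q r)"
  proof (rule integral_kernel_swap[OF _ q _ _ WB Wm])
    fix r
    show "has_bochner_integral lborel
      (\<lambda>\<tau>. if 0 \<le> r \<and> r \<le> \<tau> \<and> \<tau> \<le> t then (\<tau> - r) powr (1 - \<gamma>) else 0) (W r)"
    proof (cases "0 \<le> r \<and> r \<le> t")
      case True
      then have "(\<lambda>\<tau>. if 0 \<le> r \<and> r \<le> \<tau> \<and> \<tau> \<le> t then (\<tau> - r) powr (1 - \<gamma>) else 0)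
          = (\<lambda>\<tau>. indicator {r..t} \<tau> * (\<tau> - r) powr (1 - \<gamma>))" by (auto simp: fun_eq_iff)
      then show ?thesis using True integral_powr_kernel(1)[of "1 - \<gamma>" r t] \<gamma> by (simp add: W_def)
    next
      case False
      then have "(\<lambda>\<tau>. if 0 \<le> r \<and> r \<le> \<tau> \<and> \<tau> \<le> t then (\<tau> - r) powr (1 - \<gamma>) else 0) = (\<lambda>_. 0)"
        "W r = 0" by (auto simp: fun_eq_iff W_def)
      then show ?thesis by (simp add: has_bochner_integral_zero)
    qed
  qed auto
  moreover have "(LINT r|lborel. (if 0 \<le> r \<and> r \<le> \<tau> \<and> \<tau> \<le> t then (\<tau> - r) powr (1 - \<gamma>) else 0) * q r)
      = indicator {0..t} \<tau> * (LINT r|lborel. indicator {0..\<tau>} r * (\<tau> - r) powr (1 - \<gamma>) * q r)" for \<tau>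
    unfolding Bochner_Integration.integral_mult_right_zero[symmetric]
    by (intro Bochner_Integration.integral_cong) (auto simp: indicator_def)
  ultimately have 1: "has_bochner_integral lborel
      (\<lambda>\<tau>. indicator {0..t} \<tau> * (LINT r|lborel. indicator {0..\<tau>} r * (\<tau> - r) powr (1 - \<gamma>) * q r))
      (LINT r|lborel. W r * q r)" by simp
  have "has_bochner_integral lborel
      (\<lambda>\<tau>. LINT r|lborel. (if 0 \<le> r \<and> r \<le> \<tau> \<and> \<tau> \<le> t then (t - \<tau>) powr (1 - \<gamma>) else 0) * q r)
      (LINT r|lborel. W r * q r)"
  proof (rule integral_kernel_swap[OF _ q _ _ WB Wm])
    fix r
    show "has_bochner_integral lborel
      (\<lambda>\<tau>. if 0 \<le> r \<and> r \<le> \<tau> \<and> \<tau> \<le> t then (t - \<tau>) powr (1 - \<gamma>) else 0) (W r)"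
    proof (cases "0 \<le> r \<and> r \<le> t")
      case True
      then have "(\<lambda>\<tau>. if 0 \<le> r \<and> r \<le> \<tau> \<and> \<tau> \<le> t then (t - \<tau>) powr (1 - \<gamma>) else 0)
          = (\<lambda>\<tau>. indicator {r..t} \<tau> * (t - \<tau>) powr (1 - \<gamma>))" by (auto simp: fun_eq_iff)
      then show ?thesis using True integral_powr_kernel(2)[of "1 - \<gamma>" r t] \<gamma> by (simp add: W_def)
    next
      case False
      then have "(\<lambda>\<tau>. if 0 \<le> r \<and> r \<le> \<tau> \<and> \<tau> \<le> t then (t - \<tau>) powr (1 - \<gamma>) else 0) = (\<lambda>_. 0)"
        "W r = 0" by (auto simp: fun_eq_iff W_def)
      then show ?thesis by (simp add: has_bochner_integral_zero)
    qed
  qed auto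
  moreover have "(LINT r|lborel. (if 0 \<le> r \<and> r \<le> \<tau> \<and> \<tau> \<le> t then (t - \<tau>) powr (1 - \<gamma>) else 0) * q r)
      = indicator {0..t} \<tau> * (t - \<tau>) powr (1 - \<gamma>) * (LINT r|lborel. indicator {0..\<tau>} r * q r)" for \<tau>
    unfolding Bochner_Integration.integral_mult_right_zero[symmetric]
    by (intro Bochner_Integration.integral_cong) (auto simp: indicator_def)
  ultimately have "(LINT r|lborel. indicator {0..t} r * (t - r) powr (1 - \<gamma>) * (LINT \<rho>|lborel. indicator {0..r} \<rho> * q \<rho>))
      = (LINT r|lborel. W r * q r)" by (simp add: has_bochner_integral_iff)
  with 1 show ?thesis by simp
qed

lemma lebesgue_on_borel_representative:
  fixes f :: "real \<Rightarrow> real"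
  assumes "integrable (lebesgue_on {0..T}) f"
  obtains f' where "integrable lborel f'"
    "AE x in lborel. indicator {0..T} x * f x = f' x"
    "\<And>x. x \<notin> {0..T} \<Longrightarrow> f' x = 0"
    "\<And>t m. t \<le> T \<Longrightarrow> m \<in> borel_measurable borel \<Longrightarrow>
       (LINT r|lebesgue_on {0..t}. m r * f r) = (LINT r|lborel. indicator {0..t} r * m r * f' r)"
proof -
  have i: "integrable lebesgue (\<lambda>x. indicator {0..T} x * f x)"
    using assms by (subst (asm) integrable_restrict_space) auto
  then have "(\<lambda>x. indicator {0..T} x * f x) \<in> borel_measurable (completion lborel)" by auto
  from completion_ex_borel_measurable_real[OF this] obtain g where
    g[measurable]: "g \<in> borel_measurable lborel" and ae: "AE x in lborel. indicator {0..T} x * f x = g x" by auto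
  define f' where "f' x = indicator {0..T} x * g x" for x
  have [measurable]: "f' \<in> borel_measurable lborel" unfolding f'_def by measurable
  have ae': "AE x in lborel. indicator {0..T} x * f x = f' x"
    using ae by eventually_elim (auto simp: f'_def indicator_def of_bool_def split: if_splits)
  have "integrable lebesgue f'"
    using i AE_completion[OF ae'] by (subst integrable_cong_AE[symmetric]) (auto simp: measurable_completion)
  then have "integrable lborel f'" by (simp add: integrable_completion)
  moreover have "(LINT r|lebesgue_on {0..t}. m r * f r) = (LINT r|lborel. indicator {0..t} r * m r * f' r)"
    if "t \<le> T" and [measurable]: "m \<in> borel_measurable borel" for t m
  proof -
    have mm: "(\<lambda>x. indicator {0..t} x * m x) \<in> borel_measurable lebesgue"
      by (rule measurable_completion) measurable
    have "(LINT r|lebesgue_on {0..t}. m r * f r)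
        = (LINT r|lebesgue. (indicator {0..t} r * m r) * (indicator {0..T} r * f r))"
      using that by (subst integral_restrict_space)
        (auto intro!: Bochner_Integration.integral_cong simp: indicator_def)
    also have "\<dots> = (LINT r|lebesgue. indicator {0..t} r * m r * f' r)"
    proof (rule integral_cong_AE)
      show "(\<lambda>r. indicator {0..t} r * m r * (indicator {0..T} r * f r)) \<in> borel_measurable lebesgue"
        by (rule borel_measurable_times[OF mm borel_measurable_integrable[OF i]])
      show "(\<lambda>r. indicator {0..t} r * m r * f' r) \<in> borel_measurable lebesgue"
        by (rule measurable_completion) measurable
      show "AE r in lebesgue. indicator {0..t} r * m r * (indicator {0..T} r * f r) = indicator {0..t} r * m r * f' r"
        using AE_completion[OF ae'] by eventually_elim simp
    qed
    also have "\<dots> = (LINT r|lborel. indicator {0..t} r * m r * f' r)"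
      by (rule integral_completion) measurable
    finally show ?thesis .
  qed
  ultimately show ?thesis using that[of f'] ae' by (auto simp: f'_def)
qed

lemma caputo_derivative_iff_formula:
  assumes \<gamma>: "1 < \<gamma>" "\<gamma> < 2"
    and q: "integrable (lebesgue_on {0..T}) q"
    and p: "\<And>t. t \<in> {0..T} \<Longrightarrow> p t = p 0 + (LINT r|lebesgue_on {0..t}. q r)"
    and z: "integrable (lebesgue_on {0..T}) z"
  shows "caputo_derivative \<gamma> T p z \<longleftrightarrow> (AE t in lebesgue_on {0..T}. z t = caputo_formula \<gamma> q t)"
proof -
  have p': "p t - p 0 = (LINT r|lebesgue_on {0..t}. q r)" if "0 \<le> t" "t \<le> T" for t
    using p[of t] that by simp
  obtain q' where q': "integrable lborel q'"
    "\<And>t m. t \<le> T \<Longrightarrow> m \<in> borel_measurable borel \<Longrightarrow>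
       (LINT r|lebesgue_on {0..t}. m r * q r) = (LINT r|lborel. indicator {0..t} r * m r * q' r)"
    by (rule lebesgue_on_borel_representative[OF q]) blast
  obtain z' where z': "integrable lborel z'" "AE x in lborel. indicator {0..T} x * z x = z' x"
    "\<And>x. x \<notin> {0..T} \<Longrightarrow> z' x = 0"
    "\<And>t m. t \<le> T \<Longrightarrow> m \<in> borel_measurable borel \<Longrightarrow>
       (LINT r|lebesgue_on {0..t}. m r * z r) = (LINT r|lborel. indicator {0..t} r * m r * z' r)"
    by (rule lebesgue_on_borel_representative[OF z]) blast
  define y where "y \<tau> = 1 / Gamma (2 - \<gamma>) * (LINT r|lborel. indicator {0..\<tau>} r * (\<tau> - r) powr (1 - \<gamma>) * q' r)" for \<tau>
  have y: "caputo_formula \<gamma> q t = y t" if "t \<le> T" for t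
    unfolding caputo_formula_def y_def using that by (subst q'(2)) auto
  have yi: "has_bochner_integral lborel (\<lambda>\<tau>. indicator {0..t} \<tau> * y \<tau>)
     (1 / Gamma (2 - \<gamma>) * (LINT r|lborel. indicator {0..t} r * (t - r) powr (1 - \<gamma>) * (LINT \<rho>|lborel. indicator {0..r} \<rho> * q' \<rho>)))" for t
    using has_bochner_integral_mult_right[OF caputo_kernel_identity[OF \<gamma> q'(1), of t], of "1 / Gamma (2 - \<gamma>)"]
    unfolding y_def by (simp add: mult_ac)
  have rhs: "1 / Gamma (2 - \<gamma>) * (LINT r|lebesgue_on {0..t}. (t - r) powr (1 - \<gamma>) * (p r - p 0))
     = (LINT \<tau>|lborel. indicator {0..t} \<tau> * y \<tau>)" if t: "t \<in> {0..T}" for t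
  proof -
    have "(LINT \<rho>|lebesgue_on {0..r}. q \<rho>) = (LINT \<rho>|lborel. indicator {0..r} \<rho> * q' \<rho>)" if "r \<le> T" for r
      using q'(2)[of r "\<lambda>_. 1"] that by simp
    then have "(LINT r|lebesgue_on {0..t}. (t - r) powr (1 - \<gamma>) * (p r - p 0))
        = (LINT r|lebesgue. indicator {0..t} r * (t - r) powr (1 - \<gamma>) * (LINT \<rho>|lborel. indicator {0..r} \<rho> * q' \<rho>))"
      using t by (subst integral_restrict_space)
        (auto intro!: Bochner_Integration.integral_cong simp: indicator_def p')
    also have "\<dots> = (LINT r|lborel. indicator {0..t} r * (t - r) powr (1 - \<gamma>) * (LINT \<rho>|lborel. indicator {0..r} \<rho> * q' \<rho>))"
    proof (rule integral_completion)
      have [measurable]: "q' \<in> borel_measurable lborel" using q'(1) by auto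
      have "(\<lambda>r. LINT \<rho>|lborel. (if 0 \<le> \<rho> \<and> \<rho> \<le> r then 1 else 0) * q' \<rho>) \<in> borel_measurable lborel"
        by measurable
      moreover have "(if 0 \<le> \<rho> \<and> \<rho> \<le> r then 1 else 0) = indicat_real {0..r} \<rho>" for \<rho> r :: real
        by (auto simp: indicator_def)
      ultimately have [measurable]: "(\<lambda>r. LINT \<rho>|lborel. indicator {0..r} \<rho> * q' \<rho>) \<in> borel_measurable lborel"
        by simp
      show "(\<lambda>r. indicator {0..t} r * (t - r) powr (1 - \<gamma>) * (LINT \<rho>|lborel. indicator {0..r} \<rho> * q' \<rho>)) \<in> borel_measurable lborel"
        by measurable
    qed
    finally show ?thesis using yi[of t] by (simp add: has_bochner_integral_iff)
  qed
  have lhs: "(LINT r|lebesgue_on {0..t}. z r) = (LINT \<tau>|lborel. indicator {0..t} \<tau> * z' \<tau>)" if "t \<in> {0..T}" for t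
    using z'(4)[of t "\<lambda>_. 1"] that by simp
  define d where "d x = z' x - indicator {0..T} x * y x" for x
  have zi: "integrable lborel (\<lambda>x. indicator {0..t} x * z' x)" for t :: real
    using integrable_mult_indicator[OF _ z'(1), of "{0..t}"] by simp
  have yi': "integrable lborel (\<lambda>x. indicator {0..t} x * y x)" for t
    using yi[of t] by (simp add: has_bochner_integral_iff)
  have di: "integrable lborel d" unfolding d_def using z'(1) yi'[of T] by auto
  have dI: "(LINT x|lborel. indicator {0..t} x * d x)
      = (LINT x|lborel. indicator {0..t} x * z' x) - (LINT x|lborel. indicator {0..t} x * y x)" if "t \<in> {0..T}" for t
    using that by (subst Bochner_Integration.integral_diff[OF zi yi', symmetric])
      (auto intro!: Bochner_Integration.integral_cong simp: d_def indicator_def)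
  have 1: "caputo_derivative \<gamma> T p z \<longleftrightarrow> (\<forall>t\<in>{0..T}. (LINT x|lborel. indicator {0..t} x * d x) = 0)"
  proof -
    have "caputo_derivative \<gamma> T p z \<longleftrightarrow> (\<forall>t\<in>{0..T}. (LINT r|lebesgue_on {0..t}. z r) =
        1 / Gamma (2 - \<gamma>) * (LINT r|lebesgue_on {0..t}. (t - r) powr (1 - \<gamma>) * (p r - p 0)))"
      unfolding caputo_derivative_def using z by blast
    also have "\<dots> \<longleftrightarrow> (\<forall>t\<in>{0..T}. (LINT x|lborel. indicator {0..t} x * d x) = 0)"
      by (intro ball_cong refl) (simp only: lhs rhs dI right_minus_eq)
    finally show ?thesis .
  qed
  have 2: "(\<forall>t\<in>{0..T}. (LINT x|lborel. indicator {0..t} x * d x) = 0) \<longleftrightarrow> (AE x in lborel. d x = 0)"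
  proof
    assume "AE x in lborel. d x = 0"
    then have "AE x in lborel. indicator {0..t} x * d x = 0" for t
      by eventually_elim simp
    then show "\<forall>t\<in>{0..T}. (LINT x|lborel. indicator {0..t} x * d x) = 0"
      by (auto intro!: integral_eq_zero_AE)
  next
    assume *: "\<forall>t\<in>{0..T}. (LINT x|lborel. indicator {0..t} x * d x) = 0"
    have d0: "d x = 0" if "x \<notin> {0..T}" for x using that by (simp add: d_def z'(3))
    have **: "(LINT x|lborel. indicator {0..t} x * d x) = 0" for t
    proof (cases "t \<in> {0..T}")
      case False
      show ?thesis
      proof (cases "t < 0 \<or> T < 0")
        case True
        then have "indicator {0..t} x * d x = 0" for x
          using d0[of x] by (auto simp: indicator_def)
        then show ?thesis by (simp only: Bochner_Integration.integral_zero)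
      next
        case F: False
        then have "indicator {0..t} x * d x = indicator {0..T} x * d x" for x
          using False d0[of x] by (auto simp: indicator_def)
        then have "(LINT x|lborel. indicator {0..t} x * d x) = (LINT x|lborel. indicator {0..T} x * d x)"
          by (simp only:)
        also have "\<dots> = 0" using * F by auto
        finally show ?thesis .
      qed
    qed (use * in auto)
    show "AE x in lborel. d x = 0"
    proof (rule AE_zero_of_integral_Ioi_zero[OF di])
      fix t
      have ind: "integrable lborel (\<lambda>x. indicator {0..t} x * d x)" for t
        using integrable_mult_indicator[OF _ di, of "{0..t}"] by simp
      have "indicator {t<..} x * d x = indicator {0..T} x * d x - indicator {0..t} x * d x" for x
        using d0[of x] by (auto simp: indicator_def)
      then show "(LINT x|lborel. indicator {t<..} x * d x) = 0"
        using ** ind by (simp add: Bochner_Integration.integral_diff)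
    qed
  qed
  have 3: "(AE x in lborel. d x = 0) \<longleftrightarrow> (AE x in lborel. x \<in> {0..T} \<longrightarrow> z x = caputo_formula \<gamma> q x)"
  proof -
    have "AE x in lborel. d x = 0 \<longleftrightarrow> (x \<in> {0..T} \<longrightarrow> z x = caputo_formula \<gamma> q x)"
      using z'(2) by eventually_elim (auto simp: d_def y indicator_def split: if_splits)
    then show ?thesis by (intro eventually_subst)
  qed
  show ?thesis
    unfolding 1 2 3 by (subst AE_restrict_space_iff) (auto simp: AE_completion_iff)
qed

end

theory Submission imports Defs "HOL-Complex_Analysis.Complex_Analysis" "HOL-Real_Asymp.Real_Asymp" begin

text \<open>In the eigenbasis the problem splits into the scalar equations
  \<open>\<partial>\<^sub>t\<^sup>\<gamma> y + l y = F\<close> with \<open>l = \<lambda>\<^sub>k\<^sup>s\<close>, which are solved explicitly by convolution with Mittag-Leffler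
  kernels.  Everything rests on bounds that are uniform in \<open>l\<close>, and these come from the decay
  \<open>\<bar>E\<^sub>\<gamma>\<^sub>\<mu>(-x)\<bar> \<le> C x\<^sup>-\<^sup>\<beta>\<close> for \<open>0 \<le> \<beta> \<le> 1\<close>, \<open>\<gamma>\<beta> < \<mu>\<close>.  To prove it, note that \<open>\<bar>s\<^sup>\<gamma> + l\<bar> \<ge> c (\<bar>s\<bar>\<^sup>\<gamma> + l)\<close> on the right half plane
  because \<open>1 < \<gamma> < 2\<close>.  Hence the Laplace transform of \<open>t\<^sup>\<mu> E\<^sub>\<gamma>\<^sub>\<mu>(-l t\<^sup>\<gamma>)\<close> is integrable along \<open>Re s = 1\<close> with
  integral \<open>O(l\<^sup>-\<^sup>\<beta>)\<close>, and inversion at \<open>t = 1\<close> gives the decay; the factor \<open>t\<^sup>\<mu>\<close>, in place of the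
  customary \<open>t\<close> to the power \<open>\<mu> - 1\<close>, improves the decay of the transform just enough for absolute convergence.

  With \<open>\<beta> = 1/2\<close> the square of the kernel of \<open>l\<close> to the power \<open>1/2\<close> times \<open>y\<close> is dominated by \<open>t\<close> to
  the power \<open>\<gamma> - 2\<close>, which is integrable, so that the Cauchy-Schwarz inequality bounds \<open>l y\<^sup>2\<close> by
  the square integral of \<open>F\<close>; with \<open>\<beta> = 0\<close> the same power dominates the kernel of \<open>y'\<close>.  Summation
  over the modes gives the two estimates, and uniformly small tails give continuity in time.  The difference of two solutions has
  coefficients with \<open>d = -l I\<^sup>\<gamma> d\<close>, \<open>I\<^sup>\<gamma>\<close> the fractional integral, which forces \<open>d = 0\<close>.  The
  Poincare inequality keeps the eigenvalues away from 0, so that \<open>L\<^sup>2(\<Omega>)\<close> embeds into the dual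
  of the energy space.\<close>

section \<open>Decay of Mittag-Leffler functions\<close>

text \<open>With the customary factor t^(\<mu>-1) the transform is s^(\<gamma>-\<mu>)/(s^\<gamma> +
  l), of size l^(-\<beta>) |s|^(\<gamma>\<beta>-\<mu>). In the decisive cases, \<mu> = \<gamma> with
  \<beta> = 1/2 and \<mu> = \<gamma> - 1 with \<beta> = 0, this exponent exceeds -1, so the
  inversion integral has no absolutely convergent majorant; one more power of t gains one power of
  s. The kernel of y' is of size t^(\<gamma>-2), integrable, but square integrable only for \<gamma>
  > 3/2. So Cauchy-Schwarz does not bound y' at a fixed time by the L2 norm of the forcing; that
  norm controls y' only after integration in time, and the pointwise bound uses the supremum of f.
  For continuity of the derivative, the tails of the squared coefficients of f(t) need not be small
  uniformly in t; they become so after convolution with an integrable kernel. The energy norm needs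
  no such care, its modes being dominated by a summable sequence free of t. Since y'' need not be
  integrable, the scalar equation is verified and compared in integrated form only, as identities
  between convolution kernels.\<close>

lemma integrable_vertical_line_powr:
  fixes a :: real
  assumes a: "a > 1"
  shows "integrable lborel (\<lambda>w. norm (Complex 1 w) powr (- a))"
proof -
  have "((\<lambda>x. x powr (- a)) has_integral -(1 powr (-a+1)) / (-a+1)) {1..}"
    by (rule has_integral_powr_to_inf) (use a in auto)
  from nn_integral_has_integral_lebesgue[OF _ this]
  have "(\<integral>\<^sup>+ x. ennreal (indicator {1..} x * x powr (- a)) \<partial>lborel) = ennreal (-(1 powr (-a+1)) / (-a+1))"
    by auto
  then have *: "integrable lborel (\<lambda>x. indicator {1..} x * x powr (- a))"
    by (intro integrableI_bounded) (auto simp: abs_mult)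
  have 1: "integrable lborel (\<lambda>x. indicator {1..} (1 + 1 * x) * (1 + 1 * x) powr (- a))"
    using lborel_integrable_real_affine[OF *, of 1 1] by simp
  have 2: "integrable lborel (\<lambda>x. indicator {1..} (1 + (-1) * x) * (1 + (-1) * x) powr (- a))"
    using lborel_integrable_real_affine[OF *, of "-1" 1] by simp
  show ?thesis
  proof (rule Bochner_Integration.integrable_bound)
    show "integrable lborel (\<lambda>x. 2 powr a * (indicator {1..} (1 + 1 * x) * (1 + 1 * x) powr (- a)
        + indicator {1..} (1 + (-1) * x) * (1 + (-1) * x) powr (- a)))"
      using 1 2 by auto
    show "(\<lambda>w. cmod (Complex 1 w) powr - a) \<in> borel_measurable lborel"
      unfolding complex_norm by measurable
    show "AE x in lborel. norm (cmod (Complex 1 x) powr - a) \<le> norm (2 powr a * (indicator {1..} (1 + 1 * x) * (1 + 1 * x) powr (- a)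
        + indicator {1..} (1 + (-1) * x) * (1 + (-1) * x) powr (- a)))"
    proof (rule AE_I2)
      fix x :: real
      have "(1 + \<bar>x\<bar>) / 2 \<le> cmod (Complex 1 x)"
        using abs_Re_le_cmod[of "Complex 1 x"] abs_Im_le_cmod[of "Complex 1 x"] by simp
      then have "cmod (Complex 1 x) powr - a \<le> ((1 + \<bar>x\<bar>) / 2) powr - a"
        using a by (intro powr_mono2') auto
      also have "\<dots> = 2 powr a * (1 + \<bar>x\<bar>) powr - a"
        by (simp add: powr_divide powr_minus_divide)
      also have "\<dots> \<le> 2 powr a * (indicator {1..} (1 + 1 * x) * (1 + 1 * x) powr (- a)
        + indicator {1..} (1 + (-1) * x) * (1 + (-1) * x) powr (- a))"
        by (intro mult_left_mono) (auto simp: indicator_def)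
      finally show "norm (cmod (Complex 1 x) powr - a) \<le> norm (2 powr a * (indicator {1..} (1 + 1 * x) * (1 + 1 * x) powr (- a)
        + indicator {1..} (1 + (-1) * x) * (1 + (-1) * x) powr (- a)))" by simp
    qed
  qed
qed

text \<open>Cauchy's formula for a growing rectangle whose left side lies on Re s = 1; the decay of
  H removes the other three sides. It evaluates the Laplace transform of the Bromwich integral in
  \<open>Laplace_inversion\<close>.\<close>

lemma half_plane_Cauchy_integral_formula:
  fixes H :: "complex \<Rightarrow> complex"
  assumes hol: "H holomorphic_on {s. Re s > 0}"
    and bd: "\<And>s. Re s \<ge> 1 \<Longrightarrow> norm (H s) \<le> B * norm s powr (- a)"
    and a: "a > 1" and p: "p > 1"
  shows "has_bochner_integral lborel (\<lambda>w. H (Complex 1 w) / (of_real p - Complex 1 w)) (2 * pi * H (of_real p))"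
proof -
  let ?f = "\<lambda>w. H (Complex 1 w) / (of_real p - Complex 1 w)"
  let ?I = "\<lambda>R. \<integral>w. indicator {-R..R} w *\<^sub>R ?f w \<partial>lborel"
  have B: "B \<ge> 0" using order_trans[OF norm_ge_zero bd[of 1]] by simp
  have cont: "continuous_on UNIV (\<lambda>w. H (Complex 1 w))"
  proof (rule continuous_on_compose2[OF holomorphic_on_imp_continuous_on[OF hol]])
    show "continuous_on UNIV (Complex 1)" unfolding Complex_eq by (intro continuous_intros)
  qed auto
  have nz: "of_real p - Complex 1 w \<noteq> 0" for w using p by (auto simp: complex_eq_iff)
  have contf: "continuous_on UNIV ?f"
    using cont nz unfolding Complex_eq by (intro continuous_intros) auto
  have int: "integrable lborel ?f"
  proof (rule Bochner_Integration.integrable_bound)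
    show "integrable lborel (\<lambda>w. B / (p - 1) * norm (Complex 1 w) powr (- a))"
      using integrable_vertical_line_powr[OF a] by (rule integrable_mult_right)
    show "?f \<in> borel_measurable lborel" using borel_measurable_continuous_onI[OF contf] by simp
    show "AE w in lborel. norm (?f w) \<le> norm (B / (p - 1) * norm (Complex 1 w) powr (- a))"
    proof (rule AE_I2)
      fix w
      have "p - 1 \<le> norm (of_real p - Complex 1 w)"
        using abs_Re_le_cmod[of "of_real p - Complex 1 w"] p by simp
      then have "norm (?f w) \<le> (B * norm (Complex 1 w) powr (- a)) / (p - 1)"
        unfolding norm_divide using bd[of "Complex 1 w"] p B by (intro frac_le) auto
      then show "norm (?f w) \<le> norm (B / (p - 1) * norm (Complex 1 w) powr (- a))"
        using B p by simp
    qed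
  qed
  have lim1: "((\<lambda>R. \<integral>w. indicator {-R..R} w *\<^sub>R ?f w \<partial>lborel) \<longlongrightarrow> (\<integral>w. ?f w \<partial>lborel)) at_top"
  proof (rule integral_dominated_convergence_at_top)
    show "integrable lborel (\<lambda>w. norm (?f w))" using int by (rule integrable_norm)
    show "?f \<in> borel_measurable lborel" using int by auto
    show "(\<lambda>w. indicator {-R..R} w *\<^sub>R ?f w) \<in> borel_measurable lborel" for R using int by measurable
    show "\<forall>\<^sub>F R in at_top. AE w in lborel. norm (indicator {-R..R} w *\<^sub>R ?f w) \<le> norm (?f w)"
      by (auto simp: indicator_def)
    show "AE w in lborel. ((\<lambda>R. indicator {-R..R} w *\<^sub>R ?f w) \<longlongrightarrow> ?f w) at_top"
    proof (rule AE_I2)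
      fix w :: real
      have "\<forall>\<^sub>F R in at_top. indicator {-R..R} w *\<^sub>R ?f w = ?f w"
        using eventually_ge_at_top[of "\<bar>w\<bar>"] by eventually_elim (auto simp: indicator_def)
      then show "((\<lambda>R. indicator {-R..R} w *\<^sub>R ?f w) \<longlongrightarrow> ?f w) at_top" by (rule tendsto_eventually)
    qed
  qed
  \<comment> \<open>The rectangle has the opposite corners 1 - iR and 1 + R + iR. Off the left side,
    H is at most B R^(-a) and the denominator at least R - p, and the three sides together are at
    most 5 R long.\<close>
  have est: "norm ((?I R) - 2 * pi * H (of_real p)) \<le> 5 * B * R powr (1 - a) / (R - p)"
    if R: "R > p" for R
  proof -
    define a1 a3 where "a1 = Complex 1 (-R)" and "a3 = Complex (1 + R) R"
    define a2 a4 where "a2 = Complex (1 + R) (-R)" and "a4 = Complex 1 R"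
    define g where "g = (\<lambda>w. H w / (w - of_real p))"
    have R0: "R > 1" using R p by simp
    have inbox: "of_real p \<in> box a1 a3" using R p by (auto simp: in_box_complex_iff a1_def a3_def)
    have sub: "path_image (rectpath a1 a3) \<subseteq> {s. Re s > 0} - {of_real p}"
    proof -
      have "path_image (rectpath a1 a3) = cbox a1 a3 - box a1 a3"
        by (rule path_image_rectpath_cbox_minus_box) (use R0 in \<open>auto simp: a1_def a3_def\<close>)
      moreover have "Re z > 0" if "z \<in> cbox a1 a3" for z
        using that by (simp add: in_cbox_complex_iff a1_def a3_def)
      ultimately show ?thesis using inbox by blast
    qed
    have "(g has_contour_integral (2*pi * \<i> * winding_number (rectpath a1 a3) (of_real p) * H (of_real p))) (rectpath a1 a3)"
      unfolding g_def
    proof (rule Cauchy_integral_formula_convex_simple[OF _ hol _ valid_path_rectpath sub])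
      show "convex {s. Re s > 0}" by (rule convex_halfspace_Re_gt)
      have "open {s. Re s > 0}" by (rule open_halfspace_Re_gt)
      then show "of_real p \<in> interior {s. Re s > 0}" using p by (simp add: interior_open)
    qed auto
    then have hci: "(g has_contour_integral (2*pi * \<i> * H (of_real p))) (linepath a1 a2 +++ linepath a2 a3 +++ linepath a3 a4 +++ linepath a4 a1)"
      using winding_number_rectpath[OF inbox] by (simp add: rectpath_def Let_def a1_def a2_def a3_def a4_def)
    have ci: "g contour_integrable_on linepath a1 a2" "g contour_integrable_on linepath a2 a3"
       "g contour_integrable_on linepath a3 a4" "g contour_integrable_on linepath a4 a1"
      using has_contour_integral_integrable[OF hci] by simp_all
    have eq: "2*pi * \<i> * H (of_real p) = contour_integral (linepath a1 a2) g + contour_integral (linepath a2 a3) g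
        + contour_integral (linepath a3 a4) g + contour_integral (linepath a4 a1) g"
      using contour_integral_unique[OF hci] ci by (simp add: add.assoc)
    have e: "norm (contour_integral (linepath x y) g) \<le> B * R powr (- a) / (R - p) * norm (y - x)"
      if g: "g contour_integrable_on linepath x y"
       and far: "\<And>z. z \<in> closed_segment x y \<Longrightarrow> Re z \<ge> 1 \<and> (R \<le> \<bar>Im z\<bar> \<or> Re z = 1 + R)" for x y
    proof (rule contour_integral_bound_linepath[OF g])
      show "0 \<le> B * R powr - a / (R - p)" using B R by auto
      fix z assume "z \<in> closed_segment x y"
      note z = far[OF this]
      have n: "R \<le> norm z" using z abs_Re_le_cmod[of z] abs_Im_le_cmod[of z] R0 by auto
      have d: "R - p \<le> norm (z - of_real p)"
        using z abs_Re_le_cmod[of "z - of_real p"] abs_Im_le_cmod[of "z - of_real p"] R p by auto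
      have "norm (H z) \<le> B * norm z powr (- a)" using bd z by auto
      also have "\<dots> \<le> B * R powr (- a)" using n R0 a B by (intro mult_left_mono powr_mono2') auto
      finally show "norm (g z) \<le> B * R powr (- a) / (R - p)"
        unfolding g_def norm_divide using d R B by (intro frac_le) auto
    qed
    have s1: "z \<in> closed_segment a1 a2 \<Longrightarrow> Re z \<ge> 1 \<and> (R \<le> \<bar>Im z\<bar> \<or> Re z = 1 + R)" for z
      using R0 by (auto simp: a1_def a2_def closed_segment_same_Im closed_segment_eq_real_ivl)
    have s2: "z \<in> closed_segment a2 a3 \<Longrightarrow> Re z \<ge> 1 \<and> (R \<le> \<bar>Im z\<bar> \<or> Re z = 1 + R)" for z
      using R0 by (auto simp: a3_def a2_def closed_segment_same_Re closed_segment_eq_real_ivl)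
    have s3: "z \<in> closed_segment a3 a4 \<Longrightarrow> Re z \<ge> 1 \<and> (R \<le> \<bar>Im z\<bar> \<or> Re z = 1 + R)" for z
      using R0 by (auto simp: a3_def a4_def closed_segment_same_Im closed_segment_eq_real_ivl)
    have l: "norm (a2 - a1) \<le> 2 * R" "norm (a3 - a2) \<le> 2 * R" "norm (a4 - a3) \<le> R"
      using R0 cmod_le[of "a2 - a1"] cmod_le[of "a3 - a2"] cmod_le[of "a4 - a3"] by (auto simp: a1_def a2_def a3_def a4_def)
    have sm: "norm (contour_integral (linepath a1 a2) g + contour_integral (linepath a2 a3) g
        + contour_integral (linepath a3 a4) g) \<le> B * R powr (- a) / (R - p) * (5 * R)"
    proof -
      have "norm (contour_integral (linepath a1 a2) g + contour_integral (linepath a2 a3) g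
        + contour_integral (linepath a3 a4) g) \<le> B * R powr (- a) / (R - p) * norm (a2 - a1)
          + B * R powr (- a) / (R - p) * norm (a3 - a2) + B * R powr (- a) / (R - p) * norm (a4 - a3)"
        by (intro order_trans[OF norm_triangle_ineq] add_mono e ci s1 s2 s3)
      also have "\<dots> \<le> B * R powr (- a) / (R - p) * (2 * R)
          + B * R powr (- a) / (R - p) * (2 * R) + B * R powr (- a) / (R - p) * R"
        using B R by (intro add_mono mult_left_mono l) auto
      finally show ?thesis by (simp add: algebra_simps)
    qed
    \<comment> \<open>The left side is traversed downwards; this sign and the one from replacing w -
      p by p - w cancel.\<close>
    have "contour_integral (linepath a4 a1) g = - contour_integral (linepath a1 a4) g"
      using contour_integral_reversepath[of "linepath a1 a4" g] by simp
    also have "contour_integral (linepath a1 a4) g = \<i> * integral {-R..R} (\<lambda>x. g (Complex 1 x))"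
      by (rule contour_integral_linepath_same_Re) (use R0 in \<open>auto simp: a1_def a4_def\<close>)
    also have "integral {-R..R} (\<lambda>x. g (Complex 1 x)) = - (?I R)"
    proof -
      have gf: "g (Complex 1 x) = - ?f x" for x
        unfolding g_def by (metis minus_diff_eq minus_divide_right)
      have "set_integrable lborel {-R..R} (\<lambda>x. g (Complex 1 x))"
        unfolding gf set_integrable_def using integrable_mult_indicator[OF _ int, of "{-R..R}"] by simp
      then have "integral {-R..R} (\<lambda>x. g (Complex 1 x)) = (LINT x:{-R..R}|lborel. g (Complex 1 x))"
        by (rule set_borel_integral_eq_integral(2)[symmetric])
      then show ?thesis unfolding gf set_lebesgue_integral_def by simp
    qed
    finally have "contour_integral (linepath a4 a1) g = \<i> * (?I R)" by simp
    with eq have "\<i> * (2*pi * H (of_real p) - (?I R)) = contour_integral (linepath a1 a2) g + contour_integral (linepath a2 a3) g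
        + contour_integral (linepath a3 a4) g" by (simp add: algebra_simps)
    with sm have "norm (\<i> * (2*pi * H (of_real p) - (?I R))) \<le> B * R powr (- a) / (R - p) * (5 * R)"
      by simp
    then have "norm ((?I R) - 2*pi * H (of_real p)) \<le> B * R powr (- a) / (R - p) * (5 * R)"
      by (simp add: norm_mult norm_minus_commute)
    also have "\<dots> = 5 * B * R powr (1 - a) / (R - p)"
      using R0 by (simp add: powr_diff powr_minus_divide)
    finally show ?thesis .
  qed
  have "((\<lambda>R. 5 * B * R powr (1 - a) / (R - p)) \<longlongrightarrow> 0) at_top"
    using a by real_asymp
  then have "((\<lambda>R. norm ((?I R) - 2 * pi * H (of_real p))) \<longlongrightarrow> 0) at_top"
    by (rule Lim_null_comparison[rotated]) (use eventually_gt_at_top[of p] in eventually_elim, use est in auto)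
  then have "((\<lambda>R. \<integral>w. indicator {-R..R} w *\<^sub>R ?f w \<partial>lborel) \<longlongrightarrow> 2 * pi * H (of_real p)) at_top"
    by (simp add: tendsto_norm_zero_iff LIM_zero_cancel)
  from tendsto_unique[OF _ lim1 this] have "(\<integral>w. ?f w \<partial>lborel) = 2 * pi * H (of_real p)" by simp
  with int show ?thesis by (simp add: has_bochner_integral_iff)
qed

text \<open>The substitution x = exp(-t) turns the transforms at the integers N + n into integrals
  of x^n against \<open>F\<close>, and F(t) = g(exp(-t)) with g continuous on [0, 1]. All of them
  vanish, so by Weierstrass approximation \<open>F\<close> is orthogonal to itself.\<close>

lemma Laplace_transform_unique:
  fixes f :: "real \<Rightarrow> real"
  assumes cont: "continuous_on {0..} f"
    and bd: "\<And>t. t \<ge> 0 \<Longrightarrow> \<bar>f t\<bar> \<le> C * exp (b * t)"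
    and z: "\<And>p. p > b \<Longrightarrow> (LINT t|lborel. indicator {0..} t * (exp (- p * t) * f t)) = 0"
    and t: "t \<ge> 0"
  shows "f t = 0"
proof -
  obtain N :: nat where N: "real N > max 0 (b + 1)" using reals_Archimedean2 by blast
  have N0: "N > 0" using N by simp
  define F where "F = (\<lambda>t. indicator {0..} t * (exp (- real N * t) * f t))"
  have C0: "C \<ge> 0" using order_trans[OF abs_ge_zero bd[of 0]] by simp
  have Fm: "F \<in> borel_measurable lborel"
  proof -
    have "(\<lambda>t. indicator {0..} t *\<^sub>R (exp (- real N * t) * f t)) \<in> borel_measurable borel"
      by (intro borel_measurable_continuous_on_indicator continuous_intros cont) auto
    then show ?thesis by (simp add: F_def)
  qed
  have Fb: "\<bar>F t\<bar> \<le> C * (indicator {0..} t * exp (- t))" for t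
  proof (cases "t \<ge> 0")
    case True
    have "\<bar>F t\<bar> \<le> exp (- real N * t) * (C * exp (b * t))"
      using bd[OF True] True by (auto simp: F_def abs_mult intro!: mult_left_mono)
    also have "\<dots> = C * exp ((b - real N) * t)" by (simp add: exp_add[symmetric] algebra_simps)
    also have "\<dots> \<le> C * exp (- t)"
    proof -
      have "(b - real N) * t \<le> (-1) * t" using N True by (intro mult_right_mono) auto
      then show ?thesis using C0 by (intro mult_left_mono) auto
    qed
    finally show ?thesis using True by simp
  qed (auto simp: F_def)
  have expi: "integrable lborel (\<lambda>t. indicator {0..} t * exp (- t :: real))"
  proof -
    have "((\<lambda>x. exp (- 1 * x)) has_integral (1 / 1)) {0::real..}"
      using has_integral_exp_minus_to_infinity[of 1 0] by simp
    from nn_integral_has_integral_lebesgue[OF _ this]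
    have "(\<integral>\<^sup>+ x. ennreal (indicator {0..} x * exp (- x)) \<partial>lborel) = ennreal 1"
      by auto
    then show ?thesis by (intro integrableI_bounded) (auto simp: abs_mult)
  qed
  have Fi: "integrable lborel F"
    by (rule Bochner_Integration.integrable_bound[OF integrable_mult_right[OF expi, of C] Fm])
      (use Fb C0 in \<open>auto simp: abs_mult\<close>)
  \<comment> \<open>N > b makes g tend to 0 at x = 0, the image of t at infinity; the margin N > b +
    1 also dominated \<open>F\<close> by exp(-t).\<close>
  define g where "g = (\<lambda>x. if x \<le> 0 then 0 else x ^ N * f (- ln x))"
  have gc: "continuous_on {0..1} g"
  proof (rule continuous_on_IccI)
    have "((\<lambda>x. C * x powr (real N - b)) \<longlongrightarrow> 0) (at_right 0)"
      using N by real_asymp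
    then have "(g \<longlongrightarrow> 0) (at_right 0)"
    proof (rule Lim_null_comparison[rotated])
      show "\<forall>\<^sub>F x in at_right 0. norm (g x) \<le> C * x powr (real N - b)"
        unfolding eventually_at_right_field
      proof (intro exI[of _ 1] conjI allI impI)
        fix x :: real assume x: "0 < x" "x < 1"
        have "\<bar>g x\<bar> = x ^ N * \<bar>f (- ln x)\<bar>" using x by (simp add: g_def abs_mult)
        also have "\<dots> \<le> x ^ N * (C * exp (b * (- ln x)))"
          using x by (intro mult_left_mono bd) auto
        also have "\<dots> = C * x powr (real N - b)"
          using x by (simp add: powr_def exp_add[symmetric] exp_diff exp_minus exp_of_nat_mult field_simps)
        finally show "norm (g x) \<le> C * x powr (real N - b)" by simp
      qed simp
    qed
    then show "(g \<longlongrightarrow> g 0) (at_right 0)" by (simp add: g_def)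
    have *: "continuous_on {0<..1} g"
    proof -
      have "continuous_on {0<..1} (\<lambda>x. x ^ N * f (- ln x))"
        by (intro continuous_intros continuous_on_compose2[OF cont]) auto
      then show ?thesis by (rule continuous_on_eq) (auto simp: g_def)
    qed
    then show "(g \<longlongrightarrow> g 1) (at_left 1)"
    proof -
      have "(g \<longlongrightarrow> g 1) (at 1 within {0<..1})" using * by (auto simp: continuous_on_def)
      moreover have "at 1 within {0<..1} = at_left (1::real)"
        by (rule at_within_nhd[of _ "{0<..}"]) auto
      ultimately show ?thesis by simp
    qed
    fix x :: real assume x: "0 < x" "x < 1"
    have "continuous_on {0<..<1} g" by (rule continuous_on_subset[OF *]) auto
    then have "isCont g x" using x by (subst (asm) continuous_on_eq_continuous_at) auto
    then show "g \<midarrow>x\<rightarrow> g x" by (simp add: isCont_def)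
  qed simp
  have gF: "g (exp (- t)) * indicator {0..} t = F t" for t
    by (auto simp: g_def F_def exp_of_nat_mult[symmetric] indicator_def)
  have mom: "integrable lborel (\<lambda>t. exp (- t) ^ n * F t)" "(LINT t|lborel. exp (- t) ^ n * F t) = 0" for n
  proof -
    show "integrable lborel (\<lambda>t. exp (- t) ^ n * F t)"
    proof (rule Bochner_Integration.integrable_bound[OF Fi])
      show "(\<lambda>t. exp (- t) ^ n * F t) \<in> borel_measurable lborel" using Fm by measurable
      show "AE t in lborel. norm (exp (- t) ^ n * F t) \<le> norm (F t)"
      proof (rule AE_I2)
        fix t show "norm (exp (- t) ^ n * F t) \<le> norm (F t)"
        proof (cases "t \<ge> 0")
          case True
          then show ?thesis by (auto simp: abs_mult intro!: mult_left_le_one_le power_le_one)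
        qed (auto simp: F_def)
      qed
    qed
    have "(LINT t|lborel. exp (- t) ^ n * F t) = (LINT t|lborel. indicator {0..} t * (exp (- (real (N + n)) * t) * f t))"
      by (intro Bochner_Integration.integral_cong)
        (auto simp: F_def exp_of_nat_mult[symmetric] exp_add[symmetric] algebra_simps)
    also have "\<dots> = 0" by (rule z) (use N in auto)
    finally show "(LINT t|lborel. exp (- t) ^ n * F t) = 0" .
  qed
  have F2: "integrable lborel (\<lambda>t. F t * F t)"
  proof (rule Bochner_Integration.integrable_bound[OF integrable_mult_right[OF Fi, of C]])
    show "(\<lambda>t. F t * F t) \<in> borel_measurable lborel" using Fm by measurable
    have "\<bar>F t\<bar> \<le> C" for t
    proof -
      have "C * (indicator {0..} t * exp (- t)) \<le> C"
        using C0 by (intro mult_left_le) (auto simp: indicator_def)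
      with Fb[of t] show ?thesis by linarith
    qed
    then have "norm (F t * F t) \<le> norm (C * F t)" for t
      unfolding norm_mult using C0 by (intro mult_right_mono) auto
    then show "AE t in lborel. norm (F t * F t) \<le> norm (C * F t)" by (rule AE_I2)
  qed
  \<comment> \<open>\<open>F\<close> is orthogonal to every polynomial in exp(-t), so one of the two
    factors may be replaced by an approximation error below e / (I + 1), which leaves at most e I /
    (I + 1).\<close>
  have "(LINT t|lborel. F t * F t) \<le> 0"
  proof (rule field_le_epsilon)
    fix e :: real assume e: "e > 0"
    define I where "I = (LINT t|lborel. \<bar>F t\<bar>)"
    have I0: "I \<ge> 0" by (simp add: I_def)
    have "e / (I + 1) > 0" using e I0 by simp
    from Stone_Weierstrass_real_polynomial_function[OF compact_Icc gc this]
    obtain q where q: "real_polynomial_function q" "\<And>x. x \<in> {0..1} \<Longrightarrow> \<bar>g x - q x\<bar> < e / (I + 1)" by blast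
    obtain c n where c: "q = (\<lambda>x. \<Sum>i\<le>n. c i * x ^ i)"
      using q(1) by (auto simp: real_polynomial_function_iff_sum)
    have qi: "integrable lborel (\<lambda>t. q (exp (- t)) * F t)" and q0: "(LINT t|lborel. q (exp (- t)) * F t) = 0"
    proof -
      have eq: "(\<lambda>t. q (exp (- t)) * F t) = (\<lambda>t. \<Sum>i\<le>n. c i * (exp (- t) ^ i * F t))"
        unfolding c sum_distrib_right by (simp only: mult.assoc)
      show "integrable lborel (\<lambda>t. q (exp (- t)) * F t)" unfolding eq using mom by auto
      show "(LINT t|lborel. q (exp (- t)) * F t) = 0" unfolding eq using mom
        by (subst Bochner_Integration.integral_sum) auto
    qed
    have "(LINT t|lborel. F t * F t) = (LINT t|lborel. F t * F t - q (exp (- t)) * F t)"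
      using F2 qi q0 by (subst Bochner_Integration.integral_diff) auto
    also have "\<dots> \<le> (LINT t|lborel. e / (I + 1) * \<bar>F t\<bar>)"
    proof (rule integral_mono)
      show "integrable lborel (\<lambda>t. F t * F t - q (exp (- t)) * F t)" using F2 qi by auto
      show "integrable lborel (\<lambda>t. e / (I + 1) * \<bar>F t\<bar>)" using Fi by auto
      fix t :: real
      show "F t * F t - q (exp (- t)) * F t \<le> e / (I + 1) * \<bar>F t\<bar>"
      proof (cases "t \<ge> 0")
        case True
        have "F t * F t - q (exp (- t)) * F t = (g (exp (- t)) - q (exp (- t))) * F t"
          using gF[of t] True by (simp add: algebra_simps)
        also have "\<dots> \<le> \<bar>g (exp (- t)) - q (exp (- t))\<bar> * \<bar>F t\<bar>" by (metis abs_ge_self abs_mult)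
        also have "\<dots> \<le> e / (I + 1) * \<bar>F t\<bar>"
          using q(2)[of "exp (- t)"] True by (intro mult_right_mono) auto
        finally show ?thesis .
      qed (auto simp: F_def)
    qed
    also have "\<dots> = e * (I / (I + 1))" by (simp add: I_def)
    also have "\<dots> \<le> e" using e I0 by (intro mult_left_le) auto
    finally show "(LINT t|lborel. F t * F t) \<le> 0 + e" by simp
  qed
  moreover have "(LINT t|lborel. F t * F t) \<ge> 0" by simp
  ultimately have "(LINT t|lborel. F t * F t) = 0" by simp
  then have AE: "AE t in lborel. F t = 0"
    using integral_nonneg_eq_0_iff_AE[OF F2] by simp
  \<comment> \<open>So far f vanishes almost everywhere. The set of positive t with f t \<noteq> 0
    is open and null, hence empty; t = 0 is then a right limit.\<close>
  have pos: "f t = 0" if "t > 0" for t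
  proof (rule ccontr)
    assume ft: "f t \<noteq> 0"
    have "open ({0<..} \<inter> f -` (- {0}))"
      by (intro continuous_open_preimage continuous_on_subset[OF cont]) auto
    moreover have "({0<..} \<inter> f -` (- {0})) \<in> null_sets lebesgue"
    proof -
      have "AE t in lebesgue. t \<notin> ({0<..} \<inter> f -` (- {0}))"
        using AE_completion[OF AE] by eventually_elim (auto simp: F_def indicator_def split: if_splits)
      then show ?thesis using AE_iff_null_sets[of "({0<..} \<inter> f -` (- {0}))" lebesgue] calculation
        by (auto simp: borel_open)
    qed
    ultimately have "({0<..} \<inter> f -` (- {0})) = {}"
      using open_not_negligible negligible_iff_null_sets by blast
    with ft that show False by auto
  qed
  show ?thesis
  proof (cases "t = 0")
    case True
    have "(f \<longlongrightarrow> f 0) (at 0 within {0..})" using cont by (auto simp: continuous_on_def)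
    then have "(f \<longlongrightarrow> f 0) (at_right 0)" by (rule tendsto_within_subset) auto
    moreover have "(f \<longlongrightarrow> 0) (at_right 0)"
      by (rule tendsto_eventually) (auto simp: eventually_at_right_field intro!: exI[of _ 1] pos)
    ultimately show ?thesis using True tendsto_unique trivial_limit_at_right_real by blast
  qed (use pos t in auto)
qed

section \<open>Mittag-Leffler series and their Laplace transforms\<close>

text \<open>Gamma increases from 2 on, so Mittag-Leffler series are dominated by exponential
  series.\<close>

lemma fact_le_Gamma:
  fixes \<gamma> \<mu> :: real
  assumes "\<gamma> > 1" "\<mu> > 0" "k \<ge> 2"
  shows "fact (k - 1) \<le> Gamma (\<gamma> * real k + \<mu>)"
proof -
  have "fact (k - 1) = Gamma (real k)" using Gamma_fact[of "k - 1", where 'a=real] assms by (simp add: of_nat_diff)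
  also have "\<dots> \<le> Gamma (\<gamma> * real k + \<mu>)"
  proof (rule less_imp_le, rule Gamma_real_strict_mono)
    have "1 * real k \<le> \<gamma> * real k" using assms by (intro mult_right_mono) auto
    with assms(2) show "real k < \<gamma> * real k + \<mu>" by linarith
  qed (use assms in auto)
  finally show ?thesis .
qed

lemma mittag_leffler_summable:
  fixes \<gamma> \<mu> z :: real
  assumes \<gamma>: "\<gamma> > 1" and \<mu>: "\<mu> > 0"
  shows "summable (\<lambda>k. \<bar>z ^ k / Gamma (\<gamma> * real k + \<mu>)\<bar>)" "summable (\<lambda>k. z ^ k / Gamma (\<gamma> * real k + \<mu>))"
proof -
  have "summable (\<lambda>k. \<bar>z ^ Suc k / Gamma (\<gamma> * real (Suc k) + \<mu>)\<bar>)"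
  proof (rule summable_comparison_test'[where N=1])
    show "summable (\<lambda>k. \<bar>z\<bar> * (\<bar>z\<bar> ^ k /\<^sub>R fact k))"
      by (intro summable_mult summable_exp_generic)
    fix k :: nat assume k: "k \<ge> 1"
    have "fact k \<le> Gamma (\<gamma> * real (Suc k) + \<mu>)"
      using fact_le_Gamma[OF \<gamma> \<mu>, of "Suc k"] k by simp
    then have "\<bar>z\<bar> ^ Suc k / Gamma (\<gamma> * real (Suc k) + \<mu>) \<le> \<bar>z\<bar> ^ Suc k / fact k"
      by (intro divide_left_mono mult_pos_pos) (auto intro: less_le_trans[OF fact_gt_zero])
    moreover have "Gamma (\<gamma> * real (Suc k) + \<mu>) > 0"
      using \<gamma> \<mu> by (intro Gamma_real_pos add_nonneg_pos) auto
    ultimately show "norm \<bar>z ^ Suc k / Gamma (\<gamma> * real (Suc k) + \<mu>)\<bar> \<le> \<bar>z\<bar> * (\<bar>z\<bar> ^ k /\<^sub>R fact k)"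
      by (simp add: abs_mult power_abs divide_inverse mult_ac)
  qed
  then show "summable (\<lambda>k. \<bar>z ^ k / Gamma (\<gamma> * real k + \<mu>)\<bar>)" by (subst (asm) summable_Suc_iff)
  then show "summable (\<lambda>k. z ^ k / Gamma (\<gamma> * real k + \<mu>))" by (rule summable_rabs_cancel)
qed

lemma continuous_mittag_leffler:
  assumes \<gamma>: "\<gamma> > 1" and \<mu>: "\<mu> > 0"
  shows "continuous_on UNIV (mittag_leffler \<gamma> \<mu>)"
proof -
  have "isCont (\<lambda>x. \<Sum>k. (1 / Gamma (\<gamma> * real k + \<mu>)) * x ^ k) z" for z
    by (rule isCont_powser_converges_everywhere)
      (use mittag_leffler_summable(2)[OF assms] in \<open>simp add: mult.commute\<close>)
  then show ?thesis
    by (auto simp: mittag_leffler_def continuous_on_eq_continuous_at mult.commute)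
qed

lemma mittag_leffler_0: "mittag_leffler \<gamma> \<mu> 0 = 1 / Gamma \<mu>"
proof -
  have "(\<lambda>k. 1 / Gamma (\<gamma> * real k + \<mu>) * 0 ^ k) sums (1 / Gamma (\<gamma> * real 0 + \<mu>))"
    by (rule powser_sums_zero)
  then show ?thesis
    unfolding mittag_leffler_def by (subst sums_unique[symmetric]) auto
qed

text \<open>y^a exp(-y) is the integral of y^a exp(-x) over x \<ge> y, where y^a \<le> x^a. With y =
  b t it majorizes t^q / Gamma q by a multiple of exp(b t), so that an exponential growth bound can
  be read off a series term by term.\<close>

lemma Gamma_power_exp_bound:
  fixes a y :: real
  assumes a: "a > 0" and y: "y \<ge> 0"
  shows "y powr a \<le> exp y * Gamma (a + 1)"
proof -
  have "((\<lambda>x. exp (- 1 * x)) has_integral exp (- 1 * y) / 1) {y..}"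
    by (rule has_integral_exp_minus_to_infinity) simp
  from nn_integral_has_integral_lebesgue[OF _ has_integral_mult_right[OF this, of "y powr a"]]
  have "ennreal (y powr a * exp (- y)) = (\<integral>\<^sup>+ x. ennreal (indicator {y..} x * (y powr a * exp (- x))) \<partial>lborel)"
    by (simp add: mult_ac)
  also have "\<dots> \<le> (\<integral>\<^sup>+ x. ennreal (indicator {0..} x * x powr (a + 1 - 1) / exp x) \<partial>lborel)"
    using a y by (intro nn_integral_mono ennreal_leI)
      (auto simp: indicator_def exp_minus divide_inverse intro!: mult_right_mono powr_mono2)
  also have "\<dots> = ennreal (Gamma (a + 1))"
    using Gamma_conv_nn_integral_real[of "a + 1"] a by simp
  finally have "y powr a * exp (- y) \<le> Gamma (a + 1)"
    using a by (subst (asm) ennreal_le_iff) auto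
  then show ?thesis by (simp add: exp_minus field_simps)
qed

lemma powr_Laplace_transform:
  fixes a p :: real
  assumes a: "a > -1" and p: "p > 0"
  shows "has_bochner_integral lborel (\<lambda>t. indicator {0..} t * (exp (- p * t) * t powr a)) (Gamma (a + 1) * p powr (- a - 1))"
proof -
  have "(\<integral>\<^sup>+ t. ennreal (indicator {0..} t * t powr a / exp t) \<partial>lborel) = ennreal (Gamma (a + 1))"
    using Gamma_conv_nn_integral_real[of "a + 1"] a by simp
  then have *: "has_bochner_integral lborel (\<lambda>t. indicator {0..} t * t powr a / exp t) (Gamma (a + 1))"
    using a by (intro has_bochner_integral_nn_integral) auto
  have eq: "indicator {0..} (0 + p * t) * (0 + p * t) powr a / exp (0 + p * t)
      = p powr a * (indicator {0..} t * (exp (- p * t) * t powr a))" for t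
    using p by (auto simp: indicator_def powr_mult exp_minus field_simps zero_le_mult_iff)
  have i: "integrable lborel (\<lambda>t. indicator {0..} (0 + p * t) * (0 + p * t) powr a / exp (0 + p * t))"
    using lborel_integrable_real_affine[OF integrable.intros[OF *], of p 0] p by simp
  have "(LINT t|lborel. indicator {0..} t * t powr a / exp t)
     = p * (LINT t|lborel. indicator {0..} (0 + p * t) * (0 + p * t) powr a / exp (0 + p * t))"
    using lborel_integral_real_affine[of p "\<lambda>t. indicator {0..} t * t powr a / exp t" 0] p by simp
  then have "Gamma (a + 1) = p * p powr a * (LINT t|lborel. indicator {0..} t * (exp (- p * t) * t powr a))"
    using * unfolding eq has_bochner_integral_iff by simp
  moreover have "p * p powr a = p powr (a + 1)" using p by (simp add: powr_add)
  moreover have pm: "p powr (- a - 1) = 1 / p powr (a + 1)"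
    using powr_minus_divide[of p "a + 1"] by simp
  ultimately have "(LINT t|lborel. indicator {0..} t * (exp (- p * t) * t powr a)) = Gamma (a + 1) * p powr (- a - 1)"
    using p Gamma_real_pos[of "a + 1"] a pm by (simp add: field_simps)
  moreover have "integrable lborel (\<lambda>t. indicator {0..} t * (exp (- p * t) * t powr a))"
    using i p unfolding eq by (subst (asm) integrable_mult_left_iff) auto
  ultimately show ?thesis by (simp add: has_bochner_integral_iff)
qed

text \<open>The Laplace transform of \<open>t\<^sup>\<mu> E\<^sub>\<gamma>\<^sub>\<mu>(-l t\<^sup>\<gamma>)\<close>, that is, minus the derivative of \<open>s\<^sup>\<gamma>\<^sup>-\<^sup>\<mu> / (s\<^sup>\<gamma> + l)\<close>.\<close>

definition ml_laplace :: "real \<Rightarrow> real \<Rightarrow> real \<Rightarrow> complex \<Rightarrow> complex" where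
  "ml_laplace \<gamma> \<mu> l s = s powr of_real (\<gamma> - \<mu> - 1) *
     (of_real \<gamma> * s powr of_real \<gamma> / (s powr of_real \<gamma> + of_real l)\<^sup>2 + of_real (\<mu> - \<gamma>) / (s powr of_real \<gamma> + of_real l))"

text \<open>The exponent \<nu> is free because the series is needed with \<nu> = \<mu> for the
  Laplace transform and with \<nu> = \<mu> - 1 for the convolution kernels.\<close>

lemma mittag_leffler_kernel_series:
  assumes \<gamma>: "\<gamma> > 1" and \<mu>: "\<mu> > 0" and t: "t > 0"
  shows "(\<lambda>k. (- l) ^ k * t powr (\<gamma> * real k + \<nu>) / Gamma (\<gamma> * real k + \<mu>)) sums
     (t powr \<nu> * mittag_leffler \<gamma> \<mu> (- l * t powr \<gamma>))"
proof -
  have "t powr \<nu> * ((- l * t powr \<gamma>) ^ k / Gamma (\<gamma> * real k + \<mu>))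
      = (- l) ^ k * t powr (\<gamma> * real k + \<nu>) / Gamma (\<gamma> * real k + \<mu>)" for k
  proof -
    have "(t powr \<gamma>) ^ k = t powr (\<gamma> * real k)" using t by (simp add: powr_realpow[symmetric] powr_powr)
    then show ?thesis unfolding power_mult_distrib by (simp add: powr_add)
  qed
  moreover have "(\<lambda>k. t powr \<nu> * ((- l * t powr \<gamma>) ^ k / Gamma (\<gamma> * real k + \<mu>))) sums
     (t powr \<nu> * mittag_leffler \<gamma> \<mu> (- l * t powr \<gamma>))"
    unfolding mittag_leffler_def by (intro sums_mult summable_sums mittag_leffler_summable \<gamma> \<mu>)
  ultimately show ?thesis by (simp only:)
qed

lemma sums_affine_geometric:
  fixes x :: real
  assumes "\<bar>x\<bar> < 1"
  shows "(\<lambda>k. (\<gamma> * real k + \<mu>) * x ^ k) sums (\<gamma> / (1 - x)\<^sup>2 + (\<mu> - \<gamma>) / (1 - x))"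
proof -
  have "(\<lambda>k. \<gamma> * (of_nat (Suc k) * x ^ k) + (\<mu> - \<gamma>) * x ^ k) sums (\<gamma> * (1 / (1 - x)\<^sup>2) + (\<mu> - \<gamma>) * (1 / (1 - x)))"
    using assms by (intro sums_add sums_mult geometric_deriv_sums geometric_sums) auto
  then show ?thesis by (simp add: algebra_simps)
qed

text \<open>Termwise integration: the extra power of t turns the Gamma factors of the k-th term into
  Gamma (q + 1) / Gamma q = q with q = \<gamma> k + \<mu>, so an affine-geometric series in - l
  p^(-\<gamma>) remains, convergent for l < p^\<gamma>. Large real p are enough for the uniqueness
  theorem.\<close>

lemma mittag_leffler_Laplace_transform:
  assumes \<gamma>: "\<gamma> > 1" and \<mu>: "\<mu> > 0" and l: "l > 0" and p: "p > 0" "l < p powr \<gamma>"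
  shows "has_bochner_integral lborel (\<lambda>t. indicator {0..} t * (exp (- p * t) * (t powr \<mu> * mittag_leffler \<gamma> \<mu> (- l * t powr \<gamma>))))
     (Re (ml_laplace \<gamma> \<mu> l (of_real p)))"
proof -
  let ?q = "\<lambda>k. \<gamma> * real k + \<mu>"
  let ?y = "\<lambda>t. t powr \<mu> * mittag_leffler \<gamma> \<mu> (- l * t powr \<gamma>)"
  define u where "u k t = (- l) ^ k / Gamma (?q k) * (indicator {0..} t * (exp (- p * t) * t powr (?q k)))" for k t
  have pos: "\<gamma> * real k + \<mu> > 0" for k using \<gamma> \<mu> by (intro add_nonneg_pos) auto
  have G: "Gamma (\<gamma> * real k + \<mu> + 1) / Gamma (?q k) = \<gamma> * real k + \<mu>" for k

  proof -
    have "\<gamma> * real k + \<mu> \<notin> \<int>\<^sub>\<le>\<^sub>0" using pos[of k] by (force elim!: nonpos_Ints_cases)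
    from Gamma_plus1[OF this] show ?thesis using Gamma_real_pos[OF pos[of k]] by simp
  qed
  have ppow: "p powr (- (?q k) - 1) = p powr (- \<mu> - 1) * (p powr (- \<gamma>)) ^ k" for k
    using p by (simp add: powr_realpow[symmetric] powr_powr powr_add[symmetric] algebra_simps)
  have ui: "has_bochner_integral lborel (u k) (p powr (- \<mu> - 1) * ((?q k) * (- l * p powr (- \<gamma>)) ^ k))" for k
  proof -
    have "has_bochner_integral lborel (u k) ((- l) ^ k / Gamma (?q k) * (Gamma (\<gamma> * real k + \<mu> + 1) * p powr (- (?q k) - 1)))"
      unfolding u_def using pos[of k] p
      by (intro has_bochner_integral_mult_right powr_Laplace_transform) auto
    also have "((- l) ^ k / Gamma (?q k) * (Gamma (\<gamma> * real k + \<mu> + 1) * p powr (- (?q k) - 1)))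
        = (- l) ^ k * (Gamma (\<gamma> * real k + \<mu> + 1) / Gamma (?q k)) * p powr (- (?q k) - 1)"
      by simp
    also have "\<dots> = p powr (- \<mu> - 1) * ((?q k) * (- l * p powr (- \<gamma>)) ^ k)"
      unfolding G ppow power_mult_distrib by simp
    finally show ?thesis .
  qed
  have abs_u: "\<bar>u k t\<bar> = l ^ k / Gamma (?q k) * (indicator {0..} t * (exp (- p * t) * t powr (?q k)))" for k t
    using Gamma_real_pos[OF pos[of k]] l by (simp add: u_def abs_mult power_abs)
  have "has_bochner_integral lborel (\<lambda>t. \<bar>u k t\<bar>) (p powr (- \<mu> - 1) * ((?q k) * (l * p powr (- \<gamma>)) ^ k))" for k
  proof -
    have "has_bochner_integral lborel (\<lambda>t. \<bar>u k t\<bar>) (l ^ k / Gamma (?q k) * (Gamma (\<gamma> * real k + \<mu> + 1) * p powr (- (?q k) - 1)))"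
      unfolding abs_u using pos[of k] p
      by (intro has_bochner_integral_mult_right powr_Laplace_transform) auto
    also have "(l ^ k / Gamma (?q k) * (Gamma (\<gamma> * real k + \<mu> + 1) * p powr (- (?q k) - 1)))
        = l ^ k * (Gamma (\<gamma> * real k + \<mu> + 1) / Gamma (?q k)) * p powr (- (?q k) - 1)"
      by simp
    also have "\<dots> = p powr (- \<mu> - 1) * ((?q k) * (l * p powr (- \<gamma>)) ^ k)"
      unfolding G ppow power_mult_distrib by simp
    finally show ?thesis .
  qed
  then have iu: "(LINT t|lborel. norm (u k t)) = p powr (- \<mu> - 1) * ((?q k) * (l * p powr (- \<gamma>)) ^ k)" for k
    by (simp add: has_bochner_integral_iff)
  have x: "\<bar>l * p powr (- \<gamma>)\<bar> < 1" "\<bar>- l * p powr (- \<gamma>)\<bar> < 1"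
    using l p by (auto simp: abs_mult powr_minus divide_inverse[symmetric])
  have S: "summable (\<lambda>k. LINT t|lborel. norm (u k t))"
    unfolding iu using sums_affine_geometric[OF x(1)] by (intro summable_mult) (auto simp: sums_iff)
  have sumu: "(\<lambda>k. u k t) sums (indicator {0..} t * (exp (- p * t) * (?y t)))" for t
  proof (cases "t > 0")
    case True
    have "(\<lambda>k. exp (- p * t) * ((- l) ^ k * t powr (?q k) / Gamma (?q k))) sums
       (exp (- p * t) * (?y t))"
      by (intro sums_mult mittag_leffler_kernel_series \<gamma> \<mu> True)
    then show ?thesis using True by (simp add: u_def mult_ac)
  next
    case False
    then have "u k t = 0" for k by (cases "t = 0") (auto simp: u_def)
    moreover have "indicator {0..} t * (exp (- p * t) * (?y t)) = 0"
      using False by (cases "t = 0") auto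
    ultimately show ?thesis by (simp only: sums_zero)
  qed
  have absS: "summable (\<lambda>k. norm (u k t))" for t
  proof (cases "t > 0")
    case True
    have "(\<lambda>k. exp (- p * t) * ((- (- l)) ^ k * t powr (?q k) / Gamma (?q k))) sums
       (exp (- p * t) * (t powr \<mu> * mittag_leffler \<gamma> \<mu> (- (- l) * t powr \<gamma>)))"
      by (intro sums_mult mittag_leffler_kernel_series \<gamma> \<mu> True)
    then show ?thesis using True by (simp add: abs_u mult_ac sums_iff)
  next
    case False
    then have "u k t = 0" for k by (cases "t = 0") (auto simp: u_def)
    then show ?thesis by simp
  qed
  have uint: "integrable lborel (u k)" for k using ui[of k] by (simp add: has_bochner_integral_iff)
  note sm = sums_integral[OF uint AE_I2[OF absS] S] integrable_suminf[OF uint AE_I2[OF absS] S]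
  have sums2: "(\<lambda>k. LINT t|lborel. u k t) sums (p powr (- \<mu> - 1) * (\<gamma> / (1 - (- l * p powr (- \<gamma>)))\<^sup>2 + (\<mu> - \<gamma>) / (1 - (- l * p powr (- \<gamma>)))))"
    using sums_mult[OF sums_affine_geometric[OF x(2), of \<gamma> \<mu>], of "p powr (- \<mu> - 1)"] ui
    by (simp add: has_bochner_integral_iff)
  have su: "(\<Sum>k. u k t) = indicator {0..} t * (exp (- p * t) * (?y t))" for t
    using sumu[of t] by (simp add: sums_iff)
  have "p powr (- \<mu> - 1) * (\<gamma> / (1 - (- l * p powr (- \<gamma>)))\<^sup>2 + (\<mu> - \<gamma>) / (1 - (- l * p powr (- \<gamma>))))
      = p powr (\<gamma> - \<mu> - 1) * (\<gamma> * p powr \<gamma> / (p powr \<gamma> + l)\<^sup>2 + (\<mu> - \<gamma>) / (p powr \<gamma> + l))"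
  proof -
    define P where "P = p powr \<gamma>"
    have P: "P > 0" "P + l > 0" using p l by (auto simp: P_def add_pos_pos)
    have 1: "1 - (- l * p powr (- \<gamma>)) = (P + l) / P" using P by (simp add: P_def powr_minus field_simps)
    have 2: "p powr (\<gamma> - \<mu> - 1) = p powr (- \<mu> - 1) * P" unfolding P_def using p by (simp add: powr_add[symmetric] algebra_simps)
    show ?thesis unfolding 1 2 P_def[symmetric] using P by (simp add: field_simps power2_eq_square)
  qed
  also have "\<dots> = Re (ml_laplace \<gamma> \<mu> l (of_real p))"
  proof -
    have "ml_laplace \<gamma> \<mu> l (of_real p) = of_real (p powr (\<gamma> - \<mu> - 1) * (\<gamma> * p powr \<gamma> / (p powr \<gamma> + l)\<^sup>2 + (\<mu> - \<gamma>) / (p powr \<gamma> + l)))"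
    proof -
      have "complex_of_real p powr of_real (\<gamma> - \<mu> - 1) = of_real (p powr (\<gamma> - \<mu> - 1))"
        "complex_of_real p powr of_real \<gamma> = of_real (p powr \<gamma>)"
        using p by (intro powr_of_real; simp)+
      then show ?thesis unfolding ml_laplace_def by simp
    qed
    then show ?thesis by (simp only: Re_complex_of_real)
  qed
  finally show ?thesis using sums_unique2[OF sm(1) sums2] sm(2) unfolding su by (simp add: has_bochner_integral_iff)
qed

section \<open>The sector bound and inversion of the transform\<close>

text \<open>The square of |w + l| is at least l^2 + |w|^2 - 2 \<kappa> l |w|, which equals (1 -
  \<kappa>) (l^2 + |w|^2) + \<kappa> (l - |w|)^2.\<close>

lemma norm_add_of_real_ge:
  fixes w :: complex
  assumes k: "0 \<le> \<kappa>" "\<kappa> \<le> 1" and w: "Re w \<ge> - \<kappa> * norm w" and l: "l \<ge> 0"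
  shows "sqrt ((1 - \<kappa>) / 2) * (l + norm w) \<le> norm (w + of_real l)"
proof (rule power2_le_imp_le)
  have "(sqrt ((1 - \<kappa>) / 2) * (l + norm w))\<^sup>2 = (1 - \<kappa>) / 2 * (l + norm w)\<^sup>2"
    using k by (simp add: power_mult_distrib)
  also have "\<dots> \<le> (1 - \<kappa>) * (l\<^sup>2 + (norm w)\<^sup>2)"
  proof -
    have "(l + norm w)\<^sup>2 \<le> 2 * (l\<^sup>2 + (norm w)\<^sup>2)"
      using zero_le_power2[of "l - norm w"] by (simp add: power2_eq_square algebra_simps)
    then have "(1 - \<kappa>) / 2 * (l + norm w)\<^sup>2 \<le> (1 - \<kappa>) / 2 * (2 * (l\<^sup>2 + (norm w)\<^sup>2))"
      using k by (intro mult_left_mono) auto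
    also have "\<dots> = (1 - \<kappa>) * (l\<^sup>2 + (norm w)\<^sup>2)" by (simp add: field_simps)
    finally show ?thesis .
  qed
  also have "\<dots> \<le> l\<^sup>2 + (norm w)\<^sup>2 - 2 * \<kappa> * (l * norm w)"
  proof -
    have "0 \<le> \<kappa> * (l - norm w)\<^sup>2" using k by simp
    then show ?thesis by (simp add: power2_eq_square algebra_simps)
  qed
  also have "\<dots> \<le> l\<^sup>2 + (norm w)\<^sup>2 + 2 * (l * Re w)"
    using mult_left_mono[OF w l] by (simp add: algebra_simps)
  also have "\<dots> = (norm (w + of_real l))\<^sup>2"
    unfolding cmod_power2 by (simp add: power2_eq_square algebra_simps)
  finally show "(sqrt ((1 - \<kappa>) / 2) * (l + norm w))\<^sup>2 \<le> (norm (w + of_real l))\<^sup>2" .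
qed simp

text \<open>The power maps the right half plane into the sector |arg| < \<gamma> pi / 2, whose
  half-angle is below pi because \<gamma> < 2; cosine decreases on [0, pi].\<close>

lemma Re_powr_ge:
  assumes \<gamma>: "1 < \<gamma>" "\<gamma> < 2" and s: "Re s > 0"
  shows "Re (s powr of_real \<gamma>) \<ge> cos (\<gamma> * pi / 2) * norm (s powr of_real \<gamma>)"
proof -
  have s0: "s \<noteq> 0" using s by auto
  have "\<bar>Arg s\<bar> < pi / 2" using s Arg_Re_pos[of s] s0 by auto
  then have "\<bar>\<gamma> * Arg s\<bar> \<le> \<gamma> * pi / 2" using \<gamma> by (simp add: abs_mult field_simps)
  moreover have "\<gamma> * pi / 2 \<le> pi" using \<gamma> by simp
  ultimately have "cos (\<gamma> * pi / 2) \<le> cos \<bar>\<gamma> * Arg s\<bar>"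
    using \<gamma> by (intro cos_monotone_0_pi_le) auto
  then have c: "cos (\<gamma> * pi / 2) \<le> cos (\<gamma> * Arg s)" by simp
  have "s powr of_real \<gamma> = of_real (norm s powr \<gamma>) * cis (\<gamma> * Arg s)"
    using s0 by (simp add: powr_def Arg_def exp_eq_polar Ln_times_of_real)
  then have "Re (s powr of_real \<gamma>) = norm s powr \<gamma> * cos (\<gamma> * Arg s)" "norm (s powr of_real \<gamma>) = norm s powr \<gamma>"
    by (simp_all add: norm_mult)
  then show ?thesis using mult_left_mono[OF c, of "norm s powr \<gamma>"] by (simp add: mult.commute)
qed

lemma integral_exp_atLeast:
  fixes z :: complex
  assumes z: "Re z < 0"
  shows "has_bochner_integral lborel (\<lambda>t. indicator {0..} t *\<^sub>R exp (of_real t * z)) (- 1 / z)"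
proof -
  have z0: "z \<noteq> 0" using z by auto
  have m: "(\<lambda>t. indicator {0..} t *\<^sub>R exp (of_real t * z)) \<in> borel_measurable borel"
    by (intro borel_measurable_continuous_on_indicator continuous_intros) auto
  have "((\<lambda>x. exp (- (- Re z) * x)) has_integral exp (- (- Re z) * 0) / (- Re z)) {0::real..}"
    by (rule has_integral_exp_minus_to_infinity) (use z in simp)
  from nn_integral_has_integral_lebesgue[OF _ this]
  have "(\<integral>\<^sup>+ x. ennreal (indicator {0..} x * exp (Re z * x)) \<partial>lborel) = ennreal (1 / (- Re z))"
    by auto
  then have "integrable lborel (\<lambda>x. indicator {0..} x * exp (Re z * x))"
    by (intro integrableI_bounded) (auto simp: abs_mult)
  then have i: "integrable lborel (\<lambda>t. indicator {0..} t *\<^sub>R exp (of_real t * z))"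
    by (rule Bochner_Integration.integrable_bound) (use m in \<open>auto simp: mult.commute\<close>)
  have "(LINT x|lborel. indicator {..y} x *\<^sub>R (indicator {0..} x *\<^sub>R exp (of_real x * z))) = exp (of_real y * z) / z - 1 / z"
    if y: "y \<ge> 0" for y
  proof -
    have "(LINT x|lborel. indicator {0..y} x *\<^sub>R exp (of_real x * z)) = exp (of_real y * z) / z - exp (of_real 0 * z) / z"
    proof (rule integral_FTC_Icc[OF y])
      show "continuous_on {0..y} (\<lambda>x. exp (of_real x * z))" by (intro continuous_intros)
      fix x :: real
      show "((\<lambda>x. exp (complex_of_real x * z) / z) has_vector_derivative exp (complex_of_real x * z)) (at x within {0..y})"
      proof (rule has_vector_derivative_at_within, rule has_vector_derivative_real_field[where f = "\<lambda>x. exp (x * z) / z", simplified])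
        show "((\<lambda>x. exp (x * z) / z) has_field_derivative exp (complex_of_real x * z)) (at (complex_of_real x))"
          using z0 by (auto intro!: derivative_eq_intros)
      qed
    qed
    moreover have "indicator {..y} x *\<^sub>R (indicator {0..} x *\<^sub>R exp (of_real x * z)) = indicator {0..y} x *\<^sub>R exp (of_real x * z)" for x
      by (auto simp: indicator_def)
    ultimately show ?thesis by simp
  qed
  then have "\<forall>\<^sub>F y in at_top. (LINT x|lborel. indicator {..y} x *\<^sub>R (indicator {0..} x *\<^sub>R exp (of_real x * z))) = exp (of_real y * z) / z - 1 / z"
    using eventually_ge_at_top[of 0] by (rule eventually_mono[rotated])
  moreover have "((\<lambda>y. exp (of_real y * z) / z - 1 / z) \<longlongrightarrow> 0 / z - 1 / z) at_top"
  proof (intro tendsto_intros z0)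
    have "((\<lambda>y. exp (y * Re z)) \<longlongrightarrow> 0) at_top" using z by real_asymp
    then show "((\<lambda>y. exp (of_real y * z)) \<longlongrightarrow> 0) at_top"
      by (rule Lim_null_comparison[rotated]) auto
  qed
  ultimately have "((\<lambda>y. LINT x|lborel. indicator {..y} x *\<^sub>R (indicator {0..} x *\<^sub>R exp (of_real x * z))) \<longlongrightarrow> 0 / z - 1 / z) at_top"
    by (simp add: tendsto_cong)
  moreover have "((\<lambda>y. LINT x|lborel. indicator {..y} x *\<^sub>R (indicator {0..} x *\<^sub>R exp (of_real x * z))) \<longlongrightarrow> (LINT x|lborel. indicator {0..} x *\<^sub>R exp (of_real x * z))) at_top"
    by (rule tendsto_integral_at_top[OF _ i]) simp
  ultimately have "(LINT x|lborel. indicator {0..} x *\<^sub>R exp (of_real x * z)) = 0 / z - 1 / z"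
    by (rule tendsto_unique[OF trivial_limit_at_top_linorder, rotated])
  with i show ?thesis by (simp add: has_bochner_integral_iff)
qed

text \<open>Bromwich inversion on the line \<open>Re s = 1\<close>, verified by taking Laplace transforms again.\<close>

lemma Laplace_inversion:
  fixes H :: "complex \<Rightarrow> complex" and f :: "real \<Rightarrow> real"
  assumes hol: "H holomorphic_on {s. Re s > 0}"
    and bd: "\<And>s. Re s \<ge> 1 \<Longrightarrow> norm (H s) \<le> B * norm s powr (- a)" and a: "a > 1"
    and f: "continuous_on {0..} f" "\<And>t. t \<ge> 0 \<Longrightarrow> \<bar>f t\<bar> \<le> C * exp (b * t)"
    and lap: "\<And>p. p > b \<Longrightarrow> has_bochner_integral lborel (\<lambda>t. indicator {0..} t * (exp (- p * t) * f t)) (Re (H (of_real p)))"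
    and t: "t \<ge> 0"
  shows "\<bar>f t\<bar> \<le> exp t * (B * (LINT w|lborel. norm (Complex 1 w) powr (- a)))"
proof -
  let ?K = "LINT w|lborel. norm (Complex 1 w) powr (- a)"
  have B: "B \<ge> 0" using order_trans[OF norm_ge_zero bd[of 1]] by simp
  define h where "h w = H (Complex 1 w)" for w
  have cont: "continuous_on UNIV h" unfolding h_def
  proof (rule continuous_on_compose2[OF holomorphic_on_imp_continuous_on[OF hol]])
    show "continuous_on UNIV (Complex 1)" unfolding Complex_eq by (intro continuous_intros)
  qed auto
  have hm[measurable]: "h \<in> borel_measurable borel" by (rule borel_measurable_continuous_onI[OF cont])
  have nh: "norm (h w) \<le> B * norm (Complex 1 w) powr (- a)" for w unfolding h_def by (rule bd) simp
  have Ci: "integrable lborel (\<lambda>w. B * norm (Complex 1 w) powr (- a))"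
    using integrable_vertical_line_powr[OF a] by simp
  have hi: "integrable lborel h"
    by (rule Bochner_Integration.integrable_bound[OF Ci]) (use nh B in \<open>auto simp: abs_mult\<close>)
  have nhi: "integrable lborel (\<lambda>w. norm (h w))" using hi by (rule integrable_norm)
  define e where "e t w = exp (of_real t * Complex 1 w)" for t w
  have ne: "norm (e t w) = exp t" for t w by (simp add: e_def)
  have em: "(\<lambda>w. e t w * h w) \<in> borel_measurable borel" for t
    unfolding e_def Complex_eq by (intro borel_measurable_continuous_onI continuous_intros cont)
  \<comment> \<open>The Bromwich integral of H along Re s = 1, which will turn out to have the same
    Laplace transform as f. The real part matches the form in which the transform of f is
    given.\<close>
  define R where "R t = 1 / (2 * pi) * Re (LINT w|lborel. e t w * h w)" for t
  have Rb: "\<bar>R t\<bar> \<le> exp t * (B * ?K)" for t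
  proof -
    have "norm (LINT w|lborel. e t w * h w) \<le> (LINT w|lborel. exp t * (B * norm (Complex 1 w) powr (- a)))"
    proof (rule order_trans[OF integral_norm_bound], rule integral_mono)
      show i: "integrable lborel (\<lambda>w. exp t * (B * norm (Complex 1 w) powr (- a)))" using Ci by simp
      have "integrable lborel (\<lambda>w. e t w * h w)"
        by (rule Bochner_Integration.integrable_bound[OF i])
          (use em nh B in \<open>auto simp: norm_mult ne abs_mult\<close>)
      then show "integrable lborel (\<lambda>w. norm (e t w * h w))" by (rule integrable_norm)
      show "norm (e t w * h w) \<le> exp t * (B * norm (Complex 1 w) powr (- a))" for w
        using nh by (simp add: norm_mult ne)
    qed
    then have "\<bar>Re (LINT w|lborel. e t w * h w)\<bar> \<le> exp t * (B * ?K)"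
      using abs_Re_le_cmod order_trans by fastforce
    moreover have "\<bar>R t\<bar> \<le> 1 * \<bar>Re (LINT w|lborel. e t w * h w)\<bar>"
      unfolding R_def abs_mult using pi_ge_two by (intro mult_right_mono) auto
    ultimately show ?thesis by simp
  qed
  have Rc: "continuous_on {0..} R"
  proof (rule continuous_on_subset[of UNIV])
    have "isCont R t" for t
    proof -
      have "((\<lambda>s. LINT w|lborel. e s w * h w) \<longlongrightarrow> (LINT w|lborel. e t w * h w)) (at t)"
      proof (subst tendsto_at_iff_sequentially, intro allI impI)
        fix X :: "nat \<Rightarrow> real" assume X: "\<forall>i. X i \<in> UNIV - {t}" "X \<longlonglongrightarrow> t"
        obtain K where K: "\<And>i. \<bar>X i\<bar> \<le> K" using X(2) convergent_imp_Bseq[of X] by (auto simp: convergent_def Bseq_def)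
        show "((\<lambda>s. LINT w|lborel. e s w * h w) \<circ> X) \<longlonglongrightarrow> (LINT w|lborel. e t w * h w)"
          unfolding o_def
        proof (rule integral_dominated_convergence)
          show "integrable lborel (\<lambda>w. exp K * norm (h w))" using nhi by simp
          show "AE w in lborel. (\<lambda>i. e (X i) w * h w) \<longlonglongrightarrow> e t w * h w"
            unfolding e_def by (intro AE_I2 tendsto_intros X)
          have "exp (X i) \<le> exp K" for i using K[of i] by simp
          then show "AE w in lborel. norm (e (X i) w * h w) \<le> exp K * norm (h w)" for i
            by (intro AE_I2) (simp add: norm_mult ne mult_right_mono)
        qed (use em in auto)
      qed
      then show "isCont R t" unfolding isCont_def R_def by (intro tendsto_intros)
    qed
    then show "continuous_on UNIV R" by (simp add: continuous_on_eq_continuous_at)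
  qed simp
  \<comment> \<open>Fubini: integrating exp(t (1 + iw - p)) over t \<ge> 0 gives 1 / (p - 1 - iw),
    absolutely for p > 1, and what remains is the line integral of
    \<open>half_plane_Cauchy_integral_formula\<close>.\<close>
  have RL: "has_bochner_integral lborel (\<lambda>t. indicator {0..} t * (exp (- p * t) * R t)) (Re (H (of_real p)))" if p: "p > 1" for p
  proof -
    define k where "k = (\<lambda>(w, t). indicator {0..} t *\<^sub>R exp (of_real t * (Complex 1 w - of_real p)) * h w)"
    have inner: "has_bochner_integral lborel (\<lambda>t. k (w, t)) (H (Complex 1 w) / (of_real p - Complex 1 w))" for w
    proof -
      have "has_bochner_integral lborel (\<lambda>t. indicator {0..} t *\<^sub>R exp (of_real t * (Complex 1 w - of_real p)) * h w) (- 1 / (Complex 1 w - of_real p) * h w)"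
        using p by (intro has_bochner_integral_mult_left integral_exp_atLeast) auto
      then show ?thesis by (simp add: k_def h_def minus_divide_right)
    qed
    have int: "integrable (lborel \<Otimes>\<^sub>M lborel) k"
    proof (rule lborel_pair.Fubini_integrable)
      have "(\<lambda>(w, t). indicator {0..} (t::real) *\<^sub>R (exp (of_real t * (Complex 1 w - of_real p)) * h w)) \<in> borel_measurable borel"
      proof -
        have "(\<lambda>x. indicator (UNIV \<times> {0..}) x *\<^sub>R (exp (of_real (snd x) * (Complex 1 (fst x) - of_real p)) * h (fst x))) \<in> borel_measurable (borel :: (real \<times> real) measure)"
        proof (rule borel_measurable_continuous_on_indicator)
          show "UNIV \<times> {0..} \<in> sets (borel :: (real \<times> real) measure)" by (intro borel_closed closed_Times) auto
          show "continuous_on (UNIV \<times> {0..}) (\<lambda>x::real\<times>real. exp (of_real (snd x) * (Complex 1 (fst x) - of_real p)) * h (fst x))"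
            unfolding Complex_eq by (intro continuous_intros continuous_on_compose2[OF cont]) auto
        qed
        then show ?thesis by (simp add: split_def indicator_def mem_Times_iff)
      qed
      then show "k \<in> borel_measurable (lborel \<Otimes>\<^sub>M lborel)"
        by (simp add: k_def lborel_prod)
      have nk: "norm (k (w, t)) = indicator {0..} t * exp (- (p - 1) * t) * norm (h w)" for w t
        by (simp add: k_def norm_mult)
      have "has_bochner_integral lborel (\<lambda>t. indicator {0..} t * exp (- (p - 1) * t) * norm (h w)) (1 / (p - 1) * norm (h w))" for w
      proof -
        have "((\<lambda>x. exp (- (p - 1) * x)) has_integral exp (- (p - 1) * 0) / (p - 1)) {0::real..}"
          by (rule has_integral_exp_minus_to_infinity) (use p in simp)
        from nn_integral_has_integral_lebesgue[OF _ this]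
        have "(\<integral>\<^sup>+ x. ennreal (indicator {0..} x * exp (- (p - 1) * x)) \<partial>lborel) = ennreal (1 / (p - 1))"
          by auto
        then have "has_bochner_integral lborel (\<lambda>x. indicator {0..} x * exp (- (p - 1) * x)) (1 / (p - 1))"
          using p by (intro has_bochner_integral_nn_integral) auto
        then show ?thesis by (rule has_bochner_integral_mult_left)
      qed
      then have "(LINT t|lborel. norm (k (w, t))) = 1 / (p - 1) * norm (h w)" for w
        unfolding nk by (simp add: has_bochner_integral_iff)
      then show "integrable lborel (\<lambda>w. LINT t|lborel. norm (k (w, t)))" using nhi by simp
      show "AE w in lborel. integrable lborel (\<lambda>t. k (w, t))"
        using inner by (auto simp: has_bochner_integral_iff)
    qed
    have kt: "(LINT w|lborel. k (w, t)) = of_real (indicator {0..} t * exp (- p * t)) * (LINT w|lborel. e t w * h w)" for t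
    proof -
      have "k (w, t) = of_real (indicator {0..} t * exp (- p * t)) * (e t w * h w)" for w
        by (auto simp: k_def e_def indicator_def exp_of_real[symmetric] exp_add[symmetric] algebra_simps)
      then show ?thesis by simp
    qed
    have i2: "integrable lborel (\<lambda>t. LINT w|lborel. k (w, t))"
      using lborel_pair.integrable_snd[of "\<lambda>w t. k (w, t)"] int by simp
    have "(LINT t|lborel. LINT w|lborel. k (w, t)) = (LINT w|lborel. LINT t|lborel. k (w, t))"
      using lborel_pair.Fubini_integral[of "\<lambda>w t. k (w, t)"] int by simp
    also have "\<dots> = (LINT w|lborel. H (Complex 1 w) / (of_real p - Complex 1 w))"
      using inner by (simp add: has_bochner_integral_iff)
    also have "\<dots> = 2 * pi * H (of_real p)"
      using half_plane_Cauchy_integral_formula[OF hol bd a p] by (simp add: has_bochner_integral_iff)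
    finally have "has_bochner_integral lborel (\<lambda>t. LINT w|lborel. k (w, t)) (2 * pi * H (of_real p))"
      using i2 by (simp add: has_bochner_integral_iff)
    from has_bochner_integral_mult_right[OF has_bochner_integral_bounded_linear[OF bounded_linear_Re this], of "1 / (2 * pi)"]
    show ?thesis unfolding kt by (simp add: R_def mult_ac)
  qed
  define C' b' where "C' = \<bar>C\<bar> + B * ?K" and "b' = max 1 b"
  have "f t - R t = 0"
  proof (rule Laplace_transform_unique[where f = "\<lambda>t. f t - R t" and t = t and b = b' and C = C'])
    show "continuous_on {0..} (\<lambda>t. f t - R t)" by (intro continuous_intros f Rc)
    show "\<bar>f t - R t\<bar> \<le> C' * exp (b' * t)" if t: "t \<ge> 0" for t
    proof -
      have I0: "B * ?K \<ge> 0" using B by (intro mult_nonneg_nonneg) auto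
      have "b * t \<le> b' * t" "1 * t \<le> b' * t" using t mult_right_mono[of b b' t] mult_right_mono[of 1 b' t] by (auto simp: b'_def)
      then have E: "exp (b * t) \<le> exp (b' * t)" "exp t \<le> exp (b' * t)" by auto
      have "\<bar>f t - R t\<bar> \<le> \<bar>f t\<bar> + \<bar>R t\<bar>" by simp
      also have "\<dots> \<le> \<bar>C\<bar> * exp (b * t) + exp t * (B * ?K)"
      proof (rule add_mono[OF _ Rb])
        show "\<bar>f t\<bar> \<le> \<bar>C\<bar> * exp (b * t)"
          by (rule order_trans[OF f(2)[OF t]]) (auto intro!: mult_right_mono)
      qed
      also have "\<dots> \<le> \<bar>C\<bar> * exp (b' * t) + exp (b' * t) * (B * ?K)"
        using E I0 by (intro add_mono mult_left_mono mult_right_mono) auto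
      finally show ?thesis by (simp add: C'_def algebra_simps)
    qed
    show "(LINT t|lborel. indicator {0..} t * (exp (- p * t) * (f t - R t))) = 0" if "p > b'" for p
    proof -
      have "has_bochner_integral lborel (\<lambda>t. indicator {0..} t * (exp (- p * t) * f t) - indicator {0..} t * (exp (- p * t) * R t)) (Re (H (of_real p)) - Re (H (of_real p)))"
        using that by (intro has_bochner_integral_diff lap RL) (auto simp: b'_def)
      then show ?thesis by (simp add: has_bochner_integral_iff algebra_simps)
    qed
  qed fact
  then show ?thesis using Rb[of t] by simp
qed

theorem mittag_leffler_decay:
  assumes \<gamma>: "1 < \<gamma>" "\<gamma> < 2" and \<beta>: "0 \<le> \<beta>" "\<beta> \<le> 1" and \<mu>: "\<mu> > \<gamma> * \<beta>" "\<mu> > 0"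
  obtains C where "C > 0" "\<And>x. x > 0 \<Longrightarrow> \<bar>mittag_leffler \<gamma> \<mu> (- x)\<bar> \<le> C * x powr (- \<beta>)"
proof -
  let ?d = "\<lambda>(s::complex) l. s powr of_real \<gamma> + of_real l"
  let ?q = "\<lambda>k. \<gamma> * real k + \<mu>"
  \<comment> \<open>The cosine of the angle between the edge of the sector and the negative axis:
    \<gamma> > 1 makes it nonnegative, \<gamma> < 2 makes it less than 1 and thus c
    positive.\<close>
  define \<kappa> where "\<kappa> = - cos (\<gamma> * pi / 2)"
  have \<kappa>: "0 \<le> \<kappa>" "\<kappa> < 1"
  proof -
    have "cos (\<gamma> * pi / 2) \<le> cos (pi / 2)" using \<gamma> by (intro cos_monotone_0_pi_le) auto
    then show "0 \<le> \<kappa>" by (simp add: \<kappa>_def)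
    have "cos pi < cos (\<gamma> * pi / 2)" using \<gamma> by (intro cos_monotone_0_pi) auto
    then show "\<kappa> < 1" by (simp add: \<kappa>_def)
  qed
  define c where "c = sqrt ((1 - \<kappa>) / 2)"
  have c: "c > 0" using \<kappa> by (simp add: c_def)
  define D where "D = \<gamma> / c\<^sup>2 + \<bar>\<mu> - \<gamma>\<bar> / c"
  have D: "D > 0" using c \<gamma> by (auto simp: D_def intro!: add_pos_nonneg)
  \<comment> \<open>The decay exponent in s that \<open>ml_laplace\<close> retains once l^(-\<beta>)
    has been split off; a > 1 is exactly the hypothesis \<mu> > \<gamma> \<beta>.\<close>
  define a where "a = \<mu> + 1 - \<gamma> * \<beta>"
  have a: "a > 1" using \<mu> by (simp add: a_def)
  define I where "I = (LINT w|lborel. norm (Complex 1 w) powr (- a))"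
  have low: "c * (l + norm s powr \<gamma>) \<le> norm (?d s l)" if "Re s > 0" "l > 0" for s l
    using norm_add_of_real_ge[of \<kappa> "s powr of_real \<gamma>" l] Re_powr_ge[OF \<gamma> that(1)] that \<kappa>
    by (simp add: c_def \<kappa>_def norm_powr_real_powr')
  have est: "\<bar>mittag_leffler \<gamma> \<mu> (- l)\<bar> \<le> (exp 1 * D * I) * l powr (- \<beta>)" if l: "l > 0" for l
  proof -
    have nz: "s powr of_real \<gamma> + of_real l \<noteq> 0" if "Re s > 0" for s
      using low[OF that l] c l by (smt (verit) mult_pos_pos norm_zero powr_ge_zero)
    have hol: "ml_laplace \<gamma> \<mu> l holomorphic_on {s. Re s > 0}"
      unfolding ml_laplace_def using nz
      by (intro holomorphic_intros) (auto simp: complex_nonpos_Reals_iff)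
    have bd: "norm (ml_laplace \<gamma> \<mu> l s) \<le> (D * l powr (- \<beta>)) * norm s powr (- a)" if s: "Re s \<ge> 1" for s
    proof -
      define r where "r = norm s powr \<gamma>"
      have n1: "norm s > 0" using s by auto
      have r: "r > 0" using s by (auto simp: r_def)
      define d where "d = l + r"
      have d: "d > 0" "r \<le> d" using l r by (auto simp: d_def)
      have lo: "c * d \<le> norm (?d s l)" using low[of s l] s l by (simp add: d_def r_def)
      have cd: "c * d > 0" using c d by simp
      have "norm (of_real \<gamma> * s powr of_real \<gamma> / (?d s l)\<^sup>2 + of_real (\<mu> - \<gamma>) / (?d s l))
         \<le> \<gamma> * r / (c * d)\<^sup>2 + \<bar>\<mu> - \<gamma>\<bar> / (c * d)"
      proof (rule order_trans[OF norm_triangle_ineq], rule add_mono)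
        show "norm (of_real \<gamma> * s powr of_real \<gamma> / (?d s l)\<^sup>2) \<le> \<gamma> * r / (c * d)\<^sup>2"
          unfolding norm_divide norm_power norm_mult using \<gamma> r lo cd
          by (intro frac_le power_mono) (auto simp: r_def norm_powr_real_powr')
        show "norm (of_real (\<mu> - \<gamma>) / (?d s l)) \<le> \<bar>\<mu> - \<gamma>\<bar> / (c * d)"
          unfolding norm_divide norm_of_real using lo cd by (intro frac_le) auto
      qed
      also have "\<dots> \<le> D / d"
      proof -
        have "\<gamma> * r / (c * d)\<^sup>2 \<le> \<gamma> / c\<^sup>2 / d"
        proof -
          have "\<gamma> * r / (c * d)\<^sup>2 = \<gamma> / c\<^sup>2 / d * (r / d)" by (simp add: power2_eq_square)
          also have "\<dots> \<le> \<gamma> / c\<^sup>2 / d" using d r \<gamma> by (intro mult_left_le) auto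
          finally show ?thesis .
        qed
        then show ?thesis by (simp add: D_def add_divide_distrib)
      qed
      \<comment> \<open>d = l + r dominates both summands, so d = d^\<beta> d^(1-\<beta>) is at
        least l^\<beta> r^(1-\<beta>): \<beta> trades decay in l against decay in s.\<close>
      also have "1 / d \<le> l powr (- \<beta>) * r powr (- (1 - \<beta>))"
      proof -
        have "l powr \<beta> * r powr (1 - \<beta>) \<le> d powr \<beta> * d powr (1 - \<beta>)"
          using l r d \<beta> by (intro mult_mono powr_mono2) (auto simp: d_def)
        also have "\<dots> = d" using d by (simp add: powr_add[symmetric])
        finally have "1 / d \<le> 1 / (l powr \<beta> * r powr (1 - \<beta>))"
          using l r d by (intro divide_left_mono mult_pos_pos) auto
        then show ?thesis unfolding powr_minus_divide by simp
      qed
      then have "D / d \<le> D * (l powr (- \<beta>) * r powr (- (1 - \<beta>)))"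
        using D by (simp add: divide_inverse mult_left_mono)
      finally have *: "norm (of_real \<gamma> * s powr of_real \<gamma> / (?d s l)\<^sup>2 + of_real (\<mu> - \<gamma>) / (?d s l))
         \<le> D * (l powr (- \<beta>) * r powr (- (1 - \<beta>)))" .
      have "norm (ml_laplace \<gamma> \<mu> l s) = norm s powr (\<gamma> - \<mu> - 1) * norm (of_real \<gamma> * s powr of_real \<gamma> / (?d s l)\<^sup>2 + of_real (\<mu> - \<gamma>) / (?d s l))"
        unfolding ml_laplace_def norm_mult by (subst norm_powr_real_powr') auto
      also have "\<dots> \<le> norm s powr (\<gamma> - \<mu> - 1) * (D * (l powr (- \<beta>) * r powr (- (1 - \<beta>))))"
        by (intro mult_left_mono *) auto
      also have "\<dots> = (D * l powr (- \<beta>)) * (norm s powr (\<gamma> - \<mu> - 1) * norm s powr (\<gamma> * (- (1 - \<beta>))))"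
        by (simp add: r_def powr_powr)
      also have "norm s powr (\<gamma> - \<mu> - 1) * norm s powr (\<gamma> * (- (1 - \<beta>))) = norm s powr (- a)"
        unfolding a_def powr_add[symmetric] by (simp add: algebra_simps)
      finally show ?thesis .
    qed
    define f where "f t = t powr \<mu> * mittag_leffler \<gamma> \<mu> (- l * t powr \<gamma>)" for t
    \<comment> \<open>Any growth rate b with b^\<gamma> > l makes the majorant with ratio l
      b^(-\<gamma>) converge. That b and C depend on l is harmless: the bound of
      \<open>Laplace_inversion\<close> does not contain them.\<close>
    define b where "b = (l + 1) powr (1 / \<gamma>)"
    have b: "b > 0" "b powr \<gamma> = l + 1" using l \<gamma> by (auto simp: b_def powr_powr)
    have "l / (l + 1) < 1" using l by simp
    then have x: "\<bar>l * b powr (- \<gamma>)\<bar> < 1" using l b by (simp add: powr_minus divide_inverse abs_mult)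
    define C where "C = b powr (- \<mu>) * (\<gamma> / (1 - l * b powr (- \<gamma>))\<^sup>2 + (\<mu> - \<gamma>) / (1 - l * b powr (- \<gamma>)))"
    have fc: "continuous_on {0..} f" unfolding f_def using \<gamma> \<mu>
      by (intro continuous_intros continuous_on_compose2[OF continuous_mittag_leffler[OF \<gamma>(1) \<mu>(2)]] continuous_on_powr') auto
    have fb: "\<bar>f t\<bar> \<le> C * exp (b * t)" if t: "t \<ge> 0" for t
    proof (cases "t = 0")
      case True
      have "(\<lambda>k. (?q k) * (l * b powr (- \<gamma>)) ^ k) sums (\<gamma> / (1 - l * b powr (- \<gamma>))\<^sup>2 + (\<mu> - \<gamma>) / (1 - l * b powr (- \<gamma>)))"
        by (rule sums_affine_geometric[OF x])
      then have "0 \<le> (\<gamma> / (1 - l * b powr (- \<gamma>))\<^sup>2 + (\<mu> - \<gamma>) / (1 - l * b powr (- \<gamma>)))"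
        by (rule sums_le[OF _ sums_zero, rotated]) (use \<gamma> \<mu> l in auto)
      then show ?thesis using True by (simp add: f_def C_def)
    next
      case False
      with t have t0: "t > 0" by simp
      have s: "(\<lambda>k. (- l) ^ k * t powr (?q k) / Gamma (?q k)) sums f t"
        unfolding f_def by (rule mittag_leffler_kernel_series[OF \<gamma>(1) \<mu>(2) t0])
      have g: "(\<lambda>k. exp (b * t) * (b powr (- \<mu>) * ((?q k) * (l * b powr (- \<gamma>)) ^ k))) sums (exp (b * t) * C)"
        unfolding C_def by (intro sums_mult sums_affine_geometric x)
      have le: "\<bar>(- l) ^ k * t powr (?q k) / Gamma (?q k)\<bar> \<le> exp (b * t) * (b powr (- \<mu>) * ((?q k) * (l * b powr (- \<gamma>)) ^ k))" for k
      proof -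
        define q where "q = \<gamma> * real k + \<mu>"
        have q: "q > 0" using \<gamma> \<mu> by (auto simp: q_def intro!: add_nonneg_pos)
        have G: "Gamma (q + 1) = q * Gamma q" using q by (intro Gamma_plus1) (auto elim!: nonpos_Ints_cases)
        have "(b * t) powr q \<le> exp (b * t) * (q * Gamma q)"
          using Gamma_power_exp_bound[OF q, of "b * t"] b t unfolding G by simp
        then have "t powr q / Gamma q \<le> exp (b * t) * q * b powr (- q)"
          using b t0 Gamma_real_pos[OF q] by (simp add: powr_mult powr_minus field_simps)
        then have "l ^ k * (t powr q / Gamma q) \<le> l ^ k * (exp (b * t) * q * b powr (- q))"
          using l by (intro mult_left_mono) auto
        moreover have "b powr (- q) = b powr (- \<mu>) * (b powr (- \<gamma>)) ^ k"
          using b by (simp add: q_def powr_realpow[symmetric] powr_powr powr_add[symmetric] algebra_simps)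
        moreover have "\<bar>(- l) ^ k * t powr q / Gamma q\<bar> = l ^ k * (t powr q / Gamma q)"
          using l Gamma_real_pos[OF q] by (simp add: abs_mult power_abs)
        ultimately show ?thesis unfolding q_def[symmetric] power_mult_distrib by (simp add: mult_ac)
      qed
      have "\<bar>f t\<bar> \<le> exp (b * t) * C"
      proof -
        have sa: "summable (\<lambda>k. \<bar>(- l) ^ k * t powr (?q k) / Gamma (?q k)\<bar>)"
          by (rule summable_comparison_test'[OF sums_summable[OF g], of 0]) (use le in simp)
        have "\<bar>f t\<bar> \<le> (\<Sum>k. \<bar>(- l) ^ k * t powr (?q k) / Gamma (?q k)\<bar>)"
          using summable_rabs[OF sa] s by (simp add: sums_iff)
        also have "\<dots> \<le> exp (b * t) * C"
          using suminf_le[OF le sa sums_summable[OF g]] g by (simp add: sums_iff)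
        finally show ?thesis .
      qed
      then show ?thesis by (simp add: mult.commute)
    qed
    have "\<bar>f 1\<bar> \<le> exp 1 * (D * l powr (- \<beta>) * I)"
      unfolding I_def
    proof (rule Laplace_inversion[OF hol bd a fc fb])
      fix p assume "p > b"
      moreover from this have "b powr \<gamma> < p powr \<gamma>" using b \<gamma> by (intro powr_less_mono2) auto
      ultimately show "has_bochner_integral lborel (\<lambda>t. indicator {0..} t * (exp (- p * t) * f t)) (Re (ml_laplace \<gamma> \<mu> l (complex_of_real p)))"
        unfolding f_def using b \<gamma> \<mu> l by (intro mittag_leffler_Laplace_transform) auto
    qed auto
    then show ?thesis by (simp add: f_def mult_ac)
  qed
  have I0: "I \<ge> 0" by (simp add: I_def)
  show ?thesis
  proof (rule that[of "exp 1 * D * I + 1"])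
    show "exp 1 * D * I + 1 > 0" using D I0 by (intro add_nonneg_pos mult_nonneg_nonneg) auto
    show "\<bar>mittag_leffler \<gamma> \<mu> (- x)\<bar> \<le> (exp 1 * D * I + 1) * x powr (- \<beta>)" if "x > 0" for x
      by (rule order_trans[OF est[OF that]]) (auto intro!: mult_right_mono)
  qed
qed

section \<open>Square integrable functions and orthonormal bases\<close>

lemma abs_mult_le_squares: "\<bar>a * b\<bar> \<le> a\<^sup>2 + (b::real)\<^sup>2"
  using sum_squares_bound[of "\<bar>a\<bar>" "\<bar>b\<bar>"] abs_ge_zero[of "a * b"] unfolding abs_mult power2_abs by linarith

lemma l2_lincomb:
  fixes x y :: "nat \<Rightarrow> real"
  assumes x: "summable (\<lambda>k. (x k)\<^sup>2)" and y: "summable (\<lambda>k. (y k)\<^sup>2)"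
  shows "summable (\<lambda>k. (a * x k + b * y k)\<^sup>2)"
proof (rule summable_comparison_test'[where N=0])
  show "summable (\<lambda>k. 2 * a\<^sup>2 * (x k)\<^sup>2 + 2 * b\<^sup>2 * (y k)\<^sup>2)" by (intro summable_add summable_mult x y)
  fix k
  have "0 \<le> (a * x k - b * y k)\<^sup>2" by simp
  then have "(a * x k + b * y k)\<^sup>2 \<le> 2 * a\<^sup>2 * (x k)\<^sup>2 + 2 * b\<^sup>2 * (y k)\<^sup>2"
    by (simp add: power2_eq_square algebra_simps)
  then show "norm ((a * x k + b * y k)\<^sup>2) \<le> 2 * a\<^sup>2 * (x k)\<^sup>2 + 2 * b\<^sup>2 * (y k)\<^sup>2"
    by simp
qed

lemma l2_triangle:
  fixes x y :: "nat \<Rightarrow> real"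
  assumes x: "summable (\<lambda>k. (x k)\<^sup>2)" and y: "summable (\<lambda>k. (y k)\<^sup>2)"
  shows "sqrt (\<Sum>k. (x k + y k)\<^sup>2) \<le> sqrt (\<Sum>k. (x k)\<^sup>2) + sqrt (\<Sum>k. (y k)\<^sup>2)"
proof -
  have xy: "summable (\<lambda>k. (x k + y k)\<^sup>2)" using l2_lincomb[OF x y, of 1 1] by simp
  have "sqrt (\<Sum>k<n. (x k + y k)\<^sup>2) \<le> sqrt (\<Sum>k. (x k)\<^sup>2) + sqrt (\<Sum>k. (y k)\<^sup>2)" for n
  proof -
    have "sqrt (\<Sum>k<n. (x k + y k)\<^sup>2) \<le> sqrt (\<Sum>k<n. (x k)\<^sup>2) + sqrt (\<Sum>k<n. (y k)\<^sup>2)"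
      using L2_set_triangle_ineq[of x y "{..<n}"] by (simp add: L2_set_def)
    also have "\<dots> \<le> sqrt (\<Sum>k. (x k)\<^sup>2) + sqrt (\<Sum>k. (y k)\<^sup>2)"
      by (intro add_mono real_sqrt_le_mono sum_le_suminf x y) auto
    finally show ?thesis .
  qed
  moreover have "(\<lambda>n. sqrt (\<Sum>k<n. (x k + y k)\<^sup>2)) \<longlonglongrightarrow> sqrt (\<Sum>k. (x k + y k)\<^sup>2)"
    by (intro tendsto_real_sqrt summable_LIMSEQ xy)
  ultimately show ?thesis by (intro LIMSEQ_le_const2) auto
qed

lemma l2_Cauchy_Schwarz:
  fixes x y :: "nat \<Rightarrow> real"
  assumes x: "summable (\<lambda>k. (x k)\<^sup>2)" and y: "summable (\<lambda>k. (y k)\<^sup>2)"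
  shows "summable (\<lambda>k. \<bar>x k * y k\<bar>)" "summable (\<lambda>k. x k * y k)"
    "\<bar>\<Sum>k<n. x k * y k\<bar> \<le> sqrt (\<Sum>k. (x k)\<^sup>2) * sqrt (\<Sum>k. (y k)\<^sup>2)"
    "\<bar>\<Sum>k. x k * y k\<bar> \<le> sqrt (\<Sum>k. (x k)\<^sup>2) * sqrt (\<Sum>k. (y k)\<^sup>2)"
proof -
  show s: "summable (\<lambda>k. \<bar>x k * y k\<bar>)"
  proof (rule summable_comparison_test'[where N=0])
    show "summable (\<lambda>k. (x k)\<^sup>2 + (y k)\<^sup>2)" by (intro summable_add x y)
    fix k
    show "norm \<bar>x k * y k\<bar> \<le> (x k)\<^sup>2 + (y k)\<^sup>2"
      using abs_mult_le_squares[of "x k" "y k"] by simp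
  qed
  then show s': "summable (\<lambda>k. x k * y k)" by (rule summable_rabs_cancel)
  have *: "\<bar>\<Sum>k<n. x k * y k\<bar> \<le> sqrt (\<Sum>k. (x k)\<^sup>2) * sqrt (\<Sum>k. (y k)\<^sup>2)" for n
  proof -
    have "\<bar>\<Sum>k<n. x k * y k\<bar> \<le> (\<Sum>k<n. \<bar>x k\<bar> * \<bar>y k\<bar>)"
      by (rule order_trans[OF sum_abs]) (simp add: abs_mult)
    also have "\<dots> \<le> sqrt (\<Sum>k<n. (x k)\<^sup>2) * sqrt (\<Sum>k<n. (y k)\<^sup>2)"
      using L2_set_mult_ineq[of x y "{..<n}"] by (simp add: L2_set_def)
    also have "\<dots> \<le> sqrt (\<Sum>k. (x k)\<^sup>2) * sqrt (\<Sum>k. (y k)\<^sup>2)"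
      by (intro mult_mono real_sqrt_le_mono sum_le_suminf x y) (auto intro!: suminf_nonneg sum_nonneg x)
    finally show ?thesis .
  qed
  then show "\<bar>\<Sum>k<n. x k * y k\<bar> \<le> sqrt (\<Sum>k. (x k)\<^sup>2) * sqrt (\<Sum>k. (y k)\<^sup>2)" .
  have "(\<lambda>n. \<bar>\<Sum>k<n. x k * y k\<bar>) \<longlonglongrightarrow> \<bar>\<Sum>k. x k * y k\<bar>"
    by (intro tendsto_rabs summable_LIMSEQ s')
  then show "\<bar>\<Sum>k. x k * y k\<bar> \<le> sqrt (\<Sum>k. (x k)\<^sup>2) * sqrt (\<Sum>k. (y k)\<^sup>2)"
    by (rule LIMSEQ_le_const2) (use * in auto)
qed

lemma nonneg_quadratic_discriminant:
  fixes p q b :: real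
  assumes ge: "\<And>t. 0 \<le> p + 2 * t * b + t\<^sup>2 * q" and q: "0 \<le> q"
  shows "b\<^sup>2 \<le> p * q"
proof (cases "q = 0")
  case True
  have "b = 0"
  proof (rule ccontr)
    assume "b \<noteq> 0"
    then have "p + 2 * (- (p + 1) / (2 * b)) * b = - 1" by (simp add: field_simps)
    then show False using ge[of "- (p + 1) / (2 * b)"] True by simp
  qed
  then show ?thesis using True by simp
next
  case False
  have "0 \<le> (p + 2 * (- b / q) * b + (- b / q)\<^sup>2 * q) * q" by (rule mult_nonneg_nonneg[OF ge q])
  also have "\<dots> = p * q - b\<^sup>2" using False by (simp add: power2_eq_square field_simps)
  finally show ?thesis by simp
qed

lemma integral_Cauchy_Schwarz:
  fixes a b :: "'a \<Rightarrow> real"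
  assumes a: "a \<in> borel_measurable M" "integrable M (\<lambda>x. (a x)\<^sup>2)"
    and b: "b \<in> borel_measurable M" "integrable M (\<lambda>x. (b x)\<^sup>2)"
  shows "integrable M (\<lambda>x. a x * b x)"
    "\<bar>LINT x|M. a x * b x\<bar> \<le> sqrt (LINT x|M. (a x)\<^sup>2) * sqrt (LINT x|M. (b x)\<^sup>2)"
proof -
  show ab: "integrable M (\<lambda>x. a x * b x)"
  proof (rule Bochner_Integration.integrable_bound)
    show "integrable M (\<lambda>x. (a x)\<^sup>2 + (b x)\<^sup>2)" using a b by auto
    have "norm (a x * b x) \<le> norm ((a x)\<^sup>2 + (b x)\<^sup>2)" for x
      using abs_mult_le_squares[of "a x" "b x"] by simp
    then show "AE x in M. norm (a x * b x) \<le> norm ((a x)\<^sup>2 + (b x)\<^sup>2)" by simp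
  qed (use a b in measurable)
  have "(LINT x|M. a x * b x)\<^sup>2 \<le> (LINT x|M. (a x)\<^sup>2) * (LINT x|M. (b x)\<^sup>2)"
  proof (rule nonneg_quadratic_discriminant)
    fix t
    have "0 \<le> (LINT x|M. (a x + t * b x)\<^sup>2)" by simp
    also have "(\<lambda>x. (a x + t * b x)\<^sup>2) = (\<lambda>x. (a x)\<^sup>2 + 2 * t * (a x * b x) + t\<^sup>2 * (b x)\<^sup>2)"
      by (simp add: fun_eq_iff power2_eq_square algebra_simps)
    also have "(LINT x|M. (a x)\<^sup>2 + 2 * t * (a x * b x) + t\<^sup>2 * (b x)\<^sup>2)
        = (LINT x|M. (a x)\<^sup>2) + 2 * t * (LINT x|M. a x * b x) + t\<^sup>2 * (LINT x|M. (b x)\<^sup>2)"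
      using a b ab by simp
    finally show "0 \<le> (LINT x|M. (a x)\<^sup>2) + 2 * t * (LINT x|M. a x * b x) + t\<^sup>2 * (LINT x|M. (b x)\<^sup>2)" .
  qed simp
  then have "sqrt ((LINT x|M. a x * b x)\<^sup>2) \<le> sqrt ((LINT x|M. (a x)\<^sup>2) * (LINT x|M. (b x)\<^sup>2))"
    by (rule real_sqrt_le_mono)
  then show "\<bar>LINT x|M. a x * b x\<bar> \<le> sqrt (LINT x|M. (a x)\<^sup>2) * sqrt (LINT x|M. (b x)\<^sup>2)"
    by (simp add: real_sqrt_mult)
qed

section \<open>Square integrable functions on a set\<close>

lemma L2_spaceD:
  assumes "w \<in> L2_space \<Omega>"
  shows "w \<in> borel_measurable (lebesgue_on \<Omega>)" "integrable (lebesgue_on \<Omega>) (\<lambda>x. (w x)\<^sup>2)"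
  using assms by (auto simp: L2_space_def)

lemma L2_integrable_mult:
  assumes w: "w \<in> L2_space \<Omega>" and v: "v \<in> L2_space \<Omega>"
  shows "integrable (lebesgue_on \<Omega>) (\<lambda>x. w x * v x)"
  by (rule integral_Cauchy_Schwarz(1)[OF L2_spaceD[OF w] L2_spaceD[OF v]])

lemma L2_lincomb:
  assumes w: "w \<in> L2_space \<Omega>" and v: "v \<in> L2_space \<Omega>"
  shows "(\<lambda>x. a * w x + b * v x) \<in> L2_space \<Omega>"
proof -
  have eq: "(a * w x + b * v x)\<^sup>2 = a\<^sup>2 * (w x)\<^sup>2 + 2 * a * b * (w x * v x) + b\<^sup>2 * (v x)\<^sup>2" for x
    by (simp add: power2_eq_square algebra_simps)
  have "integrable (lebesgue_on \<Omega>) (\<lambda>x. (a * w x + b * v x)\<^sup>2)" unfolding eq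
    using L2_spaceD(2)[OF w] L2_spaceD(2)[OF v] L2_integrable_mult[OF w v] by auto
  moreover have "(\<lambda>x. a * w x + b * v x) \<in> borel_measurable (lebesgue_on \<Omega>)"
    using L2_spaceD(1)[OF w] L2_spaceD(1)[OF v] by auto
  ultimately show ?thesis by (simp add: L2_space_def)
qed

lemma L2_zero: "(\<lambda>x. 0) \<in> L2_space \<Omega>" by (simp add: L2_space_def)

lemma L2_scale: "w \<in> L2_space \<Omega> \<Longrightarrow> (\<lambda>x. a * w x) \<in> L2_space \<Omega>"
  using L2_lincomb[of w \<Omega> w a 0] by simp

lemma L2_add: "w \<in> L2_space \<Omega> \<Longrightarrow> v \<in> L2_space \<Omega> \<Longrightarrow> (\<lambda>x. w x + v x) \<in> L2_space \<Omega>"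
  using L2_lincomb[of w \<Omega> v 1 1] by simp

lemma L2_diff: "w \<in> L2_space \<Omega> \<Longrightarrow> v \<in> L2_space \<Omega> \<Longrightarrow> (\<lambda>x. w x - v x) \<in> L2_space \<Omega>"
  using L2_lincomb[of w \<Omega> v 1 "-1"] by simp

lemma L2_sum: "(\<And>i. i \<in> I \<Longrightarrow> w i \<in> L2_space \<Omega>) \<Longrightarrow> (\<lambda>x. \<Sum>i\<in>I. w i x) \<in> L2_space \<Omega>"
  by (induction I rule: infinite_finite_induct) (auto simp: L2_zero L2_add)

lemma L2_inner_commute: "L2_inner \<Omega> w v = L2_inner \<Omega> v w"
  by (simp add: L2_inner_def mult.commute)

lemma L2_inner_lincomb:
  assumes w: "w \<in> L2_space \<Omega>" and v: "v \<in> L2_space \<Omega>" and u: "u \<in> L2_space \<Omega>"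
  shows "L2_inner \<Omega> (\<lambda>x. a * w x + b * v x) u = a * L2_inner \<Omega> w u + b * L2_inner \<Omega> v u"
proof -
  have "(a * w x + b * v x) * u x = a * (w x * u x) + b * (v x * u x)" for x by (simp add: algebra_simps)
  then show ?thesis
    using L2_integrable_mult[OF w u] L2_integrable_mult[OF v u] by (simp add: L2_inner_def)
qed

lemma L2_inner_scale: "L2_inner \<Omega> (\<lambda>x. a * w x) u = a * L2_inner \<Omega> w u"
  by (simp add: L2_inner_def mult.assoc)

lemma L2_inner_diff:
  "w \<in> L2_space \<Omega> \<Longrightarrow> v \<in> L2_space \<Omega> \<Longrightarrow> u \<in> L2_space \<Omega> \<Longrightarrow>
    L2_inner \<Omega> (\<lambda>x. w x - v x) u = L2_inner \<Omega> w u - L2_inner \<Omega> v u"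
  using L2_inner_lincomb[of w \<Omega> v u 1 "-1"] by simp

lemma L2_inner_add:
  "w \<in> L2_space \<Omega> \<Longrightarrow> v \<in> L2_space \<Omega> \<Longrightarrow> u \<in> L2_space \<Omega> \<Longrightarrow>
    L2_inner \<Omega> (\<lambda>x. w x + v x) u = L2_inner \<Omega> w u + L2_inner \<Omega> v u"
  using L2_inner_lincomb[of w \<Omega> v u 1 1] by simp

lemma L2_inner_sum:
  assumes "\<And>i. i \<in> I \<Longrightarrow> w i \<in> L2_space \<Omega>" "u \<in> L2_space \<Omega>"
  shows "L2_inner \<Omega> (\<lambda>x. \<Sum>i\<in>I. w i x) u = (\<Sum>i\<in>I. L2_inner \<Omega> (w i) u)"
  using assms(1)
proof (induction I rule: infinite_finite_induct)
  case (insert i I)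
  then show ?case using L2_inner_add[of "w i" \<Omega> "\<lambda>x. \<Sum>i\<in>I. w i x" u] L2_sum[of I w \<Omega>] assms(2) by simp
qed (simp_all add: L2_inner_def)

lemma L2_norm_nonneg [simp]: "0 \<le> L2_norm \<Omega> w" by (simp add: L2_norm_def)

lemma L2_norm_square: "(L2_norm \<Omega> w)\<^sup>2 = L2_inner \<Omega> w w"
  by (simp add: L2_norm_def L2_inner_def power2_eq_square)

lemma L2_norm_uminus: "L2_norm \<Omega> (\<lambda>x. w x - v x) = L2_norm \<Omega> (\<lambda>x. v x - w x)"
  by (simp add: L2_norm_def power2_commute)

lemma L2_norm_square_lincomb:
  assumes w: "w \<in> L2_space \<Omega>" and v: "v \<in> L2_space \<Omega>"
  shows "(L2_norm \<Omega> (\<lambda>x. a * w x + b * v x))\<^sup>2 = a\<^sup>2 * (L2_norm \<Omega> w)\<^sup>2 + 2 * a * b * L2_inner \<Omega> w v + b\<^sup>2 * (L2_norm \<Omega> v)\<^sup>2"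
proof -
  let ?u = "\<lambda>x. a * w x + b * v x"
  have u: "?u \<in> L2_space \<Omega>" by (rule L2_lincomb[OF w v])
  have "(L2_norm \<Omega> ?u)\<^sup>2 = a * L2_inner \<Omega> w ?u + b * L2_inner \<Omega> v ?u"
    unfolding L2_norm_square by (rule L2_inner_lincomb[OF w v u])
  also have "L2_inner \<Omega> w ?u = a * L2_inner \<Omega> w w + b * L2_inner \<Omega> w v"
    by (subst (1 2 3) L2_inner_commute) (rule L2_inner_lincomb[OF w v w])
  also have "L2_inner \<Omega> v ?u = a * L2_inner \<Omega> w v + b * L2_inner \<Omega> v v"
    by (subst L2_inner_commute) (rule L2_inner_lincomb[OF w v v])
  finally show ?thesis unfolding L2_norm_square by (simp add: power2_eq_square algebra_simps)
qed

lemma L2_Cauchy_Schwarz: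
  assumes w: "w \<in> L2_space \<Omega>" and v: "v \<in> L2_space \<Omega>"
  shows "\<bar>L2_inner \<Omega> w v\<bar> \<le> L2_norm \<Omega> w * L2_norm \<Omega> v"
  using integral_Cauchy_Schwarz[OF L2_spaceD[OF w] L2_spaceD[OF v]]
  by (simp add: L2_inner_def L2_norm_def)

lemma L2_norm_triangle:
  assumes w: "w \<in> L2_space \<Omega>" and v: "v \<in> L2_space \<Omega>"
  shows "L2_norm \<Omega> (\<lambda>x. w x + v x) \<le> L2_norm \<Omega> w + L2_norm \<Omega> v"
proof (rule power2_le_imp_le)
  show "(L2_norm \<Omega> (\<lambda>x. w x + v x))\<^sup>2 \<le> (L2_norm \<Omega> w + L2_norm \<Omega> v)\<^sup>2"
    using L2_norm_square_lincomb[OF w v, of 1 1] L2_Cauchy_Schwarz[OF w v]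
    by (simp add: power2_sum)
qed simp

lemma L2_norm_triangle_diff:
  assumes "w \<in> L2_space \<Omega>" "v \<in> L2_space \<Omega>"
  shows "L2_norm \<Omega> w \<le> L2_norm \<Omega> (\<lambda>x. w x - v x) + L2_norm \<Omega> v"
  using L2_norm_triangle[OF L2_diff[OF assms] assms(2)] by simp

lemma L2_norm_eq_0_AE:
  assumes w: "w \<in> L2_space \<Omega>" "L2_norm \<Omega> w = 0"
  shows "AE x in lebesgue_on \<Omega>. w x = 0"
  using integral_nonneg_eq_0_iff_AE[OF L2_spaceD(2)[OF w(1)]] w(2) by (simp add: L2_norm_def)

lemma L2_inner_cong_AE:
  assumes "w \<in> borel_measurable (lebesgue_on \<Omega>)" "v \<in> borel_measurable (lebesgue_on \<Omega>)"
    "u \<in> borel_measurable (lebesgue_on \<Omega>)" and e: "AE x in lebesgue_on \<Omega>. w x = v x"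
  shows "L2_inner \<Omega> w u = L2_inner \<Omega> v u"
  unfolding L2_inner_def by (rule integral_cong_AE) (use assms in auto)

text \<open>Along a subsequence with increments below 2^(-j), finiteness of the measure turns L2
  bounds into L1 bounds, so the increments sum absolutely almost everywhere and a pointwise limit
  exists. Fatou's lemma then gives convergence of the whole sequence in L2.\<close>

theorem L2_complete:
  assumes \<Omega>: "\<Omega> \<in> lmeasurable" and s: "\<And>n. s n \<in> L2_space \<Omega>"
    and cauchy: "\<And>e. e > 0 \<Longrightarrow> \<exists>N. \<forall>m\<ge>N. \<forall>n\<ge>N. L2_norm \<Omega> (\<lambda>x. s m x - s n x) < e"
  obtains w where "w \<in> L2_space \<Omega>" "(\<lambda>n. L2_norm \<Omega> (\<lambda>x. s n x - w x)) \<longlonglongrightarrow> 0"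
proof -
  let ?M = "lebesgue_on \<Omega>"
  have "\<forall>j. \<exists>N. \<forall>m\<ge>N. \<forall>n\<ge>N. L2_norm \<Omega> (\<lambda>x. s m x - s n x) < (1/2) ^ j"
    using cauchy by simp
  then obtain N where N: "\<And>j m n. m \<ge> N j \<Longrightarrow> n \<ge> N j \<Longrightarrow> L2_norm \<Omega> (\<lambda>x. s m x - s n x) < (1/2) ^ j"
    by metis
  \<comment> \<open>Summing the thresholds gives a monotone index sequence beyond every earlier
    threshold, without a recursive choice.\<close>
  define r where "r j = (\<Sum>i\<le>j. N i)" for j
  have rN: "N j \<le> r j" for j unfolding r_def by (rule member_le_sum) auto
  have rS: "r j \<le> r (Suc j)" for j by (simp add: r_def)
  have rN': "N i \<le> r j" if "i \<le> j" for i j unfolding r_def by (rule member_le_sum) (use that in auto)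
  define d where "d j x = s (r (Suc j)) x - s (r j) x" for j x
  have dL: "d j \<in> L2_space \<Omega>" for j unfolding d_def by (intro L2_diff s)
  have dn: "L2_norm \<Omega> (d j) < (1/2) ^ j" for j
    unfolding d_def using rN[of j] rS[of j] by (intro N) auto
  have one: "(\<lambda>x. 1) \<in> L2_space \<Omega>" using \<Omega> by (simp add: L2_space_def fmeasurable_def lmeasurable_iff_integrable[symmetric])
      (metis \<Omega> finite_measure.integrable_const finite_measure_lebesgue_on)
  define K where "K = L2_norm \<Omega> (\<lambda>x. 1)"
  have K: "K \<ge> 0" by (simp add: K_def)
  have abs: "(\<lambda>x. \<bar>d j x\<bar>) \<in> L2_space \<Omega>" for j
    using L2_spaceD[OF dL[of j]] by (simp add: L2_space_def)
  have di: "integrable ?M (\<lambda>x. \<bar>d j x\<bar>)" "(LINT x|?M. \<bar>d j x\<bar>) \<le> (1/2) ^ j * K" for j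
  proof -
    show "integrable ?M (\<lambda>x. \<bar>d j x\<bar>)" using L2_integrable_mult[OF abs one] by simp
    have "(LINT x|?M. \<bar>d j x\<bar>) = L2_inner \<Omega> (\<lambda>x. \<bar>d j x\<bar>) (\<lambda>x. 1)" by (simp add: L2_inner_def)
    also have "\<dots> \<le> L2_norm \<Omega> (\<lambda>x. \<bar>d j x\<bar>) * K"
      using L2_Cauchy_Schwarz[OF abs[of j] one] by (simp add: K_def)
    also have "L2_norm \<Omega> (\<lambda>x. \<bar>d j x\<bar>) = L2_norm \<Omega> (d j)" by (simp add: L2_norm_def)
    also have "L2_norm \<Omega> (d j) * K \<le> (1/2) ^ j * K" using dn[of j] K by (intro mult_right_mono) auto
    finally show "(LINT x|?M. \<bar>d j x\<bar>) \<le> (1/2) ^ j * K" .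
  qed
  have dm[measurable]: "d j \<in> borel_measurable ?M" for j using L2_spaceD(1)[OF dL] .
  have sm[measurable]: "s j \<in> borel_measurable ?M" for j using L2_spaceD(1)[OF s] .
  have "(\<integral>\<^sup>+x. (\<Sum>j. ennreal \<bar>d j x\<bar>) \<partial>?M) = (\<Sum>j. \<integral>\<^sup>+x. ennreal \<bar>d j x\<bar> \<partial>?M)"
    by (rule nn_integral_suminf) measurable
  also have "\<dots> \<le> (\<Sum>j. ennreal ((1/2) ^ j * K))"
  proof (rule suminf_le)
    fix j show "(\<integral>\<^sup>+x. ennreal \<bar>d j x\<bar> \<partial>?M) \<le> ennreal ((1/2) ^ j * K)"
      using nn_integral_eq_integral[OF di(1)[of j]] di(2)[of j] by (simp add: ennreal_leI)
  qed auto
  also have "\<dots> = ennreal (\<Sum>j. (1/2) ^ j * K)"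
    using K by (intro suminf_ennreal2) (auto intro!: summable_mult2 summable_geometric)
  finally have "(\<integral>\<^sup>+x. (\<Sum>j. ennreal \<bar>d j x\<bar>) \<partial>?M) \<noteq> \<infinity>" by (auto simp: top_unique)
  then have "AE x in ?M. (\<Sum>j. ennreal \<bar>d j x\<bar>) \<noteq> \<infinity>"
    by (intro nn_integral_PInf_AE) auto
  then have conv: "AE x in ?M. convergent (\<lambda>j. s (r j) x)"
  proof eventually_elim
    case (elim x)
    have "summable (\<lambda>j. \<bar>d j x\<bar>)" using elim by (intro summable_suminf_not_top) auto
    then have "summable (\<lambda>j. s (r (Suc j)) x - s (r j) x)" unfolding d_def by (rule summable_rabs_cancel)
    then have "(\<lambda>n. s (r 0) x + (\<Sum>j<n. s (r (Suc j)) x - s (r j) x)) \<longlonglongrightarrow> s (r 0) x + (\<Sum>j. s (r (Suc j)) x - s (r j) x)"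
      by (intro tendsto_intros summable_LIMSEQ)
    then show ?case
      by (auto simp: sum_lessThan_telescope[of "\<lambda>j. s (r j) x"] convergent_def)
  qed
  define w where "w x = lim (\<lambda>j. s (r j) x)" for x
  have wm[measurable]: "w \<in> borel_measurable ?M" unfolding w_def by (rule borel_measurable_lim_metric) measurable
  have lim: "AE x in ?M. (\<lambda>j. s (r j) x) \<longlonglongrightarrow> w x"
    using conv by eventually_elim (auto simp: w_def convergent_LIMSEQ_iff)
  \<comment> \<open>Fatou in the subsequence index with n fixed: the Cauchy bound between s n and s
    (r j) survives the limit in j.\<close>
  have fat: "(\<integral>\<^sup>+x. ennreal ((s n x - w x)\<^sup>2) \<partial>?M) \<le> ennreal (((1/2) ^ i)\<^sup>2)" if n: "n \<ge> N i" for n i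
  proof -
    have "(\<integral>\<^sup>+x. ennreal ((s n x - w x)\<^sup>2) \<partial>?M) = (\<integral>\<^sup>+x. liminf (\<lambda>j. ennreal ((s n x - s (r j) x)\<^sup>2)) \<partial>?M)"
    proof (rule nn_integral_cong_AE, use lim in eventually_elim)
      fix x assume "(\<lambda>j. s (r j) x) \<longlonglongrightarrow> w x"
      then have "(\<lambda>j. ennreal ((s n x - s (r j) x)\<^sup>2)) \<longlonglongrightarrow> ennreal ((s n x - w x)\<^sup>2)"
        by (intro tendsto_intros)
      then show "ennreal ((s n x - w x)\<^sup>2) = liminf (\<lambda>j. ennreal ((s n x - s (r j) x)\<^sup>2))"
        by (rule lim_imp_Liminf[OF sequentially_bot, symmetric])
    qed
    also have "\<dots> \<le> liminf (\<lambda>j. \<integral>\<^sup>+x. ennreal ((s n x - s (r j) x)\<^sup>2) \<partial>?M)"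
      by (rule nn_integral_liminf) measurable
    also have "\<dots> \<le> ennreal (((1/2) ^ i)\<^sup>2)"
    proof (rule Liminf_le)
      have "(\<integral>\<^sup>+x. ennreal ((s n x - s (r j) x)\<^sup>2) \<partial>?M) \<le> ennreal (((1/2) ^ i)\<^sup>2)" if j: "j \<ge> i" for j
      proof -
        have "(\<integral>\<^sup>+x. ennreal ((s n x - s (r j) x)\<^sup>2) \<partial>?M) = ennreal (LINT x|?M. (s n x - s (r j) x)\<^sup>2)"
          by (rule nn_integral_eq_integral) (use L2_spaceD(2)[OF L2_diff[OF s s]] in auto)
        also have "(LINT x|?M. (s n x - s (r j) x)\<^sup>2) = (L2_norm \<Omega> (\<lambda>x. s n x - s (r j) x))\<^sup>2"
          by (simp add: L2_norm_def)
        also have "\<dots> \<le> ((1/2) ^ i)\<^sup>2"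
          using N[OF n rN'[OF j]] by (intro power_mono) auto
        finally show ?thesis by (simp add: ennreal_leI)
      qed
      then show "\<forall>\<^sub>F j in sequentially. (\<integral>\<^sup>+x. ennreal ((s n x - s (r j) x)\<^sup>2) \<partial>?M) \<le> ennreal (((1/2) ^ i)\<^sup>2)"
        by (auto simp: eventually_sequentially)
    qed simp
    finally show ?thesis .
  qed
  have L: "(\<lambda>x. s n x - w x) \<in> L2_space \<Omega>" "L2_norm \<Omega> (\<lambda>x. s n x - w x) \<le> (1/2) ^ i" if n: "n \<ge> N i" for n i
  proof -
    have f: "(\<integral>\<^sup>+x. ennreal (norm ((s n x - w x)\<^sup>2)) \<partial>?M) \<le> ennreal (((1/2) ^ i)\<^sup>2)"
      using fat[OF n] by simp
    have I: "integrable ?M (\<lambda>x. (s n x - w x)\<^sup>2)"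
      by (rule integrableI_bounded) (measurable, rule le_less_trans[OF f], simp)
    then show "(\<lambda>x. s n x - w x) \<in> L2_space \<Omega>" by (simp add: L2_space_def)
    have "ennreal (LINT x|?M. (s n x - w x)\<^sup>2) \<le> ennreal (((1/2) ^ i)\<^sup>2)"
      using fat[OF n] nn_integral_eq_integral[OF I] by simp
    then have "(LINT x|?M. (s n x - w x)\<^sup>2) \<le> ((1/2) ^ i)\<^sup>2" by (subst (asm) ennreal_le_iff) auto
    then have "L2_norm \<Omega> (\<lambda>x. s n x - w x) \<le> sqrt (((1/2) ^ i)\<^sup>2)" unfolding L2_norm_def by (rule real_sqrt_le_mono)
    then show "L2_norm \<Omega> (\<lambda>x. s n x - w x) \<le> (1/2) ^ i" by simp
  qed
  have "w \<in> L2_space \<Omega>" using L2_diff[OF s[of "N 0"] L(1)[of 0 "N 0"]] by simp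
  moreover have "(\<lambda>n. L2_norm \<Omega> (\<lambda>x. s n x - w x)) \<longlonglongrightarrow> 0"
  proof (rule LIMSEQ_I)
    fix e :: real assume e: "e > 0"
    obtain i where i: "(1/2) ^ i < e" using real_arch_pow_inv[OF e, of "1/2"] by auto
    have "norm (L2_norm \<Omega> (\<lambda>x. s n x - w x) - 0) < e" if "n \<ge> N i" for n
      using L(2)[OF that] i by simp
    then show "\<exists>no. \<forall>n\<ge>no. norm (L2_norm \<Omega> (\<lambda>x. s n x - w x) - 0) < e" by blast
  qed
  ultimately show ?thesis by (rule that)
qed

section \<open>Expansion in an orthonormal basis\<close>

locale L2_basis =
  fixes \<Omega> :: "'a::euclidean_space set" and \<phi> :: "nat \<Rightarrow> 'a \<Rightarrow> real"
  assumes basis: "L2_orthonormal_basis \<Omega> \<phi>" and \<Omega>_lmeasurable: "\<Omega> \<in> lmeasurable"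
begin

abbreviation coef :: "('a \<Rightarrow> real) \<Rightarrow> nat \<Rightarrow> real" where "coef w k \<equiv> L2_inner \<Omega> w (\<phi> k)"

lemma \<phi>_L2 [simp]: "\<phi> k \<in> L2_space \<Omega>" using basis by (simp add: L2_orthonormal_basis_def)

lemma coef_\<phi>: "coef (\<phi> j) k = (if j = k then 1 else 0)" using basis by (simp add: L2_orthonormal_basis_def)

lemma L2_sums_coef: "w \<in> L2_space \<Omega> \<Longrightarrow> L2_sums \<Omega> (\<lambda>k x. coef w k * \<phi> k x) w"
  using basis by (simp add: L2_orthonormal_basis_def)

lemma fsum_L2: "(\<lambda>x. \<Sum>k<n. c k * \<phi> k x) \<in> L2_space \<Omega>"
  by (intro L2_sum L2_scale) simp

lemma fsum_inner: "v \<in> L2_space \<Omega> \<Longrightarrow> L2_inner \<Omega> (\<lambda>x. \<Sum>k<n. c k * \<phi> k x) v = (\<Sum>k<n. c k * coef v k)"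
  by (subst L2_inner_sum) (auto intro!: L2_scale sum.cong simp: L2_inner_scale L2_inner_commute)

lemma coef_fsum: "coef (\<lambda>x. \<Sum>k<n. c k * \<phi> k x) j = (if j < n then c j else 0)"
proof -
  have "coef (\<lambda>x. \<Sum>k<n. c k * \<phi> k x) j = (\<Sum>k<n. c k * (if j = k then 1 else 0))"
    by (simp add: fsum_inner coef_\<phi>)
  also have "\<dots> = (\<Sum>k<n. if j = k then c k else 0)" by (rule sum.cong) auto
  finally show ?thesis by simp
qed

lemma inner_sums:
  assumes w: "w \<in> L2_space \<Omega>" and v: "v \<in> L2_space \<Omega>"
  shows "(\<lambda>k. coef w k * coef v k) sums L2_inner \<Omega> w v"
proof -
  have s: "(\<lambda>n. L2_norm \<Omega> (\<lambda>x. (\<Sum>k<n. coef w k * \<phi> k x) - w x)) \<longlonglongrightarrow> 0"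
    using L2_sums_coef[OF w] by (simp add: L2_sums_def)
  have "(\<lambda>n. L2_inner \<Omega> (\<lambda>x. (\<Sum>k<n. coef w k * \<phi> k x) - w x) v) \<longlonglongrightarrow> 0"
  proof (rule Lim_null_comparison)
    show "\<forall>\<^sub>F n in sequentially. norm (L2_inner \<Omega> (\<lambda>x. (\<Sum>k<n. coef w k * \<phi> k x) - w x) v)
        \<le> L2_norm \<Omega> (\<lambda>x. (\<Sum>k<n. coef w k * \<phi> k x) - w x) * L2_norm \<Omega> v"
      using L2_Cauchy_Schwarz[OF L2_diff[OF fsum_L2 w] v] by simp
    show "(\<lambda>n. L2_norm \<Omega> (\<lambda>x. (\<Sum>k<n. coef w k * \<phi> k x) - w x) * L2_norm \<Omega> v) \<longlonglongrightarrow> 0"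
      using tendsto_mult_right[OF s, of "L2_norm \<Omega> v"] by simp
  qed
  then have "(\<lambda>n. (\<Sum>k<n. coef w k * coef v k) - L2_inner \<Omega> w v) \<longlonglongrightarrow> 0"
    using w v by (simp add: L2_inner_diff fsum_L2 fsum_inner)
  then show ?thesis unfolding sums_def by (rule LIM_zero_cancel)
qed

lemma Parseval:
  assumes w: "w \<in> L2_space \<Omega>"
  shows "(\<lambda>k. (coef w k)\<^sup>2) sums (L2_norm \<Omega> w)\<^sup>2"
  unfolding L2_norm_square using inner_sums[OF w w] by (simp add: power2_eq_square)

lemma L2_norm_\<phi>: "L2_norm \<Omega> (\<phi> k) = 1"
  using L2_norm_square[of \<Omega> "\<phi> k"] L2_norm_nonneg[of \<Omega> "\<phi> k"] by (simp add: coef_\<phi> power2_eq_1_iff)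

lemma L2_norm_coef: "w \<in> L2_space \<Omega> \<Longrightarrow> L2_norm \<Omega> w = sqrt (\<Sum>k. (coef w k)\<^sup>2)"
  using Parseval[of w] by (simp add: sums_iff)

lemma coef_summable: "w \<in> L2_space \<Omega> \<Longrightarrow> summable (\<lambda>k. (coef w k)\<^sup>2)"
  using Parseval[of w] by (simp add: sums_iff)

lemma L2_eqI_AE:
  assumes w: "w \<in> L2_space \<Omega>" and v: "v \<in> L2_space \<Omega>" and e: "\<And>k. coef w k = coef v k"
  shows "AE x in lebesgue_on \<Omega>. w x = v x"
proof -
  have "L2_norm \<Omega> (\<lambda>x. w x - v x) = 0"
    using e by (subst L2_norm_coef) (auto intro!: L2_diff w v simp: L2_inner_diff w v)
  from L2_norm_eq_0_AE[OF L2_diff[OF w v] this] show ?thesis by simp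
qed

text \<open>Partial sums are Cauchy by Parseval, and coefficients pass to the limit by
  Cauchy-Schwarz. The solution, its derivative and the values of vector integrals are all produced
  from coefficient sequences in this way.\<close>

theorem Riesz_Fischer:
  assumes c: "summable (\<lambda>k. (c k)\<^sup>2)"
  obtains w where "w \<in> L2_space \<Omega>" "\<And>k. coef w k = c k"
proof -
  define s where "s n x = (\<Sum>k<n. c k * \<phi> k x)" for n x
  have s: "s n \<in> L2_space \<Omega>" for n unfolding s_def by (rule fsum_L2)
  have cs: "coef (s n) k = (if k < n then c k else 0)" for n k unfolding s_def by (rule coef_fsum)
  have nd: "(L2_norm \<Omega> (\<lambda>x. s m x - s n x))\<^sup>2 = (\<Sum>k\<in>{n..<m}. (c k)\<^sup>2)" if "n \<le> m" for m n
  proof -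
    have "(\<lambda>k. (coef (\<lambda>x. s m x - s n x) k)\<^sup>2) sums (L2_norm \<Omega> (\<lambda>x. s m x - s n x))\<^sup>2"
      by (intro Parseval L2_diff s)
    moreover have "(\<lambda>k. (coef (\<lambda>x. s m x - s n x) k)\<^sup>2) sums (\<Sum>k\<in>{n..<m}. (coef (\<lambda>x. s m x - s n x) k)\<^sup>2)"
      by (rule sums_finite) (use that in \<open>auto simp: L2_inner_diff s cs\<close>)
    ultimately have "(L2_norm \<Omega> (\<lambda>x. s m x - s n x))\<^sup>2 = (\<Sum>k\<in>{n..<m}. (coef (\<lambda>x. s m x - s n x) k)\<^sup>2)"
      by (rule sums_unique2)
    also have "\<dots> = (\<Sum>k\<in>{n..<m}. (c k)\<^sup>2)" by (rule sum.cong) (auto simp: L2_inner_diff s cs)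
    finally show ?thesis .
  qed
  obtain w where w: "w \<in> L2_space \<Omega>" "(\<lambda>n. L2_norm \<Omega> (\<lambda>x. s n x - w x)) \<longlonglongrightarrow> 0"
  proof (rule L2_complete[OF \<Omega>_lmeasurable s])
    fix e :: real assume e: "e > 0"
    then have "e\<^sup>2 > 0" by simp
    with c obtain N where N: "\<And>m n. m \<ge> N \<Longrightarrow> norm (\<Sum>k\<in>{m..<n}. (c k)\<^sup>2) < e\<^sup>2"
      unfolding summable_Cauchy by blast
    have *: "L2_norm \<Omega> (\<lambda>x. s m x - s n x) < e" if "m \<ge> N" "n \<ge> N" "n \<le> m" for m n
    proof (rule power2_less_imp_less)
      show "(L2_norm \<Omega> (\<lambda>x. s m x - s n x))\<^sup>2 < e\<^sup>2" using N[of n m] that by (simp add: nd)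
    qed (use e in simp)
    have "L2_norm \<Omega> (\<lambda>x. s m x - s n x) < e" if "m \<ge> N" "n \<ge> N" for m n
      using *[of m n] *[of n m] that L2_norm_uminus[of \<Omega> "s m" "s n"] by (cases "n \<le> m") auto
    then show "\<exists>N. \<forall>m\<ge>N. \<forall>n\<ge>N. L2_norm \<Omega> (\<lambda>x. s m x - s n x) < e" by blast
  qed
  have "coef w k = c k" for k
  proof -
    have "(\<lambda>n. coef (\<lambda>x. s n x - w x) k) \<longlonglongrightarrow> 0"
    proof (rule Lim_null_comparison)
      show "\<forall>\<^sub>F n in sequentially. norm (coef (\<lambda>x. s n x - w x) k) \<le> L2_norm \<Omega> (\<lambda>x. s n x - w x) * L2_norm \<Omega> (\<phi> k)"
        using L2_Cauchy_Schwarz[OF L2_diff[OF s w(1)] \<phi>_L2] by simp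
      show "(\<lambda>n. L2_norm \<Omega> (\<lambda>x. s n x - w x) * L2_norm \<Omega> (\<phi> k)) \<longlonglongrightarrow> 0"
        using tendsto_mult_right[OF w(2), of "L2_norm \<Omega> (\<phi> k)"] by simp
    qed
    moreover have "\<forall>\<^sub>F n in sequentially. coef (\<lambda>x. s n x - w x) k = c k - coef w k"
      using eventually_gt_at_top[of k] by eventually_elim (simp add: L2_inner_diff s w cs)
    ultimately have "(\<lambda>n::nat. c k - coef w k) \<longlonglongrightarrow> 0" by (simp add: tendsto_cong)
    then show ?thesis by (simp add: LIMSEQ_const_iff)
  qed
  with w(1) show ?thesis by (rule that)
qed

end

section \<open>Bochner integrals over a time interval\<close>

abbreviation leb :: "real \<Rightarrow> real measure" where "leb T \<equiv> lebesgue_on {0<..<T}"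

section \<open>Measurability and norms of functions of time\<close>

text \<open>One interface for L2, the energy space and its dual. Functions are not identified almost
  everywhere, so N is only a seminorm; its nonnegativity is asked on X alone because outside X the
  series or supremum behind N need not converge.\<close>

locale seminormed_space =
  fixes X :: "('c \<Rightarrow> real) set" and N :: "('c \<Rightarrow> real) \<Rightarrow> real"
  assumes diff: "v \<in> X \<Longrightarrow> w \<in> X \<Longrightarrow> (\<lambda>x. v x - w x) \<in> X"
    and nonneg: "v \<in> X \<Longrightarrow> 0 \<le> N v"
    and zero: "N (\<lambda>x. 0) = 0"
    and sym: "N (\<lambda>x. v x - w x) = N (\<lambda>x. w x - v x)"
    and triangle: "v \<in> X \<Longrightarrow> w \<in> X \<Longrightarrow> N v \<le> N (\<lambda>x. v x - w x) + N w"
begin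

lemma reverse_triangle: "v \<in> X \<Longrightarrow> w \<in> X \<Longrightarrow> \<bar>N v - N w\<bar> \<le> N (\<lambda>x. v x - w x)"
  using triangle[of v w] triangle[of w v] sym[of v w] by linarith

end

text \<open>Completeness makes almost everywhere limits measurable, and strong measurability
  provides no better limits than those.\<close>

lemma complete_lebesgue_on:
  assumes "S \<in> sets lebesgue" shows "complete_measure (lebesgue_on S)"
proof
  fix A B assume "B \<subseteq> A" "A \<in> null_sets (lebesgue_on S)"
  then have "B \<in> null_sets lebesgue" "B \<subseteq> S"
    using assms by (auto simp: null_sets_restrict_space intro: completion.complete2)
  then show "B \<in> sets (lebesgue_on S)"
    using assms by (auto simp: sets_restrict_space_iff)
qed

lemma (in complete_measure) borel_measurable_AE_cong:
  fixes f g :: "'a \<Rightarrow> real"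
  assumes f: "f \<in> borel_measurable M" and e: "AE x in M. f x = g x"
  shows "g \<in> borel_measurable M"
proof (subst borel_measurable_iff_greater, intro allI)
  fix a
  have *: "{x \<in> space M. a < f x} \<in> sets M" using f by measurable
  have "AE x in M. x \<in> {x \<in> space M. a < f x} \<longleftrightarrow> x \<in> {x \<in> space M. a < g x}"
    using e by eventually_elim auto
  then show "{x \<in> space M. a < g x} \<in> sets M"
    using in_sets_AE[OF _ *] by blast
qed

lemma (in complete_measure) borel_measurable_AE_LIMSEQ:
  fixes f :: "nat \<Rightarrow> 'a \<Rightarrow> real"
  assumes f: "\<And>j. f j \<in> borel_measurable M" and e: "AE x in M. (\<lambda>j. f j x) \<longlonglongrightarrow> g x"
  shows "g \<in> borel_measurable M"
proof (rule borel_measurable_AE_cong)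
  show "(\<lambda>x. lim (\<lambda>j. f j x)) \<in> borel_measurable M" using f by (rule borel_measurable_lim_metric)
  show "AE x in M. lim (\<lambda>j. f j x) = g x" using e by eventually_elim (rule limI)
qed

lemma Ioo_lebesgue [simp]: "{a<..<b::real} \<in> sets lebesgue" "{a<..<b::real} \<in> lmeasurable"
  by (auto intro: lmeasurable_open)

lemma finite_measure_Ioo: "finite_measure (lebesgue_on {a<..<b::real})"
  by (rule finite_measure_lebesgue_on) simp

text \<open>Composing a simple function with N gives a simple function whatever N is; the reverse
  triangle inequality carries this over to the almost everywhere limit.\<close>

lemma (in seminormed_space) strongly_measurable_norm:
  assumes u: "strongly_measurable M X N u" and M: "complete_measure M"
  shows "(\<lambda>t. N (u t)) \<in> borel_measurable M"
proof -
  interpret complete_measure M by fact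
  obtain \<sigma> where \<sigma>: "\<And>j. simple_function M (\<sigma> j)" "\<And>j. \<sigma> j ` space M \<subseteq> X"
    "AE t in M. (\<lambda>j. N (\<lambda>x. \<sigma> j t x - u t x)) \<longlonglongrightarrow> 0" and uX: "AE t in M. u t \<in> X"
    using u unfolding strongly_measurable_def by blast
  show ?thesis
  proof (rule borel_measurable_AE_LIMSEQ[where f = "\<lambda>j t. N (\<sigma> j t)"])
    show "(\<lambda>t. N (\<sigma> j t)) \<in> borel_measurable M" for j
      using simple_function_compose[OF \<sigma>(1)[of j], of N] by (auto simp: o_def intro: borel_measurable_simple_function)
    show "AE t in M. (\<lambda>j. N (\<sigma> j t)) \<longlonglongrightarrow> N (u t)"
      using \<sigma>(3) uX AE_space
    proof eventually_elim
      case (elim t)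
      have "\<sigma> j t \<in> X" for j using \<sigma>(2)[of j] elim(3) by auto
      then have "\<bar>N (\<sigma> j t) - N (u t)\<bar> \<le> N (\<lambda>x. \<sigma> j t x - u t x)" for j using elim by (intro reverse_triangle)
      then have "(\<lambda>j. N (\<sigma> j t) - N (u t)) \<longlonglongrightarrow> 0"
        by (intro Lim_null_comparison[OF _ elim(1)]) auto
      then show ?case by (rule LIM_zero_cancel)
    qed
  qed
qed

context seminormed_space begin

lemma C_time_norm_continuous:
  assumes u: "u \<in> C_time T X N"
  shows "continuous_on {0..T} (\<lambda>t. N (u t))"
  unfolding continuous_on_def
proof
  fix t assume t: "t \<in> {0..T}"
  have 1: "((\<lambda>\<tau>. N (\<lambda>x. u \<tau> x - u t x)) \<longlongrightarrow> 0) (at t within {0..T})" and uX: "\<And>t. t \<in> {0..T} \<Longrightarrow> u t \<in> X"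
    using u t by (auto simp: C_time_def)
  have "((\<lambda>\<tau>. N (u \<tau>) - N (u t)) \<longlongrightarrow> 0) (at t within {0..T})"
  proof (rule Lim_null_comparison[OF _ 1])
    show "\<forall>\<^sub>F \<tau> in at t within {0..T}. norm (N (u \<tau>) - N (u t)) \<le> N (\<lambda>x. u \<tau> x - u t x)"
      using t by (auto simp: eventually_at_filter intro!: always_eventually reverse_triangle uX)
  qed
  then show "((\<lambda>t. N (u t)) \<longlongrightarrow> N (u t)) (at t within {0..T})" by (rule LIM_zero_cancel)
qed

lemma C_time_bounded:
  assumes u: "u \<in> C_time T X N"
  obtains B where "B \<ge> 0" "\<And>t. t \<in> {0..T} \<Longrightarrow> N (u t) \<le> B"
proof -
  have "bounded ((\<lambda>t. N (u t)) ` {0..T})"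
    by (intro compact_imp_bounded compact_continuous_image C_time_norm_continuous u) auto
  then obtain B where "\<forall>t\<in>{0..T}. \<bar>N (u t)\<bar> \<le> B" unfolding bounded_iff by auto
  then show ?thesis by (intro that[of "max 0 B"]) (auto simp: le_max_iff_disj abs_le_iff)
qed

lemma C_time_strongly_measurable:
  assumes u: "u \<in> C_time T X N" and T: "T > 0"
  shows "strongly_measurable (leb T) X N u"
  unfolding strongly_measurable_def
proof (intro conjI exI allI)
  let ?M = "leb T"
  \<comment> \<open>t rounded down to the grid of mesh T / (j + 1). There are finitely many grid
    points, so sampling u there gives a simple function, and continuity gives convergence at every
    t.\<close>
  define s where "s j t = T * real_of_int \<lfloor>real (Suc j) * t / T\<rfloor> / real (Suc j)" for j t
  have uX: "\<And>t. t \<in> {0..T} \<Longrightarrow> u t \<in> X" using u by (auto simp: C_time_def)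
  show "AE t in ?M. u t \<in> X" by (rule AE_I2) (auto intro: uX)
  have s_le: "s j t \<le> t" "t - T / real (Suc j) \<le> s j t" for j t
  proof -
    have "real_of_int \<lfloor>real (Suc j) * t / T\<rfloor> \<le> real (Suc j) * t / T" by simp
    then have "T / real (Suc j) * real_of_int \<lfloor>real (Suc j) * t / T\<rfloor> \<le> T / real (Suc j) * (real (Suc j) * t / T)"
      using T by (intro mult_left_mono) auto
    then show "s j t \<le> t" using T by (simp add: s_def)
    have "real (Suc j) * t / T - 1 \<le> real_of_int \<lfloor>real (Suc j) * t / T\<rfloor>" by linarith
    then have "T / real (Suc j) * (real (Suc j) * t / T - 1) \<le> T / real (Suc j) * real_of_int \<lfloor>real (Suc j) * t / T\<rfloor>"
      using T by (intro mult_left_mono) auto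
    moreover have "T / real (Suc j) * (real (Suc j) * t / T - 1) = t - T / real (Suc j)"
      using T by (simp add: right_diff_distrib del: of_nat_Suc)
    ultimately show "t - T / real (Suc j) \<le> s j t" by (simp add: s_def)
  qed
  have s0: "0 \<le> s j t" if "0 \<le> t" for j t
    using that T by (auto simp: s_def intro!: divide_nonneg_pos mult_nonneg_nonneg)
  have s_in: "s j t \<in> {0..T}" if "t \<in> {0<..<T}" for j t
    using s0[of t j] s_le(1)[of j t] that by auto
  show "simple_function ?M (\<lambda>t. u (s j t))" for j
  proof -
    have "simple_function ?M (s j)"
    proof (rule simple_function_borel_measurable)
      have "s j \<in> borel_measurable lborel" unfolding s_def by measurable
      then show "s j \<in> borel_measurable ?M"
        by (intro measurable_restrict_space1 measurable_completion)
      have "s j ` space ?M \<subseteq> (\<lambda>i. T * real_of_int i / real (Suc j)) ` {0..int (Suc j)}"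
      proof
        fix y assume "y \<in> s j ` space ?M"
        then obtain t where t: "0 < t" "t < T" "y = s j t" by auto
        have "real (Suc j) * t / T \<le> real (Suc j)" using t T by (simp add: field_simps del: of_nat_Suc)
        then have "\<lfloor>real (Suc j) * t / T\<rfloor> \<in> {0..int (Suc j)}" using t T
          by (auto simp: floor_le_iff simp del: of_nat_Suc)
        then show "y \<in> (\<lambda>i. T * real_of_int i / real (Suc j)) ` {0..int (Suc j)}"
          unfolding t(3) s_def by (intro imageI)
      qed
      then show "finite (s j ` space ?M)" by (rule finite_subset) auto
    qed
    from simple_function_compose[OF this, of u] show ?thesis by (simp add: o_def)
  qed
  show "(\<lambda>t. u (s j t)) ` space ?M \<subseteq> X" for j using s_in uX by auto
  show "AE t in ?M. (\<lambda>j. N (\<lambda>x. u (s j t) x - u t x)) \<longlonglongrightarrow> 0"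
  proof (rule AE_I2)
    fix t assume "t \<in> space ?M"
    then have t: "t \<in> {0<..<T}" by simp
    have "continuous (at t within {0..T}) (\<lambda>\<tau>. N (\<lambda>x. u \<tau> x - u t x))"
      using u t by (auto simp: continuous_within C_time_def zero)
    moreover have "(\<lambda>j. s j t) \<longlonglongrightarrow> t"
    proof (rule tendsto_sandwich)
      show "\<forall>\<^sub>F j in sequentially. t - T / real (Suc j) \<le> s j t" "\<forall>\<^sub>F j in sequentially. s j t \<le> t"
        using s_le by auto
      have "(\<lambda>j. t - T / real (Suc j)) \<longlonglongrightarrow> t - 0"
        by (intro tendsto_diff tendsto_const) real_asymp
      then show "(\<lambda>j. t - T / real (Suc j)) \<longlonglongrightarrow> t" by simp
    qed auto
    ultimately have "(\<lambda>j. N (\<lambda>x. u (s j t) x - u t x)) \<longlonglongrightarrow> N (\<lambda>x. u t x - u t x)"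
      using s_in[OF t] continuous_within_tendsto_compose'[of t "{0..T}" "\<lambda>\<tau>. N (\<lambda>x. u \<tau> x - u t x)" "\<lambda>j. s j t" sequentially] by blast
    then show "(\<lambda>j. N (\<lambda>x. u (s j t) x - u t x)) \<longlonglongrightarrow> 0" by (simp add: zero)
  qed
qed

lemma strongly_measurable_bounded_Lp_time:
  assumes u: "strongly_measurable (leb T) X N u"
    and B: "AE t in leb T. N (u t) \<le> B" and p: "p \<ge> 0"
  shows "u \<in> Lp_time p T X N"
proof -
  let ?M = "leb T"
  interpret finite_measure ?M by (rule finite_measure_Ioo)
  have uX: "AE t in ?M. u t \<in> X" using u by (auto simp: strongly_measurable_def)
  have "integrable ?M (\<lambda>t. N (u t) powr p)"
  proof (rule integrable_const_bound)
    show "AE t in ?M. norm (N (u t) powr p) \<le> B powr p"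
      using uX B by eventually_elim (auto intro!: powr_mono2 p nonneg)
    show "(\<lambda>t. N (u t) powr p) \<in> borel_measurable ?M"
      using strongly_measurable_norm[OF u] complete_lebesgue_on[of "{0<..<T}"] by auto
  qed
  then show ?thesis using u by (simp add: Lp_time_def)
qed

lemma strongly_measurable_bounded_Linf_time:
  assumes u: "strongly_measurable (leb T) X N u"
    and B: "AE t in leb T. N (u t) \<le> B"
  shows "u \<in> Linf_time T X N"
proof -
  let ?M = "leb T"
  have "(\<lambda>t. ereal (N (u t))) \<in> borel_measurable ?M"
    using strongly_measurable_norm[OF u] complete_lebesgue_on[of "{0<..<T}"] by auto
  then have "esssup ?M (\<lambda>t. ereal (N (u t))) \<le> ereal B"
    by (rule esssup_I) (use B in auto)
  then show ?thesis using u by (auto simp: Linf_time_def intro: le_less_trans)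
qed

lemma C_time_Lp_time:
  assumes u: "u \<in> C_time T X N" and T: "T > 0" and p: "p \<ge> 0"
  shows "u \<in> Lp_time p T X N"
proof -
  obtain B where B: "\<And>t. t \<in> {0..T} \<Longrightarrow> N (u t) \<le> B" by (rule C_time_bounded[OF u]) blast
  have "AE t in leb T. N (u t) \<le> B" by (rule AE_I2) (auto intro: B)
  then show ?thesis by (intro strongly_measurable_bounded_Lp_time C_time_strongly_measurable u T p)
qed

lemma C_time_Linf_time:
  assumes u: "u \<in> C_time T X N" and T: "T > 0"
  shows "u \<in> Linf_time T X N"
proof -
  obtain B where B: "\<And>t. t \<in> {0..T} \<Longrightarrow> N (u t) \<le> B" by (rule C_time_bounded[OF u]) blast
  have "AE t in leb T. N (u t) \<le> B" by (rule AE_I2) (auto intro: B)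
  then show ?thesis by (intro strongly_measurable_bounded_Linf_time C_time_strongly_measurable u T)
qed

lemma Linf_time_norm_bound:
  assumes u: "u \<in> Linf_time T X N" and T: "T > 0"
  shows "0 \<le> Linf_time_norm T N u" "AE t in leb T. N (u t) \<le> Linf_time_norm T N u"
proof -
  let ?M = "leb T" and ?e = "esssup (leb T) (\<lambda>t. ereal (N (u t)))"
  have sm: "strongly_measurable ?M X N u" and fin: "?e < \<infinity>" using u by (auto simp: Linf_time_def)
  have m: "(\<lambda>t. ereal (N (u t))) \<in> borel_measurable ?M"
    using strongly_measurable_norm[OF sm] complete_lebesgue_on[of "{0<..<T}"] by auto
  have uX: "AE t in ?M. u t \<in> X" using sm by (auto simp: strongly_measurable_def)
  \<comment> \<open>T > 0 matters here: over a null space the essential supremum is minus infinity,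
    which \<open>real_of_ereal\<close> would send to 0.\<close>
  have sp: "emeasure ?M (space ?M) \<noteq> 0" using T by (simp add: emeasure_restrict_space)
  have "0 = esssup ?M (\<lambda>t. 0::ereal)" using esssup_const[OF sp, of "0::ereal"] by simp
  also have "\<dots> \<le> ?e" by (rule esssup_AE_mono) (use uX in \<open>auto simp: nonneg elim: eventually_mono\<close>)
  finally have e: "0 \<le> ?e" .
  with fin have eq: "?e = ereal (Linf_time_norm T N u)" unfolding Linf_time_norm_def by (cases ?e) auto
  show "0 \<le> Linf_time_norm T N u" using e eq by simp
  show "AE t in ?M. N (u t) \<le> Linf_time_norm T N u"
    using esssup_AE[of "\<lambda>t. ereal (N (u t))" ?M] unfolding eq by simp
qed

lemma Linf_time_norm_le:
  assumes u: "strongly_measurable (leb T) X N u"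
    and B: "AE t in leb T. N (u t) \<le> B" "B \<ge> 0"
  shows "Linf_time_norm T N u \<le> B"
proof -
  let ?M = "leb T"
  have "(\<lambda>t. ereal (N (u t))) \<in> borel_measurable ?M"
    using strongly_measurable_norm[OF u] complete_lebesgue_on[of "{0<..<T}"] by auto
  then have "esssup ?M (\<lambda>t. ereal (N (u t))) \<le> ereal B"
    by (rule esssup_I) (use B in auto)
  then show ?thesis unfolding Linf_time_norm_def using B(2)
    by (cases "esssup ?M (\<lambda>t. ereal (N (u t)))") auto
qed

end

lemma seminormed_L2: "seminormed_space (L2_space \<Omega>) (L2_norm \<Omega>)"
proof
  show "L2_norm \<Omega> (\<lambda>x. 0) = 0" by (simp add: L2_norm_def)
qed (auto intro: L2_diff L2_norm_uminus L2_norm_triangle_diff)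

section \<open>The Bochner integral in coordinates\<close>

text \<open>The norm of an integral is at most the integral of the norm, in finitely many
  coordinates. Pair with the vector a of the integrals itself: |a|^2 is the integral of the inner
  product of a with c(r), and Cauchy-Schwarz under the integral sign leaves |a| times the integral
  of G.\<close>

lemma sum_square_integral_le:
  fixes c :: "nat \<Rightarrow> 'a \<Rightarrow> real"
  assumes c: "\<And>k. integrable M (c k)" and G: "integrable M G"
    and le: "AE r in M. sqrt (\<Sum>k<n. (c k r)\<^sup>2) \<le> G r"
  shows "(\<Sum>k<n. (LINT r|M. c k r)\<^sup>2) \<le> (LINT r|M. G r)\<^sup>2"
proof -
  define a where "a k = (LINT r|M. c k r)" for k
  define A where "A = (\<Sum>k<n. (a k)\<^sup>2)"
  have A: "A \<ge> 0" by (simp add: A_def sum_nonneg)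
  have "A = (LINT r|M. (\<Sum>k<n. a k * c k r))"
    unfolding A_def using c by (simp add: power2_eq_square a_def)
  also have "\<dots> \<le> (LINT r|M. sqrt A * G r)"
  proof (rule integral_mono_AE)
    show "AE r in M. (\<Sum>k<n. a k * c k r) \<le> sqrt A * G r"
      using le
    proof eventually_elim
      case (elim r)
      have "(\<Sum>k<n. a k * c k r) \<le> (\<Sum>k<n. \<bar>a k\<bar> * \<bar>c k r\<bar>)"
        by (intro sum_mono) (metis abs_ge_self abs_mult)
      also have "\<dots> \<le> sqrt A * sqrt (\<Sum>k<n. (c k r)\<^sup>2)"
        using L2_set_mult_ineq[of a "\<lambda>k. c k r" "{..<n}"] by (simp add: L2_set_def A_def)
      also have "\<dots> \<le> sqrt A * G r" using A elim by (intro mult_left_mono) auto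
      finally show ?case .
    qed
  qed (use c G in auto)
  finally have *: "A \<le> sqrt A * (LINT r|M. G r)" by simp
  show ?thesis
  proof (cases "A = 0")
    case False
    then have "sqrt A > 0" using A by simp
    moreover have "sqrt A * sqrt A \<le> sqrt A * (LINT r|M. G r)" using * A by simp
    ultimately have "sqrt A \<le> (LINT r|M. G r)" by (metis mult_left_le_imp_le)
    then have "(sqrt A)\<^sup>2 \<le> (LINT r|M. G r)\<^sup>2" using A by (intro power_mono) auto
    then show ?thesis using A by (simp add: A_def a_def)
  qed (use A in \<open>simp add: A_def a_def\<close>)
qed

lemma simple_integral_L2:
  assumes M: "finite_measure M" and \<sigma>: "simple_function M \<sigma>" "\<sigma> ` space M \<subseteq> L2_space \<Omega>" and v: "v \<in> L2_space \<Omega>"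
  shows "simple_integral_fun M \<sigma> \<in> L2_space \<Omega>"
    "L2_inner \<Omega> (simple_integral_fun M \<sigma>) v = (LINT r|M. L2_inner \<Omega> (\<sigma> r) v)"
proof -
  interpret finite_measure M by fact
  have fin: "finite (\<sigma> ` space M)" and meas: "\<And>z. \<sigma> -` {z} \<inter> space M \<in> sets M"
    using \<sigma>(1) by (auto simp: simple_function_def intro: simple_functionD(2)[OF \<sigma>(1)])
  show "simple_integral_fun M \<sigma> \<in> L2_space \<Omega>"
    unfolding simple_integral_fun_def using \<sigma>(2) by (intro L2_sum L2_scale) auto
  have "L2_inner \<Omega> (simple_integral_fun M \<sigma>) v = (\<Sum>z\<in>\<sigma> ` space M. measure M (\<sigma> -` {z} \<inter> space M) * L2_inner \<Omega> z v)"
    unfolding simple_integral_fun_def using \<sigma>(2) v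
    by (subst L2_inner_sum) (auto simp: L2_inner_scale intro!: L2_scale)
  also have "\<dots> = (LINT r|M. (\<Sum>z\<in>\<sigma> ` space M. indicator (\<sigma> -` {z} \<inter> space M) r * L2_inner \<Omega> z v))"
    using meas by (subst Bochner_Integration.integral_sum)
      (auto intro!: integrable_mult_left integrable_real_indicator simp: emeasure_eq_measure less_top[symmetric])
  also have "\<dots> = (LINT r|M. L2_inner \<Omega> (\<sigma> r) v)"
  proof (rule Bochner_Integration.integral_cong[OF refl])
    fix r assume r: "r \<in> space M"
    have "(\<Sum>z\<in>\<sigma> ` space M. indicator (\<sigma> -` {z} \<inter> space M) r * L2_inner \<Omega> z v)
        = (\<Sum>z\<in>\<sigma> ` space M. if z = \<sigma> r then L2_inner \<Omega> z v else 0)"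
      using r by (intro sum.cong) (auto simp: indicator_def)
    also have "\<dots> = L2_inner \<Omega> (\<sigma> r) v" using fin r by (simp add: sum.delta)
    finally show "(\<Sum>z\<in>\<sigma> ` space M. indicator (\<sigma> -` {z} \<inter> space M) r * L2_inner \<Omega> z v) = L2_inner \<Omega> (\<sigma> r) v" .
  qed
  finally show "L2_inner \<Omega> (simple_integral_fun M \<sigma>) v = (LINT r|M. L2_inner \<Omega> (\<sigma> r) v)" .
qed

text \<open>Rounding down to multiples of 2^(-j) after clamping to [-B, B]. The clamp leaves
  finitely many values and changes nothing where |x| \<le> B.\<close>

definition quantize :: "real \<Rightarrow> nat \<Rightarrow> real \<Rightarrow> real" where
  "quantize B j x = of_int \<lfloor>2 ^ j * max (- B) (min B x)\<rfloor> / 2 ^ j"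

lemma quantize_error: "\<bar>x\<bar> \<le> B \<Longrightarrow> \<bar>quantize B j x - x\<bar> \<le> (1/2) ^ j"
proof -
  assume "\<bar>x\<bar> \<le> B"
  then have e: "max (- B) (min B x) = x" by auto
  have "\<bar>real_of_int \<lfloor>2 ^ j * x\<rfloor> - 2 ^ j * x\<bar> \<le> 1" by linarith
  then have "\<bar>real_of_int \<lfloor>2 ^ j * x\<rfloor> - 2 ^ j * x\<bar> / 2 ^ j \<le> 1 / 2 ^ j" by (intro divide_right_mono) auto
  moreover have "\<bar>real_of_int \<lfloor>2 ^ j * x\<rfloor> - 2 ^ j * x\<bar> / 2 ^ j = \<bar>quantize B j x - x\<bar>"
    unfolding quantize_def e by (simp add: diff_divide_distrib[symmetric] abs_divide field_simps)
  ultimately show ?thesis by (simp add: power_divide)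
qed

lemma quantize_simple:
  assumes [measurable]: "c \<in> borel_measurable M" and B: "B \<ge> 0"
  shows "simple_function M (\<lambda>r. quantize B j (c r))"
proof (rule simple_function_borel_measurable)
  show "(\<lambda>r. quantize B j (c r)) \<in> borel_measurable M" unfolding quantize_def by measurable
  have "quantize B j x \<in> (\<lambda>i. of_int i / 2 ^ j) ` {\<lfloor>2 ^ j * (- B)\<rfloor>..\<lfloor>2 ^ j * B\<rfloor>}" for x
  proof -
    have "2 ^ j * (- B) \<le> 2 ^ j * max (- B) (min B x)" "2 ^ j * max (- B) (min B x) \<le> 2 ^ j * B"
      using B by (intro mult_left_mono; simp)+
    then show ?thesis unfolding quantize_def by (intro imageI) (simp only: atLeastAtMost_iff floor_mono)
  qed
  then have "(\<lambda>r. quantize B j (c r)) ` space M \<subseteq> (\<lambda>i. of_int i / 2 ^ j) ` {\<lfloor>2 ^ j * (- B)\<rfloor>..\<lfloor>2 ^ j * B\<rfloor>}" by auto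
  then show "finite ((\<lambda>r. quantize B j (c r)) ` space M)" by (rule finite_subset) auto
qed

context L2_basis begin

text \<open>The simple functions demanded by the definition are built from coefficients: keep the
  first j of them and quantize each to 2^(-j). The squared error is at most j 4^(-j) plus the tail
  of the squared coefficients, and it is dominated by a constant. Thus only measurability of the
  coefficients is required.\<close>

theorem bounded_has_vector_integral:
  fixes U :: "real \<Rightarrow> 'a \<Rightarrow> real" and a b B :: real
  defines "M \<equiv> lebesgue_on {a<..<b}"
  assumes UL: "AE r in M. U r \<in> L2_space \<Omega>" and UB: "AE r in M. L2_norm \<Omega> (U r) \<le> B"
    and Um: "\<And>k. (\<lambda>r. coef (U r) k) \<in> borel_measurable M"
    and I: "I \<in> L2_space \<Omega>" "\<And>k. coef I k = (LINT r|M. coef (U r) k)"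
  shows "has_vector_integral M (L2_space \<Omega>) (L2_norm \<Omega>) U I"
proof -
  interpret M: finite_measure M unfolding M_def by (rule finite_measure_Ioo)
  \<comment> \<open>A negative B is compatible with the hypotheses when the interval is
    empty.\<close>
  define B' where "B' = max B 0"
  have B': "B' \<ge> 0" by (simp add: B'_def)
  define cc where "cc r k = coef (U r) k" for r k
  let ?S = "\<lambda>r. \<Sum>k. (cc r k)\<^sup>2"
  have ccm[measurable]: "(\<lambda>r. cc r k) \<in> borel_measurable M" for k using Um by (simp add: cc_def)
  have good: "AE r in M. U r \<in> L2_space \<Omega> \<and> L2_norm \<Omega> (U r) \<le> B'"
    using UL UB by eventually_elim (auto simp: B'_def)
  have cs: "summable (\<lambda>k. (cc r k)\<^sup>2)" "(?S r) \<le> B'\<^sup>2" "\<bar>cc r k\<bar> \<le> B'"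
    if "U r \<in> L2_space \<Omega> \<and> L2_norm \<Omega> (U r) \<le> B'" for r k
  proof -
    show s: "summable (\<lambda>k. (cc r k)\<^sup>2)" using that by (simp add: cc_def coef_summable)
    have "(L2_norm \<Omega> (U r))\<^sup>2 \<le> B'\<^sup>2" using that by (intro power_mono) auto
    then show *: "(?S r) \<le> B'\<^sup>2" using Parseval[of "U r"] that by (simp add: cc_def sums_iff)
    have "(cc r k)\<^sup>2 \<le> (?S r)" using sum_le_suminf[OF s, of "{k}"] by simp
    with * have "\<bar>cc r k\<bar>\<^sup>2 \<le> B'\<^sup>2" by simp
    then show "\<bar>cc r k\<bar> \<le> B'" using B' by (rule power2_le_imp_le)
  qed
  define \<sigma> where "\<sigma> j r x = (\<Sum>k<j. quantize B' j (cc r k) * \<phi> k x)" for j r x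
  have \<sigma>L: "\<sigma> j r \<in> L2_space \<Omega>" for j r unfolding \<sigma>_def by (rule fsum_L2)
  have \<sigma>c: "coef (\<sigma> j r) k = (if k < j then quantize B' j (cc r k) else 0)" for j r k
    unfolding \<sigma>_def by (rule coef_fsum)
  have \<sigma>s: "simple_function M (\<sigma> j)" for j
  proof -
    have "simple_function M (\<lambda>r x. \<Sum>k<n. quantize B' j (cc r k) * \<phi> k x)" for n
    proof (induction n)
      case (Suc n)
      have "simple_function M (\<lambda>r. (\<lambda>p q x. p x + q * \<phi> n x) (\<lambda>x. \<Sum>k<n. quantize B' j (cc r k) * \<phi> k x) (quantize B' j (cc r n)))"
        by (rule simple_function_compose2[OF Suc quantize_simple[OF ccm B']])
      then show ?case by simp
    qed simp
    then show ?thesis by (simp add: \<sigma>_def[abs_def])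
  qed
  define d where "d j r k = coef (\<sigma> j r) k - cc r k" for j r k
  have dm[measurable]: "(\<lambda>r. d j r k) \<in> borel_measurable M" for j k
    unfolding d_def \<sigma>c using borel_measurable_simple_function[OF quantize_simple[OF ccm B']] by auto
  define e where "e j r = sqrt (\<Sum>k. (d j r k)\<^sup>2)" for j r
  have em[measurable]: "e j \<in> borel_measurable M" for j unfolding e_def by measurable
  have ds: "summable (\<lambda>k. (d j r k)\<^sup>2)" "L2_norm \<Omega> (\<lambda>x. \<sigma> j r x - U r x) = e j r"
    "(e j r)\<^sup>2 \<le> real j * (1/4) ^ j + ((?S r) - (\<Sum>k<j. (cc r k)\<^sup>2))"
    if g: "U r \<in> L2_space \<Omega> \<and> L2_norm \<Omega> (U r) \<le> B'" for j r
  proof -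
    have D: "(\<lambda>x. \<sigma> j r x - U r x) \<in> L2_space \<Omega>" using g by (intro L2_diff \<sigma>L) auto
    have dc: "coef (\<lambda>x. \<sigma> j r x - U r x) k = d j r k" for k using g \<sigma>L by (simp add: L2_inner_diff d_def cc_def)
    show s: "summable (\<lambda>k. (d j r k)\<^sup>2)" using coef_summable[OF D] by (simp add: dc)
    show "L2_norm \<Omega> (\<lambda>x. \<sigma> j r x - U r x) = e j r" unfolding L2_norm_coef[OF D] dc e_def ..
    have "(e j r)\<^sup>2 = (\<Sum>k. (d j r k)\<^sup>2)" using s by (simp add: e_def suminf_nonneg)
    also have "\<dots> = (\<Sum>k. (d j r (k + j))\<^sup>2) + (\<Sum>k<j. (d j r k)\<^sup>2)"
      by (rule suminf_split_initial_segment[OF s])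
    also have "(\<Sum>k. (d j r (k + j))\<^sup>2) = (?S r) - (\<Sum>k<j. (cc r k)\<^sup>2)"
      using suminf_split_initial_segment[OF cs(1)[OF g], of j] by (simp add: d_def \<sigma>c)
    also have "(\<Sum>k<j. (d j r k)\<^sup>2) \<le> (\<Sum>k<j. (1/4) ^ j)"
    proof (rule sum_mono)
      fix k assume "k \<in> {..<j}"
      then have "\<bar>d j r k\<bar> \<le> (1/2) ^ j" using quantize_error[OF cs(3)[OF g]] by (simp add: d_def \<sigma>c)
      then have "\<bar>d j r k\<bar>\<^sup>2 \<le> ((1/2) ^ j)\<^sup>2" by (intro power_mono) auto
      then show "(d j r k)\<^sup>2 \<le> (1/4) ^ j" by (simp add: power2_eq_square power_mult_distrib[symmetric])
    qed
    finally show "(e j r)\<^sup>2 \<le> real j * (1/4) ^ j + ((?S r) - (\<Sum>k<j. (cc r k)\<^sup>2))" by simp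
  qed
  have e0: "AE r in M. (\<lambda>j. e j r) \<longlonglongrightarrow> 0"
    using good
  proof eventually_elim
    case (elim r)
    have "(\<lambda>j. real j * (1/4) ^ j + ((?S r) - (\<Sum>k<j. (cc r k)\<^sup>2))) \<longlonglongrightarrow> 0 + ((?S r) - (?S r))"
      by (intro tendsto_add tendsto_diff tendsto_const summable_LIMSEQ cs(1)[OF elim]) real_asymp
    then have "(\<lambda>j. (e j r)\<^sup>2) \<longlonglongrightarrow> 0"
      by (intro Lim_null_comparison[of "\<lambda>j. (e j r)\<^sup>2" "\<lambda>j. real j * (1/4) ^ j + ((?S r) - (\<Sum>k<j. (cc r k)\<^sup>2))"])
        (use ds(3)[OF elim] in auto)
    from tendsto_real_sqrt[OF this] show ?case by (simp add: e_def suminf_nonneg ds(1)[OF elim])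
  qed
  have eb: "AE r in M. norm (e j r) \<le> 1 + B'" for j
    using good
  proof eventually_elim
    case (elim r)
    have "real j * (1/4) ^ j \<le> 1"
    proof -
      have "real j \<le> 4 ^ j" using of_nat_less_two_power[of j, where 'a=real] power_mono[of "2::real" 4 j] by linarith
      then show ?thesis by (simp add: power_divide)
    qed
    moreover have "0 \<le> (\<Sum>k<j. (cc r k)\<^sup>2)" by (simp add: sum_nonneg)
    ultimately have "(e j r)\<^sup>2 \<le> 1 + B'\<^sup>2" using ds(3)[OF elim, of j] cs(2)[OF elim] by linarith
    also have "\<dots> \<le> (1 + B')\<^sup>2" using B' by (simp add: power2_sum)
    finally have "e j r \<le> 1 + B'" using B' by (intro power2_le_imp_le[of "e j r"]) auto
    then show ?case by (simp add: e_def suminf_nonneg ds(1)[OF elim])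
  qed
  have ei: "integrable M (e j)" for j
    by (rule M.integrable_const_bound[OF eb]) measurable
  have elim0: "(\<lambda>j. LINT r|M. e j r) \<longlonglongrightarrow> (LINT r|M. 0)"
    by (rule integral_dominated_convergence[where w = "\<lambda>_. 1 + B'"]) (use e0 eb in auto)
  have e_nonneg: "AE r in M. 0 \<le> e j r" for j
    using good by eventually_elim (simp add: e_def suminf_nonneg ds(1))
  have nn: "(\<integral>\<^sup>+ t. ennreal (L2_norm \<Omega> (\<lambda>x. \<sigma> j t x - U t x)) \<partial>M) = ennreal (LINT r|M. e j r)" for j
  proof -
    have "(\<integral>\<^sup>+ t. ennreal (L2_norm \<Omega> (\<lambda>x. \<sigma> j t x - U t x)) \<partial>M) = (\<integral>\<^sup>+ t. ennreal (e j t) \<partial>M)"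
      by (rule nn_integral_cong_AE) (use good in eventually_elim, simp add: ds(2))
    then show ?thesis using nn_integral_eq_integral[OF ei e_nonneg] by simp
  qed
  have cci: "integrable M (\<lambda>r. cc r k)" for k
    by (rule M.integrable_const_bound[of _ B']) (use good in eventually_elim, use cs(3) in auto)
  have ci\<sigma>: "integrable M (\<lambda>r. coef (\<sigma> j r) k)" for j k
  proof -
    have "integrable M (\<lambda>r. d j r k)"
    proof (rule M.integrable_const_bound[of _ "1 + B'"])
      show "AE r in M. norm (d j r k) \<le> 1 + B'" using good eb[of j]
      proof eventually_elim
        case (elim r)
        have "(d j r k)\<^sup>2 \<le> (\<Sum>k. (d j r k)\<^sup>2)" using sum_le_suminf[OF ds(1)[OF elim(1)], of "{k}"] by simp
        then have "\<bar>d j r k\<bar> \<le> e j r" unfolding e_def by (metis real_sqrt_abs real_sqrt_le_mono)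
        then show ?case using elim(2) by simp
      qed
    qed measurable
    from Bochner_Integration.integrable_add[OF this cci[of k]] show ?thesis by (simp add: d_def)
  qed
  \<comment> \<open>The coefficients of this difference are integrals of the coefficient errors, so
    \<open>sum_square_integral_le\<close> bounds its norm by the integral of the error norm.\<close>
  have N0: "L2_norm \<Omega> (\<lambda>x. simple_integral_fun M (\<sigma> j) x - I x) \<le> (LINT r|M. e j r)" for j
  proof -
    note si = simple_integral_L2[OF M.finite_measure_axioms \<sigma>s[of j] _ \<phi>_L2]
    have \<sigma>X: "\<sigma> j ` space M \<subseteq> L2_space \<Omega>" using \<sigma>L by auto
    have D: "(\<lambda>x. simple_integral_fun M (\<sigma> j) x - I x) \<in> L2_space \<Omega>" using si(1)[OF \<sigma>X] I(1) by (rule L2_diff)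
    have dc: "coef (\<lambda>x. simple_integral_fun M (\<sigma> j) x - I x) k = (LINT r|M. d j r k)" for k
      using si(1)[OF \<sigma>X] I si(2)[OF \<sigma>X] ci\<sigma> cci by (simp add: L2_inner_diff d_def cc_def)
    have di: "integrable M (\<lambda>r. d j r k)" for k unfolding d_def using ci\<sigma> cci by auto
    have I0: "0 \<le> (LINT r|M. e j r)" by (rule integral_nonneg_AE[OF e_nonneg])
    have "(\<Sum>k<n. (LINT r|M. d j r k)\<^sup>2) \<le> (LINT r|M. e j r)\<^sup>2" for n
    proof (rule sum_square_integral_le[OF di ei])
      show "AE r in M. sqrt (\<Sum>k<n. (d j r k)\<^sup>2) \<le> e j r"
        using good by eventually_elim (auto simp: e_def intro!: sum_le_suminf ds(1))
    qed
    moreover have "(\<lambda>n. \<Sum>k<n. (LINT r|M. d j r k)\<^sup>2) \<longlonglongrightarrow> (L2_norm \<Omega> (\<lambda>x. simple_integral_fun M (\<sigma> j) x - I x))\<^sup>2"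
      using Parseval[OF D] by (simp add: dc sums_def)
    ultimately have "(L2_norm \<Omega> (\<lambda>x. simple_integral_fun M (\<sigma> j) x - I x))\<^sup>2 \<le> (LINT r|M. e j r)\<^sup>2"
      by (intro LIMSEQ_le_const2) auto
    then show ?thesis using I0 by (rule power2_le_imp_le)
  qed
  show ?thesis
    unfolding has_vector_integral_def
  proof (intro conjI exI[of _ \<sigma>] allI)
    show "AE t in M. (\<lambda>j. L2_norm \<Omega> (\<lambda>x. \<sigma> j t x - U t x)) \<longlonglongrightarrow> 0"
      using good e0 by eventually_elim (simp add: ds(2))
    show "(\<lambda>j. \<integral>\<^sup>+ t. ennreal (L2_norm \<Omega> (\<lambda>x. \<sigma> j t x - U t x)) \<partial>M) \<longlonglongrightarrow> 0"
      unfolding nn using tendsto_ennrealI[OF elim0] by simp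
    show "(\<lambda>j. L2_norm \<Omega> (\<lambda>x. simple_integral_fun M (\<sigma> j) x - I x)) \<longlonglongrightarrow> 0"
      by (rule Lim_null_comparison[OF _ elim0[simplified]]) (use N0 in auto)
  qed (use UL I(1) \<sigma>s \<sigma>L in auto)
qed

lemma bounded_vector_integral_exists:
  fixes U :: "real \<Rightarrow> 'a \<Rightarrow> real" and a b B :: real
  defines "M \<equiv> lebesgue_on {a<..<b}"
  assumes UL: "AE r in M. U r \<in> L2_space \<Omega>" and UB: "AE r in M. L2_norm \<Omega> (U r) \<le> B"
    and Um: "\<And>k. (\<lambda>r. coef (U r) k) \<in> borel_measurable M"
  obtains I where "I \<in> L2_space \<Omega>" "\<And>k. coef I k = (LINT r|M. coef (U r) k)"
proof -
  interpret M: finite_measure M unfolding M_def by (rule finite_measure_Ioo)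
  have le: "AE r in M. sqrt (\<Sum>k<n. (coef (U r) k)\<^sup>2) \<le> B" for n
    using UL UB
  proof eventually_elim
    case (elim r)
    have "sqrt (\<Sum>k<n. (coef (U r) k)\<^sup>2) \<le> L2_norm \<Omega> (U r)"
      unfolding L2_norm_coef[OF elim(1)] by (intro real_sqrt_le_mono sum_le_suminf coef_summable elim) auto
    with elim(2) show ?case by simp
  qed
  have i: "integrable M (\<lambda>r. coef (U r) k)" for k
  proof (rule M.integrable_const_bound[OF _ Um])
    show "AE r in M. norm (coef (U r) k) \<le> B" using le[of "Suc k"]
    proof eventually_elim
      case (elim r)
      have "(coef (U r) k)\<^sup>2 \<le> (\<Sum>k<Suc k. (coef (U r) k)\<^sup>2)" by (simp add: sum_nonneg)
      then have "\<bar>coef (U r) k\<bar> \<le> sqrt (\<Sum>k<Suc k. (coef (U r) k)\<^sup>2)" by (metis real_sqrt_abs real_sqrt_le_mono)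
      with elim show ?case by simp
    qed
  qed
  have "(\<Sum>k<n. (LINT r|M. coef (U r) k)\<^sup>2) \<le> (LINT r|M. B)\<^sup>2" for n
    by (rule sum_square_integral_le[OF i _ le]) simp
  then have "summable (\<lambda>k. (LINT r|M. coef (U r) k)\<^sup>2)"
    by (intro summableI_nonneg_bounded[where x = "(LINT r|M. B)\<^sup>2"]) auto
  from Riesz_Fischer[OF this] that show ?thesis by blast
qed

end

section \<open>Test functions on the line\<close>

text \<open>Counting derivatives makes closure under sums, products, reciprocals and affine
  substitution plain inductions. Smoothness means every n, and
  \<open>iterated_derivative_times_differentiable\<close> translates it into the form used by
  \<open>test_functions\<close>.\<close>

primrec times_differentiable :: "nat \<Rightarrow> (real \<Rightarrow> real) \<Rightarrow> bool" where
  "times_differentiable 0 f \<longleftrightarrow> True"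
| "times_differentiable (Suc n) f \<longleftrightarrow> (\<exists>f'. (\<forall>x. (f has_real_derivative f' x) (at x)) \<and> times_differentiable n f')"

lemma times_differentiable_SucD: "times_differentiable (Suc n) f \<Longrightarrow> times_differentiable n f"
proof (induction n arbitrary: f)
  case (Suc n)
  then obtain f' where "\<forall>x. (f has_real_derivative f' x) (at x)" "times_differentiable (Suc n) f'"
    unfolding times_differentiable.simps(2)[of "Suc n" f] by blast
  with Suc.IH show ?case unfolding times_differentiable.simps(2)[of n f] by blast
qed simp

lemma times_differentiable_deriv:
  "times_differentiable (Suc n) f \<Longrightarrow> times_differentiable n (deriv f)"
proof -
  assume "times_differentiable (Suc n) f"
  then obtain f' where f': "\<And>x. (f has_real_derivative f' x) (at x)" "times_differentiable n f'" by auto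
  have "deriv f = f'" using f'(1) DERIV_imp_deriv by blast
  with f'(2) show ?thesis by simp
qed

lemma times_differentiable_const: "times_differentiable n (\<lambda>x. c)"
proof (induction n arbitrary: c)
  case (Suc n)
  have "\<forall>x. ((\<lambda>x. c) has_real_derivative 0) (at x)" by auto
  with Suc[of 0] show ?case by (auto intro!: exI[of _ "\<lambda>x. 0"])
qed simp

lemma times_differentiable_add:
  "times_differentiable n f \<Longrightarrow> times_differentiable n g \<Longrightarrow> times_differentiable n (\<lambda>x. f x + g x)"
proof (induction n arbitrary: f g)
  case (Suc n)
  then obtain f' g' where d: "\<And>x. (f has_real_derivative f' x) (at x)" "times_differentiable n f'"
    "\<And>x. (g has_real_derivative g' x) (at x)" "times_differentiable n g'" by auto
  have "\<forall>x. ((\<lambda>x. f x + g x) has_real_derivative f' x + g' x) (at x)"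
    using d by (auto intro: DERIV_add)
  with Suc.IH[OF d(2,4)] show ?case
    by (auto intro!: exI[of _ "\<lambda>x. f' x + g' x"])
qed simp

lemma times_differentiable_mult:
  "times_differentiable n f \<Longrightarrow> times_differentiable n g \<Longrightarrow> times_differentiable n (\<lambda>x. f x * g x)"
proof (induction n arbitrary: f g)
  case (Suc n)
  then obtain f' g' where d: "\<And>x. (f has_real_derivative f' x) (at x)" "times_differentiable n f'"
    "\<And>x. (g has_real_derivative g' x) (at x)" "times_differentiable n g'" by auto
  have "\<forall>x. ((\<lambda>x. f x * g x) has_real_derivative f' x * g x + g' x * f x) (at x)"
    using d by (auto intro: DERIV_mult)
  moreover have "times_differentiable n (\<lambda>x. f' x * g x + g' x * f x)"
    using Suc.prems d by (intro times_differentiable_add Suc.IH) (auto dest: times_differentiable_SucD simp del: times_differentiable.simps)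
  ultimately show ?case by (auto intro!: exI[of _ "\<lambda>x. f' x * g x + g' x * f x"])
qed simp

lemma times_differentiable_inverse:
  assumes "\<And>x. g x \<noteq> 0"
  shows "times_differentiable n g \<Longrightarrow> times_differentiable n (\<lambda>x. 1 / g x)"
proof (induction n)
  case (Suc n)
  then obtain g' where d: "\<And>x. (g has_real_derivative g' x) (at x)" "times_differentiable n g'" by auto
  have "times_differentiable n g" using Suc.prems by (rule times_differentiable_SucD)
  then have i: "times_differentiable n (\<lambda>x. 1 / g x)" by (rule Suc.IH)
  have "times_differentiable n (\<lambda>x. (-1) * (g' x * ((1 / g x) * (1 / g x))))"
    by (intro times_differentiable_mult times_differentiable_const d i)
  moreover have "\<forall>x. ((\<lambda>x. 1 / g x) has_real_derivative (-1) * (g' x * ((1 / g x) * (1 / g x)))) (at x)"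
    using assms by (auto intro!: derivative_eq_intros d(1))
  ultimately show ?case by (auto intro!: exI[of _ "\<lambda>x. (-1) * (g' x * ((1 / g x) * (1 / g x)))"])
qed simp

lemma times_differentiable_affine:
  "times_differentiable n f \<Longrightarrow> times_differentiable n (\<lambda>x. f (a * x + b))"
proof (induction n arbitrary: f)
  case (Suc n)
  then obtain f' where d: "\<And>x. (f has_real_derivative f' x) (at x)" "times_differentiable n f'" by auto
  have "\<forall>x. ((\<lambda>x. f (a * x + b)) has_real_derivative f' (a * x + b) * a) (at x)"
    by (auto intro!: DERIV_chain2[OF d(1)] derivative_eq_intros)
  moreover have "times_differentiable n (\<lambda>x. f' (a * x + b) * a)"
    by (intro times_differentiable_mult times_differentiable_const Suc.IH d)
  ultimately show ?case by (auto intro!: exI[of _ "\<lambda>x. f' (a * x + b) * a"])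
qed simp

text \<open>The polynomial makes the family closed under differentiation, so that smoothness of
  exp(-1/x) across 0 is a single induction over all members.\<close>

definition flat_exp :: "real poly \<Rightarrow> real \<Rightarrow> real" where
  "flat_exp p x = (if x > 0 then poly p (1 / x) * exp (- (1 / x)) else 0)"

lemma flat_exp_tendsto_0: "((\<lambda>x. flat_exp p x / x) \<longlongrightarrow> 0) (at_right 0)"
proof -
  have 1: "((\<lambda>y::real. y ^ k * exp (- y)) \<longlongrightarrow> 0) at_top" for k
    using tendsto_power_div_exp_0[of k] by (simp add: exp_minus divide_inverse)
  have "((\<lambda>y::real. poly q y * exp (- y)) \<longlongrightarrow> 0) at_top" for q
  proof -
    have "((\<lambda>y::real. \<Sum>k\<le>degree q. coeff q k * (y ^ k * exp (- y))) \<longlongrightarrow> (\<Sum>k\<le>degree q. coeff q k * 0)) at_top"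
      by (intro tendsto_sum tendsto_mult tendsto_const 1)
    then show ?thesis by (simp add: poly_altdef sum_distrib_right mult.assoc)
  qed
  from filterlim_compose[OF this filterlim_inverse_at_top_right]
  have "((\<lambda>x. poly (pCons 0 p) (inverse x) * exp (- inverse x)) \<longlongrightarrow> 0) (at_right 0)" .
  then show ?thesis
    by (rule Lim_transform_eventually) (auto simp: eventually_at_right_field flat_exp_def divide_inverse intro!: exI[of _ 1])
qed

text \<open>In y = 1/x the derivative acts as -y^2 d/dy, which sends p(y) exp(-y) to y^2 (p - p')(y)
  exp(-y). At 0 the difference quotient belongs to the polynomial y p(y), which is the
  \<open>pCons 0 p\<close> of the preceding limit.\<close>

lemma DERIV_flat_exp:
  "(flat_exp p has_real_derivative flat_exp (monom 1 2 * (p - pderiv p)) x) (at x)"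
proof -
  consider "x > 0" | "x < 0" | "x = 0" by linarith
  then show ?thesis
  proof cases
    case 1
    have "((\<lambda>x. poly p (1 / x) * exp (- (1 / x))) has_real_derivative flat_exp (monom 1 2 * (p - pderiv p)) x) (at x)"
      using 1 by (auto intro!: derivative_eq_intros poly_DERIV DERIV_chain2[where f = "poly p"]
          simp: flat_exp_def poly_monom power2_eq_square field_simps)
    then show ?thesis
      by (rule has_field_derivative_transform_within_open[of _ _ _ "{0<..}"]) (use 1 in \<open>auto simp: flat_exp_def\<close>)
  next
    case 2
    have "((\<lambda>x. 0) has_real_derivative flat_exp (monom 1 2 * (p - pderiv p)) x) (at x)"
      using 2 by (simp add: flat_exp_def)
    then show ?thesis
      by (rule has_field_derivative_transform_within_open[of _ _ _ "{..<0}"]) (use 2 in \<open>auto simp: flat_exp_def\<close>)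
  next
    case 3
    have r: "((\<lambda>y. flat_exp p y / y) \<longlongrightarrow> 0) (at_right 0)" by (rule flat_exp_tendsto_0)
    have l: "((\<lambda>y. flat_exp p y / y) \<longlongrightarrow> 0) (at_left 0)"
      by (rule tendsto_eventually) (auto simp: eventually_at_left_field flat_exp_def intro!: exI[of _ "-1"])
    have "((\<lambda>y. flat_exp p y / y) \<longlongrightarrow> 0) (at 0)" using l r by (simp add: filterlim_at_split)
    then show ?thesis using 3 by (simp add: has_field_derivative_iff flat_exp_def)
  qed
qed

lemma times_differentiable_flat_exp: "times_differentiable n (flat_exp p)"
proof (induction n arbitrary: p)
  case (Suc n)
  with DERIV_flat_exp[of p] show ?case unfolding times_differentiable.simps by blast
qed simp

definition smooth_step :: "real \<Rightarrow> real" where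
  "smooth_step x = flat_exp 1 x / (flat_exp 1 x + flat_exp 1 (1 - x))"

lemma flat_exp_1: "flat_exp 1 x \<ge> 0" "x > 0 \<Longrightarrow> flat_exp 1 x > 0" "x \<le> 0 \<Longrightarrow> flat_exp 1 x = 0"
  by (auto simp: flat_exp_def)

lemma smooth_step_denom: "flat_exp 1 x + flat_exp 1 (1 - x) > 0"
  using flat_exp_1[of x] flat_exp_1[of "1 - x"] by (cases "x > 0") (auto intro: add_pos_nonneg add_nonneg_pos)

lemma smooth_step_bounds: "0 \<le> smooth_step x" "smooth_step x \<le> 1"
  using smooth_step_denom[of x] flat_exp_1(1)[of x] flat_exp_1(1)[of "1 - x"]
  by (auto simp: smooth_step_def divide_le_eq_1)

lemma smooth_step_0: "x \<le> 0 \<Longrightarrow> smooth_step x = 0" and smooth_step_1: "x \<ge> 1 \<Longrightarrow> smooth_step x = 1"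
  using smooth_step_denom[of x] by (auto simp: smooth_step_def flat_exp_1(3))

lemma times_differentiable_smooth_step: "times_differentiable n smooth_step"
proof -
  have a: "times_differentiable n (\<lambda>x. flat_exp 1 ((-1) * x + 1))"
    by (intro times_differentiable_affine times_differentiable_flat_exp)
  have eq: "smooth_step = (\<lambda>x. flat_exp 1 x * (1 / (flat_exp 1 x + flat_exp 1 ((-1) * x + 1))))"
    by (auto simp: smooth_step_def)
  show ?thesis unfolding eq
    by (intro times_differentiable_mult times_differentiable_inverse times_differentiable_add a times_differentiable_flat_exp)
      (use smooth_step_denom in \<open>auto simp: less_le\<close>)
qed

lemma DERIV_smooth_step: "(smooth_step has_real_derivative deriv smooth_step x) (at x)"
  using times_differentiable_smooth_step[of 1] by simp (metis DERIV_imp_deriv)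

lemma continuous_deriv_smooth_step: "continuous_on UNIV (deriv smooth_step)"
proof -
  have "times_differentiable (Suc 0) (deriv smooth_step)"
    by (rule times_differentiable_deriv) (rule times_differentiable_smooth_step)
  then obtain f' where "\<And>x. (deriv smooth_step has_real_derivative f' x) (at x)" by auto
  then show ?thesis by (intro DERIV_continuous_on) (auto intro: has_field_derivative_at_within)
qed

lemma iterated_derivative_times_differentiable:
  "(\<And>n. times_differentiable n \<psi>) \<Longrightarrow> set bs \<subseteq> (Basis :: real set) \<Longrightarrow> times_differentiable n (iterated_derivative bs \<psi>)"
proof (induction bs arbitrary: n)
  case (Cons b bs)
  then have t: "times_differentiable n (iterated_derivative bs \<psi>)" for n by auto
  have b: "b = 1" using Cons.prems by simp
  have "frechet_derivative (iterated_derivative bs \<psi>) (at x) b = deriv (iterated_derivative bs \<psi>) x" for x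
  proof -
    obtain f' where f': "\<And>x. (iterated_derivative bs \<psi> has_real_derivative f' x) (at x)" using t[of 1] by auto
    then have "frechet_derivative (iterated_derivative bs \<psi>) (at x) = (*) (f' x)"
      by (metis frechet_derivative_at has_field_derivative_def)
    then show ?thesis using f'[of x] b by (simp add: DERIV_imp_deriv)
  qed
  then have "iterated_derivative (b # bs) \<psi> = deriv (iterated_derivative bs \<psi>)" by auto
  then show ?case using times_differentiable_deriv[OF t[of "Suc n"]] by simp
qed simp

lemma test_function_realI:
  assumes "\<And>n. times_differentiable n \<psi>" "\<And>x. x \<notin> {a..b} \<Longrightarrow> \<psi> x = 0" "{a..b} \<subseteq> \<Omega>"
  shows "\<psi> \<in> test_functions \<Omega>"
proof -
  have "closure {x. \<psi> x \<noteq> 0} \<subseteq> {a..b}" by (rule closure_minimal) (use assms(2) in blast, simp)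
  moreover from this have "compact (closure {x. \<psi> x \<noteq> 0})"
    by (meson bounded_closed_interval bounded_subset closed_closure compact_eq_bounded_closed)
  moreover have "iterated_derivative bs \<psi> differentiable (at x)" if "set bs \<subseteq> Basis" for bs x
    using iterated_derivative_times_differentiable[OF assms(1) that, of 1]
    by (auto simp: has_field_derivative_def differentiable_def)
  ultimately show ?thesis using assms(3) by (auto simp: test_functions_def)
qed

text \<open>Rises on [a, a + e] and falls on [b, b + e]. Such bumps approximate indicators of
  intervals, and their derivatives are differences of two mollifiers; both properties are used to
  test weak derivatives in time.\<close>

definition bump :: "real \<Rightarrow> real \<Rightarrow> real \<Rightarrow> real \<Rightarrow> real" where
  "bump e a b x = smooth_step ((x - a) / e) - smooth_step ((x - b) / e)"

lemma times_differentiable_bump: "times_differentiable n (bump e a b)"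
proof -
  have eq: "bump e a b = (\<lambda>x. smooth_step ((1 / e) * x + (- a / e)) + (-1) * smooth_step ((1 / e) * x + (- b / e)))"
    by (auto simp: bump_def diff_divide_distrib)
  show ?thesis unfolding eq
    by (intro times_differentiable_add times_differentiable_mult times_differentiable_const times_differentiable_affine times_differentiable_smooth_step)
qed

lemma bump_test_function:
  assumes "0 < e" "0 < a" "a \<le> b" "b + e < T"
  shows "bump e a b \<in> test_functions {0<..<T}"
proof (rule test_function_realI[OF times_differentiable_bump])
  fix x assume "x \<notin> {a..b + e}"
  then consider "x < a" | "x > b + e" by fastforce
  then show "bump e a b x = 0"
  proof cases
    case 1
    then show ?thesis using assms by (simp add: bump_def smooth_step_0 divide_nonpos_pos)
  next
    case 2
    then show ?thesis using assms by (simp add: bump_def smooth_step_1)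
  qed
qed (use assms in auto)

lemma bump_bound: "\<bar>bump e a b x\<bar> \<le> 1"
  using smooth_step_bounds[of "(x - a) / e"] smooth_step_bounds[of "(x - b) / e"] by (auto simp: bump_def)

lemma deriv_bump:
  "(bump e a b has_real_derivative deriv smooth_step ((x - a) / e) / e - deriv smooth_step ((x - b) / e) / e) (at x)"
proof -
  have "((\<lambda>x. smooth_step ((x - c) / e)) has_real_derivative deriv smooth_step ((x - c) / e) * (1 / e)) (at x)" for c
    by (rule DERIV_chain2[OF DERIV_smooth_step], rule DERIV_cdivide) (auto intro!: derivative_eq_intros)
  from DERIV_diff[OF this[of a] this[of b]] show ?thesis unfolding bump_def by simp
qed

section \<open>A lower bound for Dirichlet eigenvalues\<close>

text \<open>Difference quotients in direction b have integral 0 by translation invariance, and by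
  the mean value theorem they converge to G boundedly on a fixed ball.\<close>

lemma integral_directional_derivative_zero:
  fixes F G :: "'a::euclidean_space \<Rightarrow> real"
  assumes dF: "\<And>x. (F has_derivative F' x) (at x)" and G: "\<And>x. F' x b = G x" and Gc: "continuous_on UNIV G"
    and R: "\<And>x. norm x > R \<Longrightarrow> F x = 0"
  shows "(LINT x|lborel. G x) = 0"
proof -
  have Fc: "continuous_on UNIV F"
    using dF by (auto simp: continuous_on_eq_continuous_at intro: has_derivative_continuous)
  \<comment> \<open>The shifts \<open>h n *\<^sub>R b\<close> are no longer than b, so outside the
    ball of radius R' both terms of the difference quotient vanish.\<close>
  define R' where "R' = max R 0 + norm b + 1"
  have G0: "G x = 0" if "norm x > R" for x
  proof -
    have "((\<lambda>x. 0) has_derivative F' x) (at x)"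
      by (rule has_derivative_transform_within_open[OF dF[of x], of "{x. norm x > R}"])
        (use that R in \<open>auto intro!: open_Collect_less continuous_intros\<close>)
    then have "F' x = (\<lambda>x. 0)" using has_derivative_const has_derivative_unique by blast
    then show ?thesis using G[of x] by simp
  qed
  have "bounded (G ` cball 0 R')"
    by (intro compact_imp_bounded compact_continuous_image continuous_on_subset[OF Gc]) auto
  then obtain K0 where K0: "\<forall>x\<in>cball 0 R'. \<bar>G x\<bar> \<le> K0" unfolding bounded_iff by auto
  define K where "K = max K0 0"
  have K: "\<bar>G x\<bar> \<le> K" for x
  proof (cases "norm x \<le> R'")
    case False
    then have "norm x > R" using norm_ge_zero[of b] unfolding R'_def by linarith
    then show ?thesis by (simp add: G0 K_def)
  qed (use K0 in \<open>auto simp: K_def le_max_iff_disj\<close>)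
  have [measurable]: "F \<in> borel_measurable borel" "G \<in> borel_measurable borel"
    using Fc Gc by (auto intro: borel_measurable_continuous_onI)
  have Fi: "integrable lborel F"
  proof -
    have "integrable lborel (\<lambda>x. indicator (cball 0 R') x *\<^sub>R F x)"
      by (rule borel_integrable_compact) (auto intro: continuous_on_subset[OF Fc])
    moreover have "indicator (cball 0 R') x *\<^sub>R F x = F x" for x
    proof (cases "norm x \<le> R'")
      case False
      then have "norm x > R" using norm_ge_zero[of b] unfolding R'_def by linarith
      then show ?thesis by (simp add: R)
    qed simp
    ultimately show ?thesis by (simp only:)
  qed
  define h where "h n = 1 / real (Suc n)" for n
  have h: "0 < h n" "h n \<le> 1" for n by (auto simp: h_def)
  have shift: "integrable lborel (\<lambda>x. F (x + y))" "(LINT x|lborel. F (x + y)) = (LINT x|lborel. F x)" for y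
  proof -
    have "integrable (distr lborel borel ((+) y)) F" using Fi by (simp add: lborel_distr_plus)
    then show "integrable lborel (\<lambda>x. F (x + y))" by (subst (asm) integrable_distr_eq) (auto simp: add.commute)
    have "(LINT x|lborel. F x) = (LINT x|distr lborel borel ((+) y). F x)" by (simp add: lborel_distr_plus)
    also have "\<dots> = (LINT x|lborel. F (x + y))" by (subst integral_distr) (auto simp: add.commute)
    finally show "(LINT x|lborel. F (x + y)) = (LINT x|lborel. F x)" ..
  qed
  define q where "q n x = (F (x + h n *\<^sub>R b) - F x) / h n" for n x
  have q0: "(LINT x|lborel. q n x) = 0" for n
    unfolding q_def using shift Fi by (simp add: Bochner_Integration.integral_diff)
  have line: "((\<lambda>t. F (x + t *\<^sub>R b)) has_real_derivative G (x + t *\<^sub>R b)) (at t)" for x t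
  proof -
    have "((\<lambda>t. F (x + t *\<^sub>R b)) has_derivative (\<lambda>s. F' (x + t *\<^sub>R b) (s *\<^sub>R b))) (at t)"
      by (rule has_derivative_compose[OF _ dF]) (auto intro!: derivative_eq_intros)
    moreover have "F' (x + t *\<^sub>R b) (s *\<^sub>R b) = G (x + t *\<^sub>R b) * s" for s
      using linear_cmul[OF has_derivative_linear[OF dF]] G by simp
    ultimately show ?thesis by (simp add: has_field_derivative_def)
  qed
  have lim: "(\<lambda>n. LINT x|lborel. q n x) \<longlonglongrightarrow> (LINT x|lborel. G x)"
  proof (rule integral_dominated_convergence)
    have "emeasure lborel (cball 0 R' :: 'a set) < \<infinity>" by (rule emeasure_lborel_cball_finite)
    then show "integrable lborel (\<lambda>x::'a. indicator (cball 0 R') x * K)" by (auto intro!: integrable_real_indicator)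
    show "q n \<in> borel_measurable lborel" for n unfolding q_def by measurable
    show "G \<in> borel_measurable lborel" by simp
    show "AE x in lborel. (\<lambda>n. q n x) \<longlonglongrightarrow> G x"
    proof (rule AE_I2)
      fix x
      have "((\<lambda>t. (F (x + t *\<^sub>R b) - F x) / t) \<longlongrightarrow> G x) (at 0)"
        using line[of x 0] by (simp add: has_field_derivative_iff)
      moreover have "filterlim h (at 0) sequentially"
      proof (rule filterlim_atI)
        show "h \<longlonglongrightarrow> 0" unfolding h_def using LIMSEQ_inverse_real_of_nat by (simp add: inverse_eq_divide)
        show "\<forall>\<^sub>F n in sequentially. h n \<noteq> 0" using h(1) by (auto intro!: always_eventually simp: less_le)
      qed
      ultimately show "(\<lambda>n. q n x) \<longlonglongrightarrow> G x" unfolding q_def by (rule filterlim_compose)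
    qed
    show "AE x in lborel. norm (q n x) \<le> indicator (cball 0 R') x * K" for n
    proof (rule AE_I2)
      fix x
      show "norm (q n x) \<le> indicator (cball 0 R') x * K"
      proof (cases "norm x \<le> R'")
        case True
        obtain z where "0 < z" "z < h n" "F (x + h n *\<^sub>R b) - F (x + 0 *\<^sub>R b) = (h n - 0) * G (x + z *\<^sub>R b)"
          using MVT2[of 0 "h n" "\<lambda>t. F (x + t *\<^sub>R b)" "\<lambda>t. G (x + t *\<^sub>R b)"] h line by auto
        then have "q n x = G (x + z *\<^sub>R b)" using h(1)[of n] by (simp add: q_def)
        then show ?thesis using K True by simp
      next
        case False
        have "norm x \<le> norm (x + h n *\<^sub>R b) + norm (h n *\<^sub>R b)" by (metis add_diff_cancel_right' norm_triangle_ineq4)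
        also have "norm (h n *\<^sub>R b) \<le> norm b" using h[of n] by (simp add: mult_left_le_one_le)
        finally have "R < norm (x + h n *\<^sub>R b)" "R < norm x"
          using False norm_ge_zero[of b] unfolding R'_def by linarith+
        then have "F (x + h n *\<^sub>R b) = 0" "F x = 0" by (simp_all only: R)
        then show ?thesis using False by (simp add: q_def)
      qed
    qed
  qed
  show ?thesis using LIMSEQ_unique[OF lim] q0 by simp
qed

lemma test_functionsD:
  assumes "\<psi> \<in> test_functions \<Omega>"
  shows "\<psi> differentiable (at x)" "compact (closure {x. \<psi> x \<noteq> 0})" "closure {x. \<psi> x \<noteq> 0} \<subseteq> \<Omega>" "x \<notin> \<Omega> \<Longrightarrow> \<psi> x = 0"
    "continuous_on UNIV \<psi>"
proof -
  have d: "\<forall>x. iterated_derivative [] \<psi> differentiable (at x)"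
    using assms unfolding test_functions_def by (metis (mono_tags, lifting) empty_subsetI list.set(1) mem_Collect_eq)
  then show "\<psi> differentiable (at x)" by simp
  show "continuous_on UNIV \<psi>" using d by (auto simp: continuous_on_eq_continuous_at differentiable_imp_continuous_within)
  show s: "compact (closure {x. \<psi> x \<noteq> 0})" "closure {x. \<psi> x \<noteq> 0} \<subseteq> \<Omega>" using assms by (auto simp: test_functions_def)
  show "x \<notin> \<Omega> \<Longrightarrow> \<psi> x = 0" using s(2) closure_subset[of "{x. \<psi> x \<noteq> 0}"] by auto
qed

lemma iterated_derivative_append:
  "iterated_derivative (bs @ bs') \<psi> = iterated_derivative bs (iterated_derivative bs' \<psi>)"
  by (induction bs) auto

lemma partial_derivative_test_function:
  assumes "\<psi> \<in> test_functions \<Omega>"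
  shows "partial_derivative i \<psi> \<in> test_functions \<Omega>"
proof -
  have eq: "partial_derivative i \<psi> = iterated_derivative [axis i 1] \<psi>" by (auto simp: partial_derivative_def)
  have d: "iterated_derivative bs (partial_derivative i \<psi>) differentiable (at x)" if "set bs \<subseteq> Basis" for bs x
  proof -
    have "set (bs @ [axis i 1 :: real^'a]) \<subseteq> Basis" using that by (simp add: axis_in_Basis_iff)
    then have "iterated_derivative (bs @ [axis i 1]) \<psi> differentiable (at x)"
      using assms unfolding test_functions_def by blast
    then show ?thesis by (simp only: iterated_derivative_append eq)
  qed
  have sub: "closure {x. partial_derivative i \<psi> x \<noteq> 0} \<subseteq> closure {x. \<psi> x \<noteq> 0}"
  proof (rule closure_minimal)
    show "{x. partial_derivative i \<psi> x \<noteq> 0} \<subseteq> closure {x. \<psi> x \<noteq> 0}"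
    proof (rule ccontr)
      assume "\<not> ?thesis"
      then obtain x where x: "partial_derivative i \<psi> x \<noteq> 0" "x \<in> - closure {x. \<psi> x \<noteq> 0}" by auto
      have "(\<psi> has_derivative (\<lambda>x. 0)) (at x)"
        by (rule has_derivative_transform_within_open[of "\<lambda>x. 0" _ _ _ "- closure {x. \<psi> x \<noteq> 0}"])
          (use x(2) closure_subset[of "{x. \<psi> x \<noteq> 0}"] in auto)
      then have "frechet_derivative \<psi> (at x) = (\<lambda>x. 0)" by (simp add: frechet_derivative_at[symmetric])
      with x(1) show False by (simp add: partial_derivative_def)
    qed
  qed simp
  have "compact (closure {x. partial_derivative i \<psi> x \<noteq> 0})"
    using compact_Int_closed[OF test_functionsD(2)[OF assms] closed_closure[of "{x. partial_derivative i \<psi> x \<noteq> 0}"]] sub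
    by (simp add: Int_absorb1)
  then show ?thesis using d sub test_functionsD(3)[OF assms] by (auto simp: test_functions_def)
qed

lemma test_function_L2:
  assumes \<psi>: "\<psi> \<in> test_functions \<Omega>" and \<Omega>: "\<Omega> \<in> lmeasurable"
  shows "\<psi> \<in> L2_space \<Omega>"
proof -
  interpret finite_measure "lebesgue_on \<Omega>" using \<Omega> by (rule finite_measure_lebesgue_on)
  note t = test_functionsD[OF \<psi>]
  have "bounded (\<psi> ` closure {x. \<psi> x \<noteq> 0})"
    by (intro compact_imp_bounded compact_continuous_image continuous_on_subset[OF t(5)] t(2)) auto
  then obtain K where K: "\<forall>x\<in>closure {x. \<psi> x \<noteq> 0}. \<bar>\<psi> x\<bar> \<le> K" unfolding bounded_iff by auto
  have K': "\<bar>\<psi> x\<bar> \<le> max K 0" for x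
    using K closure_subset[of "{x. \<psi> x \<noteq> 0}"] by (cases "\<psi> x = 0") (auto simp: le_max_iff_disj)
  have m: "\<psi> \<in> borel_measurable (lebesgue_on \<Omega>)"
    using borel_measurable_continuous_onI[OF t(5)] by (intro measurable_restrict_space1 measurable_completion) simp
  have "integrable (lebesgue_on \<Omega>) (\<lambda>x. (\<psi> x)\<^sup>2)"
  proof (rule integrable_const_bound)
    have "\<bar>\<psi> x\<bar>\<^sup>2 \<le> (max K 0)\<^sup>2" for x by (rule power_mono[OF K']) simp
    then show "AE x in lebesgue_on \<Omega>. norm ((\<psi> x)\<^sup>2) \<le> (max K 0)\<^sup>2" by simp
  qed (use m in measurable)
  with m show ?thesis by (simp add: L2_space_def)
qed

lemma L2_inner_lborel:
  assumes "\<Omega> \<in> sets lebesgue" "f \<in> borel_measurable borel" "g \<in> borel_measurable borel" "\<And>x. x \<notin> \<Omega> \<Longrightarrow> f x * g x = 0"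
  shows "L2_inner \<Omega> f g = (LINT x|lborel. f x * g x)"
proof -
  have "L2_inner \<Omega> f g = (LINT x|lebesgue. indicator \<Omega> x *\<^sub>R (f x * g x))"
    unfolding L2_inner_def using assms(1) by (subst integral_restrict_space) auto
  also have "\<dots> = (LINT x|lebesgue. f x * g x)"
    by (rule Bochner_Integration.integral_cong) (use assms(4) in \<open>auto simp: indicator_def\<close>)
  also have "\<dots> = (LINT x|lborel. f x * g x)"
    by (rule integral_completion) (use assms in auto)
  finally show ?thesis .
qed

text \<open>The i-th derivative of x_i \<psi>^2 has integral 0, so the squared norm of \<psi> is -2
  times the inner product of x_i D with \<psi>, where D is the i-th derivative of \<psi>.
  Cauchy-Schwarz and |x_i| \<le> R on \<Omega> give the constant 2 R.\<close>

theorem Poincare_inequality: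
  fixes \<Omega> :: "(real^'n::finite) set"
  assumes \<Omega>: "\<Omega> \<in> lmeasurable" "bounded \<Omega>"
  obtains C where "C > 0" "\<And>\<psi>. \<psi> \<in> test_functions \<Omega> \<Longrightarrow> L2_norm \<Omega> \<psi> \<le> C * L2_norm \<Omega> (partial_derivative i \<psi>)"
proof -
  obtain R where R: "R > 0" "\<And>x. x \<in> \<Omega> \<Longrightarrow> norm x \<le> R" using \<Omega>(2) by (auto simp: bounded_pos)
  have "L2_norm \<Omega> \<psi> \<le> 2 * R * L2_norm \<Omega> (partial_derivative i \<psi>)" if \<psi>: "\<psi> \<in> test_functions \<Omega>" for \<psi>
  proof -
    define D where "D = partial_derivative i \<psi>"
    have D: "D \<in> test_functions \<Omega>" unfolding D_def by (rule partial_derivative_test_function[OF \<psi>])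
    note t = test_functionsD[OF \<psi>] and tD = test_functionsD[OF D]
    define G where "G x = (\<psi> x)\<^sup>2 + 2 * (x $ i * \<psi> x * D x)" for x
    have dps: "(\<psi> has_derivative frechet_derivative \<psi> (at x)) (at x)" for x
      using t(1)[of x] by (simp add: frechet_derivative_works)
    have ci: "continuous_on UNIV (\<lambda>x::real^'n. x $ i)" by (intro continuous_intros)
    have "(LINT x|lborel. G x) = 0"
    proof (rule integral_directional_derivative_zero[where F = "\<lambda>x. x $ i * (\<psi> x)\<^sup>2" and b = "axis i 1" and R = R])
      show "((\<lambda>x. x $ i * (\<psi> x)\<^sup>2) has_derivative (\<lambda>y. y $ i * (\<psi> x)\<^sup>2 + x $ i * (2 * \<psi> x * frechet_derivative \<psi> (at x) y))) (at x)" for x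
        by (rule derivative_eq_intros dps bounded_linear_imp_has_derivative[OF bounded_linear_vec_nth] refl)+
          (simp add: fun_eq_iff algebra_simps)
      show "axis i 1 $ i * (\<psi> x)\<^sup>2 + x $ i * (2 * \<psi> x * frechet_derivative \<psi> (at x) (axis i 1)) = G x" for x
        by (simp add: G_def D_def partial_derivative_def axis_def)
      show "continuous_on UNIV G" unfolding G_def by (intro continuous_intros t tD)
      show "norm x > R \<Longrightarrow> x $ i * (\<psi> x)\<^sup>2 = 0" for x using R(2)[of x] t(4)[of x] by auto
    qed
    moreover have G: "G x = \<psi> x * \<psi> x + 2 * ((x $ i * D x) * \<psi> x)" for x by (simp add: G_def power2_eq_square)
    moreover have int: "integrable lborel (\<lambda>x. f x * \<psi> x)" if "continuous_on UNIV f" for f :: "real^'n \<Rightarrow> real"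
    proof -
      have "integrable lborel (\<lambda>x. indicator (closure {x. \<psi> x \<noteq> 0}) x *\<^sub>R (f x * \<psi> x))"
        by (rule borel_integrable_compact[OF t(2)]) (intro continuous_intros continuous_on_subset[OF t(5)] continuous_on_subset[OF that], auto)
      moreover have "indicator (closure {x. \<psi> x \<noteq> 0}) x *\<^sub>R (f x * \<psi> x) = f x * \<psi> x" for x
        using closure_subset[of "{x. \<psi> x \<noteq> 0}"] by (auto simp: indicator_def)
      ultimately show ?thesis by (simp only:)
    qed
    have xD: "continuous_on UNIV (\<lambda>x. x $ i * D x)" by (intro continuous_intros tD)
    ultimately have "(LINT x|lborel. \<psi> x * \<psi> x) + 2 * (LINT x|lborel. (x $ i * D x) * \<psi> x) = 0"
      using int[OF t(5)] int[OF xD] by simp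
    moreover have "(LINT x|lborel. \<psi> x * \<psi> x) = L2_inner \<Omega> \<psi> \<psi>"
      by (rule L2_inner_lborel[symmetric]) (use \<Omega> t in \<open>auto intro: borel_measurable_continuous_onI\<close>)
    moreover have "(LINT x|lborel. (x $ i * D x) * \<psi> x) = L2_inner \<Omega> (\<lambda>x. x $ i * D x) \<psi>"
      by (rule L2_inner_lborel[symmetric]) (use \<Omega> t xD in \<open>auto intro: borel_measurable_continuous_onI\<close>)
    ultimately have eq: "(L2_norm \<Omega> \<psi>)\<^sup>2 = - 2 * L2_inner \<Omega> (\<lambda>x. x $ i * D x) \<psi>" by (simp add: L2_norm_square)
    have \<psi>L: "\<psi> \<in> L2_space \<Omega>" and DL: "D \<in> L2_space \<Omega>" using test_function_L2 \<psi> D \<Omega> by auto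
    have xm: "(\<lambda>x. x $ i * D x) \<in> borel_measurable (lebesgue_on \<Omega>)"
      using borel_measurable_continuous_onI[OF xD] by (intro measurable_restrict_space1 measurable_completion) simp
    have le: "AE x in lebesgue_on \<Omega>. (x $ i * D x)\<^sup>2 \<le> R\<^sup>2 * (D x)\<^sup>2"
    proof (rule AE_I2)
      fix x assume "x \<in> space (lebesgue_on \<Omega>)"
      then have "\<bar>x $ i\<bar> \<le> R" using R(2)[of x] component_le_norm_cart[of x i] by simp
      then have "\<bar>x $ i\<bar>\<^sup>2 \<le> R\<^sup>2" by (intro power_mono) auto
      then show "(x $ i * D x)\<^sup>2 \<le> R\<^sup>2 * (D x)\<^sup>2" by (simp add: power_mult_distrib mult_right_mono)
    qed
    have xi: "integrable (lebesgue_on \<Omega>) (\<lambda>x. (x $ i * D x)\<^sup>2)"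
      by (rule Bochner_Integration.integrable_bound[OF integrable_mult_right[OF L2_spaceD(2)[OF DL], of "R\<^sup>2"]])
        (use xm le in auto)
    have xL: "(\<lambda>x. x $ i * D x) \<in> L2_space \<Omega>" using xm xi by (simp add: L2_space_def)
    have "(L2_norm \<Omega> (\<lambda>x. x $ i * D x))\<^sup>2 \<le> (R * L2_norm \<Omega> D)\<^sup>2"
    proof -
      have "(LINT x|lebesgue_on \<Omega>. (x $ i * D x)\<^sup>2) \<le> (LINT x|lebesgue_on \<Omega>. R\<^sup>2 * (D x)\<^sup>2)"
        by (rule integral_mono_AE[OF xi _ le]) (use L2_spaceD(2)[OF DL] in auto)
      then show ?thesis by (simp add: L2_norm_def power_mult_distrib)
    qed
    then have xn: "L2_norm \<Omega> (\<lambda>x. x $ i * D x) \<le> R * L2_norm \<Omega> D" by (rule power2_le_imp_le) (use R in simp)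
    have "(L2_norm \<Omega> \<psi>)\<^sup>2 \<le> 2 * (L2_norm \<Omega> (\<lambda>x. x $ i * D x) * L2_norm \<Omega> \<psi>)"
      using eq L2_Cauchy_Schwarz[OF xL \<psi>L] by linarith
    also have "\<dots> \<le> 2 * (R * L2_norm \<Omega> D * L2_norm \<Omega> \<psi>)"
      using xn by (intro mult_left_mono mult_right_mono) auto
    finally have "L2_norm \<Omega> \<psi> * L2_norm \<Omega> \<psi> \<le> 2 * R * L2_norm \<Omega> D * L2_norm \<Omega> \<psi>"
      by (simp add: power2_eq_square mult_ac)
    then show ?thesis
      using R by (cases "L2_norm \<Omega> \<psi> = 0") (auto simp: D_def less_le)
  qed
  then show ?thesis using R(1) by (intro that[of "2 * R"]) auto
qed

lemma L2_inner_tendsto: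
  assumes w: "\<And>j. w j \<in> L2_space \<Omega>" "w' \<in> L2_space \<Omega>" and v: "v \<in> L2_space \<Omega>"
    and l: "(\<lambda>j. L2_norm \<Omega> (\<lambda>x. w j x - w' x)) \<longlonglongrightarrow> 0"
  shows "(\<lambda>j. L2_inner \<Omega> (w j) v) \<longlonglongrightarrow> L2_inner \<Omega> w' v" "(\<lambda>j. L2_norm \<Omega> (w j)) \<longlonglongrightarrow> L2_norm \<Omega> w'"
proof -
  have "(\<lambda>j. L2_inner \<Omega> (w j) v - L2_inner \<Omega> w' v) \<longlonglongrightarrow> 0"
  proof (rule Lim_null_comparison)
    show "\<forall>\<^sub>F j in sequentially. norm (L2_inner \<Omega> (w j) v - L2_inner \<Omega> w' v) \<le> L2_norm \<Omega> (\<lambda>x. w j x - w' x) * L2_norm \<Omega> v"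
      using L2_Cauchy_Schwarz[OF L2_diff[OF w] v] by (simp add: L2_inner_diff w v)
    show "(\<lambda>j. L2_norm \<Omega> (\<lambda>x. w j x - w' x) * L2_norm \<Omega> v) \<longlonglongrightarrow> 0"
      using tendsto_mult_right[OF l, of "L2_norm \<Omega> v"] by simp
  qed
  then show "(\<lambda>j. L2_inner \<Omega> (w j) v) \<longlonglongrightarrow> L2_inner \<Omega> w' v" by (rule LIM_zero_cancel)
  have "(\<lambda>j. L2_norm \<Omega> (w j) - L2_norm \<Omega> w') \<longlonglongrightarrow> 0"
  proof (rule Lim_null_comparison[OF always_eventually l], rule allI)
    fix j show "norm (L2_norm \<Omega> (w j) - L2_norm \<Omega> w') \<le> L2_norm \<Omega> (\<lambda>x. w j x - w' x)"
      using L2_norm_triangle_diff[OF w(1)[of j] w(2)] L2_norm_triangle_diff[OF w(2) w(1)[of j]] L2_norm_uminus[of \<Omega> "w j" w']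
      by (simp add: abs_le_iff)
  qed
  then show "(\<lambda>j. L2_norm \<Omega> (w j)) \<longlonglongrightarrow> L2_norm \<Omega> w'" by (rule LIM_zero_cancel)
qed

text \<open>Whatever weak gradient \<open>D\<close> the eigenpair comes with, its components dominate those of the
  gradient that the approximating test functions converge to, because derivatives of test functions
  are test functions.  This avoids the uniqueness of weak gradients.\<close>

theorem eigenvalue_lower_bound:
  fixes \<Omega> :: "(real^'n::finite) set"
  assumes \<Omega>: "\<Omega> \<in> lmeasurable" "bounded \<Omega>"
    and A: "\<alpha> > 0" "\<And>x \<xi>. x \<in> \<Omega> \<Longrightarrow> \<alpha> * (norm \<xi>)\<^sup>2 \<le> \<xi> \<bullet> (A x *v \<xi>)"
    and c: "AE x in lebesgue_on \<Omega>. 0 \<le> c x"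
  obtains m where "m > 0" "\<And>\<mu> \<phi>. \<mu> > 0 \<Longrightarrow> L2_norm \<Omega> \<phi> = 1 \<Longrightarrow> dirichlet_eigenpair \<Omega> A c \<mu> \<phi> \<Longrightarrow> m \<le> \<mu>"
proof -
  \<comment> \<open>A single direction suffices for the Poincare inequality, and every type is
    inhabited.\<close>
  fix i :: 'n
  obtain C where C: "C > 0" "\<And>\<psi>. \<psi> \<in> test_functions \<Omega> \<Longrightarrow> L2_norm \<Omega> \<psi> \<le> C * L2_norm \<Omega> (partial_derivative i \<psi>)"
    by (rule Poincare_inequality[OF \<Omega>]) blast
  have "\<alpha> / C\<^sup>2 \<le> \<mu>" if \<mu>: "\<mu> > 0" and \<phi>1: "L2_norm \<Omega> \<phi> = 1" and e: "dirichlet_eigenpair \<Omega> A c \<mu> \<phi>" for \<mu> \<phi>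
  proof -
    have H: "\<phi> \<in> H01_space \<Omega>" using e by (simp add: dirichlet_eigenpair_def)
    obtain D where D: "has_weak_gradient \<Omega> \<phi> D"
      "\<And>v Dv. v \<in> H01_space \<Omega> \<Longrightarrow> has_weak_gradient \<Omega> v Dv \<Longrightarrow>
        (LINT x|lebesgue_on \<Omega>. (A x *v D x) \<bullet> Dv x + c x * \<phi> x * v x) = \<mu> * L2_inner \<Omega> \<phi> v"
      using e by (auto simp: dirichlet_eigenpair_def)
    obtain D' \<psi> where D': "has_weak_gradient \<Omega> \<phi> D'" "\<And>j. \<psi> j \<in> test_functions \<Omega>"
      "(\<lambda>j::nat. L2_norm \<Omega> (\<lambda>x. \<psi> j x - \<phi> x)) \<longlonglongrightarrow> 0"
      "(\<lambda>j. L2_norm \<Omega> (\<lambda>x. partial_derivative i (\<psi> j) x - D' x $ i)) \<longlonglongrightarrow> 0" and \<phi>L: "\<phi> \<in> L2_space \<Omega>"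
      using H unfolding H01_space_def by blast
    let ?d = "\<lambda>x. D x $ i" and ?d' = "\<lambda>x. D' x $ i"
    have dL: "?d \<in> L2_space \<Omega>" and d'L: "?d' \<in> L2_space \<Omega>" using D(1) D'(1) by (auto simp: has_weak_gradient_def)
    have p: "partial_derivative i (\<psi> j) \<in> test_functions \<Omega>" for j by (rule partial_derivative_test_function[OF D'(2)])
    have pL: "partial_derivative i (\<psi> j) \<in> L2_space \<Omega>" and \<psi>L: "\<psi> j \<in> L2_space \<Omega>" for j
      using test_function_L2 p D'(2) \<Omega> by auto
    have "L2_inner \<Omega> ?d \<eta> = L2_inner \<Omega> ?d' \<eta>" if "\<eta> \<in> test_functions \<Omega>" for \<eta>
    proof -
      have "L2_inner \<Omega> \<phi> (partial_derivative i \<eta>) = - L2_inner \<Omega> ?d \<eta>"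
        "L2_inner \<Omega> \<phi> (partial_derivative i \<eta>) = - L2_inner \<Omega> ?d' \<eta>"
        using D(1) D'(1) that unfolding has_weak_gradient_def by blast+
      then show ?thesis by simp
    qed
    then have "L2_inner \<Omega> (partial_derivative i (\<psi> j)) ?d = L2_inner \<Omega> (partial_derivative i (\<psi> j)) ?d'" for j
      using p L2_inner_commute by metis
    moreover have "(\<lambda>j. L2_inner \<Omega> (partial_derivative i (\<psi> j)) ?d) \<longlonglongrightarrow> L2_inner \<Omega> ?d' ?d"
      "(\<lambda>j. L2_inner \<Omega> (partial_derivative i (\<psi> j)) ?d') \<longlonglongrightarrow> L2_inner \<Omega> ?d' ?d'"
      by (intro L2_inner_tendsto(1) pL d'L dL D'(4))+
    ultimately have "L2_inner \<Omega> ?d' ?d' = L2_inner \<Omega> ?d' ?d" using LIMSEQ_unique by simp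
    then have "(L2_norm \<Omega> ?d')\<^sup>2 \<le> L2_norm \<Omega> ?d' * L2_norm \<Omega> ?d"
      using L2_Cauchy_Schwarz[OF d'L dL] by (simp add: L2_norm_square)
    then have le: "L2_norm \<Omega> ?d' \<le> L2_norm \<Omega> ?d"
      by (cases "L2_norm \<Omega> ?d' = 0") (auto simp: power2_eq_square less_le)
    have "L2_norm \<Omega> \<phi> \<le> C * L2_norm \<Omega> ?d'"
    proof (rule LIMSEQ_le)
      show "(\<lambda>j. L2_norm \<Omega> (\<psi> j)) \<longlonglongrightarrow> L2_norm \<Omega> \<phi>" by (rule L2_inner_tendsto(2)[OF \<psi>L \<phi>L \<phi>L D'(3)])
      show "(\<lambda>j. C * L2_norm \<Omega> (partial_derivative i (\<psi> j))) \<longlonglongrightarrow> C * L2_norm \<Omega> ?d'"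
        by (intro tendsto_intros L2_inner_tendsto(2)[OF pL d'L d'L D'(4)])
    qed (use C(2) D'(2) in auto)
    also have "\<dots> \<le> C * L2_norm \<Omega> ?d" using le C(1) by (intro mult_left_mono) auto
    finally have "1 \<le> C * L2_norm \<Omega> ?d" using \<phi>1 by simp
    then have "1\<^sup>2 \<le> (C * L2_norm \<Omega> ?d)\<^sup>2" by (intro power_mono) auto
    then have one: "1 \<le> C\<^sup>2 * (L2_norm \<Omega> ?d)\<^sup>2" by (simp add: power_mult_distrib)
    have \<mu>eq: "(LINT x|lebesgue_on \<Omega>. (A x *v D x) \<bullet> D x + c x * \<phi> x * \<phi> x) = \<mu>"
      using D(2)[OF H D(1)] \<phi>1 L2_norm_square[of \<Omega> \<phi>] by simp
    \<comment> \<open>The Bochner integral of a non-integrable function is 0 by default, so the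
      value \<mu> > 0 forces integrability.\<close>
    then have int: "integrable (lebesgue_on \<Omega>) (\<lambda>x. (A x *v D x) \<bullet> D x + c x * \<phi> x * \<phi> x)"
      using \<mu> not_integrable_integral_eq by fastforce
    have "\<alpha> * (L2_norm \<Omega> ?d)\<^sup>2 = (LINT x|lebesgue_on \<Omega>. \<alpha> * (D x $ i)\<^sup>2)" by (simp add: L2_norm_def)
    also have "\<dots> \<le> \<mu>" unfolding \<mu>eq[symmetric]
    proof (rule integral_mono_AE[OF _ int])
      show "integrable (lebesgue_on \<Omega>) (\<lambda>x. \<alpha> * (D x $ i)\<^sup>2)" using L2_spaceD(2)[OF dL] by simp
      show "AE x in lebesgue_on \<Omega>. \<alpha> * (D x $ i)\<^sup>2 \<le> (A x *v D x) \<bullet> D x + c x * \<phi> x * \<phi> x"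
        using c AE_space
      proof eventually_elim
        case (elim x)
        have "\<bar>D x $ i\<bar>\<^sup>2 \<le> (norm (D x))\<^sup>2" by (intro power_mono component_le_norm_cart) simp
        then have "\<alpha> * (D x $ i)\<^sup>2 \<le> \<alpha> * (norm (D x))\<^sup>2" using A(1) by simp
        also have "\<dots> \<le> (A x *v D x) \<bullet> D x" using A(2)[of x "D x"] elim(2) by (simp add: inner_commute)
        also have "\<dots> \<le> (A x *v D x) \<bullet> D x + c x * \<phi> x * \<phi> x" using elim(1) by (simp add: mult.assoc)
        finally show ?case .
      qed
    qed
    finally have "\<alpha> * (L2_norm \<Omega> ?d)\<^sup>2 \<le> \<mu>" .
    moreover have "\<alpha> / C\<^sup>2 \<le> \<alpha> * (L2_norm \<Omega> ?d)\<^sup>2"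
      using one A(1) C(1) by (simp add: divide_le_eq mult.assoc) (simp add: mult.commute)
    ultimately show ?thesis by simp
  qed
  then show ?thesis using A(1) C(1) by (intro that[of "\<alpha> / C\<^sup>2"]) auto
qed

section \<open>Weak derivatives in time\<close>

lemma test_function_real:
  fixes \<psi> :: "real \<Rightarrow> real"
  assumes \<psi>: "\<psi> \<in> test_functions {0<..<T}"
  shows "(\<psi> has_real_derivative deriv \<psi> x) (at x)" "continuous_on UNIV (deriv \<psi>)"
    "continuous_on UNIV \<psi>" "\<psi> 0 = 0" "\<psi> T = 0"
proof -
  have d: "iterated_derivative bs \<psi> differentiable (at x)" if "set bs \<subseteq> Basis" for bs x
    using \<psi> that by (simp add: test_functions_def)
  have D: "(\<psi> has_real_derivative deriv \<psi> x) (at x)" for x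
    using d[of "[]" x] by (simp add: DERIV_deriv_iff_real_differentiable)
  then show "(\<psi> has_real_derivative deriv \<psi> x) (at x)" .
  have "frechet_derivative \<psi> (at x) 1 = deriv \<psi> x" for x
    using fun_cong[OF frechet_derivative_at[OF D[of x, unfolded has_field_derivative_def]], of 1] by simp
  then have "iterated_derivative [1] \<psi> = deriv \<psi>" by (simp add: fun_eq_iff)
  then have "deriv \<psi> differentiable (at x)" for x using d[of "[1]" x] by simp
  then show "continuous_on UNIV (deriv \<psi>)"
    by (intro continuous_at_imp_continuous_on ballI) (rule differentiable_imp_continuous_within)
  show "continuous_on UNIV \<psi>" "\<psi> 0 = 0" "\<psi> T = 0" using test_functionsD[OF \<psi>] by auto
qed

lemma continuous_integral_Ioo:
  fixes q :: "real \<Rightarrow> real"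
  assumes q: "continuous_on {a..b} q"
  shows "integrable (lebesgue_on {a<..<b}) q" "(LINT x|lebesgue_on {a<..<b}. q x) = integral {a..b} q"
proof -
  have "q absolutely_integrable_on {a..b}" by (rule absolutely_integrable_continuous_real[OF q])
  then have s: "q absolutely_integrable_on {a<..<b}" by (rule set_integrable_subset) auto
  then show "integrable (lebesgue_on {a<..<b}) q"
    by (subst integrable_restrict_space) (auto simp: set_integrable_def)
  have "(LINT x|lebesgue_on {a<..<b}. q x) = (LINT x:{a<..<b}|lebesgue. q x)"
    by (subst integral_restrict_space) (auto simp: set_lebesgue_integral_def)
  also have "\<dots> = integral {a<..<b} q" by (rule set_lebesgue_integral_eq_integral(2)[OF s])
  finally show "(LINT x|lebesgue_on {a<..<b}. q x) = integral {a..b} q" by (simp add: integral_open_interval_real)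
qed

lemma continuous_integral_Icc:
  fixes q :: "real \<Rightarrow> real"
  assumes q: "continuous_on {a..b} q"
  shows "integrable lborel (\<lambda>x. indicator {a..b} x * q x)" "(LINT x|lborel. indicator {a..b} x * q x) = integral {a..b} q"
proof -
  have s: "set_integrable lborel {a..b} q"
    unfolding set_integrable_def by (rule borel_integrable_compact[OF _ q]) simp
  then show "integrable lborel (\<lambda>x. indicator {a..b} x * q x)" by (simp add: set_integrable_def)
  show "(LINT x|lborel. indicator {a..b} x * q x) = integral {a..b} q"
    using set_borel_integral_eq_integral(2)[OF s] by (simp add: set_lebesgue_integral_def)
qed

lemma test_function_by_parts:
  assumes \<psi>: "\<psi> \<in> test_functions {0<..<T}" and T: "T > 0"
    and y: "\<And>t. t \<in> {0..T} \<Longrightarrow> (y has_vector_derivative y' t) (at t within {0..T})" and y': "continuous_on {0..T} y'"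
  shows "(LINT t|leb T. deriv \<psi> t * y t) = - (LINT t|leb T. \<psi> t * y' t)"
proof -
  note \<psi>f = test_function_real[OF \<psi>]
  have "continuous_on {0..T} y"
    unfolding continuous_on_eq_continuous_within using y by (blast intro: has_vector_derivative_continuous)
  then have c: "continuous_on {0..T} (\<lambda>t. deriv \<psi> t * y t)" "continuous_on {0..T} (\<lambda>t. \<psi> t * y' t)"
    by (intro continuous_on_mult y' continuous_on_subset[OF \<psi>f(2)] continuous_on_subset[OF \<psi>f(3)] subset_UNIV; assumption)+
  have "((\<lambda>t. \<psi> t * y' t + deriv \<psi> t * y t) has_integral (\<psi> T * y T - \<psi> 0 * y 0)) {0..T}"
  proof (rule fundamental_theorem_of_calculus)
    fix t assume t: "t \<in> {0..T}"
    have "(\<psi> has_vector_derivative deriv \<psi> t) (at t within {0..T})"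
      using has_field_derivative_at_within[OF \<psi>f(1)[of t], of "{0..T}"] by (simp add: has_real_derivative_iff_has_vector_derivative)
    from has_vector_derivative_mult[OF this y[OF t]]
    show "((\<lambda>t. \<psi> t * y t) has_vector_derivative \<psi> t * y' t + deriv \<psi> t * y t) (at t within {0..T})" .
  qed (use T in simp)
  then have "integral {0..T} (\<lambda>t. \<psi> t * y' t + deriv \<psi> t * y t) = 0" using \<psi>f(4,5) by (simp add: integral_unique)
  also have "integral {0..T} (\<lambda>t. \<psi> t * y' t + deriv \<psi> t * y t) = integral {0..T} (\<lambda>t. \<psi> t * y' t) + integral {0..T} (\<lambda>t. deriv \<psi> t * y t)"
    by (rule Henstock_Kurzweil_Integration.integral_add) (intro integrable_continuous_real c)+
  finally show ?thesis by (simp add: continuous_integral_Ioo(2)[OF c(1)] continuous_integral_Ioo(2)[OF c(2)])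
qed

lemma bump_eventually_test_function:
  assumes "0 < a" "a < b" "b < T"
  shows "\<forall>\<^sub>F n in sequentially. bump (1 / real (Suc n)) a b \<in> test_functions {0<..<T}"
proof -
  have "(\<lambda>n. inverse (real (Suc n))) \<longlonglongrightarrow> 0" by (rule LIMSEQ_inverse_real_of_nat)
  then have "\<forall>\<^sub>F n in sequentially. inverse (real (Suc n)) < T - b" using assms by (intro order_tendstoD) auto
  then show ?thesis
    by eventually_elim (use assms in \<open>auto intro!: bump_test_function simp: inverse_eq_divide\<close>)
qed

text \<open>Bumps approximating the indicator of (t, T) show that d has integral 0 over every
  half-line, whence \<open>AE_zero_of_integral_Ioi_zero\<close>. This identifies weak time
  derivatives that are merely integrable, for which point values carry no meaning.\<close>

lemma AE_zero_of_test_functions: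
  fixes d :: "real \<Rightarrow> real"
  assumes d: "integrable (leb T) d"
    and z: "\<And>\<psi>. \<psi> \<in> test_functions {0<..<T} \<Longrightarrow> (LINT t|leb T. \<psi> t * d t) = 0"
  shows "AE t in leb T. d t = 0"
proof -
  define f where "f t = indicator {0<..<T} t * d t" for t
  have fL: "integrable lebesgue f"
    using d by (subst (asm) integrable_restrict_space) (auto simp: f_def[abs_def])
  have "integrable (lebesgue_on {0..T}) f"
    using integrable_mult_indicator[OF _ fL, of "{0..T}"] by (subst integrable_restrict_space) auto
  from lebesgue_on_borel_representative[OF this] obtain f' where f': "integrable lborel f'"
    "AE x in lborel. indicator {0..T} x * f x = f' x" "\<And>x. x \<notin> {0..T} \<Longrightarrow> f' x = 0"
    "\<And>t m. t \<le> T \<Longrightarrow> m \<in> borel_measurable borel \<Longrightarrow>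
       (LINT r|lebesgue_on {0..t}. m r * f r) = (LINT r|lborel. indicator {0..t} r * m r * f' r)" by blast
  have J: "(LINT x|lborel. \<psi> x * f' x) = 0" if \<psi>: "\<psi> \<in> test_functions {0<..<T}" for \<psi>
  proof -
    have "(LINT x|lborel. \<psi> x * f' x) = (LINT r|lborel. indicator {0..T} r * \<psi> r * f' r)"
      by (rule Bochner_Integration.integral_cong) (use f'(3) in \<open>auto simp: indicator_def\<close>)
    also have "\<dots> = (LINT r|lebesgue_on {0..T}. \<psi> r * f r)"
      by (rule f'(4)[OF order_refl borel_measurable_continuous_onI[OF test_function_real(3)[OF \<psi>]], symmetric])
    also have "\<dots> = (LINT r|lebesgue. indicator {0<..<T} r *\<^sub>R (\<psi> r * d r))"
      by (subst integral_restrict_space) (auto intro!: Bochner_Integration.integral_cong simp: f_def indicator_def)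
    also have "\<dots> = (LINT r|leb T. \<psi> r * d r)" by (subst integral_restrict_space) auto
    finally show ?thesis using z[OF \<psi>] by simp
  qed
  have "AE x in lborel. f' x = 0"
  proof (rule AE_zero_of_integral_Ioi_zero[OF f'(1)])
    fix t :: real
    define t' where "t' = max t 0"
    define e where "e n = 1 / real (Suc n)" for n
    \<comment> \<open>Rises on [t' + e, t' + 2e] and falls on [T - 2e, T - e], so the support stays
      inside (0, T) as soon as 3e \<le> T - t'.\<close>
    define \<psi> where "\<psi> n = bump (e n) (t' + e n) (T - 2 * e n)" for n
    have e: "\<forall>\<^sub>F n in sequentially. e n < \<eta>" "e n > 0" if "\<eta> > 0" for \<eta> n
      using order_tendstoD(2)[OF LIMSEQ_inverse_real_of_nat that] by (auto simp: e_def inverse_eq_divide)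
    show "(LINT x|lborel. indicator {t<..} x * f' x) = 0"
    proof (cases "t' < T")
      case False
      have "AE x in lborel. indicator {t<..} x * f' x = 0"
        using AE_lborel_singleton[of T] by eventually_elim (use False f'(3) in \<open>auto simp: t'_def indicator_def\<close>)
      then show ?thesis by (rule integral_eq_zero_AE)
    next
      case True
      have "(T - t') / 3 > 0" using True by simp
      from e(1)[OF this] have ev: "\<forall>\<^sub>F n in sequentially. \<psi> n \<in> test_functions {0<..<T}"
      proof eventually_elim
        case (elim n)
        then show ?case using e(2)[of 1 n] by (auto simp: \<psi>_def t'_def intro!: bump_test_function)
      qed
      have "(\<lambda>n. LINT x|lborel. \<psi> n x * f' x) \<longlonglongrightarrow> (LINT x|lborel. indicator {t<..} x * f' x)"
      proof (rule integral_dominated_convergence)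
        show "integrable lborel (\<lambda>x. \<bar>f' x\<bar>)" using f'(1) by simp
        have [measurable]: "\<psi> n \<in> borel_measurable borel" for n unfolding \<psi>_def
          by (intro borel_measurable_continuous_onI) (auto simp: continuous_on_eq_continuous_at intro: DERIV_isCont[OF deriv_bump])
        show "(\<lambda>x. \<psi> n x * f' x) \<in> borel_measurable lborel" for n using f'(1) by measurable
        show "(\<lambda>x. indicator {t<..} x * f' x) \<in> borel_measurable lborel" using f'(1) by measurable
        show "AE x in lborel. (\<lambda>n. \<psi> n x * f' x) \<longlonglongrightarrow> indicator {t<..} x * f' x"
          using AE_lborel_singleton[of T] AE_lborel_singleton[of 0]
        proof eventually_elim
          case (elim x)
          show ?case
          proof (cases "x \<in> {0..T}")
            case x: True
            \<comment> \<open>For e n below \<eta> the point x lies outside both transition zones;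
              the half accounts for their reaching up to 2e from t' and from T.\<close>
            define \<eta> where "\<eta> = min (T - x) (if x > t' then x - t' else T - t') / 2"
            have "\<eta> > 0" using x elim True by (auto simp: \<eta>_def)
            from e(1)[OF this] have "\<forall>\<^sub>F n in sequentially. \<psi> n x * f' x = indicator {t<..} x * f' x"
            proof eventually_elim
              case n: (elim n)
              have e0: "e n > 0" by (rule e(2)[OF zero_less_one])
              have "smooth_step ((x - (T - 2 * e n)) / e n) = 0"
                by (rule smooth_step_0) (use n e0 in \<open>auto simp: \<eta>_def divide_le_0_iff split: if_splits\<close>)
              moreover have "smooth_step ((x - (t' + e n)) / e n) = indicator {t<..} x"
              proof (cases "x > t'")
                case True
                then have "1 \<le> (x - (t' + e n)) / e n" using n e0 by (auto simp: \<eta>_def field_simps split: if_splits)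
                then show ?thesis using True by (simp add: smooth_step_1 t'_def)
              next
                case False
                then have "(x - (t' + e n)) / e n \<le> 0" using e0 by (auto simp: divide_le_0_iff)
                then show ?thesis using False x elim by (auto simp: smooth_step_0 t'_def)
              qed
              ultimately show ?case by (simp add: \<psi>_def bump_def)
            qed
            then show ?thesis by (rule tendsto_eventually)
          qed (simp add: f'(3))
        qed
        show "AE x in lborel. norm (\<psi> n x * f' x) \<le> \<bar>f' x\<bar>" for n
          unfolding \<psi>_def by (intro AE_I2) (simp add: abs_mult mult_left_le_one_le bump_bound)
      qed
      moreover have "\<forall>\<^sub>F n in sequentially. (LINT x|lborel. \<psi> n x * f' x) = 0"
        using ev by eventually_elim (rule J)
      ultimately show ?thesis by (rule LIMSEQ_unique[OF _ tendsto_eventually])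
    qed
  qed
  then have "AE x in lborel. x \<in> {0<..<T} \<longrightarrow> d x = 0"
    using f'(2) by eventually_elim (auto simp: f_def)
  then show ?thesis by (subst AE_restrict_space_iff) (auto simp: AE_completion_iff)
qed

lemma integral_lebesgue_on_Ioo:
  fixes g :: "real \<Rightarrow> real"
  assumes g: "continuous_on {0..T} g"
  shows "(LINT x|leb T. g x) = (LINT x|lborel. indicator {0<..<T} x * g x)"
    "(\<lambda>x. indicator {0<..<T} x * g x) \<in> borel_measurable borel"
proof -
  have "(\<lambda>x. indicator {0<..<T} x *\<^sub>R g x) \<in> borel_measurable borel"
    by (intro borel_measurable_continuous_on_indicator continuous_on_subset[OF g]) auto
  then show m: "(\<lambda>x. indicator {0<..<T} x * g x) \<in> borel_measurable borel" by simp
  have "(LINT x|leb T. g x) = (LINT x|lebesgue. indicator {0<..<T} x *\<^sub>R g x)"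
    by (subst integral_restrict_space) auto
  also have "\<dots> = (LINT x|lborel. indicator {0<..<T} x * g x)"
    using m by (simp add: integral_completion)
  finally show "(LINT x|leb T. g x) = (LINT x|lborel. indicator {0<..<T} x * g x)" .
qed

section \<open>Mollifiers and the lemma of du Bois-Reymond\<close>

lemma deriv_smooth_step_outside: "x \<notin> {0..1} \<Longrightarrow> deriv smooth_step x = 0"
proof -
  assume "x \<notin> {0..1}"
  then consider "x < 0" | "x > 1" by fastforce
  then show ?thesis
  proof cases
    case 1
    have "(smooth_step has_real_derivative 0) (at x)"
      by (rule has_field_derivative_transform_within_open[of "\<lambda>_. 0" _ _ "{..<0}"]) (use 1 in \<open>auto simp: smooth_step_0\<close>)
    then show ?thesis by (rule DERIV_imp_deriv)
  next
    case 2
    have "(smooth_step has_real_derivative 0) (at x)"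
      by (rule has_field_derivative_transform_within_open[of "\<lambda>_. 1" _ _ "{1<..}"]) (use 2 in \<open>auto simp: smooth_step_1\<close>)
    then show ?thesis by (rule DERIV_imp_deriv)
  qed
qed

lemma integral_deriv_smooth_step: "(LINT x|lborel. deriv smooth_step x) = 1"
proof -
  have "(LINT x|lborel. deriv smooth_step x * indicator {0..1} x) = smooth_step 1 - smooth_step 0"
    by (rule integral_FTC_Icc_real)
      (use DERIV_smooth_step continuous_deriv_smooth_step in \<open>auto simp: continuous_on_eq_continuous_at\<close>)
  moreover have "deriv smooth_step x * indicator {0..1} x = deriv smooth_step x" for x
    using deriv_smooth_step_outside[of x] by (auto simp: indicator_def)
  ultimately show ?thesis by (simp add: smooth_step_0 smooth_step_1)
qed

text \<open>The derivative of the smooth step lives on [0, 1] and has integral 1, so its scaled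
  copies are one-sided mollifiers at c. Substituting x = c + e y moves the scale into v, where
  dominated convergence applies.\<close>

lemma approximate_identity_tendsto:
  assumes v: "continuous_on {0..T} v" and c: "0 < c" "c < T"
  shows "(\<lambda>n. LINT x|leb T. deriv smooth_step ((x - c) / (1 / real (Suc n))) / (1 / real (Suc n)) * v x) \<longlonglongrightarrow> v c"
proof -
  define w where "w x = indicator {0<..<T} x * v x" for x
  have wm[measurable]: "w \<in> borel_measurable borel" using integral_lebesgue_on_Ioo(2)[OF v] by (simp add: w_def[abs_def])
  have zm[measurable]: "deriv smooth_step \<in> borel_measurable borel"
    by (rule borel_measurable_continuous_onI[OF continuous_deriv_smooth_step])
  have "bounded (v ` {0..T})" "bounded (deriv smooth_step ` {0..1})"
    by (intro compact_imp_bounded compact_continuous_image v continuous_on_subset[OF continuous_deriv_smooth_step]; simp)+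
  then obtain B0 K0 where "\<forall>x\<in>{0..T}. \<bar>v x\<bar> \<le> B0" "\<forall>x\<in>{0..1}. \<bar>deriv smooth_step x\<bar> \<le> K0"
    unfolding bounded_iff by auto
  then have B: "\<bar>w x\<bar> \<le> max B0 0" and K: "\<bar>deriv smooth_step x\<bar> \<le> max K0 0 * indicator {0..1} x" for x
    using deriv_smooth_step_outside[of x] by (auto simp: w_def indicator_def le_max_iff_disj)
  have eq: "(LINT x|lborel. deriv smooth_step ((x - c) / e) / e * w x) = (LINT y|lborel. deriv smooth_step y * w (c + e * y))" if "e > 0" for e
    using that by (subst lborel_integral_real_affine[of e _ c]) (auto simp: field_simps)
  have "(\<lambda>n. LINT y|lborel. deriv smooth_step y * w (c + (1 / real (Suc n)) * y)) \<longlonglongrightarrow> (LINT y|lborel. deriv smooth_step y * v c)"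
  proof (rule integral_dominated_convergence)
    show "integrable lborel (\<lambda>y. max K0 0 * max B0 0 * indicator {0..1::real} y)" by simp
    show "AE y in lborel. norm (deriv smooth_step y * w (c + 1 / real (Suc n) * y)) \<le> max K0 0 * max B0 0 * indicator {0..1} y" for n
    proof (rule AE_I2)
      fix y
      have "norm (deriv smooth_step y * w (c + 1 / real (Suc n) * y)) \<le> (max K0 0 * indicator {0..1} y) * max B0 0"
        unfolding real_norm_def abs_mult by (intro mult_mono K B) auto
      then show "norm (deriv smooth_step y * w (c + 1 / real (Suc n) * y)) \<le> max K0 0 * max B0 0 * indicator {0..1} y"
        by (simp add: mult_ac)
    qed
    show "AE y in lborel. (\<lambda>n. deriv smooth_step y * w (c + 1 / real (Suc n) * y)) \<longlonglongrightarrow> deriv smooth_step y * v c"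
    proof (intro AE_I2 tendsto_mult tendsto_const)
      fix y :: real
      have "(\<lambda>n. c + inverse (real (Suc n)) * y) \<longlonglongrightarrow> c + 0 * y"
        by (intro tendsto_intros LIMSEQ_inverse_real_of_nat)
      then have l: "(\<lambda>n. c + 1 / real (Suc n) * y) \<longlonglongrightarrow> c" by (simp add: inverse_eq_divide)
      have "continuous_on {0<..<T} w"
        by (rule continuous_on_eq[OF continuous_on_subset[OF v]]) (auto simp: w_def)
      then have "isCont w c" using c by (simp add: continuous_on_eq_continuous_at)
      from isCont_tendsto_compose[OF this l] show "(\<lambda>n. w (c + 1 / real (Suc n) * y)) \<longlonglongrightarrow> v c"
        using c by (simp add: w_def)
    qed
  qed measurable
  note lim = this
  have one: "(LINT y|lborel. deriv smooth_step y * v c) = v c" by (simp add: integral_deriv_smooth_step)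
  have pos: "1 / real (Suc n) > 0" for n by simp
  have "(\<lambda>n. LINT x|lborel. deriv smooth_step ((x - c) / (1 / real (Suc n))) / (1 / real (Suc n)) * w x) \<longlonglongrightarrow> v c"
    unfolding eq[OF pos] using lim unfolding one .
  moreover have "(LINT x|leb T. deriv smooth_step ((x - c) / e) / e * v x) = (LINT x|lborel. deriv smooth_step ((x - c) / e) / e * w x)" if "e > 0" for e
  proof -
    have "continuous_on {0..T} (\<lambda>x. deriv smooth_step ((x - c) / e) / e * v x)"
      by (intro continuous_intros v continuous_on_compose2[OF continuous_deriv_smooth_step]) (use that in auto)
    from integral_lebesgue_on_Ioo(1)[OF this] show ?thesis by (simp only: w_def mult.left_commute)
  qed
  ultimately show ?thesis by (simp only: pos)
qed

text \<open>D = v - P, with P the primitive of p, has zero weak derivative. The derivative of a bump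
  is a mollifier at a minus a mollifier at b, so testing with bumps yields D a = D b in the limit;
  continuity extends this to the closed interval.\<close>

theorem weak_derivative_continuous:
  fixes v p :: "real \<Rightarrow> real"
  assumes T: "T > 0" and v: "continuous_on {0..T} v" and p: "continuous_on {0..T} p"
    and w: "\<And>\<psi>. \<psi> \<in> test_functions {0<..<T} \<Longrightarrow>
      (LINT t|leb T. deriv \<psi> t * v t) = - (LINT t|leb T. \<psi> t * p t)"
    and t: "t \<in> {0..T}"
  shows "v t = v 0 + (LINT r|lborel. indicator {0..t} r * p r)"
proof -
  define P where "P t = integral {0..t} p" for t
  have Pd: "(P has_vector_derivative p t) (at t within {0..T})" if "t \<in> {0..T}" for t
    unfolding P_def by (rule integral_has_vector_derivative[OF p that])
  have Pc: "continuous_on {0..T} P"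
    unfolding P_def by (intro indefinite_integral_continuous_1 integrable_continuous_interval p)
  define D where "D t = v t - P t" for t
  have Dc: "continuous_on {0..T} D" unfolding D_def by (intro continuous_on_diff v Pc)
  have z: "(LINT t|leb T. deriv \<psi> t * D t) = 0" if \<psi>: "\<psi> \<in> test_functions {0<..<T}" for \<psi>
  proof -
    have "integrable (leb T) (\<lambda>t. deriv \<psi> t * z t)" if "continuous_on {0..T} z" for z
      by (intro continuous_integral_Ioo(1) continuous_on_mult that continuous_on_subset[OF test_function_real(2)[OF \<psi>]]) simp
    then show ?thesis
      using w[OF \<psi>] test_function_by_parts[OF \<psi> T Pd p] v Pc by (simp add: D_def right_diff_distrib)
  qed
  have eq: "D a = D b" if ab: "0 < a" "a < b" "b < T" for a b
  proof -
    define Z where "Z n c x = deriv smooth_step ((x - c) / (1 / real (Suc n))) / (1 / real (Suc n))" for n c x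
    have Zi: "integrable (leb T) (\<lambda>x. Z n c x * D x)" for n c
      unfolding Z_def by (intro continuous_integral_Ioo(1) continuous_intros Dc continuous_on_compose2[OF continuous_deriv_smooth_step]) auto
    have "(\<lambda>n. (LINT x|leb T. Z n a x * D x) - (LINT x|leb T. Z n b x * D x)) \<longlonglongrightarrow> D a - D b"
      unfolding Z_def using ab by (intro tendsto_diff approximate_identity_tendsto Dc) auto
    moreover have "\<forall>\<^sub>F n in sequentially. (LINT x|leb T. Z n a x * D x) - (LINT x|leb T. Z n b x * D x) = 0"
      using bump_eventually_test_function[OF ab]
    proof eventually_elim
      case (elim n)
      have "deriv (bump (1 / real (Suc n)) a b) x = Z n a x - Z n b x" for x
        unfolding Z_def by (rule DERIV_imp_deriv[OF deriv_bump])
      then show ?case using z[OF elim] Zi by (simp add: left_diff_distrib)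
    qed
    ultimately have "(\<lambda>n. 0) \<longlonglongrightarrow> D a - D b" by (simp only: tendsto_cong)
    then show ?thesis by (simp add: LIMSEQ_const_iff)
  qed
  have Deq: "D x = D (T / 2)" if x: "x \<in> {0<..<T}" for x
  proof (cases x "T / 2" rule: linorder_cases)
    case less
    show ?thesis by (rule eq) (use x less in auto)
  next
    case greater
    show ?thesis by (rule eq[symmetric]) (use x greater in auto)
  qed (simp only:)
  have cl: "closure {0<..<T} = {0..T}" using T by simp
  have const: "D t = D (T / 2)" if "t \<in> {0..T}" for t
    by (rule continuous_constant_on_closure[of "{0<..<T}" D]) (use Dc cl that Deq in \<open>simp_all only:\<close>)
  have "D 0 = D (T / 2)" by (rule const) (use T in simp)
  with const[OF t] have "D t = D 0" by (simp only:)
  then show ?thesis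
    using continuous_integral_Icc(2)[OF continuous_on_subset[OF p], of 0 t] t by (simp add: D_def P_def)
qed

section \<open>The scalar equation\<close>

text \<open>Taken over the whole line, so that associativity is Fubini without moving limits of
  integration. Causality enters through factors that vanish at negative times.\<close>

definition conv :: "(real \<Rightarrow> real) \<Rightarrow> (real \<Rightarrow> real) \<Rightarrow> real \<Rightarrow> real" where
  "conv a b t = (LINT r|lborel. a (t - r) * b r)"

lemma integrable_shift_reflect:
  fixes a :: "real \<Rightarrow> real"
  assumes "integrable lborel a"
  shows "integrable lborel (\<lambda>r. a (t - r))" "integrable lborel (\<lambda>r. a (r - t))"
    "(LINT r|lborel. a (t - r)) = (LINT r|lborel. a r)" "(LINT r|lborel. a (r - t)) = (LINT r|lborel. a r)"
  using lborel_integrable_real_affine[OF assms, of "-1" t] lborel_integral_real_affine[of "-1" a t]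
    lborel_integrable_real_affine[OF assms, of 1 "-t"] lborel_integral_real_affine[of 1 a "-t"]
  by (auto simp: algebra_simps)

lemma conv_commute: "conv a b t = conv b a t"
  unfolding conv_def using lborel_integral_real_affine[of "-1" "\<lambda>r. a (t - r) * b r" t] by (simp add: mult.commute)

text \<open>Identities between kernels truncated at T, and between functions on [0, T], hold only up
  to time T. This and \<open>conv_kernel_cong\<close> make them usable inside a convolution
  evaluated at t \<le> T, where later times do not enter.\<close>

lemma conv_cong:
  assumes "\<And>r. r < t \<Longrightarrow> b r = b' r" "\<And>\<tau>. \<tau> \<le> 0 \<Longrightarrow> a \<tau> = 0"
  shows "conv a b t = conv a b' t"
  unfolding conv_def
proof (rule Bochner_Integration.integral_cong[OF refl])
  fix r show "a (t - r) * b r = a (t - r) * b' r"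
    using assms(1)[of r] assms(2)[of "t - r"] by (cases "r < t") auto
qed

lemma conv_kernel_cong:
  assumes "\<And>\<tau>. \<tau> \<le> t \<Longrightarrow> a \<tau> = a' \<tau>" "\<And>r. r < 0 \<Longrightarrow> b r = 0"
  shows "conv a b t = conv a' b t"
  unfolding conv_def
proof (rule Bochner_Integration.integral_cong[OF refl])
  fix r show "a (t - r) * b r = a' (t - r) * b r"
    using assms(1)[of "t - r"] assms(2)[of r] by (cases "r < 0") auto
qed

lemma integrable_conv_bounded:
  fixes a b :: "real \<Rightarrow> real"
  assumes a: "integrable lborel a" and b: "b \<in> borel_measurable borel" "\<And>r. \<bar>b r\<bar> \<le> M"
  shows "integrable lborel (\<lambda>r. a (t - r) * b r)"
proof (rule Bochner_Integration.integrable_bound)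
  show "integrable lborel (\<lambda>r. M * a (t - r))" using integrable_shift_reflect(1)[OF a] by simp
  show "(\<lambda>r. a (t - r) * b r) \<in> borel_measurable lborel" using a b by measurable
  have "norm (a (t - r) * b r) \<le> norm (M * a (t - r))" for r
  proof -
    have "\<bar>b r\<bar> * \<bar>a (t - r)\<bar> \<le> \<bar>M\<bar> * \<bar>a (t - r)\<bar>" using b(2)[of r] by (intro mult_right_mono) auto
    then show ?thesis by (simp add: abs_mult mult.commute)
  qed
  then show "AE r in lborel. norm (a (t - r) * b r) \<le> norm (M * a (t - r))" by simp
qed

lemma conv_abs_le:
  assumes a: "integrable lborel a" and b: "b \<in> borel_measurable borel" "\<And>r. \<bar>b r\<bar> \<le> M"
  shows "\<bar>conv a b t\<bar> \<le> M * (LINT r|lborel. \<bar>a r\<bar>)"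
proof -
  have "\<bar>conv a b t\<bar> \<le> (LINT r|lborel. M * \<bar>a (t - r)\<bar>)"
    unfolding conv_def
  proof (rule order_trans[OF integral_abs_bound], rule integral_mono)
    show "integrable lborel (\<lambda>r. \<bar>a (t - r) * b r\<bar>)" using integrable_conv_bounded[OF a b] by simp
    show "integrable lborel (\<lambda>r. M * \<bar>a (t - r)\<bar>)" using integrable_shift_reflect(1)[OF a] by simp
    show "\<bar>a (t - r) * b r\<bar> \<le> M * \<bar>a (t - r)\<bar>" for r
      using mult_right_mono[OF b(2)[of r], of "\<bar>a (t - r)\<bar>"] by (simp add: abs_mult mult.commute)
  qed
  also have "\<dots> = M * (LINT r|lborel. \<bar>a r\<bar>)"
    using integrable_shift_reflect(3)[of "\<lambda>r. \<bar>a r\<bar>" t] a by simp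
  finally show ?thesis .
qed

lemma conv_measurable [measurable]:
  assumes [measurable]: "a \<in> borel_measurable borel" "b \<in> borel_measurable borel"
  shows "conv a b \<in> borel_measurable borel"
proof -
  have "(\<lambda>t. LINT r|lborel. a (t - r) * b r) \<in> borel_measurable lborel" by measurable
  then show ?thesis by (simp add: conv_def[abs_def])
qed

text \<open>Fubini, with |a(t - r)| times a bound for the convolution of |b| and |c| as integrable
  majorant in r; for this it is enough that c is bounded.\<close>

lemma conv_assoc:
  assumes a: "integrable lborel a" and b: "integrable lborel b"
    and c: "c \<in> borel_measurable borel" "\<And>r. \<bar>c r\<bar> \<le> M"
  shows "conv a (conv b c) t = conv (conv a b) c t"
proof -
  have [measurable]: "a \<in> borel_measurable borel" "b \<in> borel_measurable borel" "c \<in> borel_measurable borel"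
    using a b c by auto
  have M: "M \<ge> 0" using c(2)[of 0] by linarith
  define k where "k = (\<lambda>(r, q). a (t - r) * (b (r - q) * c q))"
  have inn: "integrable lborel (\<lambda>q. b (r - q) * c q)" for r by (rule integrable_conv_bounded[OF b c])
  have I: "integrable (lborel \<Otimes>\<^sub>M lborel) k"
  proof (rule lborel_pair.Fubini_integrable)
    show "k \<in> borel_measurable (lborel \<Otimes>\<^sub>M lborel)" unfolding k_def by measurable
    show "AE r in lborel. integrable lborel (\<lambda>q. k (r, q))" unfolding k_def using inn by auto
    have le: "(LINT q|lborel. norm (k (r, q))) \<le> \<bar>a (t - r)\<bar> * (M * (LINT r|lborel. \<bar>b r\<bar>))" for r
    proof -
      have "(LINT q|lborel. norm (k (r, q))) = \<bar>a (t - r)\<bar> * (LINT q|lborel. \<bar>b (r - q) * c q\<bar>)"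
        by (simp add: k_def abs_mult)
      also have "(LINT q|lborel. \<bar>b (r - q) * c q\<bar>) = conv (\<lambda>r. \<bar>b r\<bar>) (\<lambda>r. \<bar>c r\<bar>) r" by (simp add: conv_def abs_mult)
      also have "\<dots> \<le> M * (LINT r|lborel. \<bar>\<bar>b r\<bar>\<bar>)"
        by (rule order_trans[OF abs_ge_self conv_abs_le]) (use b c in auto)
      finally show ?thesis by (simp add: mult_left_mono)
    qed
    show "integrable lborel (\<lambda>r. LINT q|lborel. norm (k (r, q)))"
    proof (rule Bochner_Integration.integrable_bound)
      show "integrable lborel (\<lambda>r. \<bar>a (t - r)\<bar> * (M * (LINT r|lborel. \<bar>b r\<bar>)))"
        using integrable_shift_reflect(1)[OF a] by simp
      show "(\<lambda>r. LINT q|lborel. norm (k (r, q))) \<in> borel_measurable lborel" unfolding k_def by simp measurable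
      show "AE r in lborel. norm (LINT q|lborel. norm (k (r, q))) \<le> norm (\<bar>a (t - r)\<bar> * (M * (LINT r|lborel. \<bar>b r\<bar>)))"
        using le M by (intro AE_I2) (simp add: abs_mult)
    qed
  qed
  have "conv a (conv b c) t = (LINT r|lborel. LINT q|lborel. k (r, q))"
    by (simp add: conv_def k_def)
  also have "\<dots> = (LINT q|lborel. LINT r|lborel. k (r, q))"
    using lborel_pair.Fubini_integral[of "\<lambda>r q. k (r, q)"] I by simp
  also have "\<dots> = (LINT q|lborel. conv a b (t - q) * c q)"
  proof (rule Bochner_Integration.integral_cong[OF refl])
    fix q
    have "(LINT r|lborel. k (r, q)) = (LINT r|lborel. a (t - r) * b (r - q)) * c q"
      by (simp add: k_def mult.assoc[symmetric])
    also have "(LINT r|lborel. a (t - r) * b (r - q)) = (LINT r|lborel. a (t - q - r) * b r)"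
      by (subst lborel_integral_real_affine[of 1 _ q]) (auto simp: algebra_simps)
    finally show "(LINT r|lborel. k (r, q)) = conv a b (t - q) * c q" by (simp add: conv_def)
  qed
  finally show ?thesis by (simp add: conv_def)
qed

lemma conv_lincomb:
  assumes a: "integrable lborel a" "integrable lborel a'" and b: "b \<in> borel_measurable borel" "\<And>r. \<bar>b r\<bar> \<le> M"
  shows "conv (\<lambda>r. x * a r + y * a' r) b t = x * conv a b t + y * conv a' b t"
proof -
  have "(x * a (t - r) + y * a' (t - r)) * b r = x * (a (t - r) * b r) + y * (a' (t - r) * b r)" for r
    by (simp add: algebra_simps)
  then show ?thesis
    using integrable_conv_bounded[OF a(1) b, of t] integrable_conv_bounded[OF a(2) b, of t] by (simp add: conv_def)
qed

text \<open>Translation is continuous in \<open>L\<^sup>1\<close>; for an almost everywhere continuous \<open>a\<close> this is Scheffe's lemma.\<close>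

lemma conv_continuous:
  assumes a: "integrable lborel a" and F: "finite F" "\<And>x. x \<notin> F \<Longrightarrow> isCont a x"
    and b: "b \<in> borel_measurable borel" "\<And>r. \<bar>b r\<bar> \<le> M"
  shows "continuous_on UNIV (conv a b)"
proof -
  have "isCont (conv a b) t" for t
    unfolding continuous_at_sequentially o_def
  proof (intro allI impI)
    fix X :: "nat \<Rightarrow> real" assume X: "X \<longlonglongrightarrow> t"
    have L1: "(\<lambda>n. \<integral>\<^sup>+ r. norm (a (X n - r) - a (t - r)) \<partial>lborel) \<longlonglongrightarrow> 0"
    proof (rule Scheffe_lemma2)
      show "integrable lborel (\<lambda>r. a (t - r))" "\<And>n. (\<lambda>r. a (X n - r)) \<in> borel_measurable lborel"
        using integrable_shift_reflect(1)[OF a] by auto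
      have "AE r in lborel. r \<notin> (\<lambda>x. t - x) ` F"
        by (rule AE_not_in) (use F(1) in \<open>auto intro!: finite_imp_null_set_lborel\<close>)
      then show "AE r in lborel. (\<lambda>n. a (X n - r)) \<longlonglongrightarrow> a (t - r)"
      proof eventually_elim
        case (elim r)
        then have "t - r \<notin> F" by (metis diff_diff_eq2 add_diff_cancel_left' image_eqI)
        from isCont_tendsto_compose[OF F(2)[OF this] tendsto_diff[OF X tendsto_const]] show ?case .
      qed
      fix n
      have "(\<integral>\<^sup>+ r. norm (a (s - r)) \<partial>lborel) = ennreal (LINT r|lborel. \<bar>a r\<bar>)" for s
        using integrable_shift_reflect[of "\<lambda>r. \<bar>a r\<bar>" s] a by (subst nn_integral_eq_integral) auto
      then show "(\<integral>\<^sup>+ r. norm (a (X n - r)) \<partial>lborel) \<le> (\<integral>\<^sup>+ r. norm (a (t - r)) \<partial>lborel)" by simp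
    qed
    have di: "integrable lborel (\<lambda>r. \<bar>a (X n - r) - a (t - r)\<bar>)" for n
      using integrable_shift_reflect(1)[OF a] by auto
    have M: "M \<ge> 0" using b(2)[of 0] by linarith
    have "(\<lambda>n. ennreal (LINT r|lborel. \<bar>a (X n - r) - a (t - r)\<bar>)) \<longlonglongrightarrow> ennreal 0"
      using L1 nn_integral_eq_integral[OF di] by simp
    then have lim: "(\<lambda>n. LINT r|lborel. \<bar>a (X n - r) - a (t - r)\<bar>) \<longlonglongrightarrow> 0"
      by (subst (asm) tendsto_ennreal_iff) auto
    have "(\<lambda>n. conv a b (X n) - conv a b t) \<longlonglongrightarrow> 0"
    proof (rule Lim_null_comparison)
      show "(\<lambda>n. M * (LINT r|lborel. \<bar>a (X n - r) - a (t - r)\<bar>)) \<longlonglongrightarrow> 0"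
        using tendsto_mult_left[OF lim, of M] by simp
      show "\<forall>\<^sub>F n in sequentially. norm (conv a b (X n) - conv a b t) \<le> M * (LINT r|lborel. \<bar>a (X n - r) - a (t - r)\<bar>)"
      proof (intro always_eventually allI)
        fix n
        note i = integrable_conv_bounded[OF a b]
        have "conv a b (X n) - conv a b t = (LINT r|lborel. (a (X n - r) - a (t - r)) * b r)"
          unfolding conv_def left_diff_distrib using i by simp
        also have "\<bar>\<dots>\<bar> \<le> (LINT r|lborel. M * \<bar>a (X n - r) - a (t - r)\<bar>)"
        proof (rule order_trans[OF integral_abs_bound], rule integral_mono)
          show "integrable lborel (\<lambda>r. \<bar>(a (X n - r) - a (t - r)) * b r\<bar>)"
            unfolding left_diff_distrib using i by auto
          show "integrable lborel (\<lambda>r. M * \<bar>a (X n - r) - a (t - r)\<bar>)" using di by simp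
          show "\<bar>(a (X n - r) - a (t - r)) * b r\<bar> \<le> M * \<bar>a (X n - r) - a (t - r)\<bar>" for r
            using mult_right_mono[OF b(2)[of r], of "\<bar>a (X n - r) - a (t - r)\<bar>"] by (simp add: abs_mult mult.commute)
        qed
        finally show "norm (conv a b (X n) - conv a b t) \<le> M * (LINT r|lborel. \<bar>a (X n - r) - a (t - r)\<bar>)" by simp
      qed
    qed
    then show "(\<lambda>n. conv a b (X n)) \<longlonglongrightarrow> conv a b t" by (rule LIM_zero_cancel)
  qed
  then show ?thesis by (simp add: continuous_on_eq_continuous_at)
qed

text \<open>Kernels are cut off at \<open>T\<close>, which makes them integrable and does not change
  convolutions on \<open>{0..T}\<close>.\<close>

definition power_kernel :: "real \<Rightarrow> real \<Rightarrow> real \<Rightarrow> real" where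
  "power_kernel T a t = (if 0 < t \<and> t \<le> T then t powr (a - 1) / Gamma a else 0)"

definition ml_kernel :: "real \<Rightarrow> real \<Rightarrow> real \<Rightarrow> real \<Rightarrow> real \<Rightarrow> real" where
  "ml_kernel \<gamma> l T \<mu> t = (if 0 < t \<and> t \<le> T then t powr (\<mu> - 1) * mittag_leffler \<gamma> \<mu> (- l * t powr \<gamma>) else 0)"

lemma power_kernel_nonneg: "a > 0 \<Longrightarrow> 0 \<le> power_kernel T a t"
  by (auto simp: power_kernel_def)

lemma powr_cutoff_integral:
  fixes a T :: real
  assumes a: "a > 0" and T: "T \<ge> 0"
  shows "has_bochner_integral lborel (\<lambda>t. if 0 < t \<and> t \<le> T then t powr (a - 1) else 0) (T powr a / a)"
proof -
  have "has_bochner_integral lborel (\<lambda>x. indicator {0..T} x * (x - 0) powr (a - 1)) ((T - 0) powr (a - 1 + 1) / (a - 1 + 1))"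
    by (rule integral_powr_kernel) (use assms in auto)
  moreover have "indicator {0..T} x * (x - 0) powr (a - 1) = (if 0 < x \<and> x \<le> T then x powr (a - 1) else 0)" for x
    by (cases "x = 0") (auto simp: indicator_def)
  ultimately show ?thesis by simp
qed

lemma power_kernel_integrable: "a > 0 \<Longrightarrow> T \<ge> 0 \<Longrightarrow> integrable lborel (power_kernel T a)"
proof -
  assume "a > 0" "T \<ge> 0"
  from integrable.intros[OF has_bochner_integral_mult_right[OF powr_cutoff_integral[OF this], of "1 / Gamma a"]]
  show ?thesis by (rule Bochner_Integration.integrable_cong[THEN iffD1, rotated 2]) (auto simp: power_kernel_def)
qed

text \<open>The substitution r = t x gives a Beta integral. This is the semigroup law of fractional
  integration; for t \<le> T the truncation is invisible.\<close>

lemma conv_power_kernel: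
  assumes a: "a > 0" and b: "b > 0" and t: "t \<le> T"
  shows "has_bochner_integral lborel (\<lambda>r. power_kernel T a (t - r) * power_kernel T b r) (power_kernel T (a + b) t)"
proof (cases "t > 0")
  case False
  then have "power_kernel T a (t - r) * power_kernel T b r = 0" "power_kernel T (a + b) t = 0" for r
    by (auto simp: power_kernel_def)
  then show ?thesis by (simp only: has_bochner_integral_zero)
next
  case True
  define f where "f r = power_kernel T a (t - r) * power_kernel T b r" for r
  have "((\<lambda>x. x powr (b - 1) * (1 - x) powr (a - 1)) has_integral Beta b a) {0..1}"
    by (rule has_integral_Beta_real[OF b a])
  from nn_integral_has_integral_lebesgue[OF _ this]
  have "(\<integral>\<^sup>+ x. ennreal (indicator {0..1} x * (x powr (b - 1) * (1 - x) powr (a - 1))) \<partial>lborel) = ennreal (Beta b a)" by auto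
  moreover have "Beta b a > 0" using a b by (simp add: Beta_def)
  ultimately have B: "has_bochner_integral lborel (\<lambda>x. indicator {0..1} x * (x powr (b - 1) * (1 - x) powr (a - 1))) (Beta b a)"
    by (intro has_bochner_integral_nn_integral) auto
  have eq: "f (0 + t * x) = t powr (a + b - 2) / (Gamma a * Gamma b) * (indicator {0..1} x * (x powr (b - 1) * (1 - x) powr (a - 1)))" for x
  proof (cases "0 < x \<and> x < 1")
    case x: True
    have "t * x < t * 1" using True x by (intro mult_strict_left_mono) auto
    moreover have "t - t * x = t * (1 - x)" by (simp add: algebra_simps)
    moreover have "0 < t * (1 - x)" using True x by simp
    moreover have "0 < t * x" using True x by simp
    ultimately have "f (0 + t * x) = (t * (1 - x)) powr (a - 1) / Gamma a * ((t * x) powr (b - 1) / Gamma b)"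
      using t by (auto simp: f_def power_kernel_def)
    also have "\<dots> = (t powr (a - 1) * t powr (b - 1)) / (Gamma a * Gamma b) * (x powr (b - 1) * (1 - x) powr (a - 1))"
      using True x by (simp add: powr_mult)
    also have "t powr (a - 1) * t powr (b - 1) = t powr (a + b - 2)" by (simp add: powr_add[symmetric])
    finally show ?thesis using x by simp
  next
    case False
    then have "x \<le> 0 \<or> 1 \<le> x" by auto
    then have "t * x \<le> 0 \<or> t - t * x \<le> 0" using True by (auto simp: mult_nonneg_nonpos)
    then have "f (0 + t * x) = 0" by (auto simp: f_def power_kernel_def)
    moreover have "indicator {0..1} x * (x powr (b - 1) * (1 - x) powr (a - 1)) = 0"
      using False by (cases "x = 0"; cases "x = 1") (auto simp: indicator_def)
    ultimately show ?thesis by simp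
  qed
  have "has_bochner_integral lborel (\<lambda>x. f (0 + t * x)) (t powr (a + b - 2) / (Gamma a * Gamma b) * Beta b a)"
    unfolding eq by (rule has_bochner_integral_mult_right[OF B])
  also have "t powr (a + b - 2) / (Gamma a * Gamma b) * Beta b a = power_kernel T (a + b) t /\<^sub>R \<bar>t\<bar>"
  proof -
    have "t powr (a + b - 1) = t powr (a + b - 2) * t" using True powr_add[of t "a + b - 2" 1] by simp
    moreover have "Gamma a \<noteq> 0" "Gamma b \<noteq> 0"
      using Gamma_real_pos[OF a] Gamma_real_pos[OF b] by (metis less_irrefl)+
    ultimately show ?thesis using True t
      by (simp add: power_kernel_def Beta_def add.commute)
  qed
  finally show ?thesis
    using lborel_has_bochner_integral_real_affine_iff[of t f "power_kernel T (a + b) t" 0] True by (simp add: f_def[abs_def])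
qed

lemma mittag_leffler_rec:
  assumes \<gamma>: "\<gamma> > 1" and \<mu>: "\<mu> > 0"
  shows "mittag_leffler \<gamma> \<mu> z = 1 / Gamma \<mu> + z * mittag_leffler \<gamma> (\<mu> + \<gamma>) z"
proof -
  have "mittag_leffler \<gamma> \<mu> z = (\<Sum>k. z ^ Suc k / Gamma (\<gamma> * real (Suc k) + \<mu>)) + 1 / Gamma \<mu>"
    unfolding mittag_leffler_def by (subst suminf_split_head[OF mittag_leffler_summable(2)[OF assms]]) auto
  also have "(\<lambda>k. z ^ Suc k / Gamma (\<gamma> * real (Suc k) + \<mu>)) = (\<lambda>k. z * (z ^ k / Gamma (\<gamma> * real k + (\<mu> + \<gamma>))))"
    by (simp add: fun_eq_iff algebra_simps)
  also have "(\<Sum>k. z * (z ^ k / Gamma (\<gamma> * real k + (\<mu> + \<gamma>)))) = z * mittag_leffler \<gamma> (\<mu> + \<gamma>) z"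
    unfolding mittag_leffler_def using assms by (intro suminf_mult mittag_leffler_summable) auto
  finally show ?thesis by simp
qed

section \<open>Mittag-Leffler kernels under fractional integration\<close>

locale ml_kernels =
  fixes \<gamma> T :: real
  assumes \<gamma>: "1 < \<gamma>" "\<gamma> < 2" and T: "T > 0"
begin

abbreviation mlk where "mlk l \<equiv> ml_kernel \<gamma> l T"

text \<open>Together with \<open>conv_ml_kernel\<close> this is, on [0, T], the resolvent equation k
  + l I^\<gamma> k = power kernel of order \<mu>, where k is \<open>mlk l \<mu>\<close> and
  I^\<gamma> denotes fractional integration.\<close>

lemma ml_kernel_rec:
  assumes "\<mu> > 0"
  shows "mlk l \<mu> t = power_kernel T \<mu> t - l * mlk l (\<mu> + \<gamma>) t"
proof (cases "0 < t \<and> t \<le> T")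
  case True
  have "t powr (\<mu> + \<gamma> - 1) = t powr (\<mu> - 1) * t powr \<gamma>" by (simp add: powr_add[symmetric] algebra_simps)
  moreover have "mlk l \<mu> t = t powr (\<mu> - 1) * (1 / Gamma \<mu> + (- l * t powr \<gamma>) * mittag_leffler \<gamma> (\<mu> + \<gamma>) (- l * t powr \<gamma>))"
    using True unfolding ml_kernel_def mittag_leffler_rec[OF \<gamma>(1) assms, of "- l * t powr \<gamma>"] by (simp only: if_True simp_thms)
  ultimately show ?thesis using True
    by (simp add: ml_kernel_def power_kernel_def algebra_simps)
qed (auto simp: ml_kernel_def power_kernel_def)

lemma ml_kernel_sums:
  assumes "\<mu> > 0"
  shows "(\<lambda>k. (- l) ^ k * power_kernel T (\<gamma> * real k + \<mu>) t) sums mlk l \<mu> t"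
proof (cases "0 < t \<and> t \<le> T")
  case True
  then show ?thesis using mittag_leffler_kernel_series[OF \<gamma>(1) assms, of t l "\<mu> - 1"]
    by (simp add: ml_kernel_def power_kernel_def algebra_simps)
next
  case False
  then have "power_kernel T a t = 0" "mlk l \<mu> t = 0" for a
    by (auto simp: power_kernel_def ml_kernel_def)
  then show ?thesis by simp
qed

text \<open>A fixed choice turns the existential decay bound into a number depending on \<gamma>,
  \<beta>, \<mu> alone. Being the same for all l, it allows estimates to be summed over the
  modes.\<close>

definition ml_bound :: "real \<Rightarrow> real \<Rightarrow> real" where
  "ml_bound \<beta> \<mu> = (SOME C. C > 0 \<and> (\<forall>x>0. \<bar>mittag_leffler \<gamma> \<mu> (- x)\<bar> \<le> C * x powr (- \<beta>)))"

lemma ml_bound: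
  assumes "0 \<le> \<beta>" "\<beta> \<le> 1" "\<mu> > \<gamma> * \<beta>" "\<mu> > 0"
  shows "ml_bound \<beta> \<mu> > 0" "x > 0 \<Longrightarrow> \<bar>mittag_leffler \<gamma> \<mu> (- x)\<bar> \<le> ml_bound \<beta> \<mu> * x powr (- \<beta>)"
proof -
  have "\<exists>C. C > 0 \<and> (\<forall>x>0. \<bar>mittag_leffler \<gamma> \<mu> (- x)\<bar> \<le> C * x powr (- \<beta>))"
    by (rule mittag_leffler_decay[OF \<gamma> assms]) blast
  from someI_ex[OF this] show "ml_bound \<beta> \<mu> > 0" "x > 0 \<Longrightarrow> \<bar>mittag_leffler \<gamma> \<mu> (- x)\<bar> \<le> ml_bound \<beta> \<mu> * x powr (- \<beta>)"
    unfolding ml_bound_def by auto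
qed

text \<open>The factor l^\<beta> cancels against (l t^\<gamma>)^(-\<beta>). Later \<beta> is 0 or
  1/2, the latter paying for a square root of l.\<close>

lemma ml_kernel_bound:
  assumes "l > 0" "0 \<le> \<beta>" "\<beta> \<le> 1" "\<mu> > \<gamma> * \<beta>" "\<mu> > 0"
  shows "l powr \<beta> * \<bar>mlk l \<mu> t\<bar> \<le> ml_bound \<beta> \<mu> * (if 0 < t \<and> t \<le> T then t powr (\<mu> - \<gamma> * \<beta> - 1) else 0)"
proof (cases "0 < t \<and> t \<le> T")
  case True
  have x: "l * t powr \<gamma> > 0" using assms True by simp
  have "l powr \<beta> * \<bar>mlk l \<mu> t\<bar> = l powr \<beta> * t powr (\<mu> - 1) * \<bar>mittag_leffler \<gamma> \<mu> (- (l * t powr \<gamma>))\<bar>"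
    using True by (simp add: ml_kernel_def abs_mult)
  also have "\<dots> \<le> l powr \<beta> * t powr (\<mu> - 1) * (ml_bound \<beta> \<mu> * (l * t powr \<gamma>) powr (- \<beta>))"
    by (intro mult_left_mono ml_bound assms x) auto
  also have "\<dots> = ml_bound \<beta> \<mu> * ((l powr \<beta> * l powr (- \<beta>)) * (t powr (\<mu> - 1) * t powr (\<gamma> * (- \<beta>))))"
    using assms True by (simp add: powr_mult powr_powr)
  also have "l powr \<beta> * l powr (- \<beta>) = 1" using assms by (simp add: powr_add[symmetric])
  also have "t powr (\<mu> - 1) * t powr (\<gamma> * (- \<beta>)) = t powr (\<mu> - \<gamma> * \<beta> - 1)" by (simp add: powr_add[symmetric] algebra_simps)
  finally show ?thesis using True by simp
qed (auto simp: ml_kernel_def)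

lemma ml_kernel_measurable [measurable]:
  assumes "\<mu> > 0"
  shows "mlk l \<mu> \<in> borel_measurable borel"
proof -
  have [measurable]: "mittag_leffler \<gamma> \<mu> \<in> borel_measurable borel"
    by (rule borel_measurable_continuous_onI[OF continuous_mittag_leffler[OF \<gamma>(1) assms]])
  show ?thesis unfolding ml_kernel_def by measurable
qed

lemma ml_kernel_integrable:
  assumes l: "l > 0" and \<mu>: "\<mu> > 0"
  shows "integrable lborel (mlk l \<mu>)"
proof (rule Bochner_Integration.integrable_bound)
  show "integrable lborel (\<lambda>t. ml_bound 0 \<mu> * (if 0 < t \<and> t \<le> T then t powr (\<mu> - 1) else 0))"
    using integrable.intros[OF powr_cutoff_integral[OF \<mu>, of T]] T by simp
  show "mlk l \<mu> \<in> borel_measurable lborel" using ml_kernel_measurable[OF \<mu>] by simp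
  have "norm (mlk l \<mu> t) \<le> norm (ml_bound 0 \<mu> * (if 0 < t \<and> t \<le> T then t powr (\<mu> - 1) else 0))" for t
    using ml_kernel_bound[OF l, of 0 \<mu> t] l \<mu> by (auto simp: ml_kernel_def split: if_splits)
  then show "AE t in lborel. norm (mlk l \<mu> t) \<le> norm (ml_bound 0 \<mu> * (if 0 < t \<and> t \<le> T then t powr (\<mu> - 1) else 0))"
    by simp
qed

lemma ml_kernel_isCont:
  assumes \<mu>: "\<mu> > 0" and x: "x \<notin> {0, T}"
  shows "isCont (mlk l \<mu>) x"
proof -
  consider "x < 0" | "0 < x" "x < T" | "x > T" using x by fastforce
  then show ?thesis
  proof cases
    case 1
    have "isCont (\<lambda>_. 0::real) x" by simp
    then show ?thesis
      by (rule isCont_cong[THEN iffD1, rotated])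
        (use 1 in \<open>auto simp: eventually_nhds ml_kernel_def intro!: exI[of _ "{..<0}"]\<close>)
  next
    case 2
    have "isCont (mittag_leffler \<gamma> \<mu>) (- l * x powr \<gamma>)"
      using continuous_mittag_leffler[OF \<gamma>(1) \<mu>] by (simp add: continuous_on_eq_continuous_at)
    then have "isCont (\<lambda>t. mittag_leffler \<gamma> \<mu> (- l * t powr \<gamma>)) x"
      by (rule isCont_o2[rotated]) (use 2 in \<open>auto intro!: continuous_intros\<close>)
    then have "isCont (\<lambda>t. t powr (\<mu> - 1) * mittag_leffler \<gamma> \<mu> (- l * t powr \<gamma>)) x"
      using 2 by (intro continuous_intros) auto
    then show ?thesis
      by (rule isCont_cong[THEN iffD1, rotated])
        (use 2 in \<open>auto simp: eventually_nhds ml_kernel_def intro!: exI[of _ "{0<..<T}"]\<close>)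
  next
    case 3
    have "isCont (\<lambda>_. 0::real) x" by simp
    then show ?thesis
      by (rule isCont_cong[THEN iffD1, rotated])
        (use 3 in \<open>auto simp: eventually_nhds ml_kernel_def intro!: exI[of _ "{T<..}"]\<close>)
  qed
qed

text \<open>Termwise by the semigroup law: fractional integration of order a raises the second
  Mittag-Leffler index by a. Absolute convergence is read off the same series with -l for l.\<close>

lemma conv_ml_kernel:
  assumes l: "l > 0" and a: "a > 0" and \<mu>: "\<mu> > 0" and t: "t \<le> T"
  shows "conv (power_kernel T a) (mlk l \<mu>) t = mlk l (\<mu> + a) t"
    and "integrable lborel (\<lambda>r. power_kernel T a (t - r) * mlk l \<mu> r)"
proof -
  define u where "u k r = (- l) ^ k * (power_kernel T a (t - r) * power_kernel T (\<gamma> * real k + \<mu>) r)" for k r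
  have pos: "\<gamma> * real k + \<mu> > 0" for k using \<gamma> \<mu> by (intro add_nonneg_pos) auto
  have ui: "has_bochner_integral lborel (u k) ((- l) ^ k * power_kernel T (\<gamma> * real k + (\<mu> + a)) t)" for k
    using has_bochner_integral_mult_right[OF conv_power_kernel[OF a pos t], of "(- l) ^ k" k] by (simp add: u_def[abs_def] add_ac)
  have au: "\<bar>u k r\<bar> = l ^ k * (power_kernel T a (t - r) * power_kernel T (\<gamma> * real k + \<mu>) r)" for k r
    using l by (simp add: u_def abs_mult power_abs power_kernel_nonneg a pos)
  have aui: "(LINT r|lborel. norm (u k r)) = (- (- l)) ^ k * power_kernel T (\<gamma> * real k + (\<mu> + a)) t" for k
    using has_bochner_integral_mult_right[OF conv_power_kernel[OF a pos t], of "l ^ k" k]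
    by (simp add: au has_bochner_integral_iff add_ac)
  have S: "summable (\<lambda>k. LINT r|lborel. norm (u k r))"
    unfolding aui using ml_kernel_sums[of "\<mu> + a" "- l" t] \<mu> a by (simp add: sums_iff)
  have absS: "summable (\<lambda>k. norm (u k r))" for r
    using summable_mult[OF sums_summable[OF ml_kernel_sums[OF \<mu>, of "- l" r]], of "power_kernel T a (t - r)"]
    by (simp add: au mult_ac)
  have sumu: "(\<Sum>k. u k r) = power_kernel T a (t - r) * mlk l \<mu> r" for r
    using sums_mult[OF ml_kernel_sums[OF \<mu>, of l r], of "power_kernel T a (t - r)"]
    by (simp add: u_def sums_iff mult_ac)
  note int = integrable.intros[OF ui]
  show "integrable lborel (\<lambda>r. power_kernel T a (t - r) * mlk l \<mu> r)"
    using integrable_suminf[OF int AE_I2[OF absS] S] by (simp add: sumu)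
  have "(\<lambda>k. LINT r|lborel. u k r) sums conv (power_kernel T a) (mlk l \<mu>) t"
    using sums_integral[OF int AE_I2[OF absS] S] by (simp add: sumu conv_def)
  moreover have "(\<lambda>k. LINT r|lborel. u k r) sums mlk l (\<mu> + a) t"
    using ml_kernel_sums[of "\<mu> + a" l t] \<mu> a ui by (simp add: has_bochner_integral_iff)
  ultimately show "conv (power_kernel T a) (mlk l \<mu>) t = mlk l (\<mu> + a) t" by (rule sums_unique2)
qed

end

context ml_kernels begin

lemma interval_integral_conv:
  assumes "\<And>r. r \<le> 0 \<Longrightarrow> b r = 0" "t \<le> T" and b: "b \<in> borel_measurable borel"
  shows "(LINT r|lborel. indicator {0..t} r * b r) = conv (power_kernel T 1) b t"
  unfolding conv_def
proof (rule integral_cong_AE)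
  have [measurable]: "power_kernel T 1 \<in> borel_measurable borel" unfolding power_kernel_def by measurable
  show "(\<lambda>r. indicator {0..t} r * b r) \<in> borel_measurable lborel" using b by measurable
  show "(\<lambda>r. power_kernel T 1 (t - r) * b r) \<in> borel_measurable lborel" using b by measurable
  show "AE r in lborel. indicator {0..t} r * b r = power_kernel T 1 (t - r) * b r"
    using AE_lborel_singleton[of t]
  proof eventually_elim
    case (elim r)
    show ?case
      by (cases "r \<le> 0") (use elim assms in \<open>auto simp: indicator_def power_kernel_def\<close>)
  qed
qed

lemma kernels_measurable:
  "mlk l 1 \<in> borel_measurable borel" "mlk l 2 \<in> borel_measurable borel"
  "mlk l \<gamma> \<in> borel_measurable borel" "mlk l (1 + \<gamma>) \<in> borel_measurable borel"
  "mlk l (\<gamma> - 1) \<in> borel_measurable borel"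
  by (rule ml_kernel_measurable; use \<gamma> in simp)+

text \<open>The solution of \<open>\<partial>\<^sub>t\<^sup>\<gamma> y + l y = f\<close>, \<open>y(0) = g\<close>, \<open>y'(0) = h\<close>, and its derivative.\<close>

definition mode :: "real \<Rightarrow> real \<Rightarrow> real \<Rightarrow> (real \<Rightarrow> real) \<Rightarrow> real \<Rightarrow> real" where
  "mode l g h f t = mittag_leffler \<gamma> 1 (- l * t powr \<gamma>) * g + t * mittag_leffler \<gamma> 2 (- l * t powr \<gamma>) * h
     + conv (mlk l \<gamma>) f t"

definition mode' :: "real \<Rightarrow> real \<Rightarrow> real \<Rightarrow> (real \<Rightarrow> real) \<Rightarrow> real \<Rightarrow> real" where
  "mode' l g h f t = - l * (t powr (\<gamma> - 1) * mittag_leffler \<gamma> \<gamma> (- l * t powr \<gamma>)) * g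
     + mittag_leffler \<gamma> 1 (- l * t powr \<gamma>) * h + conv (mlk l (\<gamma> - 1)) f t"

end

section \<open>Solving the scalar equation\<close>

locale forcing = ml_kernels +
  fixes f :: "real \<Rightarrow> real" and M :: real
  assumes f_measurable [measurable]: "f \<in> borel_measurable borel" and f_bound: "\<And>t. \<bar>f t\<bar> \<le> M"
    and f_support: "\<And>t. t \<notin> {0<..<T} \<Longrightarrow> f t = 0"
begin

lemma conv_ml_nonpos: "t \<le> 0 \<Longrightarrow> conv (mlk l \<mu>) f t = 0"
proof -
  assume "t \<le> 0"
  then have "mlk l \<mu> (t - r) * f r = 0" for r
    using f_support[of r] by (cases "0 < r") (auto simp: ml_kernel_def)
  then show ?thesis by (simp only: conv_def Bochner_Integration.integral_zero)
qed

lemma conv_ml_continuous: "l > 0 \<Longrightarrow> \<mu> > 0 \<Longrightarrow> continuous_on UNIV (conv (mlk l \<mu>) f)"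
  by (rule conv_continuous[of _ "{0, T}"]) (auto intro: ml_kernel_integrable ml_kernel_isCont f_bound)

lemma conv_ml_bounded:
  assumes "l > 0" "\<mu> > 0" shows "\<bar>conv (mlk l \<mu>) f t\<bar> \<le> M * (LINT r|lborel. \<bar>mlk l \<mu> r\<bar>)"
  by (rule conv_abs_le) (use assms in \<open>auto intro: ml_kernel_integrable f_bound\<close>)

lemma conv_power_conv_ml:
  assumes l: "l > 0" and a: "a > 0" and \<mu>: "\<mu> > 0" and t: "t \<le> T"
  shows "conv (power_kernel T a) (conv (mlk l \<mu>) f) t = conv (mlk l (\<mu> + a)) f t"
proof -
  have "conv (power_kernel T a) (conv (mlk l \<mu>) f) t = conv (conv (power_kernel T a) (mlk l \<mu>)) f t"
    by (rule conv_assoc[OF power_kernel_integrable[OF a] ml_kernel_integrable[OF l \<mu>] f_measurable f_bound]) (use T in simp)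
  also have "\<dots> = conv (mlk l (\<mu> + a)) f t"
  proof (rule conv_kernel_cong)
    fix \<tau> assume "\<tau> \<le> t"
    then show "conv (power_kernel T a) (mlk l \<mu>) \<tau> = mlk l (\<mu> + a) \<tau>"
      using t by (intro conv_ml_kernel l a \<mu>) simp
  qed (use f_support in auto)
  finally show ?thesis .
qed

lemma conv_power_lincomb:
  assumes l: "l > 0" and a: "a > 0" and \<mu>: "\<mu> > 0" "\<mu>' > 0" "\<nu> > 0" and t: "t \<le> T"
  shows "conv (power_kernel T a) (\<lambda>r. x * mlk l \<mu> r + y * mlk l \<mu>' r + conv (mlk l \<nu>) f r) t
    = x * mlk l (\<mu> + a) t + y * mlk l (\<mu>' + a) t + conv (mlk l (\<nu> + a)) f t"
proof -
  have i: "integrable lborel (\<lambda>r. power_kernel T a (t - r) * conv (mlk l \<nu>) f r)"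
    by (rule integrable_conv_bounded[OF power_kernel_integrable[OF a] _ conv_ml_bounded[OF l \<mu>(3)]])
      (use T \<mu> in auto)
  have eq: "power_kernel T a (t - r) * (x * mlk l \<mu> r + y * mlk l \<mu>' r + conv (mlk l \<nu>) f r)
    = x * (power_kernel T a (t - r) * mlk l \<mu> r) + y * (power_kernel T a (t - r) * mlk l \<mu>' r)
      + power_kernel T a (t - r) * conv (mlk l \<nu>) f r" for r
    by (simp add: algebra_simps)
  have "conv (power_kernel T a) (\<lambda>r. x * mlk l \<mu> r + y * mlk l \<mu>' r + conv (mlk l \<nu>) f r) t
    = x * conv (power_kernel T a) (mlk l \<mu>) t + y * conv (power_kernel T a) (mlk l \<mu>') t
      + conv (power_kernel T a) (conv (mlk l \<nu>) f) t"
    unfolding conv_def[of "power_kernel T a"] eq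
    using i conv_ml_kernel(2)[OF l a \<mu>(1) t] conv_ml_kernel(2)[OF l a \<mu>(2) t] by simp
  then show ?thesis using conv_ml_kernel(1)[OF l a _ t] conv_power_conv_ml[OF l a \<mu>(3) t] \<mu> by simp
qed

lemma conv_ml_rec:
  assumes l: "l > 0" and \<mu>: "\<mu> > 0"
  shows "conv (mlk l \<mu>) f t = conv (power_kernel T \<mu>) f t - l * conv (mlk l (\<mu> + \<gamma>)) f t"
proof -
  have "conv (mlk l \<mu>) f t = conv (\<lambda>r. 1 * power_kernel T \<mu> r + (- l) * mlk l (\<mu> + \<gamma>) r) f t"
    by (rule arg_cong[where f = "\<lambda>k. conv k f t"]) (use ml_kernel_rec[OF \<mu>, of l] in auto)
  also have "\<dots> = 1 * conv (power_kernel T \<mu>) f t + (- l) * conv (mlk l (\<mu> + \<gamma>)) f t"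
    by (rule conv_lincomb[OF power_kernel_integrable[OF \<mu>] ml_kernel_integrable[OF l] f_measurable f_bound])
      (use T \<gamma> \<mu> in auto)
  finally show ?thesis by simp
qed

text \<open>The third form removes the constant term of the series multiplying h by the recursion.
  Then y' - h is a combination of kernels of the shape that \<open>conv_power_lincomb\<close> can
  integrate fractionally.\<close>

lemma mode_kernel:
  assumes "0 < t" "t \<le> T"
  shows "mode l g h f t = g * mlk l 1 t + h * mlk l 2 t + conv (mlk l \<gamma>) f t"
    "mode' l g h f t = - l * g * mlk l \<gamma> t + h * mlk l 1 t + conv (mlk l (\<gamma> - 1)) f t"
    "mode' l g h f t - h = - l * g * mlk l \<gamma> t + (- l * h) * mlk l (1 + \<gamma>) t + conv (mlk l (\<gamma> - 1)) f t"
proof -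
  show 1: "mode l g h f t = g * mlk l 1 t + h * mlk l 2 t + conv (mlk l \<gamma>) f t"
    "mode' l g h f t = - l * g * mlk l \<gamma> t + h * mlk l 1 t + conv (mlk l (\<gamma> - 1)) f t"
    using assms by (auto simp: mode_def mode'_def ml_kernel_def)
  have eq: "mlk l 1 t = 1 - l * mlk l (1 + \<gamma>) t"
    using ml_kernel_rec[of 1 l t] assms by (simp add: power_kernel_def)
  show "mode' l g h f t - h = - l * g * mlk l \<gamma> t + (- l * h) * mlk l (1 + \<gamma>) t + conv (mlk l (\<gamma> - 1)) f t"
    unfolding 1 eq by (simp add: algebra_simps)
qed

lemma mode_0: "l > 0 \<Longrightarrow> mode l g h f 0 = g" "l > 0 \<Longrightarrow> mode' l g h f 0 = h"
  by (simp_all add: mode_def mode'_def conv_ml_nonpos mittag_leffler_0)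

lemma mode_continuous:
  assumes l: "l > 0"
  shows "continuous_on {0..T} (mode l g h f)" "continuous_on {0..T} (mode' l g h f)"
proof -
  have ml: "continuous_on {0..T} (\<lambda>t. mittag_leffler \<gamma> \<mu> (- l * t powr \<gamma>))" if "\<mu> > 0" for \<mu>
    by (rule continuous_on_compose2[OF continuous_mittag_leffler[OF \<gamma>(1) that]])
      (use \<gamma> in \<open>auto intro!: continuous_intros continuous_on_powr'\<close>)
  have c: "continuous_on {0..T} (conv (mlk l \<mu>) f)" if "\<mu> > 0" for \<mu>
    using conv_ml_continuous[OF l that] by (rule continuous_on_subset) simp
  have p: "continuous_on {0..T} (\<lambda>t. t powr (\<gamma> - 1))" using \<gamma> by (intro continuous_on_powr') (auto intro!: continuous_intros)
  show "continuous_on {0..T} (mode l g h f)" "continuous_on {0..T} (mode' l g h f)"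
    unfolding mode_def mode'_def using \<gamma> by (intro continuous_intros ml c p; simp)+
qed

text \<open>Integration of order 1 raises every index of y' - h by one, and the recursion turns the
  result into y - g - t h. Working in integrated form, neither the singular kernel nor the
  convolution is ever differentiated.\<close>

theorem mode_derivative:
  assumes l: "l > 0" and t: "t \<in> {0..T}"
  shows "mode l g h f t = g + (LINT r|lborel. indicator {0..t} r * mode' l g h f r)"
proof -
  define z where "z r = - l * g * mlk l \<gamma> r + (- l * h) * mlk l (1 + \<gamma>) r + conv (mlk l (\<gamma> - 1)) f r" for r
  note [measurable] = kernels_measurable[of l]
  have [measurable]: "z \<in> borel_measurable borel" unfolding z_def by measurable
  have z0: "z r = 0" if "r \<le> 0" for r using that conv_ml_nonpos[OF that] by (simp add: z_def ml_kernel_def)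
  have h1: "(LINT r|lborel. indicator {0..t} r * h) = t * h" using t by simp
  have "integrable lborel (\<lambda>r. indicator {0..t} r *\<^sub>R mode' l g h f r)"
    by (rule borel_integrable_compact[OF compact_Icc continuous_on_subset[OF mode_continuous(2)[OF l]]]) (use t in auto)
  then have mi: "integrable lborel (\<lambda>r. indicator {0..t} r * mode' l g h f r)" by simp
  have hi: "integrable lborel (\<lambda>r. indicator {0..t} r * h)" using t by simp
  have AE: "AE r in lborel. indicator {0..t} r * z r = indicator {0..t} r * mode' l g h f r - indicator {0..t} r * h"
    using AE_lborel_singleton[of 0]
  proof eventually_elim
    case (elim r)
    then show ?case using t mode_kernel(3)[of r l g h] by (auto simp: z_def indicator_def)
  qed
  have "(LINT r|lborel. indicator {0..t} r * z r) = (LINT r|lborel. indicator {0..t} r * mode' l g h f r - indicator {0..t} r * h)"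
    by (rule integral_cong_AE[OF _ _ AE]) (use mi hi in \<open>auto intro: borel_measurable_diff\<close>)
  also have "\<dots> = (LINT r|lborel. indicator {0..t} r * mode' l g h f r) - t * h"
    using mi hi h1 by simp
  finally have "(LINT r|lborel. indicator {0..t} r * mode' l g h f r) = t * h + conv (power_kernel T 1) z t"
    using interval_integral_conv[of z t] z0 t by simp
  also have "conv (power_kernel T 1) z t = - l * g * mlk l (\<gamma> + 1) t + (- l * h) * mlk l (1 + \<gamma> + 1) t + conv (mlk l (\<gamma> - 1 + 1)) f t"
    unfolding z_def using l \<gamma> t by (intro conv_power_lincomb) auto
  finally have *: "(LINT r|lborel. indicator {0..t} r * mode' l g h f r) = t * h - l * g * mlk l (1 + \<gamma>) t - l * h * mlk l (2 + \<gamma>) t + conv (mlk l \<gamma>) f t"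
    by (simp add: add.commute)
  show ?thesis
  proof (cases "t = 0")
    case True
    then show ?thesis using * mode_0[OF l] conv_ml_nonpos[of 0] by (simp add: ml_kernel_def)
  next
    case False
    then have t': "0 < t" "t \<le> T" using t by auto
    have eqs: "mlk l 1 t = 1 - l * mlk l (1 + \<gamma>) t" "mlk l 2 t = t - l * mlk l (2 + \<gamma>) t"
      using ml_kernel_rec[of 1 l t] ml_kernel_rec[of 2 l t] t' Gamma_fact[of 1, where 'a=real] by (simp_all add: power_kernel_def)
    show ?thesis unfolding * mode_kernel(1)[OF t'] eqs by (simp add: algebra_simps)
  qed
qed

text \<open>Both sides reduce to the same kernels. Integration of order 2 - \<gamma> raises the
  indices \<gamma>, 1 + \<gamma>, \<gamma> - 1 of y' - h to 2, 3, 1. On the left, order 1 raises the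
  indices 1, 2, \<gamma> of y to 2, 3, 1 + \<gamma>, and \<open>conv_ml_rec\<close> merges the last
  of these with the integral of f.\<close>

theorem mode_caputo:
  assumes l: "l > 0" and t: "t \<in> {0..T}"
  shows "(LINT r|lborel. indicator {0..t} r * (f r - l * mode l g h f r))
    = 1 / Gamma (2 - \<gamma>) * (LINT r|lborel. indicator {0..t} r * ((t - r) powr (1 - \<gamma>) * (mode' l g h f r - h)))"
proof -
  define z where "z r = - l * g * mlk l \<gamma> r + (- l * h) * mlk l (1 + \<gamma>) r + conv (mlk l (\<gamma> - 1)) f r" for r
  define y where "y r = g * mlk l 1 r + h * mlk l 2 r + conv (mlk l \<gamma>) f r" for r
  note [measurable] = kernels_measurable[of l]
  have [measurable]: "z \<in> borel_measurable borel" "y \<in> borel_measurable borel"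
    unfolding z_def y_def by measurable
  have z0: "z r = 0" "y r = 0" if "r \<le> 0" for r using that conv_ml_nonpos[OF that] by (simp_all add: z_def y_def ml_kernel_def)
  have "integrable lborel (\<lambda>r. indicator {0..t} r *\<^sub>R mode l g h f r)"
    by (rule borel_integrable_compact[OF compact_Icc continuous_on_subset[OF mode_continuous(1)[OF l]]]) (use t in auto)
  then have mi: "integrable lborel (\<lambda>r. indicator {0..t} r * mode l g h f r)" by simp
  have fi: "integrable lborel (\<lambda>r. indicator {0..t} r * f r)"
  proof (rule Bochner_Integration.integrable_bound)
    show "integrable lborel (\<lambda>r. indicator {0..t} r * M)" using t by simp
    show "AE r in lborel. norm (indicator {0..t} r * f r) \<le> norm (indicator {0..t} r * M)"
      using f_bound by (intro AE_I2) (auto simp: indicator_def intro: order_trans[OF f_bound])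
  qed measurable
  have AE0: "AE r in lborel. r \<noteq> (0::real)" "AE r in lborel. r \<noteq> t" by (rule AE_lborel_singleton)+
  have L: "(LINT r|lborel. indicator {0..t} r * (f r - l * mode l g h f r)) = conv (mlk l 1) f t - l * (g * mlk l 2 t + h * mlk l 3 t)"
  proof -
    have "(LINT r|lborel. indicator {0..t} r * (f r - l * mode l g h f r)) = (LINT r|lborel. indicator {0..t} r * f r) - l * (LINT r|lborel. indicator {0..t} r * mode l g h f r)"
    proof -
      have "indicator {0..t} r * (f r - l * mode l g h f r) = indicator {0..t} r * f r - l * (indicator {0..t} r * mode l g h f r)" for r
        by (simp add: algebra_simps)
      then show ?thesis using mi fi by simp
    qed
    also have "(LINT r|lborel. indicator {0..t} r * mode l g h f r) = (LINT r|lborel. indicator {0..t} r * y r)"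
    proof (rule integral_cong_AE)
      show "AE r in lborel. indicator {0..t} r * mode l g h f r = indicator {0..t} r * y r"
        using AE0(1)
      proof eventually_elim
        case (elim r)
        then show ?case using t mode_kernel(1)[of r l g h] by (auto simp: y_def indicator_def)
      qed
    qed (use mi in measurable)
    also have "\<dots> = conv (power_kernel T 1) y t" using interval_integral_conv[of y t] z0 t by simp
    also have "\<dots> = g * mlk l (1 + 1) t + h * mlk l (2 + 1) t + conv (mlk l (\<gamma> + 1)) f t"
      unfolding y_def using l \<gamma> t by (intro conv_power_lincomb) auto
    also have "(LINT r|lborel. indicator {0..t} r * f r) = conv (power_kernel T 1) f t"
      using interval_integral_conv[of f t] f_support t by simp
    finally show ?thesis using conv_ml_rec[OF l, of 1 t] by (simp add: algebra_simps)
  qed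
  have "1 / Gamma (2 - \<gamma>) * (LINT r|lborel. indicator {0..t} r * ((t - r) powr (1 - \<gamma>) * (mode' l g h f r - h)))
     = (LINT r|lborel. 1 / Gamma (2 - \<gamma>) * (indicator {0..t} r * ((t - r) powr (1 - \<gamma>) * (mode' l g h f r - h))))" by simp
  also have "\<dots> = conv (power_kernel T (2 - \<gamma>)) z t"
    unfolding conv_def
  proof (rule integral_cong_AE)
    have [measurable]: "power_kernel T a \<in> borel_measurable borel" for a unfolding power_kernel_def by measurable
    have "(\<lambda>r. indicator {0..t} r *\<^sub>R mode' l g h f r) \<in> borel_measurable borel"
      by (intro borel_measurable_continuous_on_indicator continuous_on_subset[OF mode_continuous(2)[OF l]]) (use t in auto)
    then have [measurable]: "(\<lambda>r. indicator {0..t} r * mode' l g h f r) \<in> borel_measurable borel" by simp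
    have "(\<lambda>r. 1 / Gamma (2 - \<gamma>) * ((t - r) powr (1 - \<gamma>) * (indicator {0..t} r * mode' l g h f r - indicator {0..t} r * h))) \<in> borel_measurable lborel"
      by measurable
    then show "(\<lambda>r. 1 / Gamma (2 - \<gamma>) * (indicator {0..t} r * ((t - r) powr (1 - \<gamma>) * (mode' l g h f r - h)))) \<in> borel_measurable lborel"
      by (simp add: algebra_simps)
    show "(\<lambda>r. power_kernel T (2 - \<gamma>) (t - r) * z r) \<in> borel_measurable lborel" by measurable
    show "AE r in lborel. 1 / Gamma (2 - \<gamma>) * (indicator {0..t} r * ((t - r) powr (1 - \<gamma>) * (mode' l g h f r - h))) = power_kernel T (2 - \<gamma>) (t - r) * z r"
      using AE0
    proof eventually_elim
      case (elim r)
      consider "r < 0" | "r > t" | "0 < r" "r < t" using elim by linarith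
      then show ?case
      proof cases
        case 3
        then have "z r = mode' l g h f r - h" using t mode_kernel(3)[of r l g h] by (simp add: z_def)
        then show ?thesis using 3 t by (simp add: power_kernel_def)
      qed (use z0 in \<open>auto simp: power_kernel_def\<close>)
    qed
  qed
  also have "\<dots> = - l * g * mlk l (\<gamma> + (2 - \<gamma>)) t + (- l * h) * mlk l (1 + \<gamma> + (2 - \<gamma>)) t + conv (mlk l (\<gamma> - 1 + (2 - \<gamma>))) f t"
    unfolding z_def using l \<gamma> t by (intro conv_power_lincomb) auto
  finally show ?thesis unfolding L by (simp add: algebra_simps)
qed

end

context ml_kernels begin

text \<open>Convolve d = -l I^\<gamma> d with the kernel k = \<open>mlk l 1\<close>, writing k.d for
  the convolution. The resolvent equation gives k.d = I^1 d - l k.(I^\<gamma> d) = I^1 d + k.d, so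
  I^1 d = 0, and finally d = -l I^(\<gamma>-1) I^1 d = 0. This takes the place of a Gronwall
  inequality with a singular kernel.\<close>

theorem mode_unique:
  assumes l: "l > 0" and d: "continuous_on {0..T} d" and p: "continuous_on {0..T} p"
    and dp: "\<And>t. t \<in> {0..T} \<Longrightarrow> d t = (LINT r|lborel. indicator {0..t} r * p r)"
    and eq: "\<And>t. t \<in> {0..T} \<Longrightarrow> - l * (LINT r|lborel. indicator {0..t} r * d r) = 1 / Gamma (2 - \<gamma>) * (LINT r|lborel. indicator {0..t} r * ((t - r) powr (1 - \<gamma>) * p r))"
    and t: "t \<in> {0..T}"
  shows "d t = 0"
proof -
  \<comment> \<open>Extension by zero to the line, so that interval integrals become convolutions
    with power kernels.\<close>
  define cut where "cut b r = (if 0 < r \<and> r \<le> T then b r else 0)" for b :: "real \<Rightarrow> real" and r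
  have cut0: "cut b r = 0" if "r \<le> 0" for b r using that by (simp add: cut_def)
  have cutm: "cut b \<in> borel_measurable borel" if "continuous_on {0..T} b" for b
  proof -
    have "(\<lambda>r. indicator {0<..T} r *\<^sub>R b r) \<in> borel_measurable borel"
      by (intro borel_measurable_continuous_on_indicator continuous_on_subset[OF that]) auto
    moreover have "cut b = (\<lambda>r. indicator {0<..T} r *\<^sub>R b r)" by (auto simp: cut_def indicator_def)
    ultimately show ?thesis by simp
  qed
  have cutb: "\<exists>B. \<forall>r. \<bar>cut b r\<bar> \<le> B" if "continuous_on {0..T} b" for b
  proof -
    have "bounded (b ` {0..T})" by (intro compact_imp_bounded compact_continuous_image that) auto
    then obtain B where "\<forall>x\<in>{0..T}. \<bar>b x\<bar> \<le> B" unfolding bounded_iff by auto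
    then show ?thesis by (intro exI[of _ "max B 0"]) (auto simp: cut_def le_max_iff_disj)
  qed
  obtain Bd Bp where Bd: "\<And>r. \<bar>cut d r\<bar> \<le> Bd" and Bp: "\<And>r. \<bar>cut p r\<bar> \<le> Bp" using cutb[OF d] cutb[OF p] by blast
  note dm[measurable] = cutm[OF d] and pm[measurable] = cutm[OF p]
  have pkm[measurable]: "power_kernel T a \<in> borel_measurable borel" for a unfolding power_kernel_def by measurable
  note pki = power_kernel_integrable[OF _ less_imp_le[OF T]]
  have I: "(LINT r|lborel. indicator {0..t} r * b r) = conv (power_kernel T 1) (cut b) t" if "continuous_on {0..T} b" "t \<in> {0..T}" for b t
  proof -
    have "(\<lambda>r. indicator {0..t} r *\<^sub>R b r) \<in> borel_measurable borel"
      by (intro borel_measurable_continuous_on_indicator continuous_on_subset[OF that(1)]) (use that in auto)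
    then have "(LINT r|lborel. indicator {0..t} r * b r) = (LINT r|lborel. indicator {0..t} r * cut b r)"
    proof (intro integral_cong_AE)
      show "AE r in lborel. indicator {0..t} r * b r = indicator {0..t} r * cut b r"
        using AE_lborel_singleton[of 0] by eventually_elim (use that in \<open>auto simp: cut_def indicator_def\<close>)
    qed (use cutm[OF that(1)] in auto)
    then show ?thesis using interval_integral_conv[OF cut0 _ cutm[OF that(1)]] that by simp
  qed
  have conv0: "conv (power_kernel T a) (cut b) s = 0" if "s \<le> 0" for a b s
  proof -
    have "power_kernel T a (s - r) * cut b r = 0" for r using that by (auto simp: power_kernel_def cut_def)
    then show ?thesis by (simp only: conv_def Bochner_Integration.integral_zero)
  qed
  have D1: "conv (power_kernel T 1) (cut p) s = cut d s" if "s \<le> T" for s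
    using I[OF p, of s] dp[of s] conv0[of s] that by (cases "s \<le> 0") (auto simp: cut_def)
  have D2: "- l * conv (power_kernel T 1) (cut d) s = conv (power_kernel T (2 - \<gamma>)) (cut p) s" if "s \<le> T" for s
  proof (cases "s \<le> 0")
    case False
    then have s: "s \<in> {0..T}" using that by simp
    have "1 / Gamma (2 - \<gamma>) * (LINT r|lborel. indicator {0..s} r * ((s - r) powr (1 - \<gamma>) * p r))
       = (LINT r|lborel. 1 / Gamma (2 - \<gamma>) * (indicator {0..s} r * ((s - r) powr (1 - \<gamma>) * p r)))" by simp
    also have "\<dots> = conv (power_kernel T (2 - \<gamma>)) (cut p) s"
      unfolding conv_def
    proof (rule integral_cong_AE)
      have "(\<lambda>r. indicator {0..s} r *\<^sub>R p r) \<in> borel_measurable borel"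
        by (intro borel_measurable_continuous_on_indicator continuous_on_subset[OF p]) (use s in auto)
      then have [measurable]: "(\<lambda>r. indicator {0..s} r * p r) \<in> borel_measurable borel" by simp
      have "(\<lambda>r. 1 / Gamma (2 - \<gamma>) * ((s - r) powr (1 - \<gamma>) * (indicator {0..s} r * p r))) \<in> borel_measurable lborel" by measurable
      then show "(\<lambda>r. 1 / Gamma (2 - \<gamma>) * (indicator {0..s} r * ((s - r) powr (1 - \<gamma>) * p r))) \<in> borel_measurable lborel"
        by (simp add: mult_ac)
      show "(\<lambda>r. power_kernel T (2 - \<gamma>) (s - r) * cut p r) \<in> borel_measurable lborel" by measurable
      show "AE r in lborel. 1 / Gamma (2 - \<gamma>) * (indicator {0..s} r * ((s - r) powr (1 - \<gamma>) * p r)) = power_kernel T (2 - \<gamma>) (s - r) * cut p r"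
        using AE_lborel_singleton[of 0] AE_lborel_singleton[of s]
      proof eventually_elim
        case (elim r)
        then show ?case using s by (auto simp: power_kernel_def cut_def indicator_def)
      qed
    qed
    finally show ?thesis using eq[OF s] I[OF d s] by simp
  qed (simp add: conv0)
  have pk_nonpos: "power_kernel T a \<tau> = 0" "mlk l a \<tau> = 0" if "\<tau> \<le> 0" for a \<tau>
    using that by (auto simp: power_kernel_def ml_kernel_def)
  have cl: "conv k (\<lambda>r. x * b r) s = x * conv k b s" for k b x s by (simp add: conv_def mult.left_commute)
  have A: "conv (power_kernel T a) (conv (power_kernel T b) (cut q)) s = conv (power_kernel T (a + b)) (cut q) s"
    if "a > 0" "b > 0" "s \<le> T" "cut q \<in> borel_measurable borel" "\<And>r. \<bar>cut q r\<bar> \<le> B" for a b q s B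
  proof -
    have "conv (power_kernel T a) (conv (power_kernel T b) (cut q)) s = conv (conv (power_kernel T a) (power_kernel T b)) (cut q) s"
      by (rule conv_assoc) (use that pki in auto)
    also have "\<dots> = conv (power_kernel T (a + b)) (cut q) s"
    proof (rule conv_kernel_cong)
      fix \<tau> assume "\<tau> \<le> s"
      then show "conv (power_kernel T a) (power_kernel T b) \<tau> = power_kernel T (a + b) \<tau>"
        using conv_power_kernel[of a b \<tau>] that by (simp add: conv_def has_bochner_integral_iff)
    qed (simp add: cut0)
    finally show ?thesis .
  qed
  \<comment> \<open>Apply I^(\<gamma>-1) to the equation; on the right I^(\<gamma>-1) I^(2-\<gamma>)
    p = I^1 p = d.\<close>
  have E: "cut d s = - l * conv (power_kernel T (\<gamma> - 1)) (conv (power_kernel T 1) (cut d)) s" if s: "s \<le> T" for s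
  proof -
    have "- l * conv (power_kernel T (\<gamma> - 1)) (conv (power_kernel T 1) (cut d)) s
        = conv (power_kernel T (\<gamma> - 1)) (\<lambda>r. - l * conv (power_kernel T 1) (cut d) r) s" by (simp only: cl)
    also have "\<dots> = conv (power_kernel T (\<gamma> - 1)) (conv (power_kernel T (2 - \<gamma>)) (cut p)) s"
      by (rule conv_cong[OF D2 pk_nonpos(1)]) (use s in auto)
    also have "\<dots> = conv (power_kernel T (\<gamma> - 1 + (2 - \<gamma>))) (cut p) s"
      by (rule A[OF _ _ s pm Bp]) (use \<gamma> in auto)
    also have "\<dots> = cut d s" using D1[OF s] by simp
    finally show ?thesis ..
  qed
  have E': "cut d s = - l * conv (power_kernel T \<gamma>) (cut d) s" if s: "s \<le> T" for s
    using E[OF s] A[OF _ _ s dm Bd, of "\<gamma> - 1" 1] \<gamma> by simp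
  have Z: "conv (power_kernel T 1) (cut d) s = 0" if s: "s \<le> T" for s
  proof -
    let ?m = "mlk l"
    have "conv (?m 1) (cut d) s = conv (\<lambda>r. 1 * power_kernel T 1 r + (- l) * ?m (1 + \<gamma>) r) (cut d) s"
      by (rule arg_cong[where f = "\<lambda>k. conv k (cut d) s"]) (use ml_kernel_rec[of 1 l] in auto)
    also have "\<dots> = 1 * conv (power_kernel T 1) (cut d) s + (- l) * conv (?m (1 + \<gamma>)) (cut d) s"
      by (rule conv_lincomb[OF pki ml_kernel_integrable dm Bd]) (use l \<gamma> in auto)
    also have "conv (?m (1 + \<gamma>)) (cut d) s = conv (conv (?m 1) (power_kernel T \<gamma>)) (cut d) s"
    proof (rule conv_kernel_cong)
      fix \<tau> assume "\<tau> \<le> s"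
      then show "?m (1 + \<gamma>) \<tau> = conv (?m 1) (power_kernel T \<gamma>) \<tau>"
        using conv_ml_kernel(1)[OF l, of \<gamma> 1 \<tau>] s \<gamma> conv_commute by simp
    qed (simp add: cut0)
    also have "\<dots> = conv (?m 1) (conv (power_kernel T \<gamma>) (cut d)) s"
      by (rule conv_assoc[OF ml_kernel_integrable pki dm Bd, symmetric]) (use l \<gamma> in auto)
    also have "(- l) * conv (?m 1) (conv (power_kernel T \<gamma>) (cut d)) s = conv (?m 1) (\<lambda>r. - l * conv (power_kernel T \<gamma>) (cut d) r) s"
      by (simp only: cl)
    also have "\<dots> = conv (?m 1) (cut d) s"
      by (rule conv_cong[OF E'[symmetric] pk_nonpos(2)]) (use s in auto)
    finally show ?thesis by simp
  qed
  have "cut d t = - l * conv (power_kernel T (\<gamma> - 1)) (\<lambda>r. 0) t"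
  proof -
    have "conv (power_kernel T (\<gamma> - 1)) (conv (power_kernel T 1) (cut d)) t = conv (power_kernel T (\<gamma> - 1)) (\<lambda>r. 0) t"
      by (rule conv_cong[OF Z pk_nonpos(1)]) (use t in auto)
    then show ?thesis using E[of t] t by simp
  qed
  then have c: "cut d t = 0" by (simp add: conv_def)
  show ?thesis
  proof (cases "t = 0")
    case True
    have "d 0 = conv (power_kernel T 1) (cut p) 0" using dp[of 0] I[OF p, of 0] T by simp
    then show ?thesis using conv0[of 0] True by simp
  qed (use c t in \<open>auto simp: cut_def\<close>)
qed

end

section \<open>Estimates uniform in l\<close>

lemma power2_sum3_le: "(x + y + z)\<^sup>2 \<le> 3 * (x\<^sup>2 + y\<^sup>2 + (z::real)\<^sup>2)"
proof -
  have "0 \<le> (x - y)\<^sup>2 + (y - z)\<^sup>2 + (x - z)\<^sup>2" by simp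
  then show ?thesis by (simp add: power2_eq_square algebra_simps)
qed

context ml_kernels begin

text \<open>Up to constants independent of \<open>l\<close>, this dominates the kernel of \<open>y'\<close> and the square of
  the kernel of \<open>y\<close> multiplied by the square root of \<open>l\<close>.\<close>

definition sing :: "real \<Rightarrow> real" where
  "sing t = (if 0 < t \<and> t \<le> T then t powr (\<gamma> - 2) else 0)"

definition sing_mass :: real where "sing_mass = T powr (\<gamma> - 1) / (\<gamma> - 1)"

lemma sing_nonneg [simp]: "0 \<le> sing t" by (simp add: sing_def)

lemma sing_mass_pos: "sing_mass > 0" using \<gamma> T by (simp add: sing_mass_def)

lemma sing_integral: "has_bochner_integral lborel sing sing_mass"
proof -
  have e: "\<gamma> - 1 - 1 = \<gamma> - 2" by simp
  show ?thesis using powr_cutoff_integral[of "\<gamma> - 1" T] \<gamma> T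
    unfolding sing_def[abs_def] sing_mass_def e by simp
qed

lemma sing_measurable [measurable]: "sing \<in> borel_measurable borel"
  unfolding sing_def by measurable

lemma sing_shift: "integrable lborel (\<lambda>r. sing (t - r))" "(LINT r|lborel. sing (t - r)) = sing_mass"
  "has_bochner_integral lborel (\<lambda>t. sing (t - r)) sing_mass"
  using integrable_shift_reflect[of sing] sing_integral by (auto simp: has_bochner_integral_iff)

end

context forcing begin

lemma f2_bound: "\<bar>(f r)\<^sup>2\<bar> \<le> M\<^sup>2"
  using power_mono[OF f_bound[of r], of 2] by simp

lemma f2_integrable: "integrable lborel (\<lambda>r. (f r)\<^sup>2)"
proof (rule Bochner_Integration.integrable_bound)
  show "integrable lborel (\<lambda>r. indicator {0..T} r * M\<^sup>2)" using T by simp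
  show "AE r in lborel. norm ((f r)\<^sup>2) \<le> norm (indicator {0..T} r * M\<^sup>2)"
    using f2_bound f_support by (intro AE_I2) (auto simp: indicator_def)
qed measurable

lemma sing_f2_integrable: "integrable lborel (\<lambda>r. sing (t - r) * (f r)\<^sup>2)"
  by (rule integrable_conv_bounded[OF integrable.intros[OF sing_integral] _ f2_bound]) measurable

lemma sing_f2_integral: "has_bochner_integral lborel (\<lambda>t. LINT r|lborel. sing (t - r) * (f r)\<^sup>2) (sing_mass * (LINT r|lborel. (f r)\<^sup>2))"
proof -
  have "has_bochner_integral lborel (\<lambda>t. LINT r|lborel. sing (t - r) * (f r)\<^sup>2) (LINT r|lborel. sing_mass * (f r)\<^sup>2)"
    by (rule integral_kernel_swap[OF _ f2_integrable _ sing_shift(3) order_refl]) auto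
  then show ?thesis by simp
qed

lemma conv_sqrt_l_bound:
  assumes l: "l > 0"
  shows "l * (conv (mlk l \<gamma>) f t)\<^sup>2 \<le> (ml_bound (1/2) \<gamma>)\<^sup>2 * sing_mass * (LINT r|lborel. (f r)\<^sup>2)"
proof -
  define k where "k \<tau> = (if 0 < \<tau> \<and> \<tau> \<le> T then \<tau> powr (\<gamma> / 2 - 1) else 0)" for \<tau>
  define b where "b = ml_bound (1/2) \<gamma>"
  have b: "b > 0" unfolding b_def using \<gamma> by (intro ml_bound) auto
  have [measurable]: "k \<in> borel_measurable borel" unfolding k_def by measurable
  have k2: "(k \<tau>)\<^sup>2 = sing \<tau>" for \<tau>
    by (auto simp: k_def sing_def power2_eq_square powr_add[symmetric])
  have kb: "l powr (1/2) * \<bar>mlk l \<gamma> \<tau>\<bar> \<le> b * k \<tau>" for \<tau>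
  proof -
    have e: "\<gamma> - \<gamma> * (1 / 2) - 1 = \<gamma> / 2 - 1" by simp
    show ?thesis using ml_kernel_bound[OF l, of "1/2" \<gamma> \<tau>] \<gamma> unfolding e b_def k_def by simp
  qed
  note CS = integral_Cauchy_Schwarz[of "\<lambda>r. k (t - r)" lborel "\<lambda>r. \<bar>f r\<bar>"]
  have CSp: "integrable lborel (\<lambda>r. (k (t - r))\<^sup>2)" "integrable lborel (\<lambda>r. \<bar>f r\<bar>\<^sup>2)"
    using sing_shift f2_integrable by (auto simp: k2)
  have "l powr (1/2) * \<bar>conv (mlk l \<gamma>) f t\<bar> = \<bar>LINT r|lborel. l powr (1/2) * (mlk l \<gamma> (t - r) * f r)\<bar>"
    by (simp add: conv_def abs_mult)
  also have "\<dots> \<le> (LINT r|lborel. b * (k (t - r) * \<bar>f r\<bar>))"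
  proof (rule order_trans[OF integral_abs_bound], rule integral_mono)
    have "integrable lborel (\<lambda>r. mlk l \<gamma> (t - r) * f r)"
      using \<gamma> by (intro integrable_conv_bounded[OF ml_kernel_integrable[OF l] _ f_bound]) auto
    then show "integrable lborel (\<lambda>r. \<bar>l powr (1/2) * (mlk l \<gamma> (t - r) * f r)\<bar>)"
      by (intro integrable_abs integrable_mult_right)
    show "integrable lborel (\<lambda>r. b * (k (t - r) * \<bar>f r\<bar>))"
      using CS(1) CSp by simp
    fix r
    have "l powr (1/2) * \<bar>mlk l \<gamma> (t - r)\<bar> * \<bar>f r\<bar> \<le> b * k (t - r) * \<bar>f r\<bar>"
      by (intro mult_right_mono kb) simp
    then show "\<bar>l powr (1/2) * (mlk l \<gamma> (t - r) * f r)\<bar> \<le> b * (k (t - r) * \<bar>f r\<bar>)"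
      by (simp add: abs_mult mult.assoc)
  qed
  also have "\<dots> = b * (LINT r|lborel. k (t - r) * \<bar>f r\<bar>)" by simp
  also have "(LINT r|lborel. k (t - r) * \<bar>f r\<bar>) \<le> sqrt sing_mass * sqrt (LINT r|lborel. (f r)\<^sup>2)"
    using CS(2) CSp sing_shift(2)[of t] by (simp add: k2)
  finally have "l powr (1/2) * \<bar>conv (mlk l \<gamma>) f t\<bar> \<le> b * (sqrt sing_mass * sqrt (LINT r|lborel. (f r)\<^sup>2))"
    using b by simp
  then have "(l powr (1/2) * \<bar>conv (mlk l \<gamma>) f t\<bar>)\<^sup>2 \<le> (b * (sqrt sing_mass * sqrt (LINT r|lborel. (f r)\<^sup>2)))\<^sup>2"
    by (intro power_mono) auto
  then show ?thesis using l sing_mass_pos by (simp add: power_mult_distrib b_def powr_half_sqrt mult.assoc)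
qed

text \<open>\<open>sing\<close> is split into two square roots, because its own square is not
  integrable for \<gamma> \<le> 3/2. One factor contributes the total mass, the other leaves the
  convolution of \<open>sing\<close> with f^2, which can be bounded at each time by the supremum of
  f or integrated in time against its L2 norm.\<close>

lemma conv_derivative_bound:
  assumes l: "l > 0"
  shows "(conv (mlk l (\<gamma> - 1)) f t)\<^sup>2 \<le> (ml_bound 0 (\<gamma> - 1))\<^sup>2 * sing_mass * (LINT r|lborel. sing (t - r) * (f r)\<^sup>2)"
proof -
  define b where "b = ml_bound 0 (\<gamma> - 1)"
  have b: "b > 0" unfolding b_def using \<gamma> by (intro ml_bound) auto
  have kb: "\<bar>mlk l (\<gamma> - 1) \<tau>\<bar> \<le> b * sing \<tau>" for \<tau>
  proof -
    have e: "\<gamma> - 1 - \<gamma> * 0 - 1 = \<gamma> - 2" by simp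
    show ?thesis using ml_kernel_bound[OF l, of 0 "\<gamma> - 1" \<tau>] \<gamma> l unfolding e b_def sing_def by simp
  qed
  note CS = integral_Cauchy_Schwarz[of "\<lambda>r. sqrt (sing (t - r))" lborel "\<lambda>r. sqrt (sing (t - r)) * \<bar>f r\<bar>"]
  have CSp: "integrable lborel (\<lambda>r. (sqrt (sing (t - r)))\<^sup>2)" "integrable lborel (\<lambda>r. (sqrt (sing (t - r)) * \<bar>f r\<bar>)\<^sup>2)"
    using sing_shift sing_f2_integrable by (auto simp: power_mult_distrib)
  have eq: "sqrt (sing (t - r)) * (sqrt (sing (t - r)) * \<bar>f r\<bar>) = sing (t - r) * \<bar>f r\<bar>" for r
    by (simp add: mult.assoc[symmetric])
  have "\<bar>conv (mlk l (\<gamma> - 1)) f t\<bar> \<le> (LINT r|lborel. b * (sing (t - r) * \<bar>f r\<bar>))"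
    unfolding conv_def
  proof (rule order_trans[OF integral_abs_bound], rule integral_mono)
    have "integrable lborel (\<lambda>r. mlk l (\<gamma> - 1) (t - r) * f r)"
      using \<gamma> by (intro integrable_conv_bounded[OF ml_kernel_integrable[OF l] _ f_bound]) auto
    then show "integrable lborel (\<lambda>r. \<bar>mlk l (\<gamma> - 1) (t - r) * f r\<bar>)" by (rule integrable_abs)
    show "integrable lborel (\<lambda>r. b * (sing (t - r) * \<bar>f r\<bar>))"
      using CS(1) CSp by (simp add: eq)
    show "\<bar>mlk l (\<gamma> - 1) (t - r) * f r\<bar> \<le> b * (sing (t - r) * \<bar>f r\<bar>)" for r
      using mult_right_mono[OF kb[of "t - r"], of "\<bar>f r\<bar>"] by (simp add: abs_mult mult.assoc)
  qed
  also have "\<dots> = b * (LINT r|lborel. sing (t - r) * \<bar>f r\<bar>)" by simp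
  also have "(LINT r|lborel. sing (t - r) * \<bar>f r\<bar>) \<le> sqrt sing_mass * sqrt (LINT r|lborel. sing (t - r) * (f r)\<^sup>2)"
    using CS(2) CSp sing_shift(2)[of t] by (simp add: eq power_mult_distrib)
  finally have "\<bar>conv (mlk l (\<gamma> - 1)) f t\<bar> \<le> b * (sqrt sing_mass * sqrt (LINT r|lborel. sing (t - r) * (f r)\<^sup>2))"
    using b by simp
  then have "\<bar>conv (mlk l (\<gamma> - 1)) f t\<bar>\<^sup>2 \<le> (b * (sqrt sing_mass * sqrt (LINT r|lborel. sing (t - r) * (f r)\<^sup>2)))\<^sup>2"
    by (intro power_mono) auto
  then show ?thesis using sing_mass_pos by (simp add: power_mult_distrib b_def mult.assoc integral_nonneg)
qed

end

context ml_kernels begin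

text \<open>The 3 comes from \<open>power2_sum3_le\<close>. Inside are the squared kernel bounds of
  the three estimates below; the 1 serves the initial time and the factor T the integral of a
  constant over time. Nothing depends on l or on the data.\<close>

definition mode_const :: real where
  "mode_const = 3 * (1 + (ml_bound 0 1)\<^sup>2 * (1 + T) + (ml_bound (1/2) 2 * T powr (1 - \<gamma> / 2))\<^sup>2
     + (ml_bound (1/2) \<gamma>)\<^sup>2 * sing_mass + (ml_bound 0 \<gamma> * T powr (\<gamma> - 1))\<^sup>2
     + (ml_bound 0 (\<gamma> - 1))\<^sup>2 * (sing_mass + sing_mass * sing_mass))"

lemma mode_const_ge:
  "1 \<le> mode_const" "3 * (ml_bound 0 1)\<^sup>2 \<le> mode_const" "3 * ((ml_bound 0 1)\<^sup>2 * T) \<le> mode_const"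
  "3 * (ml_bound (1/2) 2 * T powr (1 - \<gamma> / 2))\<^sup>2 \<le> mode_const"
  "3 * ((ml_bound (1/2) \<gamma>)\<^sup>2 * sing_mass) \<le> mode_const" "3 * (ml_bound 0 \<gamma> * T powr (\<gamma> - 1))\<^sup>2 \<le> mode_const"
  "3 * ((ml_bound 0 (\<gamma> - 1))\<^sup>2 * sing_mass) \<le> mode_const"
  "3 * ((ml_bound 0 (\<gamma> - 1))\<^sup>2 * (sing_mass * sing_mass)) \<le> mode_const"
proof -
  define p where "p = (ml_bound 0 1)\<^sup>2"
  define q where "q = (ml_bound (1/2) 2 * T powr (1 - \<gamma> / 2))\<^sup>2"
  define r where "r = (ml_bound (1/2) \<gamma>)\<^sup>2 * sing_mass"
  define u where "u = (ml_bound 0 \<gamma> * T powr (\<gamma> - 1))\<^sup>2"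
  define v where "v = (ml_bound 0 (\<gamma> - 1))\<^sup>2 * sing_mass"
  define w where "w = (ml_bound 0 (\<gamma> - 1))\<^sup>2 * (sing_mass * sing_mass)"
  have nn: "0 \<le> p" "0 \<le> q" "0 \<le> r" "0 \<le> u" "0 \<le> v" "0 \<le> w" "0 \<le> p * T"
    using sing_mass_pos T by (auto simp: p_def q_def r_def u_def v_def w_def)
  have eq: "mode_const = 3 * (1 + (p + p * T) + q + r + u + (v + w))"
    by (simp add: mode_const_def p_def q_def r_def u_def v_def w_def algebra_simps)
  note folds = p_def[symmetric] q_def[symmetric] r_def[symmetric] u_def[symmetric] v_def[symmetric] w_def[symmetric] eq
  show "1 \<le> mode_const" unfolding folds distrib_left using nn by linarith
  show "3 * (ml_bound 0 1)\<^sup>2 \<le> mode_const" unfolding folds distrib_left using nn by linarith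
  show "3 * ((ml_bound 0 1)\<^sup>2 * T) \<le> mode_const" unfolding folds distrib_left using nn by linarith
  show "3 * (ml_bound (1/2) 2 * T powr (1 - \<gamma> / 2))\<^sup>2 \<le> mode_const" unfolding folds distrib_left using nn by linarith
  show "3 * ((ml_bound (1/2) \<gamma>)\<^sup>2 * sing_mass) \<le> mode_const" unfolding folds distrib_left using nn by linarith
  show "3 * (ml_bound 0 \<gamma> * T powr (\<gamma> - 1))\<^sup>2 \<le> mode_const" unfolding folds distrib_left using nn by linarith
  show "3 * ((ml_bound 0 (\<gamma> - 1))\<^sup>2 * sing_mass) \<le> mode_const" unfolding folds distrib_left using nn by linarith
  show "3 * ((ml_bound 0 (\<gamma> - 1))\<^sup>2 * (sing_mass * sing_mass)) \<le> mode_const" unfolding folds distrib_left using nn by linarith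
qed

end

context forcing begin

lemma ml1_bound:
  assumes "l > 0" "0 < t" "t \<le> T" shows "\<bar>mlk l 1 t\<bar> \<le> ml_bound 0 1"
  using ml_kernel_bound[of l 0 1 t] assms by (simp split: if_splits)

theorem mode_bound:
  assumes l: "l > 0" and t: "t \<in> {0..T}"
  shows "l * (mode l g h f t)\<^sup>2 \<le> mode_const * (l * g\<^sup>2 + h\<^sup>2 + (LINT r|lborel. (f r)\<^sup>2))"
\<comment> \<open>At 0 the truncated kernels vanish while the solution equals g, so
  \<open>mode_kernel\<close> is available only for t > 0.\<close>
proof (cases "t = 0")
  case True
  have "l * g\<^sup>2 \<le> 1 * (l * g\<^sup>2 + h\<^sup>2 + (LINT r|lborel. (f r)\<^sup>2))" by simp
  also have "\<dots> \<le> mode_const * (l * g\<^sup>2 + h\<^sup>2 + (LINT r|lborel. (f r)\<^sup>2))"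
    using l by (intro mult_right_mono mode_const_ge) auto
  finally show ?thesis using True mode_0 l by simp
next
  case False
  then have t': "0 < t" "t \<le> T" using t by auto
  define x y z where "x = mlk l 1 t" and "y = mlk l 2 t" and "z = conv (mlk l \<gamma>) f t"
  have x: "x\<^sup>2 \<le> (ml_bound 0 1)\<^sup>2" using power_mono[OF ml1_bound[OF l t'], of 2] by (simp add: x_def)
  have y: "l * y\<^sup>2 \<le> (ml_bound (1/2) 2 * T powr (1 - \<gamma> / 2))\<^sup>2"
  proof -
    have "l powr (1/2) * \<bar>y\<bar> \<le> ml_bound (1/2) 2 * t powr (1 - \<gamma> / 2)"
    proof -
      have e: "2 - \<gamma> * (1 / 2) - 1 = 1 - \<gamma> / 2" by simp
      show ?thesis using ml_kernel_bound[OF l, of "1/2" 2 t] \<gamma> t' unfolding e y_def by simp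
    qed
    also have "\<dots> \<le> ml_bound (1/2) 2 * T powr (1 - \<gamma> / 2)"
      using t' \<gamma> ml_bound(1)[of "1/2" 2] by (intro mult_left_mono powr_mono2) auto
    finally have "(l powr (1/2) * \<bar>y\<bar>)\<^sup>2 \<le> (ml_bound (1/2) 2 * T powr (1 - \<gamma> / 2))\<^sup>2" by (intro power_mono) auto
    then show ?thesis using l by (simp add: power_mult_distrib powr_half_sqrt)
  qed
  have z: "l * z\<^sup>2 \<le> (ml_bound (1/2) \<gamma>)\<^sup>2 * sing_mass * (LINT r|lborel. (f r)\<^sup>2)"
    unfolding z_def by (rule conv_sqrt_l_bound[OF l])
  have F: "0 \<le> (LINT r|lborel. (f r)\<^sup>2)" by simp
  have "l * (mode l g h f t)\<^sup>2 = l * (g * x + h * y + z)\<^sup>2"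
    unfolding mode_kernel(1)[OF t'] x_def y_def z_def ..
  also have "\<dots> \<le> l * (3 * ((g * x)\<^sup>2 + (h * y)\<^sup>2 + z\<^sup>2))" using l by (intro mult_left_mono power2_sum3_le) auto
  also have "\<dots> = 3 * (x\<^sup>2 * (l * g\<^sup>2)) + 3 * (l * y\<^sup>2 * h\<^sup>2) + 3 * (l * z\<^sup>2)" by (simp add: power_mult_distrib algebra_simps)
  also have "\<dots> \<le> 3 * ((ml_bound 0 1)\<^sup>2 * (l * g\<^sup>2)) + 3 * ((ml_bound (1/2) 2 * T powr (1 - \<gamma> / 2))\<^sup>2 * h\<^sup>2) + 3 * ((ml_bound (1/2) \<gamma>)\<^sup>2 * sing_mass * (LINT r|lborel. (f r)\<^sup>2))"
    using l x y z by (intro add_mono mult_left_mono mult_right_mono) auto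
  also have "\<dots> \<le> mode_const * (l * g\<^sup>2) + mode_const * h\<^sup>2 + mode_const * (LINT r|lborel. (f r)\<^sup>2)"
    unfolding mult.assoc[symmetric, of 3] using l mode_const_ge F by (intro add_mono mult_right_mono) (auto simp: mult.assoc)
  finally show ?thesis by (simp add: algebra_simps)
qed

theorem mode'_bound:
  assumes l: "l > 0" and t: "t \<in> {0..T}"
  shows "(mode' l g h f t)\<^sup>2 \<le> mode_const * (l\<^sup>2 * g\<^sup>2 + h\<^sup>2 + (LINT r|lborel. sing (t - r) * (f r)\<^sup>2))"
proof (cases "t = 0")
  case True
  have "h\<^sup>2 \<le> 1 * (l\<^sup>2 * g\<^sup>2 + h\<^sup>2 + (LINT r|lborel. sing (t - r) * (f r)\<^sup>2))" by (simp add: integral_nonneg)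
  also have "\<dots> \<le> mode_const * (l\<^sup>2 * g\<^sup>2 + h\<^sup>2 + (LINT r|lborel. sing (t - r) * (f r)\<^sup>2))"
    using l by (intro mult_right_mono mode_const_ge add_nonneg_nonneg) (auto simp: integral_nonneg)
  finally show ?thesis using True mode_0 l by simp
next
  case False
  then have t': "0 < t" "t \<le> T" using t by auto
  define x y z where "x = mlk l 1 t" and "y = mlk l \<gamma> t" and "z = conv (mlk l (\<gamma> - 1)) f t"
  have x: "x\<^sup>2 \<le> (ml_bound 0 1)\<^sup>2" using power_mono[OF ml1_bound[OF l t'], of 2] by (simp add: x_def)
  have y: "y\<^sup>2 \<le> (ml_bound 0 \<gamma> * T powr (\<gamma> - 1))\<^sup>2"
  proof -
    have "\<bar>y\<bar> \<le> ml_bound 0 \<gamma> * t powr (\<gamma> - 1)"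
      using ml_kernel_bound[OF l, of 0 \<gamma> t] \<gamma> l t' by (simp add: y_def)
    also have "\<dots> \<le> ml_bound 0 \<gamma> * T powr (\<gamma> - 1)"
      using t' \<gamma> ml_bound(1)[of 0 \<gamma>] by (intro mult_left_mono powr_mono2) auto
    finally have "\<bar>y\<bar>\<^sup>2 \<le> (ml_bound 0 \<gamma> * T powr (\<gamma> - 1))\<^sup>2" by (intro power_mono) auto
    then show ?thesis by simp
  qed
  have z: "z\<^sup>2 \<le> (ml_bound 0 (\<gamma> - 1))\<^sup>2 * sing_mass * (LINT r|lborel. sing (t - r) * (f r)\<^sup>2)"
    unfolding z_def by (rule conv_derivative_bound[OF l])
  have F: "0 \<le> (LINT r|lborel. sing (t - r) * (f r)\<^sup>2)" by (simp add: integral_nonneg)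
  have "(mode' l g h f t)\<^sup>2 = (- l * g * y + h * x + z)\<^sup>2"
    unfolding mode_kernel(2)[OF t'] x_def y_def z_def ..
  also have "\<dots> \<le> 3 * ((- l * g * y)\<^sup>2 + (h * x)\<^sup>2 + z\<^sup>2)" by (rule power2_sum3_le)
  also have "\<dots> = 3 * (y\<^sup>2 * (l\<^sup>2 * g\<^sup>2)) + 3 * (x\<^sup>2 * h\<^sup>2) + 3 * z\<^sup>2" by (simp add: power_mult_distrib algebra_simps)
  also have "\<dots> \<le> 3 * ((ml_bound 0 \<gamma> * T powr (\<gamma> - 1))\<^sup>2 * (l\<^sup>2 * g\<^sup>2)) + 3 * ((ml_bound 0 1)\<^sup>2 * h\<^sup>2) + 3 * ((ml_bound 0 (\<gamma> - 1))\<^sup>2 * sing_mass * (LINT r|lborel. sing (t - r) * (f r)\<^sup>2))"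
    using l x y z by (intro add_mono mult_left_mono mult_right_mono) auto
  also have "\<dots> \<le> mode_const * (l\<^sup>2 * g\<^sup>2) + mode_const * h\<^sup>2 + mode_const * (LINT r|lborel. sing (t - r) * (f r)\<^sup>2)"
    unfolding mult.assoc[symmetric, of 3] using l mode_const_ge F by (intro add_mono mult_right_mono) (auto simp: mult.assoc)
  finally show ?thesis by (simp add: algebra_simps)
qed

text \<open>Integration in time improves the term with g: with \<beta> = 1/2, l times the squared
  kernel of index \<gamma> is at most a multiple of \<open>sing\<close>, so l^2 g^2 drops to l g^2
  and the energy norm of g suffices. The forcing term is Young's inequality in the form of
  \<open>sing_f2_integral\<close>.\<close>

theorem mode'_L2_bound:
  assumes l: "l > 0"
  shows "(LINT t|lborel. indicator {0..T} t * (mode' l g h f t)\<^sup>2) \<le> mode_const * (l * g\<^sup>2 + h\<^sup>2 + (LINT r|lborel. (f r)\<^sup>2))"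
proof -
  define b where "b t = 3 * ((ml_bound (1/2) \<gamma>)\<^sup>2 * (l * g\<^sup>2)) * sing t + 3 * ((ml_bound 0 1)\<^sup>2 * h\<^sup>2) * indicator {0..T} t
    + 3 * ((ml_bound 0 (\<gamma> - 1))\<^sup>2 * sing_mass) * (LINT r|lborel. sing (t - r) * (f r)\<^sup>2)" for t
  have bi: "has_bochner_integral lborel b (3 * ((ml_bound (1/2) \<gamma>)\<^sup>2 * (l * g\<^sup>2)) * sing_mass + 3 * ((ml_bound 0 1)\<^sup>2 * h\<^sup>2) * T
    + 3 * ((ml_bound 0 (\<gamma> - 1))\<^sup>2 * sing_mass) * (sing_mass * (LINT r|lborel. (f r)\<^sup>2)))"
    unfolding b_def
  proof (intro has_bochner_integral_add has_bochner_integral_mult_right sing_integral sing_f2_integral)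
    show "has_bochner_integral lborel (indicator {0..T}) T"
      using T by (auto simp: has_bochner_integral_iff)
  qed
  have "integrable lborel (\<lambda>r. indicator {0..T} r *\<^sub>R (mode' l g h f r)\<^sup>2)"
    by (rule borel_integrable_compact[OF compact_Icc]) (intro continuous_intros mode_continuous l)
  then have mi: "integrable lborel (\<lambda>r. indicator {0..T} r * (mode' l g h f r)\<^sup>2)" by simp
  have F0: "0 \<le> (LINT r|lborel. sing (t - r) * (f r)\<^sup>2)" for t by (simp add: integral_nonneg)
  have "(LINT t|lborel. indicator {0..T} t * (mode' l g h f t)\<^sup>2) \<le> (LINT t|lborel. b t)"
  proof (rule integral_mono_AE[OF mi integrable.intros[OF bi]])
    show "AE t in lborel. indicator {0..T} t * (mode' l g h f t)\<^sup>2 \<le> b t"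
      using AE_lborel_singleton[of 0]
    proof eventually_elim
      case (elim t)
      show ?case
      proof (cases "t \<in> {0..T}")
        case True
        then have t': "0 < t" "t \<le> T" using elim by auto
        define x y z where "x = mlk l 1 t" and "y = mlk l \<gamma> t" and "z = conv (mlk l (\<gamma> - 1)) f t"
        have x: "x\<^sup>2 \<le> (ml_bound 0 1)\<^sup>2" using power_mono[OF ml1_bound[OF l t'], of 2] by (simp add: x_def)
        have y: "l * y\<^sup>2 \<le> (ml_bound (1/2) \<gamma>)\<^sup>2 * sing t"
        proof -
          have "l powr (1/2) * \<bar>y\<bar> \<le> ml_bound (1/2) \<gamma> * t powr (\<gamma> / 2 - 1)"
          proof -
            have e: "\<gamma> - \<gamma> * (1 / 2) - 1 = \<gamma> / 2 - 1" by simp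
            show ?thesis using ml_kernel_bound[OF l, of "1/2" \<gamma> t] \<gamma> t' unfolding e y_def by simp
          qed
          then have "(l powr (1/2) * \<bar>y\<bar>)\<^sup>2 \<le> (ml_bound (1/2) \<gamma> * t powr (\<gamma> / 2 - 1))\<^sup>2" by (intro power_mono) auto
          moreover have "(t powr (\<gamma> / 2 - 1))\<^sup>2 = sing t"
            using t' by (simp add: sing_def power2_eq_square powr_add[symmetric])
          ultimately show ?thesis using l by (simp add: power_mult_distrib powr_half_sqrt)
        qed
        have z: "z\<^sup>2 \<le> (ml_bound 0 (\<gamma> - 1))\<^sup>2 * sing_mass * (LINT r|lborel. sing (t - r) * (f r)\<^sup>2)"
          unfolding z_def by (rule conv_derivative_bound[OF l])
        have "(mode' l g h f t)\<^sup>2 = (- l * g * y + h * x + z)\<^sup>2"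
          unfolding mode_kernel(2)[OF t'] x_def y_def z_def ..
        also have "\<dots> \<le> 3 * ((- l * g * y)\<^sup>2 + (h * x)\<^sup>2 + z\<^sup>2)" by (rule power2_sum3_le)
        also have "\<dots> = 3 * ((l * y\<^sup>2) * (l * g\<^sup>2)) + 3 * (x\<^sup>2 * h\<^sup>2) + 3 * z\<^sup>2" by (simp add: power2_eq_square algebra_simps)
        also have "\<dots> \<le> 3 * (((ml_bound (1/2) \<gamma>)\<^sup>2 * sing t) * (l * g\<^sup>2)) + 3 * ((ml_bound 0 1)\<^sup>2 * h\<^sup>2) + 3 * ((ml_bound 0 (\<gamma> - 1))\<^sup>2 * sing_mass * (LINT r|lborel. sing (t - r) * (f r)\<^sup>2))"
          using l x y z by (intro add_mono mult_left_mono mult_right_mono) auto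
        finally show ?thesis using True by (simp add: b_def mult_ac)
      next
        case False
        then show ?thesis using F0[of t] sing_mass_pos l by (simp add: b_def)
      qed
    qed
  qed
  also have "(LINT t|lborel. b t) = 3 * ((ml_bound (1/2) \<gamma>)\<^sup>2 * sing_mass) * (l * g\<^sup>2) + 3 * ((ml_bound 0 1)\<^sup>2 * T) * h\<^sup>2
    + 3 * ((ml_bound 0 (\<gamma> - 1))\<^sup>2 * (sing_mass * sing_mass)) * (LINT r|lborel. (f r)\<^sup>2)"
    using bi by (simp add: has_bochner_integral_iff mult_ac)
  also have "\<dots> \<le> mode_const * (l * g\<^sup>2) + mode_const * h\<^sup>2 + mode_const * (LINT r|lborel. (f r)\<^sup>2)"
    using l mode_const_ge by (intro add_mono mult_right_mono) auto
  finally show ?thesis by (simp add: algebra_simps)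
qed

end

section \<open>The spectral scale\<close>

text \<open>A finite head tends to 0 and the tails are small uniformly in the parameter. Bounding
  tails through finite sections yields summability as a by-product.\<close>

lemma tails_tendsto_zero:
  fixes z :: "nat \<Rightarrow> real \<Rightarrow> real"
  assumes nonneg: "\<And>k \<tau>. \<tau> \<in> S \<Longrightarrow> 0 \<le> z k \<tau>"
    and tail: "\<And>e. e > 0 \<Longrightarrow> \<exists>n. \<forall>\<tau>\<in>S. \<forall>N. (\<Sum>k\<in>{n..<N}. z k \<tau>) \<le> e"
    and lim: "\<And>k. (z k \<longlongrightarrow> 0) (at t within S)"
  shows "((\<lambda>\<tau>. \<Sum>k. z k \<tau>) \<longlongrightarrow> 0) (at t within S)"
proof (rule tendstoI)
  fix e :: real assume e: "e > 0"
  obtain n where n: "\<And>\<tau> N. \<tau> \<in> S \<Longrightarrow> (\<Sum>k\<in>{n..<N}. z k \<tau>) \<le> e / 2" using tail[of "e / 2"] e by auto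
  have "((\<lambda>\<tau>. \<Sum>k<n. z k \<tau>) \<longlongrightarrow> (\<Sum>k<n. 0)) (at t within S)" by (intro tendsto_sum lim)
  then have "\<forall>\<^sub>F \<tau> in at t within S. (\<Sum>k<n. z k \<tau>) < e / 2" using e by (intro order_tendstoD) auto
  moreover have "\<forall>\<^sub>F \<tau> in at t within S. \<tau> \<in> S" by (auto simp: eventually_at_filter)
  ultimately show "\<forall>\<^sub>F \<tau> in at t within S. dist (\<Sum>k. z k \<tau>) 0 < e"
  proof eventually_elim
    case (elim \<tau>)
    have b: "(\<Sum>k<N. z k \<tau>) \<le> (\<Sum>k<n. z k \<tau>) + e / 2" for N
    proof -
      have "(\<Sum>k<N. z k \<tau>) \<le> (\<Sum>k\<in>{..<n} \<union> {n..<N}. z k \<tau>)"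
        by (rule sum_mono2) (use nonneg elim in auto)
      also have "\<dots> = (\<Sum>k<n. z k \<tau>) + (\<Sum>k\<in>{n..<N}. z k \<tau>)" by (rule sum.union_disjoint) auto
      finally show ?thesis using n[OF elim(2), of N] by simp
    qed
    have s: "summable (\<lambda>k. z k \<tau>)"
      by (rule summableI_nonneg_bounded[OF _ b]) (use nonneg elim in auto)
    have "(\<Sum>k. z k \<tau>) \<le> (\<Sum>k<n. z k \<tau>) + e / 2" by (rule suminf_le_const[OF s b])
    moreover have "0 \<le> (\<Sum>k. z k \<tau>)" by (rule suminf_nonneg[OF s]) (use nonneg elim in auto)
    ultimately show ?case using elim(1) by simp
  qed
qed

lemma summable_tail_small:
  fixes a :: "nat \<Rightarrow> real"
  assumes "summable a" "\<And>k. 0 \<le> a k" "e > 0"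
  obtains n where "\<And>m N. m \<ge> n \<Longrightarrow> (\<Sum>k\<in>{m..<N}. a k) \<le> e"
proof -
  obtain n where n: "\<And>m N. m \<ge> n \<Longrightarrow> norm (\<Sum>k\<in>{m..<N}. a k) < e"
    using assms(1,3) unfolding summable_Cauchy by blast
  have "(\<Sum>k\<in>{m..<N}. a k) \<le> e" if "m \<ge> n" for m N
    using n[OF that, of N] abs_ge_self[of "\<Sum>k\<in>{m..<N}. a k"] by simp
  then show ?thesis by (rule that)
qed

lemma strongly_measurable_inner:
  assumes u: "strongly_measurable M (L2_space \<Omega>) (L2_norm \<Omega>) u" and M: "complete_measure M" and v: "v \<in> L2_space \<Omega>"
  shows "(\<lambda>t. L2_inner \<Omega> (u t) v) \<in> borel_measurable M"
proof -
  interpret complete_measure M by fact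
  obtain \<sigma> where \<sigma>: "\<And>j. simple_function M (\<sigma> j)" "\<And>j. \<sigma> j ` space M \<subseteq> L2_space \<Omega>"
    "AE t in M. (\<lambda>j. L2_norm \<Omega> (\<lambda>x. \<sigma> j t x - u t x)) \<longlonglongrightarrow> 0" and uX: "AE t in M. u t \<in> L2_space \<Omega>"
    using u unfolding strongly_measurable_def by blast
  show ?thesis
  proof (rule borel_measurable_AE_LIMSEQ[where f = "\<lambda>j t. L2_inner \<Omega> (\<sigma> j t) v"])
    show "(\<lambda>t. L2_inner \<Omega> (\<sigma> j t) v) \<in> borel_measurable M" for j
      using simple_function_compose[OF \<sigma>(1)[of j], of "\<lambda>w. L2_inner \<Omega> w v"] by (auto simp: o_def intro: borel_measurable_simple_function)
    show "AE t in M. (\<lambda>j. L2_inner \<Omega> (\<sigma> j t) v) \<longlonglongrightarrow> L2_inner \<Omega> (u t) v"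
      using \<sigma>(3) uX AE_space
    proof eventually_elim
      case (elim t)
      have \<sigma>L: "\<sigma> j t \<in> L2_space \<Omega>" for j using \<sigma>(2)[of j] elim(3) by auto
      have "(\<lambda>j. L2_inner \<Omega> (\<sigma> j t) v - L2_inner \<Omega> (u t) v) \<longlonglongrightarrow> 0"
      proof (rule Lim_null_comparison)
        show "\<forall>\<^sub>F j in sequentially. norm (L2_inner \<Omega> (\<sigma> j t) v - L2_inner \<Omega> (u t) v) \<le> L2_norm \<Omega> (\<lambda>x. \<sigma> j t x - u t x) * L2_norm \<Omega> v"
          using L2_Cauchy_Schwarz[OF L2_diff[OF \<sigma>L elim(2)] v] by (simp add: L2_inner_diff \<sigma>L elim v)
        show "(\<lambda>j. L2_norm \<Omega> (\<lambda>x. \<sigma> j t x - u t x) * L2_norm \<Omega> v) \<longlonglongrightarrow> 0"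
          using tendsto_mult_right[OF elim(1), of "L2_norm \<Omega> v"] by simp
      qed
      then show ?case by (rule LIM_zero_cancel)
    qed
  qed
qed

text \<open>The counterpart of \<open>bounded_has_vector_integral\<close>: a vector identity assumed
  of an arbitrary weak derivative becomes a scalar one. Integrability is a conclusion, since for
  late j the error against a simple function has finite integral.\<close>

lemma has_vector_integral_inner:
  assumes I: "has_vector_integral (lebesgue_on {a<..<b}) (L2_space \<Omega>) (L2_norm \<Omega>) U I" and v: "v \<in> L2_space \<Omega>"
  shows "integrable (lebesgue_on {a<..<b}) (\<lambda>r. L2_inner \<Omega> (U r) v)"
    "L2_inner \<Omega> I v = (LINT r|lebesgue_on {a<..<b}. L2_inner \<Omega> (U r) v)"
proof -
  define M where "M = lebesgue_on {a<..<b}"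
  interpret M: finite_measure M unfolding M_def by (rule finite_measure_Ioo)
  have cm: "complete_measure M" unfolding M_def by (rule complete_lebesgue_on) simp
  obtain \<sigma> where \<sigma>: "\<And>j. simple_function M (\<sigma> j)" "\<And>j. \<sigma> j ` space M \<subseteq> L2_space \<Omega>"
    "AE t in M. (\<lambda>j::nat. L2_norm \<Omega> (\<lambda>x. \<sigma> j t x - U t x)) \<longlonglongrightarrow> 0"
    "(\<lambda>j. \<integral>\<^sup>+ t. ennreal (L2_norm \<Omega> (\<lambda>x. \<sigma> j t x - U t x)) \<partial>M) \<longlonglongrightarrow> 0"
    "(\<lambda>j. L2_norm \<Omega> (\<lambda>x. simple_integral_fun M (\<sigma> j) x - I x)) \<longlonglongrightarrow> 0"
    and UX: "AE t in M. U t \<in> L2_space \<Omega>" and IX: "I \<in> L2_space \<Omega>"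
    using I unfolding has_vector_integral_def M_def by blast
  let ?n = "\<lambda>j t. L2_norm \<Omega> (\<lambda>x. \<sigma> j t x - U t x)"
  have sm: "strongly_measurable M (L2_space \<Omega>) (L2_norm \<Omega>) U" using \<sigma>(1-3) UX unfolding strongly_measurable_def by blast
  have Um: "(\<lambda>r. L2_inner \<Omega> (U r) v) \<in> borel_measurable M" by (rule strongly_measurable_inner[OF sm cm v])
  have si: "integrable M (\<lambda>r. L2_inner \<Omega> (\<sigma> j r) v)" for j
  proof -
    have s: "simple_function M (\<lambda>r. L2_inner \<Omega> (\<sigma> j r) v)"
      using simple_function_compose[OF \<sigma>(1)[of j], of "\<lambda>w. L2_inner \<Omega> w v"] by (simp add: o_def)
    then have "bounded ((\<lambda>r. L2_inner \<Omega> (\<sigma> j r) v) ` space M)" by (intro finite_imp_bounded) (auto simp: simple_function_def)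
    then obtain K where "\<And>r. r \<in> space M \<Longrightarrow> \<bar>L2_inner \<Omega> (\<sigma> j r) v\<bar> \<le> K" unfolding bounded_iff by auto
    then show ?thesis by (intro M.integrable_const_bound[of _ K]) (auto intro: borel_measurable_simple_function[OF s])
  qed
  define e where "e j r = \<bar>L2_inner \<Omega> (\<sigma> j r) v - L2_inner \<Omega> (U r) v\<bar>" for j r
  have e_nonneg: "0 \<le> e j r" for j r by (simp add: e_def)
  have em: "e j \<in> borel_measurable M" for j unfolding e_def using Um si by (intro borel_measurable_abs borel_measurable_diff) auto
  have ele: "AE r in M. e j r \<le> L2_norm \<Omega> (\<lambda>x. \<sigma> j r x - U r x) * L2_norm \<Omega> v" for j
    using UX AE_space
  proof eventually_elim
    case (elim r)
    have \<sigma>L: "\<sigma> j r \<in> L2_space \<Omega>" using \<sigma>(2)[of j] elim(2) by auto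
    then show ?case using L2_Cauchy_Schwarz[OF L2_diff[OF \<sigma>L elim(1)] v] by (simp add: L2_inner_diff elim v e_def)
  qed
  have ennle: "(\<integral>\<^sup>+ r. ennreal (e j r) \<partial>M) \<le> (\<integral>\<^sup>+ t. ennreal (?n j t) \<partial>M) * ennreal (L2_norm \<Omega> v)" for j
  proof -
    have nm: "(\<lambda>t. ennreal (?n j t)) \<in> borel_measurable M"
    proof -
      interpret L: seminormed_space "L2_space \<Omega>" "L2_norm \<Omega>" by (rule seminormed_L2)
      \<comment> \<open>Pulling the constant out of the nonnegative integral requires a measurable
        error norm, which \<open>has_vector_integral\<close> does not state; approximating the error
        by \<sigma> j - \<sigma> i provides it.\<close>
      have "strongly_measurable M (L2_space \<Omega>) (L2_norm \<Omega>) (\<lambda>t x. \<sigma> j t x - U t x)"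
        unfolding strongly_measurable_def
      proof (intro conjI exI[of _ "\<lambda>i t x. \<sigma> j t x - \<sigma> i t x"] allI)
        show "AE t in M. (\<lambda>x. \<sigma> j t x - U t x) \<in> L2_space \<Omega>"
          using UX AE_space by eventually_elim (use \<sigma>(2)[of j] in \<open>auto intro!: L2_diff\<close>)
        show "simple_function M (\<lambda>t x. \<sigma> j t x - \<sigma> i t x)" for i
          using simple_function_compose2[OF \<sigma>(1)[of j] \<sigma>(1)[of i], of "\<lambda>v w x. v x - w x"] by simp
        show "(\<lambda>t x. \<sigma> j t x - \<sigma> i t x) ` space M \<subseteq> L2_space \<Omega>" for i
          using \<sigma>(2)[of i] \<sigma>(2)[of j] by (auto intro!: L2_diff)
        show "AE t in M. (\<lambda>i. L2_norm \<Omega> (\<lambda>x. (\<sigma> j t x - \<sigma> i t x) - (\<sigma> j t x - U t x))) \<longlonglongrightarrow> 0"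
          using \<sigma>(3) by eventually_elim (simp add: L2_norm_uminus[of \<Omega> "U _"])
      qed
      from L.strongly_measurable_norm[OF this cm] show ?thesis by measurable
    qed
    have "(\<integral>\<^sup>+ r. ennreal (e j r) \<partial>M) \<le> (\<integral>\<^sup>+ r. ennreal (L2_norm \<Omega> (\<lambda>x. \<sigma> j r x - U r x)) * ennreal (L2_norm \<Omega> v) \<partial>M)"
      by (rule nn_integral_mono_AE) (use ele[of j] in eventually_elim, simp add: ennreal_leI ennreal_mult'[symmetric])
    also have "\<dots> = (\<integral>\<^sup>+ t. ennreal (?n j t) \<partial>M) * ennreal (L2_norm \<Omega> v)"
      by (rule nn_integral_multc[OF nm])
    finally show ?thesis .
  qed
  have "(\<lambda>j. ennreal (L2_norm \<Omega> v) * (\<integral>\<^sup>+ t. ennreal (?n j t) \<partial>M)) \<longlonglongrightarrow> ennreal (L2_norm \<Omega> v) * 0"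
    by (intro ennreal_tendsto_cmult \<sigma>(4)) simp
  then have c0: "(\<lambda>j. (\<integral>\<^sup>+ t. ennreal (?n j t) \<partial>M) * ennreal (L2_norm \<Omega> v)) \<longlonglongrightarrow> 0"
    by (simp only: mult.commute[of _ "ennreal (L2_norm \<Omega> v)"] mult_zero_right)
  have e0: "(\<lambda>j. \<integral>\<^sup>+ r. ennreal (e j r) \<partial>M) \<longlonglongrightarrow> 0"
    by (rule tendsto_sandwich[OF _ always_eventually[OF allI[OF ennle]] tendsto_const c0]) simp
  then have "\<forall>\<^sub>F j in sequentially. (\<integral>\<^sup>+ r. ennreal (e j r) \<partial>M) < 1" by (intro order_tendstoD) auto
  then have ei: "\<forall>\<^sub>F j in sequentially. integrable M (e j)"
  proof eventually_elim
    case (elim j)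
    have "(\<integral>\<^sup>+ r. ennreal (norm (e j r)) \<partial>M) < \<infinity>" using elim by (simp add: e_def less_trans[OF _ ennreal_one_less_top])
    then show ?case by (intro integrableI_bounded em)
  qed
  then obtain j0 where "integrable M (e j0)" by (auto simp: eventually_sequentially)
  then have Ui: "integrable M (\<lambda>r. L2_inner \<Omega> (U r) v)"
    by (intro Bochner_Integration.integrable_bound[OF Bochner_Integration.integrable_add[OF integrable_abs[OF si[of j0]]] Um])
      (auto simp: e_def)
  then show "integrable (lebesgue_on {a<..<b}) (\<lambda>r. L2_inner \<Omega> (U r) v)" by (simp add: M_def)
  have "(\<lambda>j. ennreal (LINT r|M. e j r)) \<longlonglongrightarrow> ennreal 0"
  proof (rule Lim_transform_eventually[OF e0[folded ennreal_0]])
    show "\<forall>\<^sub>F j in sequentially. (\<integral>\<^sup>+ r. ennreal (e j r) \<partial>M) = ennreal (LINT r|M. e j r)"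
      using ei by eventually_elim (rule nn_integral_eq_integral, simp_all add: e_nonneg)
  qed
  then have eI: "(\<lambda>j. LINT r|M. e j r) \<longlonglongrightarrow> 0"
    by (subst (asm) tendsto_ennreal_iff) (simp_all add: e_nonneg)
  have "(\<lambda>j. (LINT r|M. L2_inner \<Omega> (\<sigma> j r) v) - (LINT r|M. L2_inner \<Omega> (U r) v)) \<longlonglongrightarrow> 0"
  proof (rule Lim_null_comparison[OF always_eventually eI], rule allI)
    fix j
    have "(LINT r|M. L2_inner \<Omega> (\<sigma> j r) v) - (LINT r|M. L2_inner \<Omega> (U r) v) = (LINT r|M. L2_inner \<Omega> (\<sigma> j r) v - L2_inner \<Omega> (U r) v)"
      by (rule Bochner_Integration.integral_diff[OF si Ui, symmetric])
    then show "norm ((LINT r|M. L2_inner \<Omega> (\<sigma> j r) v) - (LINT r|M. L2_inner \<Omega> (U r) v)) \<le> (LINT r|M. e j r)"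
      unfolding e_def by (simp only: real_norm_def integral_abs_bound)
  qed
  then have 1: "(\<lambda>j. LINT r|M. L2_inner \<Omega> (\<sigma> j r) v) \<longlonglongrightarrow> (LINT r|M. L2_inner \<Omega> (U r) v)" by (rule LIM_zero_cancel)
  note s = simple_integral_L2[OF M.finite_measure_axioms \<sigma>(1) \<sigma>(2) v]
  have "(\<lambda>j. L2_inner \<Omega> (simple_integral_fun M (\<sigma> j)) v - L2_inner \<Omega> I v) \<longlonglongrightarrow> 0"
  proof (rule Lim_null_comparison)
    show "\<forall>\<^sub>F j in sequentially. norm (L2_inner \<Omega> (simple_integral_fun M (\<sigma> j)) v - L2_inner \<Omega> I v) \<le> L2_norm \<Omega> (\<lambda>x. simple_integral_fun M (\<sigma> j) x - I x) * L2_norm \<Omega> v"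
      using L2_Cauchy_Schwarz[OF L2_diff[OF s(1) IX] v] by (simp add: L2_inner_diff s(1) IX v)
    show "(\<lambda>j. L2_norm \<Omega> (\<lambda>x. simple_integral_fun M (\<sigma> j) x - I x) * L2_norm \<Omega> v) \<longlonglongrightarrow> 0"
      using tendsto_mult_right[OF \<sigma>(5), of "L2_norm \<Omega> v"] by simp
  qed
  then have "(\<lambda>j. LINT r|M. L2_inner \<Omega> (\<sigma> j r) v) \<longlonglongrightarrow> L2_inner \<Omega> I v" unfolding s(2) by (rule LIM_zero_cancel)
  from LIMSEQ_unique[OF this 1] show "L2_inner \<Omega> I v = (LINT r|lebesgue_on {a<..<b}. L2_inner \<Omega> (U r) v)" by (simp add: M_def)
qed

context L2_basis begin

text \<open>For bounded multipliers Riesz-Fischer supplies the witness behind \<open>SOME\<close>;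
  whichever function is chosen, convergence of the partial sums in L2 determines its
  coefficients.\<close>

lemma spectral_multiplier:
  assumes w: "w \<in> L2_space \<Omega>" and m: "\<And>k. \<bar>m k\<bar> \<le> B"
  shows "spectral_multiplier \<Omega> \<phi> m w \<in> L2_space \<Omega>" "coef (spectral_multiplier \<Omega> \<phi> m w) k = m k * coef w k"
    "L2_norm \<Omega> (spectral_multiplier \<Omega> \<phi> m w) \<le> B * L2_norm \<Omega> w"
proof -
  let ?w = "spectral_multiplier \<Omega> \<phi> m w"
  have B: "B \<ge> 0" using order_trans[OF abs_ge_zero m[of 0]] .
  have le: "(m k * coef w k)\<^sup>2 \<le> B\<^sup>2 * (coef w k)\<^sup>2" for k
    using power_mono[OF m[of k], of 2] by (simp add: power_mult_distrib mult_right_mono)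
  have s: "summable (\<lambda>k. (m k * coef w k)\<^sup>2)"
    by (rule summable_comparison_test'[OF summable_mult[OF coef_summable[OF w], of "B\<^sup>2"], of 0]) (use le in simp)
  obtain y where y: "y \<in> L2_space \<Omega>" "\<And>k. coef y k = m k * coef w k" using Riesz_Fischer[OF s] by blast
  have "L2_sums \<Omega> (\<lambda>k x. m k * coef w k * \<phi> k x) y"
    using L2_sums_coef[OF y(1)] unfolding y(2) .
  then have sm: "L2_sums \<Omega> (\<lambda>k x. m k * coef w k * \<phi> k x) ?w"
    unfolding spectral_multiplier_def by (rule someI[of "L2_sums \<Omega> (\<lambda>k x. m k * coef w k * \<phi> k x)"])
  then show L: "?w \<in> L2_space \<Omega>" by (simp add: L2_sums_def)
  have c: "coef ?w k = m k * coef w k" for k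
  proof -
    let ?s = "\<lambda>N x. \<Sum>k<N. m k * coef w k * \<phi> k x"
    have "(\<lambda>N. coef (\<lambda>x. ?s N x - ?w x) k) \<longlonglongrightarrow> 0"
    proof (rule Lim_null_comparison)
      show "\<forall>\<^sub>F N in sequentially. norm (coef (\<lambda>x. ?s N x - ?w x) k)
          \<le> L2_norm \<Omega> (\<lambda>x. ?s N x - ?w x) * L2_norm \<Omega> (\<phi> k)"
        using L2_Cauchy_Schwarz[OF L2_diff[OF fsum_L2 L] \<phi>_L2] by simp
      show "(\<lambda>N. L2_norm \<Omega> (\<lambda>x. ?s N x - ?w x) * L2_norm \<Omega> (\<phi> k)) \<longlonglongrightarrow> 0"
        using sm tendsto_mult_right[of _ 0 sequentially "L2_norm \<Omega> (\<phi> k)"] by (auto simp: L2_sums_def)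
    qed
    moreover have "\<forall>\<^sub>F N in sequentially. coef (\<lambda>x. ?s N x - ?w x) k = m k * coef w k - coef ?w k"
      using eventually_gt_at_top[of k] by eventually_elim (simp add: L2_inner_diff fsum_L2 L coef_fsum)
    ultimately have "(\<lambda>N::nat. m k * coef w k - coef ?w k) \<longlonglongrightarrow> 0" by (simp add: tendsto_cong)
    then show ?thesis by (simp add: LIMSEQ_const_iff)
  qed
  show "coef ?w k = m k * coef w k" by (rule c)
  have "(L2_norm \<Omega> ?w)\<^sup>2 \<le> (B * L2_norm \<Omega> w)\<^sup>2"
    using sums_le[OF _ Parseval[OF L] sums_mult[OF Parseval[OF w], of "B\<^sup>2"]] le by (simp add: c power_mult_distrib)
  then show "L2_norm \<Omega> ?w \<le> B * L2_norm \<Omega> w"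
    by (rule power2_le_imp_le) (use B in simp)
qed

lemma L2_norm_cong_coef:
  assumes "w \<in> L2_space \<Omega>" "v \<in> L2_space \<Omega>" "\<And>k. coef w k = coef v k"
  shows "L2_norm \<Omega> w = L2_norm \<Omega> v"
  using assms by (simp add: L2_norm_coef)

end

section \<open>The energy space and its dual\<close>

locale spectral_scale = L2_basis +
  fixes lam :: "nat \<Rightarrow> real" and s lam0 :: real
  assumes lam0: "lam0 > 0" "\<And>k. lam0 \<le> lam k" and s_pos: "s > 0"
begin

definition ell :: "nat \<Rightarrow> real" where "ell k = lam k powr s"

abbreviation HS where "HS \<equiv> HH_space \<Omega> lam \<phi> s"
abbreviation HN where "HN \<equiv> HH_norm \<Omega> lam \<phi> s"
abbreviation HD where "HD \<equiv> HH_dual \<Omega> lam \<phi> s"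
abbreviation LS where "LS \<equiv> fractional_power \<Omega> lam \<phi> s"
abbreviation HDN where "HDN \<equiv> HH_dual_norm \<Omega> lam \<phi> s"

lemma lam_pos: "lam k > 0" using lam0 less_le_trans by blast

lemma ell_pos [simp]: "ell k > 0" using lam_pos[of k] by (simp add: ell_def)

lemma ell_nonneg [simp]: "0 \<le> ell k" by (rule less_imp_le[OF ell_pos])

definition ell0 :: real where "ell0 = lam0 powr s"

lemma ell0: "ell0 > 0" "ell0 \<le> ell k"
  using lam0 s_pos by (auto simp: ell0_def ell_def intro!: powr_mono2)

text \<open>Absorbing the weight as a square root puts energy norms in the form of norms of
  square-summable sequences, to which \<open>l2_triangle\<close> and
  \<open>l2_Cauchy_Schwarz\<close> apply.\<close>

lemma HS_iff: "w \<in> HS \<longleftrightarrow> w \<in> L2_space \<Omega> \<and> summable (\<lambda>k. (sqrt (ell k) * coef w k)\<^sup>2)"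
  using ell_nonneg by (simp add: HH_space_def ell_def power_mult_distrib)

lemma HN_eq: "HN w = sqrt (\<Sum>k. (sqrt (ell k) * coef w k)\<^sup>2)"
  using ell_nonneg by (simp add: HH_norm_def ell_def power_mult_distrib)

lemma HS_L2: "w \<in> HS \<Longrightarrow> w \<in> L2_space \<Omega>" by (simp add: HS_iff)

lemma HS_lincomb:
  assumes "w \<in> HS" "v \<in> HS" shows "(\<lambda>x. a * w x + b * v x) \<in> HS"
proof -
  have "summable (\<lambda>k. (a * (sqrt (ell k) * coef w k) + b * (sqrt (ell k) * coef v k))\<^sup>2)"
    using assms by (intro l2_lincomb) (auto simp: HS_iff)
  then show ?thesis using assms
    by (simp add: HS_iff L2_lincomb L2_inner_lincomb algebra_simps)
qed

lemma HS_diff: "w \<in> HS \<Longrightarrow> v \<in> HS \<Longrightarrow> (\<lambda>x. w x - v x) \<in> HS"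
  using HS_lincomb[of w v 1 "-1"] by simp

lemma HN_nonneg: "w \<in> HS \<Longrightarrow> 0 \<le> HN w"
  by (auto simp: HN_eq HS_iff intro!: suminf_nonneg)

lemma HN_square: "w \<in> HS \<Longrightarrow> (HN w)\<^sup>2 = (\<Sum>k. ell k * (coef w k)\<^sup>2)"
  using ell_nonneg by (simp add: HN_eq HS_iff suminf_nonneg power_mult_distrib)

lemma seminormed_HS: "seminormed_space HS HN"
proof
  fix v w :: "'a \<Rightarrow> real"
  show "HN (\<lambda>x. 0) = 0" by (simp add: HN_eq L2_inner_def)
  have "L2_inner \<Omega> (\<lambda>x. v x - w x) u = - L2_inner \<Omega> (\<lambda>x. w x - v x) u" for u
    using L2_inner_scale[of \<Omega> "-1" "\<lambda>x. w x - v x" u] by simp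
  then show "HN (\<lambda>x. v x - w x) = HN (\<lambda>x. w x - v x)" by (simp add: HN_eq)
  assume v: "v \<in> HS" and w: "w \<in> HS"
  show "(\<lambda>x. v x - w x) \<in> HS" by (rule HS_diff[OF v w])
  show "0 \<le> HN v" by (rule HN_nonneg[OF v])
  have "sqrt (\<Sum>k. (sqrt (ell k) * coef (\<lambda>x. v x - w x) k + sqrt (ell k) * coef w k)\<^sup>2) \<le> HN (\<lambda>x. v x - w x) + HN w"
    unfolding HN_eq using HS_diff[OF v w] w by (intro l2_triangle) (auto simp: HS_iff)
  then show "HN v \<le> HN (\<lambda>x. v x - w x) + HN w"
    using HS_L2[OF v] HS_L2[OF w] by (simp add: HN_eq[of v] L2_inner_diff algebra_simps)
qed

lemma L2_norm_le_HN: "w \<in> HS \<Longrightarrow> L2_norm \<Omega> w \<le> HN w / sqrt ell0"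
proof -
  assume w: "w \<in> HS"
  have "(sqrt ell0 * L2_norm \<Omega> w)\<^sup>2 \<le> (HN w)\<^sup>2"
  proof -
    have "(\<lambda>k. ell0 * (coef w k)\<^sup>2) sums (ell0 * (L2_norm \<Omega> w)\<^sup>2)" by (intro sums_mult Parseval HS_L2 w)
    from sums_le[OF _ this, of "\<lambda>k. ell k * (coef w k)\<^sup>2" "(HN w)\<^sup>2"] have "ell0 * (L2_norm \<Omega> w)\<^sup>2 \<le> (HN w)\<^sup>2"
      if "(\<lambda>k. ell k * (coef w k)\<^sup>2) sums (HN w)\<^sup>2" using that by (simp add: mult_right_mono ell0)
    moreover have "(\<lambda>k. ell k * (coef w k)\<^sup>2) sums (HN w)\<^sup>2"
      using w ell_nonneg by (simp add: HN_square HS_iff power_mult_distrib summable_sums)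
    ultimately show ?thesis using ell0(1) by (simp add: power_mult_distrib)
  qed
  then have "sqrt ell0 * L2_norm \<Omega> w \<le> HN w" by (rule power2_le_imp_le) (rule HN_nonneg[OF w])
  then show ?thesis using ell0(1) by (simp add: field_simps)
qed

lemma C_time_HS_L2:
  assumes u: "u \<in> C_time T HS HN"
  shows "u \<in> C_time T (L2_space \<Omega>) (L2_norm \<Omega>)"
  unfolding C_time_def mem_Collect_eq
proof (intro ballI conjI)
  fix t assume t: "t \<in> {0..T}"
  have uX: "\<And>t. t \<in> {0..T} \<Longrightarrow> u t \<in> HS" using u by (auto simp: C_time_def)
  show "u t \<in> L2_space \<Omega>" by (rule HS_L2[OF uX[OF t]])
  have 1: "((\<lambda>\<tau>. HN (\<lambda>x. u \<tau> x - u t x) / sqrt ell0) \<longlongrightarrow> 0 / sqrt ell0) (at t within {0..T})"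
    using u t ell0(1) by (intro tendsto_divide tendsto_const) (auto simp: C_time_def)
  show "((\<lambda>\<tau>. L2_norm \<Omega> (\<lambda>x. u \<tau> x - u t x)) \<longlongrightarrow> 0) (at t within {0..T})"
  proof (rule Lim_null_comparison)
    show "\<forall>\<^sub>F \<tau> in at t within {0..T}. norm (L2_norm \<Omega> (\<lambda>x. u \<tau> x - u t x)) \<le> HN (\<lambda>x. u \<tau> x - u t x) / sqrt ell0"
      using t by (auto simp: eventually_at_filter intro!: always_eventually L2_norm_le_HN HS_diff uX)
  qed (use 1 in simp)
qed

lemma HDN_le:
  assumes "\<And>v. v \<in> HS \<Longrightarrow> \<bar>F v\<bar> \<le> c * HN v" "c \<ge> 0"
  shows "HDN F \<le> c"
  unfolding HH_dual_norm_def
proof (rule cSUP_least)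
  have "(\<lambda>x. 0) \<in> HS" by (simp add: HS_iff L2_zero L2_inner_def)
  moreover have "HN (\<lambda>x. 0) = 0" by (simp add: HN_eq L2_inner_def)
  ultimately show "{v \<in> HS. HN v \<le> 1} \<noteq> {}" by force
  fix v assume v: "v \<in> {v \<in> HS. HN v \<le> 1}"
  then have "\<bar>F v\<bar> \<le> c * HN v" using assms(1) by simp
  also have "\<dots> \<le> c * 1" using v assms(2) by (intro mult_left_mono) auto
  finally show "\<bar>F v\<bar> \<le> c" by simp
qed

text \<open>The dual norm is a supremum of reals, which is meaningful only for sets bounded
  above.\<close>

lemma HD_bdd: "F \<in> HD \<Longrightarrow> bdd_above ((\<lambda>v. \<bar>F v\<bar>) ` {v \<in> HS. HN v \<le> 1})"
proof -
  assume "F \<in> HD"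
  then obtain M where M: "\<forall>v\<in>HS. \<bar>F v\<bar> \<le> M * HN v" by (auto simp: HH_dual_def)
  show ?thesis
  proof (rule bdd_aboveI2)
    fix v assume v: "v \<in> {v \<in> HS. HN v \<le> 1}"
    have "\<bar>F v\<bar> \<le> M * HN v" using M v by simp
    also have "\<dots> \<le> \<bar>M\<bar> * HN v" using v by (intro mult_right_mono) (auto intro: HN_nonneg)
    also have "\<dots> \<le> \<bar>M\<bar> * 1" using v by (intro mult_left_mono) auto
    finally show "\<bar>F v\<bar> \<le> \<bar>M\<bar>" by simp
  qed
qed

lemma seminormed_HD: "seminormed_space HD HDN"
proof
  have z: "(\<lambda>x. 0) \<in> {v \<in> HS. HN v \<le> 1}" by (simp add: HS_iff L2_zero L2_inner_def HN_eq)
  fix F G :: "('a \<Rightarrow> real) \<Rightarrow> real"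
  have "{v \<in> HS. HN v \<le> 1} \<noteq> {}" using z by blast
  then show "HDN (\<lambda>x. 0) = 0" unfolding HH_dual_norm_def abs_zero by (rule cSUP_const)
  show "HDN (\<lambda>x. F x - G x) = HDN (\<lambda>x. G x - F x)" unfolding HH_dual_norm_def by (simp add: abs_minus_commute)
  assume F: "F \<in> HD" and G: "G \<in> HD"
  show FG: "(\<lambda>x. F x - G x) \<in> HD"
  proof -
    obtain A B where A: "\<forall>v\<in>HS. \<bar>F v\<bar> \<le> A * HN v" and B: "\<forall>v\<in>HS. \<bar>G v\<bar> \<le> B * HN v"
      using F G by (auto simp: HH_dual_def)
    have "\<forall>v\<in>HS. \<bar>F v - G v\<bar> \<le> (A + B) * HN v"
    proof
      fix v assume v: "v \<in> HS"
      have "\<bar>F v - G v\<bar> \<le> \<bar>F v\<bar> + \<bar>G v\<bar>" by simp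
      also have "\<dots> \<le> A * HN v + B * HN v" using A B v by (intro add_mono) auto
      finally show "\<bar>F v - G v\<bar> \<le> (A + B) * HN v" by (simp add: distrib_right)
    qed
    moreover have "\<forall>v\<in>HS. \<forall>w\<in>HS. \<forall>a b. F (\<lambda>x. a * v x + b * w x) - G (\<lambda>x. a * v x + b * w x) = a * (F v - G v) + b * (F w - G w)"
      using F G by (simp add: HH_dual_def algebra_simps)
    ultimately show ?thesis unfolding HH_dual_def by blast
  qed
  show nn: "0 \<le> HDN F"
    unfolding HH_dual_norm_def by (rule cSUP_upper2[OF HD_bdd[OF F] z]) simp
  show "HDN F \<le> HDN (\<lambda>x. F x - G x) + HDN G"
    unfolding HH_dual_norm_def[of _ _ _ _ F]
  proof (rule cSUP_least)
    show "{v \<in> HS. HN v \<le> 1} \<noteq> {}" using z by blast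
    fix v assume v: "v \<in> {v \<in> HS. HN v \<le> 1}"
    have "\<bar>F v\<bar> \<le> \<bar>F v - G v\<bar> + \<bar>G v\<bar>" by simp
    also have "\<dots> \<le> HDN (\<lambda>x. F x - G x) + HDN G"
      unfolding HH_dual_norm_def by (intro add_mono cSUP_upper2[OF HD_bdd[OF FG] v] cSUP_upper2[OF HD_bdd[OF G] v]) auto
    finally show "\<bar>F v\<bar> \<le> HDN (\<lambda>x. F x - G x) + HDN G" .
  qed
qed

lemma frac_eq: "LS w v = (\<Sum>k. (sqrt (ell k) * coef w k) * (sqrt (ell k) * coef v k))"
  unfolding fractional_power_def
proof (rule suminf_cong)
  fix k
  have "sqrt (ell k) * sqrt (ell k) = ell k" by (simp add: less_imp_le)
  then have "(sqrt (ell k) * coef w k) * (sqrt (ell k) * coef v k) = ell k * (coef w k * coef v k)"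
    by (metis (no_types, lifting) mult.assoc mult.left_commute)
  then show "lam k powr s * coef w k * L2_inner \<Omega> (\<phi> k) v = (sqrt (ell k) * coef w k) * (sqrt (ell k) * coef v k)"
    by (simp add: ell_def L2_inner_commute[of \<Omega> "\<phi> k"])
qed

lemma frac_props:
  assumes w: "w \<in> HS" and v: "v \<in> HS"
  shows "summable (\<lambda>k. (sqrt (ell k) * coef w k) * (sqrt (ell k) * coef v k))"
    "\<bar>\<Sum>k<n. (sqrt (ell k) * coef w k) * (sqrt (ell k) * coef v k)\<bar> \<le> HN w * HN v"
    "\<bar>LS w v\<bar> \<le> HN w * HN v"
proof -
  note cs = l2_Cauchy_Schwarz[OF conjunct2[OF iffD1[OF HS_iff w]] conjunct2[OF iffD1[OF HS_iff v]]]
  show "summable (\<lambda>k. (sqrt (ell k) * coef w k) * (sqrt (ell k) * coef v k))" by (rule cs(2))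
  show "\<bar>\<Sum>k<n. (sqrt (ell k) * coef w k) * (sqrt (ell k) * coef v k)\<bar> \<le> HN w * HN v"
    unfolding HN_eq by (rule cs(3))
  show "\<bar>LS w v\<bar> \<le> HN w * HN v"
    unfolding HN_eq frac_eq by (rule cs(4))
qed

lemma frac_diff:
  assumes w: "w \<in> HS" "w' \<in> HS" and v: "v \<in> HS"
  shows "LS (\<lambda>x. w x - w' x) v = LS w v - LS w' v"
proof -
  let ?a = "\<lambda>w k. (sqrt (ell k) * coef w k) * (sqrt (ell k) * coef v k)"
  have "?a (\<lambda>x. w x - w' x) k = ?a w k - ?a w' k" for k
    by (simp only: L2_inner_diff[OF HS_L2[OF w(1)] HS_L2[OF w(2)] \<phi>_L2] left_diff_distrib right_diff_distrib)
  then show ?thesis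
    unfolding frac_eq by (simp only: suminf_diff[OF frac_props(1)[OF w(1) v] frac_props(1)[OF w(2) v]])
qed

lemma frac_\<phi>: "LS w (\<phi> k) = ell k * coef w k"
proof -
  have "LS w (\<phi> k) = (\<Sum>j. if j = k then ell k * coef w k else 0)"
    unfolding fractional_power_def by (rule suminf_cong) (auto simp: coef_\<phi> ell_def)
  also have "\<dots> = ell k * coef w k" by (subst suminf_finite[of "{k}"]) auto
  finally show ?thesis .
qed

lemma \<phi>_HS: "\<phi> k \<in> HS"
proof -
  have "summable (\<lambda>j. (sqrt (ell j) * coef (\<phi> k) j)\<^sup>2)"
    by (rule summable_finite[of "{k}"]) (auto simp: coef_\<phi>)
  then show ?thesis by (simp add: HS_iff)
qed

text \<open>The equation leaves f minus the fractional power of u as the only candidate for the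
  fractional time derivative. This places it in the dual, the part of f with the embedding constant
  1 / sqrt \<open>ell0\<close>.\<close>

lemma functional_HD:
  assumes f: "f \<in> L2_space \<Omega>" and w: "w \<in> HS"
  shows "(\<lambda>v. L2_inner \<Omega> f v - LS w v) \<in> HD"
    "HDN (\<lambda>v. L2_inner \<Omega> f v - LS w v) \<le> L2_norm \<Omega> f / sqrt ell0 + HN w"
proof -
  have b: "\<bar>L2_inner \<Omega> f v - LS w v\<bar> \<le> (L2_norm \<Omega> f / sqrt ell0 + HN w) * HN v" if v: "v \<in> HS" for v
  proof -
    have "\<bar>L2_inner \<Omega> f v\<bar> \<le> L2_norm \<Omega> f * L2_norm \<Omega> v" by (rule L2_Cauchy_Schwarz[OF f HS_L2[OF v]])
    also have "\<dots> \<le> L2_norm \<Omega> f * (HN v / sqrt ell0)" by (intro mult_left_mono L2_norm_le_HN v) auto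
    finally have "\<bar>L2_inner \<Omega> f v\<bar> \<le> L2_norm \<Omega> f / sqrt ell0 * HN v" by simp
    then show ?thesis using frac_props(3)[OF w v] by (simp add: distrib_right)
  qed
  have lin: "L2_inner \<Omega> f (\<lambda>x. a * v x + b * v' x) - LS w (\<lambda>x. a * v x + b * v' x)
     = a * (L2_inner \<Omega> f v - LS w v) + b * (L2_inner \<Omega> f v' - LS w v')"
    if v: "v \<in> HS" "v' \<in> HS" for v v' a b
  proof -
    have 1: "L2_inner \<Omega> f (\<lambda>x. a * v x + b * v' x) = a * L2_inner \<Omega> f v + b * L2_inner \<Omega> f v'"
      using L2_inner_lincomb[OF HS_L2[OF v(1)] HS_L2[OF v(2)] f, of a b] by (simp add: L2_inner_commute)
    have "(\<lambda>k. a * ((sqrt (ell k) * coef w k) * (sqrt (ell k) * coef v k)) + b * ((sqrt (ell k) * coef w k) * (sqrt (ell k) * coef v' k)))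
       sums (a * LS w v + b * LS w v')"
      unfolding frac_eq by (intro sums_add sums_mult summable_sums frac_props w v)
    then have "LS w (\<lambda>x. a * v x + b * v' x) = a * LS w v + b * LS w v'"
      unfolding frac_eq[of w "\<lambda>x. a * v x + b * v' x"]
      by (simp add: sums_iff L2_inner_lincomb HS_L2 v algebra_simps)
    then show ?thesis unfolding 1 by (simp add: algebra_simps)
  qed
  show "(\<lambda>v. L2_inner \<Omega> f v - LS w v) \<in> HD"
    unfolding HH_dual_def using b lin by blast
  show "HDN (\<lambda>v. L2_inner \<Omega> f v - LS w v) \<le> L2_norm \<Omega> f / sqrt ell0 + HN w"
    using b HN_nonneg[OF w] ell0(1) by (intro HDN_le) auto
qed

text \<open>The candidate depends linearly and continuously on the pair of f and u, so simple
  approximations of the two combine to simple approximations of it.\<close>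

lemma strongly_measurable_functional:
  assumes f: "strongly_measurable M (L2_space \<Omega>) (L2_norm \<Omega>) f" and u: "strongly_measurable M HS HN u"
  shows "strongly_measurable M HD HDN (\<lambda>t v. L2_inner \<Omega> (f t) v - LS (u t) v)"
proof -
  obtain \<sigma> where \<sigma>: "\<And>j. simple_function M (\<sigma> j)" "\<And>j. \<sigma> j ` space M \<subseteq> L2_space \<Omega>"
    "AE t in M. (\<lambda>j::nat. L2_norm \<Omega> (\<lambda>x. \<sigma> j t x - f t x)) \<longlonglongrightarrow> 0" and fX: "AE t in M. f t \<in> L2_space \<Omega>"
    using f unfolding strongly_measurable_def by blast
  obtain \<rho> where \<rho>: "\<And>j. simple_function M (\<rho> j)" "\<And>j. \<rho> j ` space M \<subseteq> HS"
    "AE t in M. (\<lambda>j::nat. HN (\<lambda>x. \<rho> j t x - u t x)) \<longlonglongrightarrow> 0" and uX: "AE t in M. u t \<in> HS"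
    using u unfolding strongly_measurable_def by blast
  define W where "W f w v = L2_inner \<Omega> f v - LS w v" for f w v
  have W: "W f w \<in> HD" if "f \<in> L2_space \<Omega>" "w \<in> HS" for f w
    using functional_HD(1)[OF that] by (simp add: W_def[abs_def])
  interpret D: seminormed_space HD HDN by (rule seminormed_HD)
  let ?df = "\<lambda>j t x. \<sigma> j t x - f t x"
  let ?du = "\<lambda>j t x. \<rho> j t x - u t x"
  have "strongly_measurable M HD HDN (\<lambda>t. W (f t) (u t))"
    unfolding strongly_measurable_def
  proof (intro conjI exI[of _ "\<lambda>j t. W (\<sigma> j t) (\<rho> j t)"] allI)
    show "AE t in M. W (f t) (u t) \<in> HD" using fX uX by eventually_elim (rule W)
    show "simple_function M (\<lambda>t. W (\<sigma> j t) (\<rho> j t))" for j by (rule simple_function_compose2[OF \<sigma>(1) \<rho>(1)])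
    show "(\<lambda>t. W (\<sigma> j t) (\<rho> j t)) ` space M \<subseteq> HD" for j using \<sigma>(2)[of j] \<rho>(2)[of j] by (auto intro!: W)
    show "AE t in M. (\<lambda>j. HDN (\<lambda>v. W (\<sigma> j t) (\<rho> j t) v - W (f t) (u t) v)) \<longlonglongrightarrow> 0"
      using \<sigma>(3) \<rho>(3) fX uX AE_space
    proof eventually_elim
      case (elim t)
      have \<sigma>L: "\<sigma> j t \<in> L2_space \<Omega>" and \<rho>L: "\<rho> j t \<in> HS" for j using \<sigma>(2)[of j] \<rho>(2)[of j] elim(5) by auto
      have "(\<lambda>j. L2_norm \<Omega> (?df j t) / sqrt ell0 + HN (?du j t)) \<longlonglongrightarrow> 0 / sqrt ell0 + 0"
        using ell0(1) by (intro tendsto_intros elim) auto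
      then have lim: "(\<lambda>j. L2_norm \<Omega> (?df j t) / sqrt ell0 + HN (?du j t)) \<longlonglongrightarrow> 0" by simp
      show ?case
      proof (rule Lim_null_comparison[OF always_eventually lim], rule allI)
        fix j
        have dL: "(?df j t) \<in> L2_space \<Omega>" and dH: "(?du j t) \<in> HS"
          by (intro L2_diff \<sigma>L elim HS_diff \<rho>L)+
        have le: "\<bar>W (\<sigma> j t) (\<rho> j t) v - W (f t) (u t) v\<bar> \<le> (L2_norm \<Omega> (?df j t) / sqrt ell0 + HN (?du j t)) * HN v" if v: "v \<in> HS" for v
        proof -
          have "\<bar>W (\<sigma> j t) (\<rho> j t) v - W (f t) (u t) v\<bar> = \<bar>L2_inner \<Omega> (?df j t) v - LS (?du j t) v\<bar>"
            using v by (simp add: W_def L2_inner_diff \<sigma>L elim HS_L2 frac_diff \<rho>L)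
          also have "\<dots> \<le> L2_norm \<Omega> (?df j t) * L2_norm \<Omega> v + HN (?du j t) * HN v"
            using L2_Cauchy_Schwarz[OF dL HS_L2[OF v]] frac_props(3)[OF dH v] by linarith
          also have "\<dots> \<le> L2_norm \<Omega> (?df j t) * (HN v / sqrt ell0) + HN (?du j t) * HN v"
            by (rule add_right_mono[OF mult_left_mono[OF L2_norm_le_HN[OF v] L2_norm_nonneg]])
          also have "\<dots> = (L2_norm \<Omega> (?df j t) / sqrt ell0 + HN (?du j t)) * HN v"
            by (simp only: distrib_right times_divide_eq_left times_divide_eq_right)
          finally show ?thesis .
        qed
        have "0 \<le> HDN (\<lambda>v. W (\<sigma> j t) (\<rho> j t) v - W (f t) (u t) v)"
          by (intro D.nonneg D.diff W \<sigma>L \<rho>L elim)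
        moreover have "HDN (\<lambda>v. W (\<sigma> j t) (\<rho> j t) v - W (f t) (u t) v) \<le> L2_norm \<Omega> (?df j t) / sqrt ell0 + HN (?du j t)"
          using le HN_nonneg[OF dH] ell0(1) by (intro HDN_le) auto
        ultimately show "norm (HDN (\<lambda>v. W (\<sigma> j t) (\<rho> j t) v - W (f t) (u t) v)) \<le> L2_norm \<Omega> (?df j t) / sqrt ell0 + HN (?du j t)"
          by simp
      qed
    qed
  qed
  then show ?thesis by (simp add: W_def[abs_def])
qed

end

lemma lborel_integral_support:
  fixes a :: "real \<Rightarrow> real"
  assumes a: "a \<in> borel_measurable borel" and "\<And>t. t \<notin> S \<Longrightarrow> a t = 0" and S: "S \<in> sets lebesgue"
  shows "integrable (lebesgue_on S) a \<longleftrightarrow> integrable lborel a" "(LINT t|lebesgue_on S. a t) = (LINT t|lborel. a t)"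
proof -
  have i: "(\<lambda>t. indicator S t * a t) = a" using assms(2) by (auto simp: fun_eq_iff split: split_indicator)
  show "integrable (lebesgue_on S) a \<longleftrightarrow> integrable lborel a"
    using S a by (subst integrable_restrict_space) (auto simp: i integrable_completion)
  show "(LINT t|lebesgue_on S. a t) = (LINT t|lborel. a t)"
    using S a by (subst integral_restrict_space) (auto simp: i integral_completion)
qed

context forcing begin

lemma mode_has_derivative:
  assumes l: "l > 0" and t: "t \<in> {0..T}"
  shows "(mode l g h f has_vector_derivative mode' l g h f t) (at t within {0..T})"
proof -
  have "((\<lambda>t. g + integral {0..t} (mode' l g h f)) has_vector_derivative 0 + mode' l g h f t) (at t within {0..T})"
    by (intro has_vector_derivative_add has_vector_derivative_const integral_has_vector_derivative mode_continuous l t)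
  moreover have "mode l g h f \<tau> = g + integral {0..\<tau>} (mode' l g h f)" if \<tau>: "\<tau> \<in> {0..T}" for \<tau>
    using continuous_integral_Icc(2)[OF continuous_on_subset[OF mode_continuous(2)[OF l]], of 0 \<tau> g h] \<tau>
    by (simp add: mode_derivative[OF l \<tau>])
  ultimately show ?thesis
    using has_vector_derivative_transform[OF t, of "mode l g h f"] by simp
qed

lemma mode_integration_by_parts:
  assumes l: "l > 0" and \<psi>: "\<psi> \<in> test_functions {0<..<T}"
  shows "(LINT t|leb T. deriv \<psi> t * mode l g h f t) = - (LINT t|leb T. \<psi> t * mode' l g h f t)"
  by (rule test_function_by_parts[OF \<psi> T mode_has_derivative[OF l] mode_continuous(2)[OF l]])

end

section \<open>The weak solution\<close>

text \<open>The coefficients of f are determined only up to null sets and only Lebesgue measurable.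
  F replaces them by Borel functions that vanish outside (0, T) and obey the Bessel bound at every
  time, so that the scalar theory applies to each mode without exceptional times.\<close>

locale wave_data = spectral_scale \<Omega> \<phi> lam s lam0 + ml_kernels \<gamma> T
  for \<Omega> :: "'a::euclidean_space set" and \<phi> lam s lam0 \<gamma> T +
  fixes f :: "real \<Rightarrow> 'a \<Rightarrow> real" and g h :: "'a \<Rightarrow> real" and F :: "nat \<Rightarrow> real \<Rightarrow> real"
  assumes f: "f \<in> Linf_time T (L2_space \<Omega>) (L2_norm \<Omega>)" and g: "g \<in> HH_space \<Omega> lam \<phi> (2 * s)" and h: "h \<in> L2_space \<Omega>"
    and F: "\<And>k. F k \<in> borel_measurable borel" "\<And>k t. t \<notin> {0<..<T} \<Longrightarrow> F k t = 0"
      "\<And>n t. (\<Sum>k<n. (F k t)\<^sup>2) \<le> (Linf_time_norm T (L2_norm \<Omega>) f)\<^sup>2"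
      "AE t in leb T. \<forall>k. coef (f t) k = F k t"

lemma (in L2_basis) coefficient_functions:
  assumes f: "f \<in> Linf_time T (L2_space \<Omega>) (L2_norm \<Omega>)" and T: "T > 0"
  obtains F :: "nat \<Rightarrow> real \<Rightarrow> real" where "\<And>k. F k \<in> borel_measurable borel" "\<And>k t. t \<notin> {0<..<T} \<Longrightarrow> F k t = 0"
      "\<And>n t. (\<Sum>k<n. (F k t)\<^sup>2) \<le> (Linf_time_norm T (L2_norm \<Omega>) f)\<^sup>2"
      "AE t in leb T. \<forall>k. coef (f t) k = F k t"
proof -
  interpret L: seminormed_space "L2_space \<Omega>" "L2_norm \<Omega>" by (rule seminormed_L2)
  define M where "M = leb T"
  have cm: "complete_measure M" unfolding M_def by (rule complete_lebesgue_on) simp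
  have sm: "strongly_measurable M (L2_space \<Omega>) (L2_norm \<Omega>) f" using f by (simp add: Linf_time_def M_def)
  define B where "B = Linf_time_norm T (L2_norm \<Omega>) f"
  have B: "AE t in M. L2_norm \<Omega> (f t) \<le> B" unfolding M_def B_def by (rule L.Linf_time_norm_bound(2)[OF f T])
  have fX: "AE t in M. f t \<in> L2_space \<Omega>" using sm by (simp add: strongly_measurable_def)
  have "\<exists>e. e \<in> borel_measurable lborel \<and> (AE t in M. coef (f t) k = e t)" for k
  proof -
    have "(\<lambda>t. coef (f t) k) \<in> borel_measurable M" by (rule strongly_measurable_inner[OF sm cm]) simp
    then have "(\<lambda>t. indicator {0<..<T} t * coef (f t) k) \<in> borel_measurable (completion lborel)"
      unfolding M_def by (subst (asm) borel_measurable_restrict_space_iff) (auto simp: mult.commute)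
    from completion_ex_borel_measurable_real[OF this] obtain e where e: "e \<in> borel_measurable lborel"
      "AE t in lborel. indicator {0<..<T} t * coef (f t) k = e t" by auto
    have "AE t in lebesgue. t \<in> {0<..<T} \<longrightarrow> coef (f t) k = e t"
      using AE_completion[OF e(2)] by eventually_elim (auto split: split_indicator_asm)
    then show ?thesis using e(1) unfolding M_def by (subst AE_restrict_space_iff) auto
  qed
  then obtain e where e [measurable]: "\<And>k. e k \<in> borel_measurable lborel" and ee: "\<And>k. AE t in M. coef (f t) k = e k t" by metis
  \<comment> \<open>The Borel versions e k may violate the Bessel bound on a null set; restricting
    them all to the one Borel set S repairs this for every n at once.\<close>
  define S where "S = {t \<in> {0<..<T}. \<forall>n. (\<Sum>k<n. (e k t)\<^sup>2) \<le> B\<^sup>2}"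
  have [measurable]: "S \<in> sets borel" unfolding S_def by measurable
  have all: "AE t in M. \<forall>k. coef (f t) k = e k t" using ee by (simp add: AE_all_countable)
  have "AE t in M. \<forall>k. coef (f t) k = indicator S t * e k t"
    using all B fX AE_space
  proof eventually_elim
    case (elim t)
    have "(\<Sum>k<n. (e k t)\<^sup>2) \<le> B\<^sup>2" for n
    proof -
      have "(\<Sum>k<n. (coef (f t) k)\<^sup>2) \<le> (L2_norm \<Omega> (f t))\<^sup>2"
        using sum_le_suminf[OF coef_summable[OF elim(3)], of "{..<n}"] Parseval[OF elim(3)] by (simp add: sums_iff)
      also have "\<dots> \<le> B\<^sup>2" using elim(2) by (intro power_mono) auto
      finally show ?thesis using elim(1) by simp
    qed
    then have "t \<in> S" using elim(4) by (simp add: S_def M_def)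
    then show ?case using elim(1) by simp
  qed
  moreover have "(\<Sum>k<n. (indicator S t * e k t)\<^sup>2) \<le> B\<^sup>2" for n t
    by (cases "t \<in> S") (auto simp: S_def)
  moreover have "(\<lambda>t. indicator S t * e k t) \<in> borel_measurable borel" for k by measurable
  moreover have "indicator S t * e k t = 0" if "t \<notin> {0<..<T}" for k t using that by (auto simp: S_def indicator_def)
  ultimately show ?thesis
    by (intro that[of "\<lambda>k t. indicator S t * e k t"]) (simp_all only: M_def B_def)
qed

context wave_data begin

abbreviation G2 where "G2 \<equiv> HH_norm \<Omega> lam \<phi> (2 * s) g"

definition "B = Linf_time_norm T (L2_norm \<Omega>) f"

lemma B_nonneg: "B \<ge> 0"
  unfolding B_def by (rule seminormed_space.Linf_time_norm_bound(1)[OF seminormed_L2 f T])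

lemma F_sum_le: "finite S \<Longrightarrow> (\<Sum>k\<in>S. (F k t)\<^sup>2) \<le> B\<^sup>2"
proof -
  assume "finite S"
  then obtain n where "S \<subseteq> {..<n}" using finite_nat_iff_bounded by blast
  then have "(\<Sum>k\<in>S. (F k t)\<^sup>2) \<le> (\<Sum>k<n. (F k t)\<^sup>2)" by (intro sum_mono2) auto
  also have "\<dots> \<le> B\<^sup>2" unfolding B_def by (rule F)
  finally show ?thesis .
qed

lemma forcing: "forcing \<gamma> T (F k) B"
proof unfold_locales
  fix t
  have "\<bar>F k t\<bar>\<^sup>2 \<le> B\<^sup>2" using F_sum_le[of "{k}" t] by simp
  then show "\<bar>F k t\<bar> \<le> B" by (rule power2_le_imp_le) (rule B_nonneg)
qed (use F in auto)

sublocale f: forcing \<gamma> T "F k" B for k by (rule forcing)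

lemma lam_powr_double: "lam k powr (2 * s) = (ell k)\<^sup>2"
  by (simp add: ell_def power2_eq_square flip: powr_add)

lemma g_L2: "g \<in> L2_space \<Omega>" and g_summable: "summable (\<lambda>k. (ell k)\<^sup>2 * (coef g k)\<^sup>2)"
  using g by (auto simp: HH_space_def lam_powr_double)

lemma ell_le: "ell k * x\<^sup>2 \<le> (ell k)\<^sup>2 * x\<^sup>2 / ell0"
proof -
  have "ell0 * (ell k * x\<^sup>2) \<le> ell k * (ell k * x\<^sup>2)" by (rule mult_right_mono) (use ell0 ell_nonneg in auto)
  then show ?thesis using ell0(1) by (simp add: field_simps power2_eq_square)
qed

lemma g_HS: "g \<in> HS"
proof -
  have "summable (\<lambda>k. ell k * (coef g k)\<^sup>2)"
    by (rule summable_comparison_test'[OF summable_divide[OF g_summable, of ell0], of 0])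
      (use ell_le ell_nonneg in auto)
  then show ?thesis using g_L2 ell_nonneg by (simp add: HS_iff power_mult_distrib)
qed

definition "Ff k = (LINT r|lborel. (F k r)\<^sup>2)"
definition "NF = Lp_time_norm 2 T (L2_norm \<Omega>) f"

lemma Ff_nonneg [simp]: "0 \<le> Ff k" by (simp add: Ff_def)

lemma f_square_integrable: "integrable (leb T) (\<lambda>t. (L2_norm \<Omega> (f t))\<^sup>2)"
  "NF\<^sup>2 = (LINT t|leb T. (L2_norm \<Omega> (f t))\<^sup>2)" "0 \<le> NF"
proof -
  interpret L: seminormed_space "L2_space \<Omega>" "L2_norm \<Omega>" by (rule seminormed_L2)
  have "f \<in> Lp_time 2 T (L2_space \<Omega>) (L2_norm \<Omega>)"
    using f L.Linf_time_norm_bound(2)[OF f T] by (intro L.strongly_measurable_bounded_Lp_time) (auto simp: Linf_time_def)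
  moreover have p: "L2_norm \<Omega> w powr 2 = (L2_norm \<Omega> w)\<^sup>2" for w by (simp add: powr_numeral)
  ultimately show "integrable (leb T) (\<lambda>t. (L2_norm \<Omega> (f t))\<^sup>2)" by (simp add: Lp_time_def)
  have e: "NF = sqrt (LINT t|leb T. (L2_norm \<Omega> (f t))\<^sup>2)"
    unfolding NF_def Lp_time_norm_def p by (simp add: powr_half_sqrt)
  show "NF\<^sup>2 = (LINT t|leb T. (L2_norm \<Omega> (f t))\<^sup>2)" "0 \<le> NF" unfolding e by simp_all
qed

lemma Ff_sum: "(\<Sum>k<n. Ff k) \<le> NF\<^sup>2"
proof -
  have m: "(\<lambda>r. \<Sum>k<n. (F k r)\<^sup>2) \<in> borel_measurable borel" using F(1) by measurable
  have i: "integrable lborel (\<lambda>r. \<Sum>k<n. (F k r)\<^sup>2)" by (intro Bochner_Integration.integrable_sum f.f2_integrable)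
  have s: "r \<notin> {0<..<T} \<Longrightarrow> (\<Sum>k<n. (F k r)\<^sup>2) = 0" for r using F(2) by simp
  have "(\<Sum>k<n. Ff k) = (LINT r|lborel. (\<Sum>k<n. (F k r)\<^sup>2))"
    unfolding Ff_def by (intro Bochner_Integration.integral_sum[symmetric] f.f2_integrable)
  also have "\<dots> = (LINT r|leb T. (\<Sum>k<n. (F k r)\<^sup>2))"
    by (rule lborel_integral_support(2)[OF m s, symmetric]) auto
  also have "\<dots> \<le> (LINT t|leb T. (L2_norm \<Omega> (f t))\<^sup>2)"
  proof (rule integral_mono_AE)
    show "integrable (leb T) (\<lambda>r. \<Sum>k<n. (F k r)\<^sup>2)"
      using i lborel_integral_support(1)[OF m, of "{0<..<T}"] s by auto
    have "AE t in leb T. f t \<in> L2_space \<Omega>" using f by (simp add: Linf_time_def strongly_measurable_def)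
    then show "AE r in leb T. (\<Sum>k<n. (F k r)\<^sup>2) \<le> (L2_norm \<Omega> (f r))\<^sup>2"
      using F(4)
    proof eventually_elim
      case (elim t)
      show ?case using sum_le_suminf[OF coef_summable[OF elim(1)], of "{..<n}"] Parseval[OF elim(1)] elim(2) by (simp add: sums_iff)
    qed
  qed (rule f_square_integrable)
  finally show ?thesis by (simp add: f_square_integrable)
qed

lemma Ff_summable: "summable Ff" "(\<Sum>k. Ff k) \<le> NF\<^sup>2"
proof -
  show s: "summable Ff" by (rule summableI_nonneg_bounded[OF _ Ff_sum]) simp
  show "(\<Sum>k. Ff k) \<le> NF\<^sup>2" by (rule suminf_le_const[OF s Ff_sum])
qed

text \<open>Up to \<open>mode_const\<close>, Q k majorizes mode k in the energy norm at all times,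
  and P k + J k t majorizes the squared derivative of mode k, with J carrying the dependence on
  time.\<close>

definition "Q k = ell k * (coef g k)\<^sup>2 + (coef h k)\<^sup>2 + Ff k"
definition "P k = (ell k)\<^sup>2 * (coef g k)\<^sup>2 + (coef h k)\<^sup>2"
definition "J k t = (LINT r|lborel. sing (t - r) * (F k r)\<^sup>2)"

lemma Q_nonneg [simp]: "0 \<le> Q k" and P_nonneg [simp]: "0 \<le> P k" and J_nonneg [simp]: "0 \<le> J k t"
  using ell_nonneg[of k] by (simp_all add: Q_def P_def J_def integral_nonneg)

lemma Q_summable: "summable Q" "(\<Sum>k. Q k) \<le> (HN g)\<^sup>2 + (L2_norm \<Omega> h)\<^sup>2 + NF\<^sup>2"
proof -
  have a: "(\<lambda>k. ell k * (coef g k)\<^sup>2) sums (HN g)\<^sup>2"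
    using g_HS ell_nonneg by (simp add: HN_square HS_iff power_mult_distrib summable_sums)
  have "Q sums ((HN g)\<^sup>2 + (L2_norm \<Omega> h)\<^sup>2 + (\<Sum>k. Ff k))"
    unfolding Q_def by (intro sums_add a Parseval h summable_sums Ff_summable)
  then show "summable Q" "(\<Sum>k. Q k) \<le> (HN g)\<^sup>2 + (L2_norm \<Omega> h)\<^sup>2 + NF\<^sup>2"
    using Ff_summable(2) by (auto simp: sums_iff)
qed

lemma P_sums: "P sums ((G2)\<^sup>2 + (L2_norm \<Omega> h)\<^sup>2)"
proof -
  have "(G2)\<^sup>2 = (\<Sum>k. (ell k)\<^sup>2 * (coef g k)\<^sup>2)"
    using g_summable by (simp add: HH_norm_def suminf_nonneg lam_powr_double)
  then have "(\<lambda>k. (ell k)\<^sup>2 * (coef g k)\<^sup>2) sums (G2)\<^sup>2" using g_summable by (simp add: summable_sums)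
  then show ?thesis unfolding P_def by (intro sums_add Parseval h)
qed

lemma J_sum: "finite S \<Longrightarrow> (\<Sum>k\<in>S. J k t) = (LINT r|lborel. sing (t - r) * (\<Sum>k\<in>S. (F k r)\<^sup>2))"
  unfolding J_def by (subst Bochner_Integration.integral_sum[symmetric]) (auto intro: f.sing_f2_integrable simp: sum_distrib_left)

lemma J_sum_le: "finite S \<Longrightarrow> (\<Sum>k\<in>S. J k t) \<le> B\<^sup>2 * sing_mass"
proof -
  assume S: "finite S"
  have "(\<Sum>k\<in>S. J k t) = (LINT r|lborel. (\<Sum>k\<in>S. sing (t - r) * (F k r)\<^sup>2))" by (simp add: J_sum[OF S] sum_distrib_left)
  also have "\<dots> \<le> (LINT r|lborel. sing (t - r) * B\<^sup>2)"
    using mult_left_mono[OF F_sum_le[OF S] sing_nonneg]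
    by (intro integral_mono Bochner_Integration.integrable_sum f.sing_f2_integrable integrable_mult_left sing_shift(1)) (simp add: sum_distrib_left)
  also have "\<dots> = B\<^sup>2 * sing_mass" by (simp add: sing_shift(2))
  finally show ?thesis .
qed

text \<open>Cut \<open>sing\<close> at height K. The part above K has small mass and meets the
  uniform bound B^2; the part below is at most K and meets a tail of the summable sequence
  \<open>Ff\<close>. Hence the tails are small uniformly in t although those of the squared
  coefficients themselves need not be.\<close>

lemma J_tail:
  assumes e: "e > 0"
  obtains n where "\<And>t N. (\<Sum>k\<in>{n..<N}. J k t) \<le> e"
proof -
  \<comment> \<open>e is shared equally between the parts above and below the cut; adding 1 to the
    square of B avoids a division by 0.\<close>
  define \<eta> where "\<eta> = e / (2 * (B\<^sup>2 + 1))"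
  have B2: "B\<^sup>2 + 1 > 0" by (smt (verit) zero_le_power2)
  have \<eta>: "\<eta> > 0" "B\<^sup>2 * \<eta> \<le> e / 2" using e B2 by (auto simp: \<eta>_def field_simps)
  have si: "integrable lborel sing" "sing \<in> borel_measurable borel" using sing_integral by (auto simp: has_bochner_integral_iff)
  have mi: "integrable lborel (\<lambda>r. min (sing r) (real n))" for n
    by (rule Bochner_Integration.integrable_bound[OF si(1)]) (use si(2) in \<open>auto simp: min_def\<close>)
  have "(\<lambda>n. LINT r|lborel. sing r - min (sing r) (real n)) \<longlonglongrightarrow> (LINT r|(lborel :: real measure). 0)"
  proof (rule integral_dominated_convergence[where w = sing and f = "\<lambda>_. 0"])
    show "AE r in lborel. (\<lambda>n. sing r - min (sing r) (real n)) \<longlonglongrightarrow> 0"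
    proof (intro AE_I2 tendsto_eventually)
      fix r
      obtain m where m: "sing r \<le> real m" using real_arch_simple by blast
      show "\<forall>\<^sub>F n in sequentially. sing r - min (sing r) (real n) = 0"
        using eventually_ge_at_top[of m] by eventually_elim (use m in auto)
    qed
  qed (use si in auto)
  then have "\<forall>\<^sub>F n in sequentially. (LINT r|lborel. sing r - min (sing r) (real n)) < \<eta>" using \<eta> by (intro order_tendstoD) auto
  then obtain K where K: "(LINT r|lborel. sing r - min (sing r) (real K)) < \<eta>" by (auto simp: eventually_sequentially)
  have "e / (2 * (real K + 1)) > 0" using e by simp
  from summable_tail_small[OF Ff_summable(1) Ff_nonneg this]
  obtain n where n: "\<And>m N. m \<ge> n \<Longrightarrow> (\<Sum>k\<in>{m..<N}. Ff k) \<le> e / (2 * (real K + 1))" by blast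
  have "(\<Sum>k\<in>{n..<N}. J k t) \<le> e" for t N
  proof -
    let ?G = "\<lambda>r. \<Sum>k\<in>{n..<N}. (F k r)\<^sup>2"
    have Gi: "integrable lborel ?G" by (intro Bochner_Integration.integrable_sum f.f2_integrable)
    have di: "integrable lborel (\<lambda>r. sing r - min (sing r) (real K))" by (intro Bochner_Integration.integrable_diff si mi)
    have "(\<Sum>k\<in>{n..<N}. J k t) = (LINT r|lborel. sing (t - r) * ?G r)" by (rule J_sum) simp
    also have "\<dots> \<le> (LINT r|lborel. (sing (t - r) - min (sing (t - r)) (real K)) * B\<^sup>2 + real K * ?G r)"
    proof (rule integral_mono)
      show "integrable lborel (\<lambda>r. sing (t - r) * ?G r)"
        unfolding sum_distrib_left by (intro Bochner_Integration.integrable_sum f.sing_f2_integrable)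
      show "integrable lborel (\<lambda>r. (sing (t - r) - min (sing (t - r)) (real K)) * B\<^sup>2 + real K * ?G r)"
        by (intro Bochner_Integration.integrable_add integrable_mult_left integrable_mult_right Gi integrable_shift_reflect(1)[OF di])
      fix r
      have "(sing (t - r) - min (sing (t - r)) (real K)) * ?G r \<le> (sing (t - r) - min (sing (t - r)) (real K)) * B\<^sup>2"
        by (intro mult_left_mono F_sum_le) auto
      moreover have "min (sing (t - r)) (real K) * ?G r \<le> real K * ?G r" by (intro mult_right_mono sum_nonneg) auto
      ultimately show "sing (t - r) * ?G r \<le> (sing (t - r) - min (sing (t - r)) (real K)) * B\<^sup>2 + real K * ?G r"
        by (simp add: left_diff_distrib)
    qed
    also have "\<dots> = (LINT r|lborel. sing r - min (sing r) (real K)) * B\<^sup>2 + real K * (\<Sum>k\<in>{n..<N}. Ff k)"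
      using integrable_shift_reflect(1,3)[OF di, of t] Gi
      by (simp add: Ff_def Bochner_Integration.integral_sum f.f2_integrable)
    also have "\<dots> \<le> \<eta> * B\<^sup>2 + real K * (e / (2 * (real K + 1)))"
      using K by (intro add_mono mult_right_mono mult_left_mono n) auto
    also have "\<dots> \<le> e / 2 + e / 2" using \<eta>(2) e by (intro add_mono) (auto simp: mult.commute field_simps)
    finally show ?thesis by simp
  qed
  then show ?thesis by (rule that)
qed

end

section \<open>Construction of the solution\<close>

lemma power2_diff_le: "(a - b)\<^sup>2 \<le> 2 * a\<^sup>2 + 2 * (b::real)\<^sup>2"
  using zero_le_power2[of "a + b"] by (simp add: power2_eq_square algebra_simps)

lemma L2_norm_scale: "L2_norm \<Omega> (\<lambda>x. a * w x) = \<bar>a\<bar> * L2_norm \<Omega> w"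
  by (simp add: L2_norm_def power_mult_distrib real_sqrt_mult)

lemma C_time_inner_continuous:
  assumes w: "w \<in> C_time T (L2_space \<Omega>) (L2_norm \<Omega>)" and v: "v \<in> L2_space \<Omega>"
  shows "continuous_on {0..T} (\<lambda>t. L2_inner \<Omega> (w t) v)"
  unfolding continuous_on_def
proof
  fix t assume t: "t \<in> {0..T}"
  have wX: "\<And>t. t \<in> {0..T} \<Longrightarrow> w t \<in> L2_space \<Omega>" using w by (auto simp: C_time_def)
  have "((\<lambda>\<tau>. L2_inner \<Omega> (w \<tau>) v - L2_inner \<Omega> (w t) v) \<longlongrightarrow> 0) (at t within {0..T})"
  proof (rule Lim_null_comparison)
    show "\<forall>\<^sub>F \<tau> in at t within {0..T}. norm (L2_inner \<Omega> (w \<tau>) v - L2_inner \<Omega> (w t) v) \<le> L2_norm \<Omega> (\<lambda>x. w \<tau> x - w t x) * L2_norm \<Omega> v"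
      unfolding eventually_at_filter
    proof (intro always_eventually allI impI)
      fix \<tau> assume "\<tau> \<in> {0..T}"
      from L2_Cauchy_Schwarz[OF L2_diff[OF wX[OF this] wX[OF t]] v]
      show "norm (L2_inner \<Omega> (w \<tau>) v - L2_inner \<Omega> (w t) v) \<le> L2_norm \<Omega> (\<lambda>x. w \<tau> x - w t x) * L2_norm \<Omega> v"
        by (simp add: L2_inner_diff wX[OF \<open>\<tau> \<in> {0..T}\<close>] wX[OF t] v)
    qed
    have "((\<lambda>\<tau>. L2_norm \<Omega> (\<lambda>x. w \<tau> x - w t x)) \<longlongrightarrow> 0) (at t within {0..T})" using w t by (simp add: C_time_def)
    from tendsto_mult_right[OF this, of "L2_norm \<Omega> v"]
    show "((\<lambda>\<tau>. L2_norm \<Omega> (\<lambda>x. w \<tau> x - w t x) * L2_norm \<Omega> v) \<longlongrightarrow> 0) (at t within {0..T})" by simp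
  qed
  then show "((\<lambda>\<tau>. L2_inner \<Omega> (w \<tau>) v) \<longlongrightarrow> L2_inner \<Omega> (w t) v) (at t within {0..T})" by (rule LIM_zero_cancel)
qed

context L2_basis begin

lemma C_time_vector_integral:
  assumes w: "w \<in> C_time T (L2_space \<Omega>) (L2_norm \<Omega>)" and a: "continuous_on {0..T} a"
  shows "I \<in> L2_space \<Omega> \<Longrightarrow> (\<And>k. coef I k = (LINT t|leb T. a t * coef (w t) k)) \<Longrightarrow>
      has_vector_integral (leb T) (L2_space \<Omega>) (L2_norm \<Omega>) (\<lambda>t x. a t * w t x) I"
    "\<exists>I\<in>L2_space \<Omega>. \<forall>k. coef I k = (LINT t|leb T. a t * coef (w t) k)"
proof -
  interpret L: seminormed_space "L2_space \<Omega>" "L2_norm \<Omega>" by (rule seminormed_L2)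
  obtain K where K: "K \<ge> 0" "\<And>t. t \<in> {0..T} \<Longrightarrow> L2_norm \<Omega> (w t) \<le> K" using L.C_time_bounded[OF w] by blast
  have "bounded (a ` {0..T})" by (intro compact_imp_bounded compact_continuous_image a) simp
  then obtain A where A: "\<And>t. t \<in> {0..T} \<Longrightarrow> \<bar>a t\<bar> \<le> A" unfolding bounded_iff by fastforce
  have wX: "\<And>t. t \<in> {0..T} \<Longrightarrow> w t \<in> L2_space \<Omega>" using w by (auto simp: C_time_def)
  have 1: "AE t in leb T. (\<lambda>x. a t * w t x) \<in> L2_space \<Omega>"
    using AE_space by eventually_elim (auto intro!: L2_scale wX)
  have 2: "AE t in leb T. L2_norm \<Omega> (\<lambda>x. a t * w t x) \<le> A * K"
    using AE_space
  proof eventually_elim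
    case (elim t)
    then have "t \<in> {0..T}" by auto
    then show ?case unfolding L2_norm_scale using A[of t] K by (intro mult_mono) auto
  qed
  have "continuous_on {0..T} (\<lambda>t. a t * coef (w t) k)" for k by (intro continuous_on_mult a C_time_inner_continuous[OF w] \<phi>_L2)
  then have 3: "(\<lambda>t. coef (\<lambda>x. a t * w t x) k) \<in> borel_measurable (leb T)" for k
    unfolding L2_inner_scale by (intro borel_measurable_integrable continuous_integral_Ioo(1))
  show "has_vector_integral (leb T) (L2_space \<Omega>) (L2_norm \<Omega>) (\<lambda>t x. a t * w t x) I"
    if "I \<in> L2_space \<Omega>" "\<And>k. coef I k = (LINT t|leb T. a t * coef (w t) k)"
    by (rule bounded_has_vector_integral[OF 1 2 3 that(1)]) (simp add: L2_inner_scale that(2))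
  obtain I where "I \<in> L2_space \<Omega>" "\<And>k. coef I k = (LINT t|leb T. coef (\<lambda>x. a t * w t x) k)"
    using bounded_vector_integral_exists[OF 1 2 3] by blast
  then show "\<exists>I\<in>L2_space \<Omega>. \<forall>k. coef I k = (LINT t|leb T. a t * coef (w t) k)"
    by (auto simp: L2_inner_scale)
qed

end

context wave_data begin

abbreviation y where "y k \<equiv> mode (ell k) (coef g k) (coef h k) (F k)"
abbreviation y' where "y' k \<equiv> mode' (ell k) (coef g k) (coef h k) (F k)"

lemma y_bound: "t \<in> {0..T} \<Longrightarrow> ell k * (y k t)\<^sup>2 \<le> mode_const * Q k"
  unfolding Q_def Ff_def by (rule f.mode_bound[OF ell_pos])

lemma y'_bound: "t \<in> {0..T} \<Longrightarrow> (y' k t)\<^sup>2 \<le> mode_const * (P k + J k t)"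
  unfolding P_def J_def by (rule f.mode'_bound[OF ell_pos])

lemma mode_const_pos: "mode_const > 0" using mode_const_ge(1) by simp

lemma y_summable:
  assumes t: "t \<in> {0..T}"
  shows "summable (\<lambda>k. ell k * (y k t)\<^sup>2)" "(\<Sum>k. ell k * (y k t)\<^sup>2) \<le> mode_const * (\<Sum>k. Q k)" "summable (\<lambda>k. (y k t)\<^sup>2)"
proof -
  show s: "summable (\<lambda>k. ell k * (y k t)\<^sup>2)"
    by (rule summable_comparison_test'[OF summable_mult[OF Q_summable(1)], of 0]) (use y_bound[OF t] ell_nonneg in auto)
  have "(\<Sum>k. ell k * (y k t)\<^sup>2) \<le> (\<Sum>k. mode_const * Q k)"
    by (rule suminf_le[OF y_bound[OF t] s summable_mult[OF Q_summable(1)]])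
  then show "(\<Sum>k. ell k * (y k t)\<^sup>2) \<le> mode_const * (\<Sum>k. Q k)" by (simp add: suminf_mult Q_summable)
  have "(y k t)\<^sup>2 \<le> ell k * (y k t)\<^sup>2 / ell0" for k
    using mult_right_mono[OF ell0(2), of "(y k t)\<^sup>2" k] ell0(1) by (simp add: field_simps)
  then show "summable (\<lambda>k. (y k t)\<^sup>2)"
    by (intro summable_comparison_test'[OF summable_divide[OF s, of ell0], of 0]) auto
qed

lemma P_le: "(\<Sum>k<n. P k) \<le> (G2)\<^sup>2 + (L2_norm \<Omega> h)\<^sup>2"
  using sum_le_suminf[of P "{..<n}"] P_sums by (simp add: sums_iff)

lemma y'_sum:
  assumes t: "t \<in> {0..T}"
  shows "(\<Sum>k<n. (y' k t)\<^sup>2) \<le> mode_const * ((G2)\<^sup>2 + (L2_norm \<Omega> h)\<^sup>2 + B\<^sup>2 * sing_mass)"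
proof -
  have "(\<Sum>k<n. (y' k t)\<^sup>2) \<le> (\<Sum>k<n. mode_const * (P k + J k t))" by (intro sum_mono y'_bound[OF t])
  also have "\<dots> = mode_const * ((\<Sum>k<n. P k) + (\<Sum>k<n. J k t))" by (simp only: sum_distrib_left[symmetric] sum.distrib)
  also have "\<dots> \<le> mode_const * ((G2)\<^sup>2 + (L2_norm \<Omega> h)\<^sup>2 + B\<^sup>2 * sing_mass)"
    using mode_const_pos by (intro mult_left_mono add_mono P_le J_sum_le) auto
  finally show ?thesis .
qed

lemma y'_summable: "t \<in> {0..T} \<Longrightarrow> summable (\<lambda>k. (y' k t)\<^sup>2)"
  by (rule summableI_nonneg_bounded[OF _ y'_sum]) simp_all

text \<open>Choosing a representative separately for each t is harmless, since measurability in time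
  will come from continuity in norm. Only t in [0, T] is meaningful.\<close>

definition u :: "real \<Rightarrow> 'a \<Rightarrow> real" where
  "u t = (SOME w. w \<in> L2_space \<Omega> \<and> (\<forall>k. coef w k = y k t))"
definition u' :: "real \<Rightarrow> 'a \<Rightarrow> real" where
  "u' t = (SOME w. w \<in> L2_space \<Omega> \<and> (\<forall>k. coef w k = y' k t))"

lemma u: assumes "t \<in> {0..T}" shows "u t \<in> L2_space \<Omega>" "coef (u t) k = y k t"
proof -
  have "\<exists>w. w \<in> L2_space \<Omega> \<and> (\<forall>k. coef w k = y k t)" using Riesz_Fischer[OF y_summable(3)[OF assms]] by metis
  from someI_ex[OF this] show "u t \<in> L2_space \<Omega>" "coef (u t) k = y k t" unfolding u_def by auto
qed

lemma u': assumes "t \<in> {0..T}" shows "u' t \<in> L2_space \<Omega>" "coef (u' t) k = y' k t"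
proof -
  have "\<exists>w. w \<in> L2_space \<Omega> \<and> (\<forall>k. coef w k = y' k t)" using Riesz_Fischer[OF y'_summable[OF assms]] by metis
  from someI_ex[OF this] show "u' t \<in> L2_space \<Omega>" "coef (u' t) k = y' k t" unfolding u'_def by auto
qed

lemma u_HS: "t \<in> {0..T} \<Longrightarrow> u t \<in> HS"
  using y_summable(1)[of t] ell_nonneg by (simp add: HS_iff u power_mult_distrib)

lemma u_HN: "t \<in> {0..T} \<Longrightarrow> (HN (u t))\<^sup>2 \<le> mode_const * ((HN g)\<^sup>2 + (L2_norm \<Omega> h)\<^sup>2 + NF\<^sup>2)"
  using y_summable(2)[of t] mult_left_mono[OF Q_summable(2) less_imp_le[OF mode_const_pos]] by (simp add: HN_square u_HS u)

lemma u'_norm: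
  assumes t: "t \<in> {0..T}"
  shows "(L2_norm \<Omega> (u' t))\<^sup>2 \<le> mode_const * ((G2)\<^sup>2 + (L2_norm \<Omega> h)\<^sup>2 + B\<^sup>2 * sing_mass)"
  using suminf_le_const[OF y'_summable[OF t] y'_sum[OF t]] Parseval[OF u'(1)[OF t]] by (simp add: u'[OF t] sums_iff)

lemma u_C_time: "u \<in> C_time T HS HN"
  unfolding C_time_def mem_Collect_eq
proof (intro ballI conjI)
  fix t assume t: "t \<in> {0..T}"
  show "u t \<in> HS" by (rule u_HS[OF t])
  have "((\<lambda>\<tau>. \<Sum>k. ell k * (y k \<tau> - y k t)\<^sup>2) \<longlongrightarrow> 0) (at t within {0..T})"
  proof (rule tails_tendsto_zero)
    show "0 \<le> ell k * (y k \<tau> - y k t)\<^sup>2" for k \<tau> using ell_nonneg by simp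
    have "((\<lambda>\<tau>. ell k * (y k \<tau> - y k t)\<^sup>2) \<longlongrightarrow> ell k * (y k t - y k t)\<^sup>2) (at t within {0..T})" for k
      using f.mode_continuous(1)[OF ell_pos, of k] t unfolding continuous_on_def by (intro tendsto_intros) auto
    then show "((\<lambda>\<tau>. ell k * (y k \<tau> - y k t)\<^sup>2) \<longlongrightarrow> 0) (at t within {0..T})" for k by simp
    fix e :: real assume e: "e > 0"
    \<comment> \<open>4 = 2 + 2: by \<open>power2_diff_le\<close> a squared difference costs twice
      each square, and both squares have the majorant \<open>mode_const * Q k\<close>.\<close>
    have "e / (4 * mode_const) > 0" using e mode_const_pos by simp
    from summable_tail_small[OF Q_summable(1) Q_nonneg this]
    obtain n where n: "\<And>m N. m \<ge> n \<Longrightarrow> (\<Sum>k\<in>{m..<N}. Q k) \<le> e / (4 * mode_const)" by blast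
    have "(\<Sum>k\<in>{n..<N}. ell k * (y k \<tau> - y k t)\<^sup>2) \<le> e" if \<tau>: "\<tau> \<in> {0..T}" for \<tau> N
    proof -
      have "ell k * (y k \<tau> - y k t)\<^sup>2 \<le> 4 * mode_const * Q k" for k
        using mult_left_mono[OF power2_diff_le[of "y k \<tau>" "y k t"] ell_nonneg[of k]] y_bound[OF \<tau>, of k] y_bound[OF t, of k]
        by (simp add: distrib_left)
      then have "(\<Sum>k\<in>{n..<N}. ell k * (y k \<tau> - y k t)\<^sup>2) \<le> (\<Sum>k\<in>{n..<N}. 4 * mode_const * Q k)" by (intro sum_mono)
      also have "\<dots> = 4 * mode_const * (\<Sum>k\<in>{n..<N}. Q k)" by (simp only: sum_distrib_left)
      also have "\<dots> \<le> 4 * mode_const * (e / (4 * mode_const))" using mode_const_pos by (intro mult_left_mono n) auto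
      finally show ?thesis using mode_const_pos by simp
    qed
    then show "\<exists>n. \<forall>\<tau>\<in>{0..T}. \<forall>N. (\<Sum>k\<in>{n..<N}. ell k * (y k \<tau> - y k t)\<^sup>2) \<le> e" by blast
  qed
  from tendsto_real_sqrt[OF this]
  have lim: "((\<lambda>\<tau>. sqrt (\<Sum>k. ell k * (y k \<tau> - y k t)\<^sup>2)) \<longlongrightarrow> 0) (at t within {0..T})" by simp
  show "((\<lambda>\<tau>. HN (\<lambda>x. u \<tau> x - u t x)) \<longlongrightarrow> 0) (at t within {0..T})"
  proof (rule Lim_transform_eventually[OF lim])
    have "sqrt (\<Sum>k. ell k * (y k \<tau> - y k t)\<^sup>2) = HN (\<lambda>x. u \<tau> x - u t x)" if "\<tau> \<in> {0..T}" for \<tau>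
      using ell_nonneg
      by (simp only: HN_eq L2_inner_diff[OF u(1)[OF that] u(1)[OF t] \<phi>_L2] u(2)[OF that] u(2)[OF t] power_mult_distrib real_sqrt_pow2)
    then show "\<forall>\<^sub>F \<tau> in at t within {0..T}. sqrt (\<Sum>k. ell k * (y k \<tau> - y k t)\<^sup>2) = HN (\<lambda>x. u \<tau> x - u t x)"
      unfolding eventually_at_filter by (intro always_eventually) blast
  qed
qed

lemma u'_C_time: "u' \<in> C_time T (L2_space \<Omega>) (L2_norm \<Omega>)"
  unfolding C_time_def mem_Collect_eq
proof (intro ballI conjI)
  fix t assume t: "t \<in> {0..T}"
  show "u' t \<in> L2_space \<Omega>" by (rule u'[OF t])
  have "((\<lambda>\<tau>. \<Sum>k. (y' k \<tau> - y' k t)\<^sup>2) \<longlongrightarrow> 0) (at t within {0..T})"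
  proof (rule tails_tendsto_zero)
    have "((\<lambda>\<tau>. (y' k \<tau> - y' k t)\<^sup>2) \<longlongrightarrow> (y' k t - y' k t)\<^sup>2) (at t within {0..T})" for k
      using f.mode_continuous(2)[OF ell_pos, of k] t unfolding continuous_on_def by (intro tendsto_intros) auto
    then show "((\<lambda>\<tau>. (y' k \<tau> - y' k t)\<^sup>2) \<longlongrightarrow> 0) (at t within {0..T})" for k by simp
    fix e :: real assume e: "e > 0"
    \<comment> \<open>The same splitting leaves 2 \<open>mode_const\<close> times four tails, two of
      P and two of J.\<close>
    define d where "d = e / (8 * mode_const)"
    have d: "d > 0" using e mode_const_pos by (simp add: d_def)
    obtain n1 where n1: "\<And>m N. m \<ge> n1 \<Longrightarrow> (\<Sum>k\<in>{m..<N}. P k) \<le> d"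
      using summable_tail_small[OF sums_summable[OF P_sums] P_nonneg d] by blast
    obtain n2 where n2: "\<And>t N. (\<Sum>k\<in>{n2..<N}. J k t) \<le> d" using J_tail[OF d] by blast
    define n where "n = max n1 n2"
    \<comment> \<open>\<open>J_tail\<close> supplies a single starting index; later ones inherit the
      bound because J is nonnegative.\<close>
    have Jn: "(\<Sum>k\<in>{n..<N}. J k \<tau>) \<le> d" for \<tau> N
      by (rule order_trans[OF sum_mono2 n2[where N = N and t = \<tau>]]) (auto simp: n_def)
    have Pn: "(\<Sum>k\<in>{n..<N}. P k) \<le> d" for N by (rule n1) (simp add: n_def)
    have "(\<Sum>k\<in>{n..<N}. (y' k \<tau> - y' k t)\<^sup>2) \<le> e" if \<tau>: "\<tau> \<in> {0..T}" for \<tau> N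
    proof -
      have "(y' k \<tau> - y' k t)\<^sup>2 \<le> 2 * (mode_const * (P k + J k \<tau>)) + 2 * (mode_const * (P k + J k t))" for k
        using power2_diff_le[of "y' k \<tau>" "y' k t"] y'_bound[OF \<tau>, of k] y'_bound[OF t, of k] by linarith
      also have "2 * (mode_const * (P k + J k \<tau>)) + 2 * (mode_const * (P k + J k t)) = 2 * mode_const * (P k + J k \<tau> + (P k + J k t))" for k
        by (simp only: distrib_left mult.assoc)
      finally have "(\<Sum>k\<in>{n..<N}. (y' k \<tau> - y' k t)\<^sup>2) \<le> (\<Sum>k\<in>{n..<N}. 2 * mode_const * (P k + J k \<tau> + (P k + J k t)))" by (intro sum_mono)
      also have "\<dots> = 2 * mode_const * ((\<Sum>k\<in>{n..<N}. P k) + (\<Sum>k\<in>{n..<N}. J k \<tau>) + ((\<Sum>k\<in>{n..<N}. P k) + (\<Sum>k\<in>{n..<N}. J k t)))"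
        by (simp only: sum_distrib_left[symmetric] sum.distrib)
      also have "\<dots> \<le> 2 * mode_const * (d + d + (d + d))" using mode_const_pos by (intro mult_left_mono add_mono Jn Pn) auto
      finally show ?thesis using mode_const_pos by (simp add: d_def)
    qed
    then show "\<exists>n. \<forall>\<tau>\<in>{0..T}. \<forall>N. (\<Sum>k\<in>{n..<N}. (y' k \<tau> - y' k t)\<^sup>2) \<le> e" by blast
  qed simp
  from tendsto_real_sqrt[OF this]
  have lim: "((\<lambda>\<tau>. sqrt (\<Sum>k. (y' k \<tau> - y' k t)\<^sup>2)) \<longlongrightarrow> 0) (at t within {0..T})" by simp
  show "((\<lambda>\<tau>. L2_norm \<Omega> (\<lambda>x. u' \<tau> x - u' t x)) \<longlongrightarrow> 0) (at t within {0..T})"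
  proof (rule Lim_transform_eventually[OF lim])
    have "sqrt (\<Sum>k. (y' k \<tau> - y' k t)\<^sup>2) = L2_norm \<Omega> (\<lambda>x. u' \<tau> x - u' t x)" if "\<tau> \<in> {0..T}" for \<tau>
      by (simp only: L2_norm_coef[OF L2_diff[OF u'(1)[OF that] u'(1)[OF t]]] L2_inner_diff[OF u'(1)[OF that] u'(1)[OF t] \<phi>_L2] u'(2)[OF that] u'(2)[OF t])
    then show "\<forall>\<^sub>F \<tau> in at t within {0..T}. sqrt (\<Sum>k. (y' k \<tau> - y' k t)\<^sup>2) = L2_norm \<Omega> (\<lambda>x. u' \<tau> x - u' t x)"
      unfolding eventually_at_filter by (intro always_eventually) blast
  qed
qed

text \<open>The definition demands one I serving as both vector integrals. A vector integral is
  identified by its coefficients here, so integration by parts in each mode is enough.\<close>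

lemma u_weak_derivative: "has_weak_time_derivative \<Omega> T u u'"
  unfolding has_weak_time_derivative_def
proof (intro conjI ballI)
  interpret L: seminormed_space "L2_space \<Omega>" "L2_norm \<Omega>" by (rule seminormed_L2)
  note uC = C_time_HS_L2[OF u_C_time]
  show "u \<in> Lp_time 1 T (L2_space \<Omega>) (L2_norm \<Omega>)" "u' \<in> Lp_time 1 T (L2_space \<Omega>) (L2_norm \<Omega>)"
    by (intro L.C_time_Lp_time uC u'_C_time T; simp)+
  fix \<psi> :: "real \<Rightarrow> real" assume \<psi>: "\<psi> \<in> test_functions {0<..<T}"
  note \<psi>f = test_function_real[OF \<psi>]
  have c: "continuous_on {0..T} (deriv \<psi>)" "continuous_on {0..T} (\<lambda>t. - \<psi> t)"
    by (intro continuous_on_minus continuous_on_subset[OF \<psi>f(2)] continuous_on_subset[OF \<psi>f(3)] subset_UNIV)+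
  obtain I where I: "I \<in> L2_space \<Omega>" "\<And>k. coef I k = (LINT t|leb T. deriv \<psi> t * coef (u t) k)"
    using C_time_vector_integral(2)[OF uC c(1)] by blast
  have "coef I k = (LINT t|leb T. - \<psi> t * coef (u' t) k)" for k
  proof -
    have "coef I k = (LINT t|leb T. deriv \<psi> t * y k t)"
      unfolding I(2) by (rule Bochner_Integration.integral_cong) (auto simp: u)
    also have "\<dots> = - (LINT t|leb T. \<psi> t * y' k t)" by (rule f.mode_integration_by_parts[OF ell_pos \<psi>])
    also have "\<dots> = (LINT t|leb T. - \<psi> t * coef (u' t) k)"
      unfolding Bochner_Integration.integral_minus[symmetric] by (rule Bochner_Integration.integral_cong) (auto simp: u')
    finally show ?thesis .
  qed
  then show "\<exists>I. has_vector_integral (leb T) (L2_space \<Omega>) (L2_norm \<Omega>) (\<lambda>t x. deriv \<psi> t * u t x) I \<and>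
      has_vector_integral (leb T) (L2_space \<Omega>) (L2_norm \<Omega>) (\<lambda>t x. - \<psi> t * u' t x) I"
    using C_time_vector_integral(1)[OF uC c(1) I] C_time_vector_integral(1)[OF u'_C_time c(2) I(1)] by blast
qed

end

lemma integrable_indicator_Icc [simp]: "integrable lborel (indicator {a..b::real} :: real \<Rightarrow> real)"
  by (rule integrable_real_indicator) (auto simp: emeasure_lborel_Icc_eq)

text \<open>The bridge from the equation, valid almost everywhere on the open interval for Lebesgue
  measure, to the Borel integrals over closed intervals of the scalar theory; endpoints are
  null.\<close>

lemma integral_lebesgue_AE_cong:
  fixes q z :: "real \<Rightarrow> real"
  assumes q: "integrable lborel (\<lambda>r. indicator {0..T} r * q r)" and z: "AE r in leb T. z r = q r"
  shows "integrable (lebesgue_on {0..T}) z"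
    "t \<in> {0..T} \<Longrightarrow> (LINT r|lebesgue_on {0..t}. z r) = (LINT r|lborel. indicator {0..t} r * q r)"
proof -
  have "AE r in lborel. r \<noteq> (0::real)" "AE r in lborel. r \<noteq> T" by (rule AE_lborel_singleton)+
  then have "AE r in lebesgue. r \<noteq> (0::real)" "AE r in lebesgue. r \<noteq> T" by (auto intro: AE_completion)
  moreover have "AE r in lebesgue. r \<in> {0<..<T} \<longrightarrow> z r = q r" using z by (subst (asm) AE_restrict_space_iff) auto
  ultimately have "AE r in lebesgue. r \<in> {0..T} \<longrightarrow> z r = q r" by eventually_elim auto
  then have ae: "AE r in lebesgue_on {0..t}. z r = q r" if "t \<le> T" for t
    using that by (subst AE_restrict_space_iff) auto
  have qt: "integrable lborel (\<lambda>r. indicator {0..t} r * q r)" if "t \<le> T" for t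
  proof -
    have e: "indicator {0..t} r *\<^sub>R (indicator {0..T} r * q r) = indicator {0..t} r * q r" for r
      using that by (auto simp: indicator_def)
    show ?thesis using integrable_mult_indicator[OF _ q, of "{0..t}"] by (simp only: e) simp
  qed
  have qi: "integrable (lebesgue_on {0..t}) q" if "t \<le> T" for t
    using qt[OF that] by (subst integrable_restrict_space) (auto simp: integrable_completion)
  have zm: "z \<in> borel_measurable (lebesgue_on {0..t})" if t: "t \<le> T" for t
  proof -
    interpret complete_measure "lebesgue_on {0..t}" by (rule complete_lebesgue_on) simp
    show ?thesis by (rule borel_measurable_AE_cong[OF borel_measurable_integrable[OF qi[OF t]]]) (use ae[OF t] in auto)
  qed
  show "integrable (lebesgue_on {0..T}) z"
    using integrable_cong_AE[OF zm borel_measurable_integrable[OF qi] ae] qi by blast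
  assume t: "t \<in> {0..T}"
  then have t': "t \<le> T" by simp
  have "(LINT r|lebesgue_on {0..t}. z r) = (LINT r|lebesgue_on {0..t}. q r)"
    by (rule integral_cong_AE[OF zm[OF t'] borel_measurable_integrable[OF qi[OF t']] ae[OF t']])
  also have "\<dots> = (LINT r|lebesgue. indicator {0..t} r * q r)" by (subst integral_restrict_space) auto
  also have "\<dots> = (LINT r|lborel. indicator {0..t} r * q r)" by (rule integral_completion) (use qt[OF t'] in auto)
  finally show "(LINT r|lebesgue_on {0..t}. z r) = (LINT r|lborel. indicator {0..t} r * q r)" .
qed

lemma integral_singular_kernel:
  fixes m :: "real \<Rightarrow> real"
  assumes m: "continuous_on {0..T} m" and t: "t \<in> {0..T}" and \<gamma>: "\<gamma> < 2"
  shows "integrable lborel (\<lambda>r. indicator {0..t} r * ((t - r) powr (1 - \<gamma>) * m r))"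
    "(LINT r|lebesgue_on {0..t}. (t - r) powr (1 - \<gamma>) * m r) = (LINT r|lborel. indicator {0..t} r * ((t - r) powr (1 - \<gamma>) * m r))"
proof -
  let ?k = "\<lambda>r. (t - r) powr (1 - \<gamma>) * m r"
  have mt: "continuous_on {0..t} m" by (rule continuous_on_subset[OF m]) (use t in auto)
  have "bounded (m ` {0..t})" by (intro compact_imp_bounded compact_continuous_image mt) simp
  then obtain A where A: "\<And>r. r \<in> {0..t} \<Longrightarrow> \<bar>m r\<bar> \<le> A" unfolding bounded_iff by fastforce
  have k: "integrable lborel (\<lambda>r. indicator {0..t} r * (t - r) powr (1 - \<gamma>))"
    using integral_powr_kernel(2)[of "1 - \<gamma>" 0 t] t \<gamma> by (simp add: has_bochner_integral_iff)
  have e: "indicator {0..t} r * (?k r) = (t - r) powr (1 - \<gamma>) * (indicator {0..t} r * m r)" for r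
    by simp
  have [measurable]: "(\<lambda>r. indicator {0..t} r * m r) \<in> borel_measurable lborel" using continuous_integral_Icc(1)[OF mt] by auto
  show i: "integrable lborel (\<lambda>r. indicator {0..t} r * (?k r))"
  proof (rule Bochner_Integration.integrable_bound[OF integrable_mult_right[OF k, of A]])
    show "(\<lambda>r. indicator {0..t} r * (?k r)) \<in> borel_measurable lborel" unfolding e by measurable
    show "AE r in lborel. norm (indicator {0..t} r * (?k r)) \<le> norm (A * (indicator {0..t} r * (t - r) powr (1 - \<gamma>)))"
    proof (intro AE_I2)
      fix r
      have "\<bar>m r\<bar> * (t - r) powr (1 - \<gamma>) \<le> \<bar>A\<bar> * (t - r) powr (1 - \<gamma>)" if "r \<in> {0..t}"
        using A[OF that] by (intro mult_right_mono) auto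
      then show "norm (indicator {0..t} r * (?k r)) \<le> norm (A * (indicator {0..t} r * (t - r) powr (1 - \<gamma>)))"
        by (auto simp: indicator_def abs_mult mult.commute)
    qed
  qed
  have "(LINT r|lebesgue_on {0..t}. (t - r) powr (1 - \<gamma>) * m r) = (LINT r|lebesgue. indicator {0..t} r * (?k r))"
    by (subst integral_restrict_space) auto
  also have "\<dots> = (LINT r|lborel. indicator {0..t} r * (?k r))"
    by (rule integral_completion) (use i in auto)
  finally show "(LINT r|lebesgue_on {0..t}. (t - r) powr (1 - \<gamma>) * m r) = (LINT r|lborel. indicator {0..t} r * (?k r))" .
qed

section \<open>The equation tested against the energy space\<close>

context wave_data begin

lemma F_square_summable: "summable (\<lambda>k. (F k t)\<^sup>2)" "sqrt (\<Sum>k. (F k t)\<^sup>2) \<le> B"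
proof -
  have b: "(\<Sum>k<n. (F k t)\<^sup>2) \<le> B\<^sup>2" for n by (rule F_sum_le) simp
  show s: "summable (\<lambda>k. (F k t)\<^sup>2)" by (rule summableI_nonneg_bounded[OF _ b]) simp
  show "sqrt (\<Sum>k. (F k t)\<^sup>2) \<le> B"
    using real_sqrt_le_mono[OF suminf_le_const[OF s b]] B_nonneg by simp
qed

lemma F_integrable: "integrable lborel (\<lambda>r. indicator {0..t} r * F k r)"
proof (rule Bochner_Integration.integrable_bound[where f = "\<lambda>r. B * indicator {0..t} r"])
  show "(\<lambda>r. indicator {0..t} r * F k r) \<in> borel_measurable lborel" using F(1) by measurable
  show "AE r in lborel. norm (indicator {0..t} r * F k r) \<le> norm (B * indicator {0..t} r)"
    using f.f_bound B_nonneg by (intro AE_I2) (auto simp: indicator_def)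
qed auto

text \<open>The pairing of f(t) with v, summed from the everywhere defined coefficients F so that
  its integrals are limits of scalar ones.\<close>

definition Fv :: "('a \<Rightarrow> real) \<Rightarrow> real \<Rightarrow> real" where "Fv v t = (\<Sum>k. F k t * coef v k)"

lemma Fv:
  assumes v: "v \<in> L2_space \<Omega>"
  shows "(\<lambda>k. F k t * coef v k) sums Fv v t" "\<bar>\<Sum>k<n. F k t * coef v k\<bar> \<le> B * L2_norm \<Omega> v"
    "AE t in leb T. L2_inner \<Omega> (f t) v = Fv v t"
proof -
  note cs = l2_Cauchy_Schwarz[OF F_square_summable(1)[of t] coef_summable[OF v]]
  show "(\<lambda>k. F k t * coef v k) sums Fv v t" unfolding Fv_def by (rule summable_sums[OF cs(2)])
  have "\<bar>\<Sum>k<n. F k t * coef v k\<bar> \<le> sqrt (\<Sum>k. (F k t)\<^sup>2) * L2_norm \<Omega> v" using cs(3) by (simp add: L2_norm_coef[OF v])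
  also have "\<dots> \<le> B * L2_norm \<Omega> v" by (intro mult_right_mono F_square_summable) auto
  finally show "\<bar>\<Sum>k<n. F k t * coef v k\<bar> \<le> B * L2_norm \<Omega> v" .
  have "AE t in leb T. f t \<in> L2_space \<Omega>" using f by (simp add: Linf_time_def strongly_measurable_def)
  with F(4) show "AE t in leb T. L2_inner \<Omega> (f t) v = Fv v t"
  proof eventually_elim
    case (elim t)
    show ?case using inner_sums[OF elim(2) v] elim(1) by (simp add: Fv_def sums_iff)
  qed
qed

lemma frac_u:
  assumes v: "v \<in> HS"
  shows "t \<in> {0..T} \<Longrightarrow> (\<lambda>k. ell k * y k t * coef v k) sums LS (u t) v"
    "t \<in> {0..T} \<Longrightarrow> \<bar>\<Sum>k<n. ell k * y k t * coef v k\<bar> \<le> HN (u t) * HN v"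
    "continuous_on {0..T} (\<lambda>t. LS (u t) v)"
proof -
  have e: "(sqrt (ell k) * a) * (sqrt (ell k) * b) = ell k * a * b" for k a b
    using real_sqrt_mult_self[of "ell k"] ell_nonneg[of k] by (metis abs_of_nonneg mult.assoc mult.left_commute)
  show "(\<lambda>k. ell k * y k t * coef v k) sums LS (u t) v" if "t \<in> {0..T}"
    using summable_sums[OF frac_props(1)[OF u_HS[OF that] v]] by (simp only: frac_eq e u(2)[OF that])
  show "\<bar>\<Sum>k<n. ell k * y k t * coef v k\<bar> \<le> HN (u t) * HN v" if "t \<in> {0..T}"
    using frac_props(2)[OF u_HS[OF that] v, of n] by (simp only: e u(2)[OF that])
  show "continuous_on {0..T} (\<lambda>t. LS (u t) v)"
    unfolding continuous_on_def
  proof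
    fix t assume t: "t \<in> {0..T}"
    have "((\<lambda>\<tau>. LS (u \<tau>) v - LS (u t) v) \<longlongrightarrow> 0) (at t within {0..T})"
    proof (rule Lim_null_comparison)
      show "\<forall>\<^sub>F \<tau> in at t within {0..T}. norm (LS (u \<tau>) v - LS (u t) v) \<le> HN (\<lambda>x. u \<tau> x - u t x) * HN v"
        unfolding eventually_at_filter
      proof (intro always_eventually allI impI)
        fix \<tau> assume "\<tau> \<in> {0..T}"
        from frac_props(3)[OF HS_diff[OF u_HS[OF this] u_HS[OF t]] v]
        show "norm (LS (u \<tau>) v - LS (u t) v) \<le> HN (\<lambda>x. u \<tau> x - u t x) * HN v"
          by (simp only: frac_diff[OF u_HS[OF \<open>\<tau> \<in> {0..T}\<close>] u_HS[OF t] v] real_norm_def)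
      qed
      have "((\<lambda>\<tau>. HN (\<lambda>x. u \<tau> x - u t x)) \<longlongrightarrow> 0) (at t within {0..T})" using u_C_time t by (simp add: C_time_def)
      from tendsto_mult_right[OF this, of "HN v"]
      show "((\<lambda>\<tau>. HN (\<lambda>x. u \<tau> x - u t x) * HN v) \<longlongrightarrow> 0) (at t within {0..T})" by simp
    qed
    then show "((\<lambda>\<tau>. LS (u \<tau>) v) \<longlongrightarrow> LS (u t) v) (at t within {0..T})"
      by (rule LIM_zero_cancel)
  qed
qed

text \<open>The scalar identities \<open>mode_caputo\<close>, weighted with the coefficients of v
  and summed. Dominated convergence works on both sides: Cauchy-Schwarz bounds the partial sums
  uniformly in n and in time, and on the right the singular kernel is integrable because \<gamma> <
  2.\<close>

lemma integrated_equation: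
  assumes v: "v \<in> HS" and t: "t \<in> {0..T}"
  shows "(LINT r|lborel. indicator {0..t} r * (Fv v r - LS (u r) v))
    = 1 / Gamma (2 - \<gamma>) * (LINT r|lborel. indicator {0..t} r * ((t - r) powr (1 - \<gamma>) * (L2_inner \<Omega> (u' r) v - L2_inner \<Omega> (u' 0) v)))"
    "integrable lborel (\<lambda>r. indicator {0..t} r * (Fv v r - LS (u r) v))"
proof -
  note vL = HS_L2[OF v]
  have rT: "r \<in> {0..T}" if "r \<in> {0..t}" for r using that t by auto
  have cont: "continuous_on {0..t} (y k)" "continuous_on {0..T} (y' k)" for k
    using f.mode_continuous[OF ell_pos, of k "coef g k" "coef h k" k] t by (auto elim: continuous_on_subset)
  define a where "a r = LS (u r) v" for r
  define q where "q n r = (\<Sum>k<n. coef v k * (F k r - ell k * y k r))" for n r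
  \<comment> \<open>A bound for the energy norm of u at all times; its counterpart K' below bounds
    the L2 norm of u'. They enter the two majorants.\<close>
  define K where "K = sqrt (mode_const * ((HN g)\<^sup>2 + (L2_norm \<Omega> h)\<^sup>2 + NF\<^sup>2))"
  have K: "HN (u r) \<le> K" if "r \<in> {0..T}" for r unfolding K_def by (rule real_le_rsqrt[OF u_HN[OF that]])
  have qi1: "integrable lborel (\<lambda>r. indicator {0..t} r * (F k r - ell k * y k r))" for k
    using Bochner_Integration.integrable_diff[OF F_integrable[of t k] integrable_mult_right[OF continuous_integral_Icc(1)[OF cont(1)[of k]], of "ell k"]]
    by (simp add: algebra_simps)
  have qe: "indicator {0..t} r * q n r = (\<Sum>k<n. coef v k * (indicator {0..t} r * (F k r - ell k * y k r)))" for n r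
    by (simp add: q_def sum_distrib_left mult_ac)
  have qi: "integrable lborel (\<lambda>r. indicator {0..t} r * q n r)" for n
    unfolding qe by (intro Bochner_Integration.integrable_sum integrable_mult_right qi1)
  have qlim: "(\<lambda>n. indicator {0..t} r * q n r) \<longlonglongrightarrow> indicator {0..t} r * (Fv v r - a r)" for r
  proof (cases "r \<in> {0..t}")
    case True
    have "(\<lambda>k. F k r * coef v k - ell k * y k r * coef v k) sums (Fv v r - a r)"
      unfolding a_def by (intro sums_diff Fv(1) vL frac_u(1) v rT True)
    then have "(\<lambda>k. coef v k * (F k r - ell k * y k r)) sums (Fv v r - a r)" by (simp only: right_diff_distrib mult_ac)
    then show ?thesis using True by (simp add: q_def sums_def)
  qed simp
  have qb: "\<bar>indicator {0..t} r * q n r\<bar> \<le> indicator {0..t} r * (B * L2_norm \<Omega> v + K * HN v)" for n r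
  proof (cases "r \<in> {0..t}")
    case True
    have "q n r = (\<Sum>k<n. F k r * coef v k) - (\<Sum>k<n. ell k * y k r * coef v k)"
      unfolding q_def sum_subtractf[symmetric] by (intro sum.cong) (simp_all add: algebra_simps)
    moreover have "HN (u r) * HN v \<le> K * HN v" by (intro mult_right_mono K rT True HN_nonneg v)
    ultimately have "\<bar>q n r\<bar> \<le> B * L2_norm \<Omega> v + K * HN v"
      using Fv(2)[OF vL, where n = n and t = r] frac_u(2)[OF v rT[OF True], of n] by linarith
    then show ?thesis using True by simp
  qed simp
  have lm: "(\<lambda>r. indicator {0..t} r * (Fv v r - a r)) \<in> borel_measurable lborel"
    by (rule borel_measurable_LIMSEQ_real[OF qlim borel_measurable_integrable[OF qi]])
  have wi: "integrable lborel (\<lambda>r. indicator {0..t} r * (B * L2_norm \<Omega> v + K * HN v))" by (intro integrable_mult_left) auto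
  have L: "(\<lambda>n. LINT r|lborel. indicator {0..t} r * q n r) \<longlonglongrightarrow> (LINT r|lborel. indicator {0..t} r * (Fv v r - a r))"
    by (rule integral_dominated_convergence[OF lm borel_measurable_integrable[OF qi] wi]) (use qlim qb in auto)
  show "integrable lborel (\<lambda>r. indicator {0..t} r * (Fv v r - LS (u r) v))"
    unfolding a_def[symmetric]
    by (rule integrable_dominated_convergence[where s = "\<lambda>n r. indicator {0..t} r * q n r", OF lm borel_measurable_integrable[OF qi] wi]) (use qlim qb in auto)
  define m where "m n r = (\<Sum>k<n. coef v k * (y' k r - coef h k))" for n r
  define k\<^sub>0 where "k\<^sub>0 r = indicator {0..t} r * (t - r) powr (1 - \<gamma>)" for r
  define p where "p r = L2_inner \<Omega> (u' r) v - L2_inner \<Omega> (u' 0) v" for r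
  define K' where "K' = sqrt (mode_const * ((G2)\<^sup>2 + (L2_norm \<Omega> h)\<^sup>2 + B\<^sup>2 * sing_mass))"
  have K': "L2_norm \<Omega> (u' r) \<le> K'" if "r \<in> {0..T}" for r unfolding K'_def by (rule real_le_rsqrt[OF u'_norm[OF that]])
  have T0: "0 \<in> {0..T}" using T by simp
  have dL: "(\<lambda>x. u' r x - u' 0 x) \<in> L2_space \<Omega>" if "r \<in> {0..T}" for r by (intro L2_diff u' that T0)
  have dc: "coef (\<lambda>x. u' r x - u' 0 x) k = y' k r - coef h k" if "r \<in> {0..T}" for r k
    by (simp only: L2_inner_diff[OF u'(1)[OF that] u'(1)[OF T0] \<phi>_L2] u'(2)[OF that] u'(2)[OF T0] f.mode_0(2)[OF ell_pos])
  have k0i: "integrable lborel k\<^sub>0"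
    using integral_powr_kernel(2)[of "1 - \<gamma>" 0 t] t \<gamma> unfolding k\<^sub>0_def by (simp add: has_bochner_integral_iff)
  have mi1: "integrable lborel (\<lambda>r. indicator {0..t} r * ((t - r) powr (1 - \<gamma>) * (y' k r - coef h k)))" for k
    by (rule integral_singular_kernel(1)[OF _ t \<gamma>(2)]) (intro continuous_on_diff cont(2) continuous_on_const)
  have me: "k\<^sub>0 r * m n r = (\<Sum>k<n. coef v k * (indicator {0..t} r * ((t - r) powr (1 - \<gamma>) * (y' k r - coef h k))))" for n r
    by (simp add: m_def k\<^sub>0_def sum_distrib_left mult_ac)
  have mi: "integrable lborel (\<lambda>r. k\<^sub>0 r * m n r)" for n
    unfolding me by (intro Bochner_Integration.integrable_sum integrable_mult_right mi1)
  have mlim: "(\<lambda>n. k\<^sub>0 r * m n r) \<longlonglongrightarrow> k\<^sub>0 r * p r" for r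
  proof (cases "r \<in> {0..t}")
    case True
    have "(\<lambda>k. (y' k r - coef h k) * coef v k) sums p r"
      using inner_sums[OF dL[OF rT[OF True]] vL]
      by (simp only: dc[OF rT[OF True]] p_def L2_inner_diff[OF u'(1)[OF rT[OF True]] u'(1)[OF T0] vL])
    then have "(\<lambda>n. m n r) \<longlonglongrightarrow> p r" by (simp only: m_def sums_def mult.commute)
    then show ?thesis by (intro tendsto_intros)
  qed (simp add: k\<^sub>0_def)
  have mb: "\<bar>k\<^sub>0 r * m n r\<bar> \<le> k\<^sub>0 r * ((K' + K') * L2_norm \<Omega> v)" for n r
  proof (cases "r \<in> {0..t}")
    case True
    note l2 = l2_Cauchy_Schwarz(3)[OF coef_summable[OF dL[OF rT[OF True]]] coef_summable[OF vL], of n]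
    have "m n r = (\<Sum>k<n. coef (\<lambda>x. u' r x - u' 0 x) k * coef v k)"
      by (simp only: m_def dc[OF rT[OF True]] mult.commute)
    then have "\<bar>m n r\<bar> \<le> L2_norm \<Omega> (\<lambda>x. u' r x - u' 0 x) * L2_norm \<Omega> v"
      using l2 by (simp only: L2_norm_coef[OF dL[OF rT[OF True]]] L2_norm_coef[OF vL])
    also have "\<dots> \<le> (K' + K') * L2_norm \<Omega> v"
    proof (intro mult_right_mono)
      have "L2_norm \<Omega> (\<lambda>x. u' r x - u' 0 x) \<le> L2_norm \<Omega> (u' r) + L2_norm \<Omega> (u' 0)"
        using L2_norm_triangle[OF u'(1)[OF rT[OF True]] L2_scale[OF u'(1)[OF T0], of "-1"]] unfolding L2_norm_scale by simp
      then show "L2_norm \<Omega> (\<lambda>x. u' r x - u' 0 x) \<le> K' + K'" using K'[OF rT[OF True]] K'[OF T0] by linarith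
    qed simp
    finally show ?thesis unfolding abs_mult by (simp add: k\<^sub>0_def mult_left_mono)
  qed (simp add: k\<^sub>0_def)
  have R: "(\<lambda>n. LINT r|lborel. k\<^sub>0 r * m n r) \<longlonglongrightarrow> (LINT r|lborel. k\<^sub>0 r * p r)"
    by (rule integral_dominated_convergence[OF borel_measurable_LIMSEQ_real[OF mlim borel_measurable_integrable[OF mi]]
          borel_measurable_integrable[OF mi] integrable_mult_left[OF k0i]]) (use mlim mb in auto)
  have eq: "(LINT r|lborel. indicator {0..t} r * q n r) = 1 / Gamma (2 - \<gamma>) * (LINT r|lborel. k\<^sub>0 r * m n r)" for n
  proof -
    have "(LINT r|lborel. indicator {0..t} r * q n r) = (\<Sum>k<n. coef v k * (LINT r|lborel. indicator {0..t} r * (F k r - ell k * y k r)))"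
      unfolding qe by (simp add: Bochner_Integration.integral_sum qi1)
    also have "\<dots> = (\<Sum>k<n. coef v k * (1 / Gamma (2 - \<gamma>) * (LINT r|lborel. indicator {0..t} r * ((t - r) powr (1 - \<gamma>) * (y' k r - coef h k)))))"
      by (simp only: f.mode_caputo[OF ell_pos t])
    also have "\<dots> = 1 / Gamma (2 - \<gamma>) * (LINT r|lborel. k\<^sub>0 r * m n r)"
      unfolding me by (simp add: Bochner_Integration.integral_sum mi1 sum_divide_distrib)
    finally show ?thesis .
  qed
  have "(LINT r|lborel. indicator {0..t} r * (Fv v r - a r)) = 1 / Gamma (2 - \<gamma>) * (LINT r|lborel. k\<^sub>0 r * p r)"
    by (rule LIMSEQ_unique[OF L]) (unfold eq, intro tendsto_mult tendsto_const R)
  then show "(LINT r|lborel. indicator {0..t} r * (Fv v r - LS (u r) v))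
    = 1 / Gamma (2 - \<gamma>) * (LINT r|lborel. indicator {0..t} r * ((t - r) powr (1 - \<gamma>) * (L2_inner \<Omega> (u' r) v - L2_inner \<Omega> (u' 0) v)))"
    by (simp only: a_def k\<^sub>0_def p_def mult.assoc)
qed

lemma u_caputo:
  assumes v: "v \<in> HS"
  shows "caputo_derivative \<gamma> T (\<lambda>t. L2_inner \<Omega> (u' t) v) (\<lambda>t. L2_inner \<Omega> (f t) v - LS (u t) v)"
proof -
  have TT: "T \<in> {0..T}" using T by simp
  have z: "AE r in leb T. L2_inner \<Omega> (f r) v - LS (u r) v = Fv v r - LS (u r) v"
    using Fv(3)[OF HS_L2[OF v]] by eventually_elim simp
  note 1 = integral_lebesgue_AE_cong[OF integrated_equation(2)[OF v TT] z]
  have c: "continuous_on {0..T} (\<lambda>r. L2_inner \<Omega> (u' r) v - L2_inner \<Omega> (u' 0) v)"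
    by (intro continuous_on_diff continuous_on_const C_time_inner_continuous[OF u'_C_time HS_L2[OF v]])
  show ?thesis
    unfolding caputo_derivative_def
    using 1(1) by (auto simp only: 1(2) integral_singular_kernel(2)[OF c _ \<gamma>(2)] integrated_equation(1)[OF v])
qed

theorem u_weak_solution: "weak_solution \<Omega> lam \<phi> s \<gamma> T f g h u"
proof -
  interpret L: seminormed_space "L2_space \<Omega>" "L2_norm \<Omega>" by (rule seminormed_L2)
  interpret H: seminormed_space HS HN by (rule seminormed_HS)
  interpret D: seminormed_space HD HDN by (rule seminormed_HD)
  have T0: "0 \<in> {0..T}" using T by simp
  have fs: "strongly_measurable (leb T) (L2_space \<Omega>) (L2_norm \<Omega>) f" using f by (simp add: Linf_time_def)
  obtain K where K: "K \<ge> 0" "\<And>t. t \<in> {0..T} \<Longrightarrow> HN (u t) \<le> K" using H.C_time_bounded[OF u_C_time] by blast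
  \<comment> \<open>With w defined by the equation, the equation itself is trivial; that w is the
    Caputo derivative is the content of \<open>u_caputo\<close>.\<close>
  define w where "w t v = L2_inner \<Omega> (f t) v - LS (u t) v" for t v
  have ws: "strongly_measurable (leb T) HD HDN w"
    using strongly_measurable_functional[OF fs H.C_time_strongly_measurable[OF u_C_time T]] by (simp add: w_def[abs_def])
  have fX: "AE t in leb T. f t \<in> L2_space \<Omega>" using fs by (simp add: strongly_measurable_def)
  have "AE t in leb T. HDN (w t) \<le> B / sqrt ell0 + K"
    using fX L.Linf_time_norm_bound(2)[OF f T] AE_space
  proof eventually_elim
    case (elim t)
    then have t: "t \<in> {0..T}" by auto
    have "HDN (w t) \<le> L2_norm \<Omega> (f t) / sqrt ell0 + HN (u t)"
      using functional_HD(2)[OF elim(1) u_HS[OF t]] by (simp add: w_def[abs_def])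
    also have "\<dots> \<le> B / sqrt ell0 + K" using elim(2) K(2)[OF t] ell0(1) by (intro add_mono divide_right_mono) (auto simp: B_def)
    finally show ?case .
  qed
  then have wL: "w \<in> Lp_time 2 T HD HDN" by (rule D.strongly_measurable_bounded_Lp_time[OF ws]) simp
  have "AE x in lebesgue_on \<Omega>. u 0 x = g x"
    by (rule L2_eqI_AE[OF u(1)[OF T0] g_L2]) (simp add: u(2)[OF T0] f.mode_0)
  moreover have "AE x in lebesgue_on \<Omega>. u' 0 x = h x"
    by (rule L2_eqI_AE[OF u'(1)[OF T0] h]) (simp add: u'(2)[OF T0] f.mode_0)
  moreover have "\<forall>v\<in>HS. caputo_derivative \<gamma> T (\<lambda>t. L2_inner \<Omega> (u' t) v) (\<lambda>t. w t v)"
    using u_caputo by (simp add: w_def)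
  moreover have "AE t in leb T. \<forall>v\<in>HS. w t v + LS (u t) v = L2_inner \<Omega> (f t) v"
    by (simp add: w_def)
  ultimately show ?thesis
    unfolding weak_solution_def
    using H.C_time_Linf_time[OF u_C_time T] u_C_time L.C_time_Linf_time[OF u'_C_time T] u'_C_time u_weak_derivative wL by blast
qed

section \<open>Uniqueness\<close>

lemma weak_derivative_coef:
  assumes w: "has_weak_time_derivative \<Omega> T v v'" and \<psi>: "\<psi> \<in> test_functions {0<..<T}"
  shows "(LINT t|leb T. deriv \<psi> t * coef (v t) k) = - (LINT t|leb T. \<psi> t * coef (v' t) k)"
    "integrable (leb T) (\<lambda>t. \<psi> t * coef (v' t) k)"
proof -
  obtain I where I: "has_vector_integral (leb T) (L2_space \<Omega>) (L2_norm \<Omega>) (\<lambda>t x. deriv \<psi> t * v t x) I"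
    "has_vector_integral (leb T) (L2_space \<Omega>) (L2_norm \<Omega>) (\<lambda>t x. - \<psi> t * v' t x) I"
    using w \<psi> unfolding has_weak_time_derivative_def by blast
  show "(LINT t|leb T. deriv \<psi> t * coef (v t) k) = - (LINT t|leb T. \<psi> t * coef (v' t) k)"
    using has_vector_integral_inner(2)[OF I(1) \<phi>_L2, of k, unfolded L2_inner_scale]
      has_vector_integral_inner(2)[OF I(2) \<phi>_L2, of k, unfolded L2_inner_scale] by simp
  show "integrable (leb T) (\<lambda>t. \<psi> t * coef (v' t) k)"
    using has_vector_integral_inner(1)[OF I(2) \<phi>_L2, of k, unfolded L2_inner_scale] by simp
qed

text \<open>Testing with \<phi> k reduces the claim to one mode: the coefficient of v minus y k
  solves the homogeneous scalar equation with zero initial data, so \<open>mode_unique\<close>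
  applies.\<close>

theorem u_unique:
  assumes v: "weak_solution \<Omega> lam \<phi> s \<gamma> T f g h v" and t: "t \<in> {0..T}"
  shows "AE x in lebesgue_on \<Omega>. v t x = u t x"
proof -
  obtain v' w where vC: "v \<in> C_time T HS HN" and v0: "AE x in lebesgue_on \<Omega>. v 0 x = g x"
    and wd: "has_weak_time_derivative \<Omega> T v v'" and v'C: "v' \<in> C_time T (L2_space \<Omega>) (L2_norm \<Omega>)"
    and v'0: "AE x in lebesgue_on \<Omega>. v' 0 x = h x"
    and cap: "\<And>z. z \<in> HS \<Longrightarrow> caputo_derivative \<gamma> T (\<lambda>t. L2_inner \<Omega> (v' t) z) (\<lambda>t. w t z)"
    and eq: "AE t in leb T. \<forall>z\<in>HS. w t z + LS (v t) z = L2_inner \<Omega> (f t) z"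
    using v unfolding weak_solution_def by blast
  note vC2 = C_time_HS_L2[OF vC]
  have T0: "0 \<in> {0..T}" using T by simp
  have vX: "v t \<in> L2_space \<Omega>" "v' t \<in> L2_space \<Omega>" if "t \<in> {0..T}" for t using vC2 v'C that by (auto simp: C_time_def)
  have init: "coef (v 0) k = coef g k" "coef (v' 0) k = coef h k" for k
    by (rule L2_inner_cong_AE[OF L2_spaceD(1) L2_spaceD(1) L2_spaceD(1)]; (rule vX T0 g_L2 h v0 v'0 \<phi>_L2)+)+
  have "coef (v t) k - y k t = 0" for k
  proof (rule mode_unique[OF ell_pos _ _ _ _ t])
    have c: "continuous_on {0..T} (\<lambda>t. coef (v t) k)" "continuous_on {0..T} (\<lambda>t. coef (v' t) k)"
      by (intro C_time_inner_continuous[OF vC2] C_time_inner_continuous[OF v'C] \<phi>_L2)+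
    note cy = f.mode_continuous[OF ell_pos, of k "coef g k" "coef h k" k]
    show "continuous_on {0..T} (\<lambda>t. coef (v t) k - y k t)" and cp: "continuous_on {0..T} (\<lambda>t. coef (v' t) k - y' k t)"
      by (intro continuous_on_diff c cy)+
    fix t assume t: "t \<in> {0..T}"
    have sub: "{0..t} \<subseteq> {0..T}" and tT: "t \<le> T" using t by auto
    note ci = continuous_integral_Icc(1)[OF continuous_on_subset[OF _ sub]]
    \<comment> \<open>Both v and v' are continuous in time, so the distributional relation between
      them becomes an integrated one, valid at every t.\<close>
    have "coef (v t) k = coef (v 0) k + (LINT r|lborel. indicator {0..t} r * coef (v' r) k)"
      by (rule weak_derivative_continuous[OF T c weak_derivative_coef(1)[OF wd] t])
    then have "coef (v t) k - y k t = (LINT r|lborel. indicator {0..t} r * coef (v' r) k) - (LINT r|lborel. indicator {0..t} r * y' k r)"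
      by (simp add: init f.mode_derivative[OF ell_pos t])
    also have "\<dots> = (LINT r|lborel. indicator {0..t} r * (coef (v' r) k - y' k r))"
      using ci[OF c(2)] ci[OF cy(2)] by (simp add: right_diff_distrib)
    finally show "coef (v t) k - y k t = (LINT r|lborel. indicator {0..t} r * (coef (v' r) k - y' k r))" .
    \<comment> \<open>\<phi> k belongs to the energy space, and evaluating the dual equation there
      isolates mode k.\<close>
    have wae: "AE r in leb T. w r (\<phi> k) = F k r - ell k * coef (v r) k"
      using eq F(4)
    proof eventually_elim
      case (elim r)
      have "w r (\<phi> k) + LS (v r) (\<phi> k) = coef (f r) k" using elim(1) \<phi>_HS by blast
      then show ?case using elim(2) by (simp add: frac_\<phi>)
    qed
    have ii: "integrable lborel (\<lambda>r. indicator {0..t} r * (F k r - ell k * z r))" if "continuous_on {0..T} z" "t \<le> T" for z t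
      using Bochner_Integration.integrable_diff[OF F_integrable[of t k] integrable_mult_right[OF continuous_integral_Icc(1)[OF continuous_on_subset[OF that(1), of "{0..t}"]], of "ell k"]] that(2)
      by (simp add: right_diff_distrib mult.left_commute)
    have "(LINT r|lebesgue_on {0..t}. w r (\<phi> k)) = (LINT r|lborel. indicator {0..t} r * (F k r - ell k * coef (v r) k))"
      by (rule integral_lebesgue_AE_cong(2)[OF ii[OF c(1) order_refl] wae t])
    moreover have "(LINT r|lebesgue_on {0..t}. w r (\<phi> k)) = 1 / Gamma (2 - \<gamma>) * (LINT r|lebesgue_on {0..t}. (t - r) powr (1 - \<gamma>) * (coef (v' r) k - coef h k))"
      by (rule bspec[OF conjunct2[OF cap[OF \<phi>_HS, of k, unfolded caputo_derivative_def init]] t])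
    moreover have "(LINT r|lebesgue_on {0..t}. (t - r) powr (1 - \<gamma>) * (coef (v' r) k - coef h k)) = (LINT r|lborel. indicator {0..t} r * ((t - r) powr (1 - \<gamma>) * (coef (v' r) k - coef h k)))"
      by (rule integral_singular_kernel(2)[OF _ t \<gamma>(2)]) (intro continuous_on_diff continuous_on_const c)
    moreover have "(LINT r|lborel. indicator {0..t} r * (F k r - ell k * y k r))
        = 1 / Gamma (2 - \<gamma>) * (LINT r|lborel. indicator {0..t} r * ((t - r) powr (1 - \<gamma>) * (y' k r - coef h k)))"
      by (rule f.mode_caputo[OF ell_pos t])
    ultimately have "(LINT r|lborel. indicator {0..t} r * (F k r - ell k * coef (v r) k)) - (LINT r|lborel. indicator {0..t} r * (F k r - ell k * y k r))
      = 1 / Gamma (2 - \<gamma>) * ((LINT r|lborel. indicator {0..t} r * ((t - r) powr (1 - \<gamma>) * (coef (v' r) k - coef h k)))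
         - (LINT r|lborel. indicator {0..t} r * ((t - r) powr (1 - \<gamma>) * (y' k r - coef h k))))"
      by (simp only: right_diff_distrib)
    also have "(LINT r|lborel. indicator {0..t} r * ((t - r) powr (1 - \<gamma>) * (coef (v' r) k - coef h k)))
         - (LINT r|lborel. indicator {0..t} r * ((t - r) powr (1 - \<gamma>) * (y' k r - coef h k)))
       = (LINT r|lborel. indicator {0..t} r * ((t - r) powr (1 - \<gamma>) * (coef (v' r) k - y' k r)))"
      unfolding Bochner_Integration.integral_diff[OF integral_singular_kernel(1)[OF continuous_on_diff[OF c(2) continuous_on_const] t \<gamma>(2)]
          integral_singular_kernel(1)[OF continuous_on_diff[OF cy(2) continuous_on_const] t \<gamma>(2)], symmetric]
      by (rule Bochner_Integration.integral_cong) (simp_all add: algebra_simps)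
    also have "(LINT r|lborel. indicator {0..t} r * (F k r - ell k * coef (v r) k)) - (LINT r|lborel. indicator {0..t} r * (F k r - ell k * y k r))
      = (LINT r|lborel. - ell k * (indicator {0..t} r * (coef (v r) k - y k r)))"
      unfolding Bochner_Integration.integral_diff[OF ii[OF c(1) tT] ii[OF cy(1) tT], symmetric]
      by (rule Bochner_Integration.integral_cong) (simp_all add: algebra_simps)
    finally show "- ell k * (LINT r|lborel. indicator {0..t} r * (coef (v r) k - y k r))
      = 1 / Gamma (2 - \<gamma>) * (LINT r|lborel. indicator {0..t} r * ((t - r) powr (1 - \<gamma>) * (coef (v' r) k - y' k r)))" by simp
  qed
  then show ?thesis by (intro L2_eqI_AE vX t u) (simp add: u(2)[OF t])
qed

end

section \<open>Representation formula and estimates\<close>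

lemma sqrt_sum3_le:
  fixes a b c :: real
  assumes "0 \<le> a" "0 \<le> b" "0 \<le> c"
  shows "sqrt (a\<^sup>2 + b\<^sup>2 + c\<^sup>2) \<le> a + b + c"
  using assms by (intro real_le_lsqrt) (auto simp: power2_eq_square algebra_simps)

lemma (in ml_kernels) mittag_leffler_bounded:
  assumes x: "x \<ge> 0" and \<mu>: "\<mu> > 0"
  shows "\<bar>mittag_leffler \<gamma> \<mu> (- x)\<bar> \<le> ml_bound 0 \<mu> + 1 / Gamma \<mu>"
proof (cases "x = 0")
  case True
  then show ?thesis using ml_bound(1)[of 0 \<mu>] Gamma_real_pos[OF \<mu>] \<mu> by (simp add: mittag_leffler_0)
next
  case False
  then show ?thesis using ml_bound(2)[of 0 \<mu> x] Gamma_real_pos[OF \<mu>] x \<mu> by (simp add: add_increasing2)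
qed

context wave_data begin

lemma G_op: "G_op \<Omega> lam \<phi> s \<gamma> t g \<in> L2_space \<Omega>"
  "coef (G_op \<Omega> lam \<phi> s \<gamma> t g) k = mittag_leffler \<gamma> 1 (- ell k * t powr \<gamma>) * coef g k"
proof -
  have b: "\<bar>mittag_leffler \<gamma> 1 (- ell k * t powr \<gamma>)\<bar> \<le> ml_bound 0 1 + 1 / Gamma 1" for k
    using mittag_leffler_bounded[of "ell k * t powr \<gamma>" 1] ell_nonneg by simp
  show "G_op \<Omega> lam \<phi> s \<gamma> t g \<in> L2_space \<Omega>"
    "coef (G_op \<Omega> lam \<phi> s \<gamma> t g) k = mittag_leffler \<gamma> 1 (- ell k * t powr \<gamma>) * coef g k"
    unfolding G_op_def ell_def[symmetric] by (rule spectral_multiplier[OF g_L2 b])+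
qed

lemma H_op: "H_op \<Omega> lam \<phi> s \<gamma> t h \<in> L2_space \<Omega>"
  "coef (H_op \<Omega> lam \<phi> s \<gamma> t h) k = t * mittag_leffler \<gamma> 2 (- ell k * t powr \<gamma>) * coef h k"
proof -
  have b: "\<bar>t * mittag_leffler \<gamma> 2 (- ell k * t powr \<gamma>)\<bar> \<le> \<bar>t\<bar> * (ml_bound 0 2 + 1 / Gamma 2)" for k
    using mittag_leffler_bounded[of "ell k * t powr \<gamma>" 2] ell_nonneg by (simp add: abs_mult mult_left_mono)
  show "H_op \<Omega> lam \<phi> s \<gamma> t h \<in> L2_space \<Omega>"
    "coef (H_op \<Omega> lam \<phi> s \<gamma> t h) k = t * mittag_leffler \<gamma> 2 (- ell k * t powr \<gamma>) * coef h k"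
    unfolding H_op_def ell_def[symmetric] by (rule spectral_multiplier[OF h b])+
qed

lemma F_op:
  assumes w: "w \<in> L2_space \<Omega>" and t: "0 < t" "t \<le> T"
  shows "F_op \<Omega> lam \<phi> s \<gamma> t w \<in> L2_space \<Omega>"
    "coef (F_op \<Omega> lam \<phi> s \<gamma> t w) k = mlk (ell k) \<gamma> t * coef w k"
    "L2_norm \<Omega> (F_op \<Omega> lam \<phi> s \<gamma> t w) \<le> T powr (\<gamma> - 1) * (ml_bound 0 \<gamma> + 1 / Gamma \<gamma>) * L2_norm \<Omega> w"
proof -
  have b: "\<bar>t powr (\<gamma> - 1) * mittag_leffler \<gamma> \<gamma> (- ell k * t powr \<gamma>)\<bar> \<le> T powr (\<gamma> - 1) * (ml_bound 0 \<gamma> + 1 / Gamma \<gamma>)" for k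
    using mittag_leffler_bounded[of "ell k * t powr \<gamma>" \<gamma>] ell_nonneg t \<gamma>
    unfolding abs_mult by (intro mult_mono) (auto intro: powr_mono2)
  have e: "F_op \<Omega> lam \<phi> s \<gamma> t w = spectral_multiplier \<Omega> \<phi> (\<lambda>k. t powr (\<gamma> - 1) * mittag_leffler \<gamma> \<gamma> (- ell k * t powr \<gamma>)) w"
    by (simp only: F_op_def ell_def)
  show "F_op \<Omega> lam \<phi> s \<gamma> t w \<in> L2_space \<Omega>"
    "L2_norm \<Omega> (F_op \<Omega> lam \<phi> s \<gamma> t w) \<le> T powr (\<gamma> - 1) * (ml_bound 0 \<gamma> + 1 / Gamma \<gamma>) * L2_norm \<Omega> w"
    unfolding e by (rule spectral_multiplier[OF w b])+
  show "coef (F_op \<Omega> lam \<phi> s \<gamma> t w) k = mlk (ell k) \<gamma> t * coef w k"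
    unfolding e spectral_multiplier(2)[OF w b] using t by (simp add: ml_kernel_def)
qed

text \<open>\<open>F_op\<close> is chosen separately for each r, so its dependence on r is
  accessible only through coefficients; measurability of these and a bound on the norm are all that
  the coordinate form of the Bochner integral asks for. In mode k the integral is the convolution
  term of \<open>mode\<close>.\<close>

theorem u_representation:
  assumes t: "t \<in> {0..T}"
  shows "\<exists>I. has_vector_integral (leb t) (L2_space \<Omega>) (L2_norm \<Omega>) (\<lambda>r. F_op \<Omega> lam \<phi> s \<gamma> (t - r) (f r)) I \<and>
    (AE x in lebesgue_on \<Omega>. u t x = G_op \<Omega> lam \<phi> s \<gamma> t g x + H_op \<Omega> lam \<phi> s \<gamma> t h x + I x)"
proof -
  interpret L: seminormed_space "L2_space \<Omega>" "L2_norm \<Omega>" by (rule seminormed_L2)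
  interpret cm: complete_measure "leb t" by (rule complete_lebesgue_on) simp
  define U where "U r = F_op \<Omega> lam \<phi> s \<gamma> (t - r) (f r)" for r
  define K where "K = T powr (\<gamma> - 1) * (ml_bound 0 \<gamma> + 1 / Gamma \<gamma>)"
  have K: "K \<ge> 0" unfolding K_def using ml_bound(1)[of 0 \<gamma>] Gamma_real_pos[of \<gamma>] \<gamma> by simp
  have "AE r in leb T. f r \<in> L2_space \<Omega>" using f by (simp add: Linf_time_def strongly_measurable_def)
  then have "AE r in leb T. f r \<in> L2_space \<Omega> \<and> L2_norm \<Omega> (f r) \<le> B \<and> (\<forall>k. coef (f r) k = F k r)"
    using F(4) L.Linf_time_norm_bound(2)[OF f T] by eventually_elim (auto simp: B_def)
  then have "AE r in leb t. f r \<in> L2_space \<Omega> \<and> L2_norm \<Omega> (f r) \<le> B \<and> (\<forall>k. coef (f r) k = F k r)"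
    by (subst (asm) AE_restrict_space_iff, simp, subst AE_restrict_space_iff, simp) (use t in \<open>auto elim!: eventually_mono\<close>)
  then have "AE r in leb t. U r \<in> L2_space \<Omega> \<and> L2_norm \<Omega> (U r) \<le> K * B \<and> (\<forall>k. mlk (ell k) \<gamma> (t - r) * F k r = coef (U r) k)"
    using AE_space
  proof eventually_elim
    case (elim r)
    then have r: "0 < t - r" "t - r \<le> T" using t by auto
    have fr: "f r \<in> L2_space \<Omega>" using elim(1) by blast
    have "L2_norm \<Omega> (U r) \<le> K * L2_norm \<Omega> (f r)" unfolding U_def K_def by (rule F_op(3)[OF fr r])
    also have "\<dots> \<le> K * B" using elim(1) K by (intro mult_left_mono) auto
    finally show ?case using elim(1) F_op(1,2)[OF fr r] by (simp add: U_def)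
  qed
  then have U: "AE r in leb t. U r \<in> L2_space \<Omega>" "AE r in leb t. L2_norm \<Omega> (U r) \<le> K * B"
    and Uc: "AE r in leb t. mlk (ell k) \<gamma> (t - r) * F k r = coef (U r) k" for k
    by (simp_all add: AE_all_countable)
  have am: "(\<lambda>r. mlk (ell k) \<gamma> (t - r) * F k r) \<in> borel_measurable borel" for k
    using kernels_measurable(3)[of "ell k"] F(1)[of k] by measurable
  have am': "(\<lambda>r. mlk (ell k) \<gamma> (t - r) * F k r) \<in> borel_measurable (leb t)" for k
    using am[of k] by (intro measurable_restrict_space1 measurable_completion) simp
  have Um: "(\<lambda>r. coef (U r) k) \<in> borel_measurable (leb t)" for k
    by (rule cm.borel_measurable_AE_cong[OF am' Uc])
  obtain I where I: "I \<in> L2_space \<Omega>" "\<And>k. coef I k = (LINT r|leb t. coef (U r) k)"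
    using bounded_vector_integral_exists[OF U Um] by blast
  have vi: "has_vector_integral (leb t) (L2_space \<Omega>) (L2_norm \<Omega>) U I"
    by (rule bounded_has_vector_integral[OF U Um I])
  have cI: "coef I k = conv (mlk (ell k) \<gamma>) (F k) t" for k
  proof -
    have "coef I k = (LINT r|leb t. mlk (ell k) \<gamma> (t - r) * F k r)"
      unfolding I(2) by (rule integral_cong_AE[OF Um am']) (use Uc[of k] in \<open>auto elim!: eventually_mono\<close>)
    also have "\<dots> = (LINT r|lborel. mlk (ell k) \<gamma> (t - r) * F k r)"
      by (rule lborel_integral_support(2)[OF am]) (use t F(2) in \<open>auto simp: ml_kernel_def\<close>)
    finally show ?thesis by (simp add: conv_def)
  qed
  have GH: "(\<lambda>x. G_op \<Omega> lam \<phi> s \<gamma> t g x + H_op \<Omega> lam \<phi> s \<gamma> t h x) \<in> L2_space \<Omega>" by (intro L2_add G_op H_op)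
  have "AE x in lebesgue_on \<Omega>. u t x = G_op \<Omega> lam \<phi> s \<gamma> t g x + H_op \<Omega> lam \<phi> s \<gamma> t h x + I x"
  proof (rule L2_eqI_AE[OF u(1)[OF t] L2_add[OF GH I(1)]])
    fix k
    show "coef (u t) k = coef (\<lambda>x. G_op \<Omega> lam \<phi> s \<gamma> t g x + H_op \<Omega> lam \<phi> s \<gamma> t h x + I x) k"
      by (simp only: L2_inner_add[OF GH I(1) \<phi>_L2] L2_inner_add[OF G_op(1) H_op(1) \<phi>_L2] u(2)[OF t] G_op(2) H_op(2) cI mode_def)
  qed
  with vi show ?thesis unfolding U_def[abs_def] by blast
qed

text \<open>The estimates are stated for an arbitrary weak derivative, which need not be continuous.
  Its coefficients agree almost everywhere with those of u' by
  \<open>AE_zero_of_test_functions\<close>, and there are countably many.\<close>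

lemma weak_derivative_norm:
  assumes w: "has_weak_time_derivative \<Omega> T u u2"
  shows "AE t in leb T. u2 t \<in> L2_space \<Omega> \<and> L2_norm \<Omega> (u2 t) = L2_norm \<Omega> (u' t)"
proof -
  have int: "integrable (leb T) (\<lambda>t. coef (z t) k)" and X: "AE t in leb T. z t \<in> L2_space \<Omega>"
    if "z \<in> Lp_time 1 T (L2_space \<Omega>) (L2_norm \<Omega>)" for z k
  proof -
    have sm: "strongly_measurable (leb T) (L2_space \<Omega>) (L2_norm \<Omega>) z"
      and i: "integrable (leb T) (\<lambda>t. L2_norm \<Omega> (z t))" using that by (auto simp: Lp_time_def)
    show X: "AE t in leb T. z t \<in> L2_space \<Omega>" using sm by (simp add: strongly_measurable_def)
    show "integrable (leb T) (\<lambda>t. coef (z t) k)"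
    proof (rule Bochner_Integration.integrable_bound[OF i])
      show "(\<lambda>t. coef (z t) k) \<in> borel_measurable (leb T)"
        by (rule strongly_measurable_inner[OF sm complete_lebesgue_on]) simp_all
      show "AE t in leb T. norm (coef (z t) k) \<le> norm (L2_norm \<Omega> (z t))"
        using X
      proof eventually_elim
        case (elim t)
        show ?case using L2_Cauchy_Schwarz[OF elim \<phi>_L2[of k]] by (simp add: L2_norm_\<phi>)
      qed
    qed
  qed
  have z: "u2 \<in> Lp_time 1 T (L2_space \<Omega>) (L2_norm \<Omega>)" "u' \<in> Lp_time 1 T (L2_space \<Omega>) (L2_norm \<Omega>)"
    using w u_weak_derivative by (auto simp: has_weak_time_derivative_def)
  have "AE t in leb T. coef (u2 t) k - coef (u' t) k = 0" for k
  proof (rule AE_zero_of_test_functions)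
    show "integrable (leb T) (\<lambda>t. coef (u2 t) k - coef (u' t) k)"
      by (intro Bochner_Integration.integrable_diff int z)
    fix \<psi> :: "real \<Rightarrow> real" assume \<psi>: "\<psi> \<in> test_functions {0<..<T}"
    show "(LINT t|leb T. \<psi> t * (coef (u2 t) k - coef (u' t) k)) = 0"
      using weak_derivative_coef[OF w \<psi>, of k] weak_derivative_coef[OF u_weak_derivative \<psi>, of k]
      by (simp add: right_diff_distrib)
  qed
  then have "AE t in leb T. \<forall>k. coef (u2 t) k - coef (u' t) k = 0" by (simp add: AE_all_countable)
  with X[OF z(1)] X[OF z(2)] show ?thesis
    by eventually_elim (auto intro!: L2_norm_cong_coef)
qed

text \<open>Each mode is integrated in time before the modes are summed, which is what makes the
  energy norm of g sufficient; the finite sections converge under a constant majorant.\<close>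

lemma u'_L2_time: "(LINT t|leb T. (L2_norm \<Omega> (u' t))\<^sup>2) \<le> mode_const * ((HN g)\<^sup>2 + (L2_norm \<Omega> h)\<^sup>2 + NF\<^sup>2)"
proof -
  define M where "M = leb T"
  interpret finite_measure M unfolding M_def by (rule finite_measure_Ioo)
  define K where "K = mode_const * ((G2)\<^sup>2 + (L2_norm \<Omega> h)\<^sup>2 + B\<^sup>2 * sing_mass)"
  have sp: "t \<in> {0..T}" if "t \<in> space M" for t using that by (auto simp: M_def)
  have cy: "continuous_on {0..T} (\<lambda>t. (y' k t)\<^sup>2)" for k by (intro continuous_on_power f.mode_continuous ell_pos)
  have yi: "integrable M (\<lambda>t. (y' k t)\<^sup>2)" for k unfolding M_def by (rule continuous_integral_Ioo(1)[OF cy])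
  have si: "integrable M (\<lambda>t. \<Sum>k<n. (y' k t)\<^sup>2)" for n by (intro Bochner_Integration.integrable_sum yi)
  have lim: "(\<lambda>n. \<Sum>k<n. (y' k t)\<^sup>2) \<longlonglongrightarrow> (L2_norm \<Omega> (u' t))\<^sup>2" if "t \<in> space M" for t
    using Parseval[OF u'(1)[OF sp[OF that]]] by (simp only: u'(2)[OF sp[OF that]] sums_def)
  have "(\<lambda>n. LINT t|M. (\<Sum>k<n. (y' k t)\<^sup>2)) \<longlonglongrightarrow> (LINT t|M. (L2_norm \<Omega> (u' t))\<^sup>2)"
  proof (rule integral_dominated_convergence[where w = "\<lambda>_. K"])
    interpret L: seminormed_space "L2_space \<Omega>" "L2_norm \<Omega>" by (rule seminormed_L2)
    show "(\<lambda>t. (L2_norm \<Omega> (u' t))\<^sup>2) \<in> borel_measurable M"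
      unfolding M_def by (intro borel_measurable_power borel_measurable_integrable continuous_integral_Ioo(1) L.C_time_norm_continuous u'_C_time)
    show "AE t in M. norm (\<Sum>k<n. (y' k t)\<^sup>2) \<le> K" for n
      using y'_sum[OF sp] by (intro AE_I2) (simp add: K_def sum_nonneg)
    show "AE t in M. (\<lambda>n. \<Sum>k<n. (y' k t)\<^sup>2) \<longlonglongrightarrow> (L2_norm \<Omega> (u' t))\<^sup>2" by (intro AE_I2 lim)
  qed (use si in auto)
  moreover have "(LINT t|M. (\<Sum>k<n. (y' k t)\<^sup>2)) \<le> mode_const * ((HN g)\<^sup>2 + (L2_norm \<Omega> h)\<^sup>2 + NF\<^sup>2)" for n
  proof -
    have "(LINT t|M. (\<Sum>k<n. (y' k t)\<^sup>2)) = (\<Sum>k<n. LINT t|M. (y' k t)\<^sup>2)" by (intro Bochner_Integration.integral_sum yi)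
    also have "\<dots> \<le> (\<Sum>k<n. mode_const * Q k)"
    proof (intro sum_mono)
      fix k
      have "(LINT t|M. (y' k t)\<^sup>2) = (LINT t|lborel. indicator {0..T} t * (y' k t)\<^sup>2)"
        unfolding M_def by (simp only: continuous_integral_Ioo(2)[OF cy] continuous_integral_Icc(2)[OF cy])
      also have "\<dots> \<le> mode_const * Q k" unfolding Q_def Ff_def by (rule f.mode'_L2_bound[OF ell_pos])
      finally show "(LINT t|M. (y' k t)\<^sup>2) \<le> mode_const * Q k" .
    qed
    also have "\<dots> = mode_const * (\<Sum>k<n. Q k)" by (simp only: sum_distrib_left)
    also have "\<dots> \<le> mode_const * ((HN g)\<^sup>2 + (L2_norm \<Omega> h)\<^sup>2 + NF\<^sup>2)"
      using mode_const_pos sum_le_suminf[OF Q_summable(1), of "{..<n}"] Q_summable(2) by (intro mult_left_mono) auto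
    finally show ?thesis .
  qed
  ultimately show ?thesis unfolding M_def by (intro LIMSEQ_le_const2) auto
qed

lemma g_norm_nonneg: "0 \<le> G2"
  using g_summable by (simp add: HH_norm_def lam_powr_double suminf_nonneg)

text \<open>One constant serves both bounds: the 2 pays for the two summands of the first, each at
  most R, and 1 + sqrt \<open>sing_mass\<close> for the supremum of f in the second.\<close>

theorem u_estimates:
  assumes w: "has_weak_time_derivative \<Omega> T u u2"
  shows "Linf_time_norm T HN u + Lp_time_norm 2 T (L2_norm \<Omega>) u2
      \<le> 2 * sqrt mode_const * (1 + sqrt sing_mass) * (Lp_time_norm 2 T (L2_norm \<Omega>) f + HN g + L2_norm \<Omega> h)"
    "Linf_time_norm T (L2_norm \<Omega>) u2
      \<le> 2 * sqrt mode_const * (1 + sqrt sing_mass) * (Linf_time_norm T (L2_norm \<Omega>) f + G2 + L2_norm \<Omega> h)"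
proof -
  interpret L: seminormed_space "L2_space \<Omega>" "L2_norm \<Omega>" by (rule seminormed_L2)
  interpret H: seminormed_space HS HN by (rule seminormed_HS)
  have m0: "0 \<le> sqrt mode_const" and s0: "0 \<le> sqrt sing_mass" using mode_const_pos sing_mass_pos by auto
  have nn: "0 \<le> HN g" "0 \<le> L2_norm \<Omega> h" "0 \<le> NF" using HN_nonneg[OF g_HS] f_square_integrable(3) by auto
  define R where "R = sqrt (mode_const * ((HN g)\<^sup>2 + (L2_norm \<Omega> h)\<^sup>2 + NF\<^sup>2))"
  have R: "R \<le> sqrt mode_const * (NF + HN g + L2_norm \<Omega> h)"
    unfolding R_def real_sqrt_mult using mult_left_mono[OF sqrt_sum3_le[OF nn] m0] by (simp add: add_ac)
  have R0: "0 \<le> R" unfolding R_def using mode_const_pos by simp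
  have a: "Linf_time_norm T HN u \<le> R"
  proof (rule H.Linf_time_norm_le[OF H.C_time_strongly_measurable[OF u_C_time T] _ R0])
    show "AE t in leb T. HN (u t) \<le> R"
      using AE_space by eventually_elim (auto simp: R_def intro!: real_le_rsqrt u_HN)
  qed
  have b: "Lp_time_norm 2 T (L2_norm \<Omega>) u2 \<le> R"
  proof -
    have "Lp_time_norm 2 T (L2_norm \<Omega>) u2 = sqrt (LINT t|leb T. (L2_norm \<Omega> (u2 t))\<^sup>2)"
      unfolding Lp_time_norm_def by (simp add: powr_numeral powr_half_sqrt)
    also have "(LINT t|leb T. (L2_norm \<Omega> (u2 t))\<^sup>2) = (LINT t|leb T. (L2_norm \<Omega> (u' t))\<^sup>2)"
    proof (rule integral_cong_AE)
      have "(\<lambda>t. L2_norm \<Omega> (z t)) \<in> borel_measurable (leb T)" if "has_weak_time_derivative \<Omega> T u z" for z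
        using that by (intro L.strongly_measurable_norm complete_lebesgue_on) (auto simp: has_weak_time_derivative_def Lp_time_def)
      then show "(\<lambda>t. (L2_norm \<Omega> (u2 t))\<^sup>2) \<in> borel_measurable (leb T)"
        "(\<lambda>t. (L2_norm \<Omega> (u' t))\<^sup>2) \<in> borel_measurable (leb T)"
        using w u_weak_derivative by (auto intro: borel_measurable_power)
    qed (use weak_derivative_norm[OF w] in eventually_elim, simp)
    also have "sqrt \<dots> \<le> R" unfolding R_def by (intro real_sqrt_le_mono u'_L2_time)
    finally show ?thesis .
  qed
  have "Linf_time_norm T HN u + Lp_time_norm 2 T (L2_norm \<Omega>) u2 \<le> 2 * (sqrt mode_const * (NF + HN g + L2_norm \<Omega> h))"
    using a b R by linarith
  also have "\<dots> = 2 * sqrt mode_const * 1 * (NF + HN g + L2_norm \<Omega> h)" by simp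
  also have "\<dots> \<le> 2 * sqrt mode_const * (1 + sqrt sing_mass) * (NF + HN g + L2_norm \<Omega> h)"
    using m0 s0 nn by (intro mult_right_mono mult_left_mono) auto
  finally show "Linf_time_norm T HN u + Lp_time_norm 2 T (L2_norm \<Omega>) u2
      \<le> 2 * sqrt mode_const * (1 + sqrt sing_mass) * (Lp_time_norm 2 T (L2_norm \<Omega>) f + HN g + L2_norm \<Omega> h)"
    by (simp only: NF_def)
  let ?G = "G2"
  define S where "S = sqrt (mode_const * (?G\<^sup>2 + (L2_norm \<Omega> h)\<^sup>2 + B\<^sup>2 * sing_mass))"
  have "Linf_time_norm T (L2_norm \<Omega>) u2 \<le> S"
  proof (rule L.Linf_time_norm_le)
    show "strongly_measurable (leb T) (L2_space \<Omega>) (L2_norm \<Omega>) u2"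
      using w by (simp add: has_weak_time_derivative_def Lp_time_def)
    show "AE t in leb T. L2_norm \<Omega> (u2 t) \<le> S"
      using weak_derivative_norm[OF w] AE_space by eventually_elim (auto simp: S_def intro!: real_le_rsqrt u'_norm)
    show "0 \<le> S" unfolding S_def using mode_const_pos sing_mass_pos by simp
  qed
  also have "S = sqrt mode_const * sqrt (?G\<^sup>2 + (L2_norm \<Omega> h)\<^sup>2 + (sqrt sing_mass * B)\<^sup>2)"
    unfolding S_def real_sqrt_mult using sing_mass_pos by (simp add: power_mult_distrib mult.commute)
  also have "\<dots> \<le> sqrt mode_const * (?G + L2_norm \<Omega> h + sqrt sing_mass * B)"
    using m0 s0 B_nonneg g_norm_nonneg by (intro mult_left_mono sqrt_sum3_le) auto
  also have "\<dots> \<le> sqrt mode_const * ((1 + sqrt sing_mass) * (B + ?G + L2_norm \<Omega> h))"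
  proof (rule mult_left_mono[OF _ m0])
    have "0 \<le> sqrt sing_mass * ?G" "0 \<le> sqrt sing_mass * L2_norm \<Omega> h" using s0 g_norm_nonneg by auto
    then show "?G + L2_norm \<Omega> h + sqrt sing_mass * B \<le> (1 + sqrt sing_mass) * (B + ?G + L2_norm \<Omega> h)"
      using B_nonneg by (simp add: algebra_simps)
  qed
  also have "\<dots> \<le> 2 * (sqrt mode_const * ((1 + sqrt sing_mass) * (B + ?G + L2_norm \<Omega> h)))"
    using m0 s0 B_nonneg g_norm_nonneg by simp
  finally show "Linf_time_norm T (L2_norm \<Omega>) u2
      \<le> 2 * sqrt mode_const * (1 + sqrt sing_mass) * (Linf_time_norm T (L2_norm \<Omega>) f + ?G + L2_norm \<Omega> h)"
    by (simp only: B_def mult.assoc)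
qed

end

theorem theorem3p5:
  fixes \<Omega> :: "(real^'n::finite) set"
    and A :: "real^'n \<Rightarrow> real^'n^'n"
    and c :: "real^'n \<Rightarrow> real"
    and lam :: "nat \<Rightarrow> real"
    and \<phi> :: "nat \<Rightarrow> real^'n \<Rightarrow> real"
    and s \<gamma> T :: real
  assumes \<Omega>: "open \<Omega>" "bounded \<Omega>" "convex \<Omega>"
    and A_lipschitz: "\<exists>K. K-lipschitz_on \<Omega> A"
    and A_symmetric: "\<And>x. x \<in> \<Omega> \<Longrightarrow> transpose (A x) = A x"
    and A_positive: "\<exists>\<alpha>>0. \<forall>x\<in>\<Omega>. \<forall>\<xi>. \<alpha> * (norm \<xi>)\<^sup>2 \<le> \<xi> \<bullet> (A x *v \<xi>)"
    and c_measurable: "c \<in> borel_measurable (lebesgue_on \<Omega>)"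
    and c_bounded: "\<exists>M. AE x in lebesgue_on \<Omega>. 0 \<le> c x \<and> c x \<le> M"
    and eigenvalues_positive: "\<And>k. lam k > 0"
    and eigenpairs: "\<And>k. dirichlet_eigenpair \<Omega> A c (lam k) (\<phi> k)"
    and basis: "L2_orthonormal_basis \<Omega> \<phi>"
    and s: "0 < s" "s < 1"
    and \<gamma>: "1 < \<gamma>" "\<gamma> < 2"
    and T: "T > 0"
  shows "\<exists>C>0. \<forall>f g h.
    f \<in> Linf_time T (L2_space \<Omega>) (L2_norm \<Omega>) \<and> g \<in> HH_space \<Omega> lam \<phi> (2 * s) \<and> h \<in> L2_space \<Omega> \<longrightarrow>
    (\<exists>u. weak_solution \<Omega> lam \<phi> s \<gamma> T f g h u \<and>
       (\<forall>v. weak_solution \<Omega> lam \<phi> s \<gamma> T f g h v \<longrightarrow>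
          (\<forall>t\<in>{0..T}. AE x in lebesgue_on \<Omega>. v t x = u t x)) \<and>
       (\<forall>t\<in>{0..T}. \<exists>I.
          has_vector_integral (lebesgue_on {0<..<t}) (L2_space \<Omega>) (L2_norm \<Omega>)
            (\<lambda>r. F_op \<Omega> lam \<phi> s \<gamma> (t - r) (f r)) I \<and>
          (AE x in lebesgue_on \<Omega>.
             u t x = G_op \<Omega> lam \<phi> s \<gamma> t g x + H_op \<Omega> lam \<phi> s \<gamma> t h x + I x)) \<and>
       (\<forall>u'. has_weak_time_derivative \<Omega> T u u' \<longrightarrow>
          Linf_time_norm T (HH_norm \<Omega> lam \<phi> s) u + Lp_time_norm 2 T (L2_norm \<Omega>) u'
            \<le> C * (Lp_time_norm 2 T (L2_norm \<Omega>) f + HH_norm \<Omega> lam \<phi> s g + L2_norm \<Omega> h) \<and>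
          Linf_time_norm T (L2_norm \<Omega>) u'
            \<le> C * (Linf_time_norm T (L2_norm \<Omega>) f + HH_norm \<Omega> lam \<phi> (2 * s) g + L2_norm \<Omega> h)))"
    (is "\<exists>C>0. \<forall>f g h. _ f g h \<longrightarrow> ?P C f g h")
proof -
  have \<Omega>m: "\<Omega> \<in> lmeasurable" by (rule lmeasurable_open) (use \<Omega> in auto)
  interpret L2_basis \<Omega> \<phi> by unfold_locales (rule basis, rule \<Omega>m)
  obtain \<alpha> where \<alpha>: "\<alpha> > 0" "\<And>x \<xi>. x \<in> \<Omega> \<Longrightarrow> \<alpha> * (norm \<xi>)\<^sup>2 \<le> \<xi> \<bullet> (A x *v \<xi>)" using A_positive by blast
  have c: "AE x in lebesgue_on \<Omega>. 0 \<le> c x" using c_bounded by (auto elim: eventually_mono)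
  \<comment> \<open>Basis functions have norm 1, so this bound holds for all eigenvalues at once; m
    becomes the \<open>lam0\<close> of \<open>spectral_scale\<close>.\<close>
  obtain m where m: "m > 0" "\<And>\<mu> \<psi>. \<mu> > 0 \<Longrightarrow> L2_norm \<Omega> \<psi> = 1 \<Longrightarrow> dirichlet_eigenpair \<Omega> A c \<mu> \<psi> \<Longrightarrow> m \<le> \<mu>"
    using eigenvalue_lower_bound[where A = A, OF \<Omega>m \<Omega>(2) \<alpha> c] by blast
  have lam: "m \<le> lam k" for k by (rule m(2)[OF eigenvalues_positive L2_norm_\<phi> eigenpairs])
  interpret ml_kernels \<gamma> T by unfold_locales (rule \<gamma> T)+
  \<comment> \<open>Fixed before f, g and h are introduced; it depends on \<gamma> and T
    alone.\<close>
  define C where "C = 2 * sqrt mode_const * (1 + sqrt sing_mass)"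
  have "C > 0" using mode_const_ge(1) sing_mass_pos by (simp add: C_def add_pos_nonneg)
  moreover have "?P C f g h"
    if f: "f \<in> Linf_time T (L2_space \<Omega>) (L2_norm \<Omega>)" and g: "g \<in> HH_space \<Omega> lam \<phi> (2 * s)" and h: "h \<in> L2_space \<Omega>" for f g h
  proof -
    obtain F :: "nat \<Rightarrow> real \<Rightarrow> real" where F: "\<And>k. F k \<in> borel_measurable borel" "\<And>k t. t \<notin> {0<..<T} \<Longrightarrow> F k t = 0"
      "\<And>n t. (\<Sum>k<n. (F k t)\<^sup>2) \<le> (Linf_time_norm T (L2_norm \<Omega>) f)\<^sup>2"
      "AE t in lebesgue_on {0<..<T}. \<forall>k. coef (f t) k = F k t"
      using coefficient_functions[OF f T] by blast
    interpret wave_data \<Omega> \<phi> lam s m \<gamma> T f g h F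
      by unfold_locales (fact m(1) lam s(1) f g h F)+
    show ?thesis unfolding C_def using u_weak_solution u_unique u_representation u_estimates by blast
  qed
  ultimately show ?thesis by blast
qed

end
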